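(* Let $D\in\mathscr R$, with associated exponents $p_1,p_2\in(1,\infty)$ and conjugate exponents $p_1^*,p_2^*$, and let $\mu$ be a rotation-invariant measure on $bD$ of order $q\in\mathbb R$, where $$|q|<\min_{j=1,2}\left|\frac{p_j}{p_j-2}\right|=\min_{j=1,2}\left|\frac1{p_j}-\frac1{p_j^*}\right|^{-1}$$ (an expression with vanishing denominator being read as $+\infty$). Then the Leray transform $\mathbb L$ is bounded on $L^2(bD,\mu)$. Moreover, with $\mathbb L_\mu^*$ the adjoint of $\mathbb L$ in $L^2(bD,\mu)$, the operator $\mathbb L_\mu^*\mathbb L$ admits an orthogonal basis of eigenfunctions, and the essential spectrum of $\mathbb L_\mu^*\mathbb L$ is equal to $$\{0\}\cup\left\{\frac{\sqrt{p(\zeta)\,p^*(\zeta)}}{2}:\zeta\in bD\right\}\cup\{\lambda_{p_j,q,n}: j=1,2,\ n\in\mathbb Z,\ n\ge 0\},$$ where $p^*(\zeta)$ is the conjugate exponent of $p(\zeta)$ and $$\lambda_{p,q,n}=\frac{\Gamma\left(\frac{2n}{p}+1+q\left(\frac1p-\frac1{p^*}\right)\right)\Gamma\left(\frac{2n}{p^*}+1+q\left(\frac1{p^*}-\frac1p\right)\right)}{\Gamma^2(n+1)\left(\frac2p\right)^{\frac{2n}{p}+1+q\left(\frac1p-\frac1{p^*}\right)}\left(\frac2{p^*}\right)^{\frac{2n}{p^*}+1+q\left(\frac1{p^*}-\frac1p\right)}},\qquad \frac1p+\frac1{p^*}=1.$$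
   Context: Reinhardt domains: $D\subset\mathbb C^2$ is Reinhardt if it is invariant under all rotations $(z_1,z_2)\mapsto(e^{i\theta_1}z_1,e^{i\theta_2}z_2)$. $bD$ is the boundary. Class $\mathscr R$: domains $D=\{(z_1,z_2): |z_1|<b_1,\ |z_2|<\phi(|z_1|)\}$ with $b_1>0$ and $\phi$ continuous, decreasing and concave on $[0,b_1]$, $\phi(b_1)=0$, $C^2$ on $(0,b_1)$ with $\phi''<0$ there, such that $\phi(r_1)=b_2-c_2r_1^{p_1}+\epsilon_1(r_1)$ for $r_1$ near $0$, and $\phi^{-1}(r_2)=b_1-c_1r_2^{p_2}+\epsilon_2(r_2)$ for $r_2$ near $0$. Here $b_j>0$, $c_j>0$, $p_j>1$ are constants and each $\epsilon_j$ is $C^1$ for $r_j\ge0$, $C^2$ for $r_j>0$, with $\epsilon_j(0)=\epsilon_j'(0)=0$ and $\epsilon_j''(r_j)=o(r_j^{p_j-2})$ as $r_j\to0$. On $bD$ write $\zeta_j=r_je^{i\theta_j}$, $r_j=|\zeta_j|$. Where $\zeta_1\zeta_2\neq0$ set $$s=\frac{-r_1\phi'(r_1)}{\phi(r_1)-r_1\phi'(r_1)},\qquad p(\zeta)=1+\frac{r_1\phi(r_1)\phi''(r_1)}{\phi'(r_1)(\phi(r_1)-r_1\phi'(r_1))}.$$ ($p(\zeta)$ is the exponent of the unique domain $\{a_1|z_1|^p+a_2|z_2|^p<1\}$, $a_j>0$, $p>1$, osculating $bD$ to second order at $\zeta$.) Set $p(\zeta)=p_1$ where $\zeta_1=0$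 and $p(\zeta)=p_2$ where $\zeta_2=0$; this makes $p$ continuous on $bD$. The function $s$ is a strictly increasing function of $r_1$ with range $(0,1)$; $(s,\theta_1,\theta_2)\in(0,1)\times[0,2\pi)^2$ are coordinates on $bD\setminus\{\zeta_1\zeta_2=0\}$ and $r_1,r_2$ are functions of $s$. Leray transform: for $w\in D$, $\mathbb Lf(w)=\int_{\zeta\in bD}f(\zeta)L(\zeta,w)$, where $$L(\zeta,w)=\frac1{(2\pi i)^2}\frac{j^*(\partial\rho\wedge\bar\partial\partial\rho)(\zeta)}{\left[\frac{\partial\rho}{\partial\zeta_1}(\zeta)(\zeta_1-w_1)+\frac{\partial\rho}{\partial\zeta_2}(\zeta)(\zeta_2-w_2)\right]^2},$$ $\rho$ is any defining function of $bD\setminus\{\zeta_1\zeta_2=0\}$ (the kernel does not depend on the choice), $j:bD\to\mathbb C^2$ is the inclusion, and the points with $\zeta_1\zeta_2=0$ are ignored. In coordinates, $$L(\zeta,w)=\frac{ds\wedge d\theta_1\wedge d\theta_2}{4\pi^2\left(1-e^{-i\theta_1}\frac s{r_1}w_1-e^{-i\theta_2}\frac{1-s}{r_2}w_2\right)^2},$$ with $bD$ oriented so that $ds\wedge d\theta_1\wedge d\theta_2>0$. Operator on $L^2$: an $(n,m)$-monomial ($n,m\in\mathbb Z$) is a function on $bD$ of the form $g(s)e^{i(n\theta_1+m\theta_2)}$. A rotation-invariant measure $d\mu=\frac1{4\pi^2}\omega(s)\,ds\,d\theta_1d\theta_2$ ($\omega$ measurable, positive a.e.) is admissible if $\int_0^1\omega\,ds<\infty$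 and $\int_0^1\omega^{-1}ds<\infty$. For such $\mu$ and an $(n,m)$-monomial $f\in L^2(bD,\mu)$, $\mathbb Lf$ is a constant multiple of $w_1^nw_2^m$ (and is $0$ if $\min\{n,m\}<0$), hence extends continuously to $\overline D$; its boundary values are denoted $\mathbb L_{n,m}f$. Writing $f\in L^2(bD,\mu)$ as the orthogonal sum $\sum_{n,m\in\mathbb Z} f_{n,m}$ of $(n,m)$-monomials, $\mathbb Lf=\sum_{n,m\ge0}\mathbb L_{n,m}f_{n,m}$; $\mathbb L$ is bounded on $L^2(bD,\mu)$ if this defines a bounded operator. (The restriction on $q$ in the claim guarantees that $\mu$ is admissible.) Order $q$: let $d\sigma$ be surface measure and $|\mathscr L|=-\frac{j^*(\partial\rho\wedge\bar\partial\partial\rho)}{|\nabla\rho|^2d\sigma}$ the Euclidean norm of the Levi form (three-form interpreted as a measure). A rotation-invariant measure on $bD$ has order $q$ if it equals $h\,|\mathscr L|^{1-q}d\sigma$ with $h$ continuous and positive on $bD$. The essential spectrum of a bounded operator is the spectrum of its image in the Calkin algebra. *)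

theory Defs
  imports "HOL-Analysis.Analysis" "HOL-Library.Landau_Symbols"
begin

section \<open>Bounded operators on $L^2(M)$\<close>

text \<open>
  Elements of $L^2(M)$ are represented by square integrable functions; equality of elements is
  equality almost everywhere, i.e. vanishing of the seminorm \<open>l2_norm\<close> of the difference.
  An operator is a map between representatives. A map that is linear and bounded in the sense
  of \<open>bounded_op\<close> automatically respects equality almost everywhere.
\<close>

definition L2 :: "'a measure \<Rightarrow> ('a \<Rightarrow> complex) set" where
  "L2 M = {f \<in> borel_measurable M. integrable M (\<lambda>x. (cmod (f x))\<^sup>2)}"

definition l2_inner :: "'a measure \<Rightarrow> ('a \<Rightarrow> complex) \<Rightarrow> ('a \<Rightarrow> complex) \<Rightarrow> complex" where
  "l2_inner M f g = (\<integral>x. f x * cnj (g x) \<partial>M)"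

definition l2_norm :: "'a measure \<Rightarrow> ('a \<Rightarrow> complex) \<Rightarrow> real" where
  "l2_norm M f = sqrt (\<integral>x. (cmod (f x))\<^sup>2 \<partial>M)"

type_synonym 'a l2op = "('a \<Rightarrow> complex) \<Rightarrow> ('a \<Rightarrow> complex)"

definition bounded_op :: "'a measure \<Rightarrow> 'a l2op \<Rightarrow> bool" where
  "bounded_op M T \<longleftrightarrow>
     (\<forall>f\<in>L2 M. T f \<in> L2 M) \<and>
     (\<forall>f\<in>L2 M. \<forall>g\<in>L2 M. \<forall>c d. AE x in M.
        T (\<lambda>y. c * f y + d * g y) x = c * T f x + d * T g x) \<and>
     (\<exists>C. \<forall>f\<in>L2 M. l2_norm M (T f) \<le> C * l2_norm M f)"

definition is_adjoint :: "'a measure \<Rightarrow> 'a l2op \<Rightarrow> 'a l2op \<Rightarrow> bool" where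
  "is_adjoint M T A \<longleftrightarrow> bounded_op M A \<and>
     (\<forall>f\<in>L2 M. \<forall>g\<in>L2 M. l2_inner M (T f) g = l2_inner M f (A g))"

definition compact_op :: "'a measure \<Rightarrow> 'a l2op \<Rightarrow> bool" where
  "compact_op M T \<longleftrightarrow> bounded_op M T \<and>
     (\<forall>u :: nat \<Rightarrow> 'a \<Rightarrow> complex. (\<forall>n. u n \<in> L2 M \<and> l2_norm M (u n) \<le> 1) \<longrightarrow>
        (\<exists>v\<in>L2 M. \<exists>k. strict_mono k \<and>
           (\<lambda>n. l2_norm M (\<lambda>x. T (u (k n)) x - v x)) \<longlonglongrightarrow> 0))"

text \<open>Equality of the images of two bounded operators in the Calkin algebra.\<close>

definition calkin_eq :: "'a measure \<Rightarrow> 'a l2op \<Rightarrow> 'a l2op \<Rightarrow> bool" where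
  "calkin_eq M S T \<longleftrightarrow> compact_op M (\<lambda>f x. S f x - T f x)"

definition calkin_invertible :: "'a measure \<Rightarrow> 'a l2op \<Rightarrow> bool" where
  "calkin_invertible M T \<longleftrightarrow>
     (\<exists>S. bounded_op M S \<and> calkin_eq M (T \<circ> S) id \<and> calkin_eq M (S \<circ> T) id)"

definition essential_spectrum :: "'a measure \<Rightarrow> 'a l2op \<Rightarrow> complex set" where
  "essential_spectrum M T = {c. \<not> calkin_invertible M (\<lambda>f x. T f x - c * f x)}"

definition is_eigenfunction :: "'a measure \<Rightarrow> 'a l2op \<Rightarrow> ('a \<Rightarrow> complex) \<Rightarrow> bool" where
  "is_eigenfunction M T e \<longleftrightarrow> e \<in> L2 M \<and> \<not> (AE x in M. e x = 0) \<and>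
     (\<exists>c. AE x in M. T e x = c * e x)"

definition orthogonal_basis :: "'a measure \<Rightarrow> ('a \<Rightarrow> complex) set \<Rightarrow> bool" where
  "orthogonal_basis M E \<longleftrightarrow> E \<subseteq> L2 M \<and> (\<forall>e\<in>E. l2_norm M e \<noteq> 0) \<and>
     pairwise (\<lambda>e e'. l2_inner M e e' = 0) E \<and>
     (\<forall>f\<in>L2 M. \<forall>\<epsilon>>0. \<exists>F c. finite F \<and> F \<subseteq> E \<and>
        l2_norm M (\<lambda>x. f x - (\<Sum>e\<in>F. c e * e x)) < \<epsilon>)"

text \<open>Unconditional convergence in $L^2(M)$ of the family \<open>F\<close> over the index set \<open>A\<close>.\<close>

definition l2_has_sum ::
  "'a measure \<Rightarrow> ('i \<Rightarrow> 'a \<Rightarrow> complex) \<Rightarrow> 'i set \<Rightarrow> ('a \<Rightarrow> complex) \<Rightarrow> bool" where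
  "l2_has_sum M F A h \<longleftrightarrow> (\<forall>i\<in>A. F i \<in> L2 M) \<and> h \<in> L2 M \<and>
     ((\<lambda>X. l2_norm M (\<lambda>x. h x - (\<Sum>i\<in>X. F i x))) \<longlongrightarrow> 0) (finite_subsets_at_top A)"


section \<open>Complex differential forms on $\mathbf{C}^2$\<close>

type_synonym C2 = "complex \<times> complex"

definition ctimes :: "complex \<Rightarrow> C2 \<Rightarrow> C2" where
  "ctimes c v = (c * fst v, c * snd v)"

text \<open>
  The values at \<open>z\<close> on the tangent vector \<open>v\<close> of the forms $\partial g$ and $\bar\partial g$,
  the complex linear and the complex antilinear part of the real differential.
\<close>

definition del :: "(C2 \<Rightarrow> complex) \<Rightarrow> C2 \<Rightarrow> C2 \<Rightarrow> complex" where
  "del g z v = (frechet_derivative g (at z) v - \<i> * frechet_derivative g (at z) (ctimes \<i> v)) / 2"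

definition delbar :: "(C2 \<Rightarrow> complex) \<Rightarrow> C2 \<Rightarrow> C2 \<Rightarrow> complex" where
  "delbar g z v = (frechet_derivative g (at z) v + \<i> * frechet_derivative g (at z) (ctimes \<i> v)) / 2"

text \<open>
  The two-form $\bar\partial\partial g = \sum_{j,k} g_{j\bar k}\, d\bar z_k\wedge dz_j$; the vectors
  \<open>v\<close>, \<open>w\<close> are extended to constant vector fields.
\<close>

definition delbar_del :: "(C2 \<Rightarrow> complex) \<Rightarrow> C2 \<Rightarrow> C2 \<Rightarrow> C2 \<Rightarrow> complex" where
  "delbar_del g z v w = delbar (\<lambda>z. del g z w) z v - delbar (\<lambda>z. del g z v) z w"

text \<open>
  The three-form $\partial g\wedge\bar\partial\partial g$, normalised so that
  $(dx\wedge dy\wedge dt)(e_1,e_2,e_3)=1$.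
\<close>

definition leray_form :: "(C2 \<Rightarrow> complex) \<Rightarrow> C2 \<Rightarrow> C2 \<Rightarrow> C2 \<Rightarrow> C2 \<Rightarrow> complex" where
  "leray_form g z u v w =
     del g z u * delbar_del g z v w + del g z v * delbar_del g z w u + del g z w * delbar_del g z u v"


section \<open>The class of domains\<close>

definition domain_of :: "real \<Rightarrow> (real \<Rightarrow> real) \<Rightarrow> C2 set" where
  "domain_of b1 \<phi> = {z. cmod (fst z) < b1 \<and> cmod (snd z) < \<phi> (cmod (fst z))}"

abbreviation bD :: "real \<Rightarrow> (real \<Rightarrow> real) \<Rightarrow> C2 set" where
  "bD b1 \<phi> \<equiv> frontier (domain_of b1 \<phi>)"

text \<open>
  \<open>power_expansion f p\<close>: near \<open>0\<close> one has $f(r) = b - c r^p + \epsilon(r)$ with $b, c > 0$ and a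
  remainder as in the definition of the class; \<open>e1\<close> and \<open>e2\<close> are the first two derivatives of the
  remainder, the first one being one-sided at \<open>0\<close>.
\<close>

definition power_expansion :: "(real \<Rightarrow> real) \<Rightarrow> real \<Rightarrow> bool" where
  "power_expansion f p \<longleftrightarrow> (\<exists>b>0. \<exists>c>0. \<exists>\<delta>>0. \<exists>e e1 e2.
     (\<forall>r\<in>{0..<\<delta>}. f r = b - c * r powr p + e r) \<and>
     (\<forall>r\<in>{0..<\<delta>}. (e has_real_derivative e1 r) (at r within {0..<\<delta>})) \<and>
     continuous_on {0..<\<delta>} e1 \<and>
     (\<forall>r\<in>{0<..<\<delta>}. (e1 has_real_derivative e2 r) (at r)) \<and>
     continuous_on {0<..<\<delta>} e2 \<and>
     e 0 = 0 \<and> e1 0 = 0 \<and>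
     e2 \<in> o[at_right 0](\<lambda>r. r powr (p - 2)))"

definition class_R :: "real \<Rightarrow> (real \<Rightarrow> real) \<Rightarrow> real \<Rightarrow> real \<Rightarrow> bool" where
  "class_R b1 \<phi> p1 p2 \<longleftrightarrow>
     0 < b1 \<and> 1 < p1 \<and> 1 < p2 \<and>
     continuous_on {0..b1} \<phi> \<and> antimono_on {0..b1} \<phi> \<and> concave_on {0..b1} \<phi> \<and> \<phi> b1 = 0 \<and>
     (\<forall>r\<in>{0<..<b1}. \<phi> differentiable (at r) \<and> deriv \<phi> differentiable (at r)) \<and>
     continuous_on {0<..<b1} (deriv (deriv \<phi>)) \<and>
     (\<forall>r\<in>{0<..<b1}. deriv (deriv \<phi>) r < 0) \<and>
     power_expansion \<phi> p1 \<and> power_expansion (inv_into {0..b1} \<phi>) p2"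

definition conj_exp :: "real \<Rightarrow> real" where
  "conj_exp p = p / (p - 1)"

definition s_coord :: "(real \<Rightarrow> real) \<Rightarrow> real \<Rightarrow> real" where
  "s_coord \<phi> r = - r * deriv \<phi> r / (\<phi> r - r * deriv \<phi> r)"

definition p_exponent :: "(real \<Rightarrow> real) \<Rightarrow> real \<Rightarrow> real \<Rightarrow> C2 \<Rightarrow> real" where
  "p_exponent \<phi> p1 p2 \<zeta> =
     (if fst \<zeta> = 0 then p1 else if snd \<zeta> = 0 then p2
      else let r = cmod (fst \<zeta>) in
        1 + r * \<phi> r * deriv (deriv \<phi>) r / (deriv \<phi> r * (\<phi> r - r * deriv \<phi> r)))"


section \<open>Boundary coordinates, surface measure, Levi form\<close>

text \<open>The defining function used for $bD\setminus\{\zeta_1\zeta_2=0\}$.\<close>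

definition rho :: "(real \<Rightarrow> real) \<Rightarrow> C2 \<Rightarrow> real" where
  "rho \<phi> z = cmod (snd z) - \<phi> (cmod (fst z))"

abbreviation crho :: "(real \<Rightarrow> real) \<Rightarrow> C2 \<Rightarrow> complex" where
  "crho \<phi> \<equiv> \<lambda>z. complex_of_real (rho \<phi> z)"

text \<open>
  $bD\setminus\{\zeta_1\zeta_2=0\}$ is parametrised by $(r_1,\theta_1,\theta_2)$. As $s$ is strictly
  increasing in $r_1$, the orientation $ds\wedge d\theta_1\wedge d\theta_2>0$ is
  $dr_1\wedge d\theta_1\wedge d\theta_2>0$.
\<close>

definition bd_param :: "(real \<Rightarrow> real) \<Rightarrow> real \<times> real \<times> real \<Rightarrow> C2" where
  "bd_param \<phi> = (\<lambda>(r, t1, t2). (of_real r * cis t1, of_real (\<phi> r) * cis t2))"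

definition param_measure :: "real \<Rightarrow> (real \<times> real \<times> real) measure" where
  "param_measure b1 = restrict_space lborel ({0<..<b1} \<times> {0..<2 * pi} \<times> {0..<2 * pi})"

text \<open>
  The partial derivatives of \<open>bd_param\<close> in $r_1$, $\theta_1$, $\theta_2$, as vector fields on
  $bD\setminus\{\zeta_1\zeta_2=0\}$; note that \<open>sgn z = z / cmod z\<close>.
\<close>

definition frame :: "(real \<Rightarrow> real) \<Rightarrow> C2 \<Rightarrow> 3 \<Rightarrow> C2" where
  "frame \<phi> \<zeta> i =
     (if i = 1 then (sgn (fst \<zeta>), of_real (deriv \<phi> (cmod (fst \<zeta>))) * sgn (snd \<zeta>))
      else if i = 2 then (\<i> * fst \<zeta>, 0)
      else (0, \<i> * snd \<zeta>))"

text \<open>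
  Densities with respect to $dr_1\,d\theta_1\,d\theta_2$ of the form
  $j^*(\partial\rho\wedge\bar\partial\partial\rho)$ and of the surface measure $d\sigma$.
\<close>

definition leray_density :: "(real \<Rightarrow> real) \<Rightarrow> C2 \<Rightarrow> complex" where
  "leray_density \<phi> \<zeta> = leray_form (crho \<phi>) \<zeta> (frame \<phi> \<zeta> 1) (frame \<phi> \<zeta> 2) (frame \<phi> \<zeta> 3)"

definition surface_density :: "(real \<Rightarrow> real) \<Rightarrow> C2 \<Rightarrow> real" where
  "surface_density \<phi> \<zeta> = sqrt (det (\<chi> i j. frame \<phi> \<zeta> i \<bullet> frame \<phi> \<zeta> j))"

definition surface_measure :: "real \<Rightarrow> (real \<Rightarrow> real) \<Rightarrow> C2 measure" where
  "surface_measure b1 \<phi> =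
     distr (density (param_measure b1) (\<lambda>x. ennreal (surface_density \<phi> (bd_param \<phi> x))))
       (restrict_space borel (bD b1 \<phi>)) (bd_param \<phi>)"

definition grad_norm_sq :: "(C2 \<Rightarrow> real) \<Rightarrow> C2 \<Rightarrow> real" where
  "grad_norm_sq g z = (\<Sum>b\<in>Basis. (frechet_derivative g (at z) b)\<^sup>2)"

text \<open>
  The Euclidean norm of the Levi form. The value on the null set $\{\zeta_1\zeta_2=0\}$ is
  arbitrary; it is fixed for the sake of measurability.
\<close>

definition levi_norm :: "(real \<Rightarrow> real) \<Rightarrow> C2 \<Rightarrow> real" where
  "levi_norm \<phi> \<zeta> =
     (if fst \<zeta> = 0 \<or> snd \<zeta> = 0 then 0
      else - Re (leray_density \<phi> \<zeta>) / (grad_norm_sq (rho \<phi>) \<zeta> * surface_density \<phi> \<zeta>))"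

definition rotation_invariant :: "C2 measure \<Rightarrow> bool" where
  "rotation_invariant M \<longleftrightarrow>
     (\<forall>t1 t2. distr M M (\<lambda>z. (cis t1 * fst z, cis t2 * snd z)) = M)"

definition has_order :: "real \<Rightarrow> (real \<Rightarrow> real) \<Rightarrow> real \<Rightarrow> C2 measure \<Rightarrow> bool" where
  "has_order b1 \<phi> q M \<longleftrightarrow>
     (\<exists>h. continuous_on (bD b1 \<phi>) h \<and> (\<forall>\<zeta>\<in>bD b1 \<phi>. 0 < h \<zeta>) \<and>
        M = density (surface_measure b1 \<phi>) (\<lambda>\<zeta>. ennreal (h \<zeta> * levi_norm \<phi> \<zeta> powr (1 - q))))"


section \<open>The Leray transform\<close>

text \<open>The Leray kernel, as a density with respect to $dr_1\,d\theta_1\,d\theta_2$.\<close>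

definition leray_kernel :: "(real \<Rightarrow> real) \<Rightarrow> C2 \<Rightarrow> C2 \<Rightarrow> complex" where
  "leray_kernel \<phi> \<zeta> w =
     1 / (2 * of_real pi * \<i>)\<^sup>2 * (leray_density \<phi> \<zeta> / (del (crho \<phi>) \<zeta> (\<zeta> - w))\<^sup>2)"

definition leray_transform :: "real \<Rightarrow> (real \<Rightarrow> real) \<Rightarrow> (C2 \<Rightarrow> complex) \<Rightarrow> C2 \<Rightarrow> complex" where
  "leray_transform b1 \<phi> f w =
     (\<integral>x. f (bd_param \<phi> x) * leray_kernel \<phi> (bd_param \<phi> x) w \<partial>param_measure b1)"

definition leray_bv :: "real \<Rightarrow> (real \<Rightarrow> real) \<Rightarrow> (C2 \<Rightarrow> complex) \<Rightarrow> C2 \<Rightarrow> complex" where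
  "leray_bv b1 \<phi> f \<zeta> = Lim (at \<zeta> within domain_of b1 \<phi>) (leray_transform b1 \<phi> f)"

definition is_monomial ::
  "real \<Rightarrow> (real \<Rightarrow> real) \<Rightarrow> int \<Rightarrow> int \<Rightarrow> (C2 \<Rightarrow> complex) \<Rightarrow> bool" where
  "is_monomial b1 \<phi> n m f \<longleftrightarrow>
     (\<exists>g :: real \<Rightarrow> complex. \<forall>\<zeta>\<in>bD b1 \<phi>. fst \<zeta> \<noteq> 0 \<longrightarrow> snd \<zeta> \<noteq> 0 \<longrightarrow>
        f \<zeta> = g (s_coord \<phi> (cmod (fst \<zeta>))) * (sgn (fst \<zeta>) powi n * sgn (snd \<zeta>) powi m))"

text \<open>
  \<open>T\<close> is the Leray transform on $L^2(bD,\mu)$: every \<open>f\<close> is the (necessarily orthogonal) sum of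
  $(n,m)$-monomials \<open>F (n, m)\<close>, and \<open>T f\<close> is the sum in $L^2(bD,\mu)$ of the boundary values of
  their Leray transforms over $n,m\ge 0$. The monomials, and hence \<open>T f\<close>, are determined by \<open>f\<close> up
  to equality almost everywhere.
\<close>

definition is_leray_operator :: "real \<Rightarrow> (real \<Rightarrow> real) \<Rightarrow> C2 measure \<Rightarrow> C2 l2op \<Rightarrow> bool" where
  "is_leray_operator b1 \<phi> M T \<longleftrightarrow>
     (\<forall>f\<in>L2 M. \<exists>F :: int \<times> int \<Rightarrow> C2 \<Rightarrow> complex.
        (\<forall>n m. is_monomial b1 \<phi> n m (F (n, m))) \<and>
        l2_has_sum M F UNIV f \<and>
        l2_has_sum M (\<lambda>k. leray_bv b1 \<phi> (F k)) ({0..} \<times> {0..}) (T f))"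

definition lambda_pqn :: "real \<Rightarrow> real \<Rightarrow> nat \<Rightarrow> real" where
  "lambda_pqn p q n =
     (let p' = conj_exp p;
          a = 2 * real n / p + 1 + q * (1 / p - 1 / p');
          b = 2 * real n / p' + 1 + q * (1 / p' - 1 / p)
      in Gamma a * Gamma b /
         ((Gamma (real n + 1))\<^sup>2 * (2 / p) powr a * (2 / p') powr b))"

end

(* Both L and its adjoint act on the spaces V n m of (n,m)-monomials, and L has rank at most one on
  each of them: expanding the kernel 1 / (1 - X)^2 in a power series shows that L f is a multiple of
  the inner product of f with one monomial u_nm, times z1^n z2^m. Hence L*L is diagonal with
  eigenvalues c_nm^2 |u_nm|^2 |v_nm|^2, n, m >= 0, the two norms being one-dimensional integrals
  I n m and J n m of the shape integral r1^(2n) r2^(2m) w ds. Laplace's method gives the limit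
  points of the eigenvalues: for n, m -> infinity with n / (n + m) -> s they converge to
  sqrt (p p') / 2 at the point with coordinate s, whereas for n (or m) fixed Watson's lemma at the
  corner s = 0 (or s = 1) gives lambda_{p_j,q,n}. All of them are compared with the model profile
  s^(1/2), (1 - s)^(1/2), whose integrals are Beta functions and cancel c_nm. *)

theory Submission
 imports Defs "HOL-Probability.Probability" "HOL-Real_Asymp.Real_Asymp"
begin

text \<open>Why one family of integrals suffices: with P = 1/p(zeta) as a function of s, both s
  r1'/r1 and -(1 - s) r2'/r2 equal P. So r1^n r2^m peaks at s = n/(n + m) on every domain, and in
  the limits only P and the corner exponents of the weight survive. The kernel replaces (r1, r2, w)
  by (s/r1, (1 - s)/r2, 1/w), which obeys the same equations with 1 - P, the reciprocal of the
  conjugate exponent. Hence I, J and the model are instances of one locale, and s -> 1 - s exchanges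
  the corners. The obstacle is regularity and uniformity. P is merely continuous, so no Taylor
  expansion to second order is available, and the saddle may run into a corner, where the weight has
  a power singularity, while n and m tend to infinity. Both are met by rescaling with the standard
  deviation at the saddle and by comparing with a constant P. In the variable s a measure of order q
  has corner exponents -q (1 - 2/p_j); the bound on |q| puts them into (-1, 1), so w and 1/w are
  integrable. Finally, 0 is in the essential spectrum since L kills infinitely many monomials of
  negative index.\<close>

section \<open>Logarithm bounds and the entropy of a Bernoulli distribution\<close>

text \<open>The damping by 1 + z keeps the bound useful on the whole half line: the gain over z is
  quadratic for small z and still linear for large z. This produces the exponential tails of the
  rescaled integrand.\<close>

lemma ln_one_plus_le_quadratic:
 fixes z :: real assumes "0 \<le> z" shows "ln (1 + z) \<le> z - z\<^sup>2 / (2 * (1 + z))"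
proof -
 define f where "f = (%z::real. z - z\<^sup>2 / (2 * (1 + z)) - ln (1 + z))"
 have "f 0 \<le> f z"
 proof (rule DERIV_nonneg_imp_nondecreasing[OF assms])
  fix x :: real assume "0 \<le> x" "x \<le> z"
  then have "(f has_real_derivative 1 - (2 * x * (2 * (1 + x)) - x\<^sup>2 * 2) / (2 * (1 + x))\<^sup>2 - 1 / (1 + x)) (at x)"
   unfolding f_def by (auto intro!: derivative_eq_intros simp: power2_eq_square)
  moreover have "1 - (2 * x * (2 * (1 + x)) - x\<^sup>2 * 2) / (2 * (1 + x))\<^sup>2 - 1 / (1 + x) = x\<^sup>2 / (2 * (1 + x)\<^sup>2)"
   using \<open>0 \<le> x\<close> by (simp add: divide_simps power2_eq_square) (auto simp: algebra_simps)
  ultimately have "(f has_real_derivative x\<^sup>2 / (2 * (1 + x)\<^sup>2)) (at x)" by simp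
  then show "\<exists>y. (f has_real_derivative y) (at x) \<and> 0 \<le> y" by force
 qed
 then show ?thesis by (simp add: f_def)
qed

lemma ln_one_minus_le_quadratic:
 fixes z :: real assumes "0 \<le> z" "z < 1" shows "ln (1 - z) \<le> - z - z\<^sup>2 / 2"
proof -
 define f where "f = (%z::real. - z - z\<^sup>2 / 2 - ln (1 - z))"
 have "f 0 \<le> f z"
 proof (rule DERIV_nonneg_imp_nondecreasing[OF assms(1)])
  fix x :: real assume "0 \<le> x" "x \<le> z"
  then have "(f has_real_derivative x\<^sup>2 / (1 - x)) (at x)"
   unfolding f_def using assms by (auto intro!: derivative_eq_intros simp: divide_simps power2_eq_square) (auto simp: algebra_simps)
  then show "\<exists>y. (f has_real_derivative y) (at x) \<and> 0 \<le> y" using assms \<open>x \<le> z\<close> by force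
 qed
 then show ?thesis by (simp add: f_def)
qed

lemma sq_div_ge: "\<bar>u\<bar> - 1 \<le> u\<^sup>2 / (1 + \<bar>u\<bar>)" for u :: real
proof -
 have "(\<bar>u\<bar> - 1) * (1 + \<bar>u\<bar>) \<le> u\<^sup>2" by (simp add: algebra_simps flip: power2_eq_square)
 then show ?thesis by (simp add: pos_le_divide_eq)
qed

text \<open>A chord bound for the relative entropy of Bernoulli distributions, on the scale of the
 standard deviation: linear decay in \<open>u\<close>, uniformly in \<open>n\<close> and \<open>m\<close>.\<close>

lemma bernoulli_entropy_bound_aux:
 fixes n m u a b :: real
 assumes "1 \<le> n" "1 \<le> m" "0 \<le> u" and a: "a = sqrt (m / (n * (n + m)))" and b: "b = sqrt (n / (m * (n + m)))"
  and lt: "b * u < 1"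
 shows "n * ln (1 + a * u) + m * ln (1 - b * u) \<le> - (u - 1) / 4"
proof -
 have a0: "0 < a" "0 < b" using assms by auto
 have a2: "a\<^sup>2 = m / (n * (n + m))" "b\<^sup>2 = n / (m * (n + m))" using assms by auto
 have "(n * a)\<^sup>2 = n * m / (n + m)" "(m * b)\<^sup>2 = n * m / (n + m)"
  unfolding power_mult_distrib a2 using assms(1,2) by (auto simp: power2_eq_square)
 then have "(n * a)\<^sup>2 = (m * b)\<^sup>2" by simp
 \<comment> \<open>The first-order terms balance because n / (n + m) is the stationary
   point.\<close>
 then have nab: "n * a = m * b" using a0 assms by (simp add: power2_eq_iff_nonneg)
 have "1 * m \<le> n * (n + m)" using assms(1,2) by (intro mult_mono) auto
 then have "m \<le> n * (n + m)" by simp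
 then have "a\<^sup>2 \<le> 1" unfolding a2 using assms(1,2) by (simp add: divide_le_eq_1)
 \<comment> \<open>This allows 1 + a u to be replaced by 1 + u, which removes n and m from the
   denominator.\<close>
 then have a1: "a \<le> 1" using a0 by (simp add: power_le_one_iff)
 have l1: "n * ln (1 + a * u) \<le> n * (a * u - (a * u)\<^sup>2 / (2 * (1 + a * u)))"
  using ln_one_plus_le_quadratic[of "a * u"] a0 assms by (intro mult_left_mono) auto
 have l2: "m * ln (1 - b * u) \<le> m * (- (b * u) - (b * u)\<^sup>2 / 2)"
  using ln_one_minus_le_quadratic[of "b * u"] a0 assms by (intro mult_left_mono) auto
 have c: "u - 1 \<le> u\<^sup>2 / (1 + u)" "0 \<le> u\<^sup>2 / (1 + u)" using sq_div_ge[of u] assms(3) by auto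
 have na: "n * a\<^sup>2 = m / (n + m)" "m * b\<^sup>2 = n / (n + m)" unfolding a2 using assms(1,2) by auto
 have s1: "n * ((a * u)\<^sup>2 / (2 * (1 + a * u))) \<ge> (m / (n + m)) * (u\<^sup>2 / (1 + u)) / 2"
 proof -
  have "n * ((a * u)\<^sup>2 / (2 * (1 + a * u))) = (n * a\<^sup>2) * (u\<^sup>2 / (1 + a * u)) / 2"
   by (simp add: power_mult_distrib algebra_simps)
  also have "\<dots> \<ge> (m / (n + m)) * (u\<^sup>2 / (1 + u)) / 2"
   unfolding na using assms a0 a1
   by (intro divide_right_mono mult_left_mono divide_left_mono) (auto simp: mult_left_le_one_le add_pos_nonneg)
  finally show ?thesis .
 qed
 have s2: "m * ((b * u)\<^sup>2 / 2) \<ge> (n / (n + m)) * (u\<^sup>2 / (1 + u)) / 2"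
 proof -
  have "m * ((b * u)\<^sup>2 / 2) = (m * b\<^sup>2) * u\<^sup>2 / 2" by (simp add: power_mult_distrib)
  also have "\<dots> \<ge> (n / (n + m)) * (u\<^sup>2 / (1 + u)) / 2"
   unfolding na using assms by (intro divide_right_mono mult_left_mono) (auto simp: field_simps)
  finally show ?thesis .
 qed
 have "n * ln (1 + a * u) + m * ln (1 - b * u) \<le>
   n * (a * u) - m * (b * u) - (n * ((a * u)\<^sup>2 / (2 * (1 + a * u))) + m * ((b * u)\<^sup>2 / 2))"
  using l1 l2 by (simp add: algebra_simps)
 also have "n * (a * u) = m * (b * u)" using nab by simp
 also have "m * (b * u) - m * (b * u) - (n * ((a * u)\<^sup>2 / (2 * (1 + a * u))) + m * ((b * u)\<^sup>2 / 2))
   \<le> - ((m / (n + m)) * (u\<^sup>2 / (1 + u)) / 2 + (n / (n + m)) * (u\<^sup>2 / (1 + u)) / 2)"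
  using s1 s2 by linarith
 also have "\<dots> = - ((m / (n + m) + n / (n + m)) * (u\<^sup>2 / (1 + u)) / 2)"
  by (simp only: distrib_right add_divide_distrib)
 \<comment> \<open>The two logarithms contribute with weights of sum 1, so the final bound no longer
   sees n and m.\<close>
 also have "m / (n + m) + n / (n + m) = 1" using assms by (simp add: add_divide_distrib[symmetric])
 also have "- (1 * (u\<^sup>2 / (1 + u)) / 2) \<le> - (u - 1) / 4"
 proof -
  have "- (1 * d / 2) \<le> - (u - 1) / 4" if "u - 1 \<le> d" "0 \<le> d" for d using that by simp
  then show ?thesis using c by blast
 qed
 finally show ?thesis .
qed

text \<open>A negative u becomes positive under the reflection of the interval, which exchanges n
  with m and a with b; the one-sided bound then applies to -u.\<close>

lemma bernoulli_entropy_bound: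
 fixes n m u a b :: real
 assumes "1 \<le> n" "1 \<le> m" and a: "a = sqrt (m / (n * (n + m)))" and b: "b = sqrt (n / (m * (n + m)))"
  and lt: "b * u < 1" "- 1 < a * u"
 shows "n * ln (1 + a * u) + m * ln (1 - b * u) \<le> - (\<bar>u\<bar> - 1) / 4"
proof (cases "0 \<le> u")
 case True
 then show ?thesis using bernoulli_entropy_bound_aux[OF assms(1,2) True a b lt(1)] by simp
next
 case False
 have "m * ln (1 + b * (- u)) + n * ln (1 - a * (- u)) \<le> - (- u - 1) / 4"
  using False assms by (intro bernoulli_entropy_bound_aux) (auto simp: add.commute)
 then show ?thesis using False by (simp add: add.commute)
qed

section \<open>Profiles: the radial data of a domain and a measure as functions of s\<close>

text \<open>Continuity up to both ends encodes the corner asymptotics: the end values are the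
  leading coefficients that appear in the limits.\<close>

definition pos_cont :: "(real \<Rightarrow> real) \<Rightarrow> bool" where
 "pos_cont f \<longleftrightarrow> continuous_on {0..1} f \<and> (\<forall>s\<in>{0..1}. 0 < f s)"

lemma pos_contD: "pos_cont f ==> continuous_on {0..1} f" "pos_cont f ==> 0 \<le> s ==> s \<le> 1 ==> 0 < f s"
 by (auto simp: pos_cont_def)

lemma pos_cont_bounds:
 assumes "pos_cont f"
 obtains c C where "0 < c" "0 < C" "!!s. 0 \<le> s ==> s \<le> 1 ==> c \<le> f s \<and> f s \<le> C"
proof -
 have c: "continuous_on {0..1} f" and p: "!!s. s \<in> {0..1} ==> 0 < f s" using assms by (auto simp: pos_cont_def)
 obtain a where a: "a \<in> {0..1}" "\<forall>s\<in>{0..1}. f a \<le> f s" using continuous_attains_inf[OF _ _ c] by auto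
 obtain b where b: "b \<in> {0..1}" "\<forall>s\<in>{0..1}. f s \<le> f b" using continuous_attains_sup[OF _ _ c] by auto
 show ?thesis using that[of "f a" "f b"] p a b by auto
qed

lemma continuous_on_01_tendsto:
 assumes "continuous_on {0..1::real} f" "0 \<le> l" "l \<le> 1" "(g \<longlongrightarrow> l) F" "eventually (%x. 0 \<le> g x \<and> g x \<le> 1) F"
 shows "((%x. f (g x)) \<longlongrightarrow> f l) F"
 using continuous_on_tendsto_compose[OF assms(1), of g l F] assms by (simp add: eventually_mono)

lemma integrable_powr_01:
 fixes a b :: real assumes "- 1 < a" "- 1 < b"
 shows "set_integrable lborel {0<..<1} (%s. s powr a * (1 - s) powr b)"
proof -
 have "((%t. t powr (a + 1 - 1) * (1 - t) powr (b + 1 - 1)) has_integral Beta (a + 1) (b + 1)) {0..1}"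
  using assms by (intro has_integral_Beta_real) auto
 then have "(%t. t powr a * (1 - t) powr b) integrable_on {0<..<1}"
  by (auto simp: has_integral_Icc_iff_Ioo integrable_on_def)
 then have "(%t. t powr a * (1 - t) powr b) absolutely_integrable_on {0<..<1}"
  by (rule nonnegative_absolutely_integrable_1) auto
 then show ?thesis
  unfolding set_integrable_def by (subst (asm) integrable_completion) auto
qed

lemma set_borel_measurable_cont:
 "continuous_on {0<..<1::real} f ==> (%s. indicator {0<..<1} s *\<^sub>R (f s :: real)) \<in> borel_measurable borel"
 by (rule borel_measurable_continuous_on_indicator) auto

text \<open>\<open>P\<close> stands for 1/p(zeta), \<open>r1\<close> and \<open>r2\<close> for the
  two radii, \<open>w\<close> for the density of the measure in s; \<open>k0\<close> and
  \<open>k1\<close> are the corner exponents of that density. The derivative conditions say that the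
  logarithmic derivatives of r1 in ln s and of r2 in ln (1 - s) are the same function P. The last
  two conditions amount to integrability of \<open>w\<close> and of its inverse. The family is
  closed under duality and reflection and contains the model, so each limit theorem is proved
  once.\<close>

locale leray_profile =
 fixes P C1 C2 H r1 r2 w :: "real \<Rightarrow> real" and k0 k1 :: real
 assumes P: "continuous_on {0..1} P" "!!s. 0 \<le> s ==> s \<le> 1 ==> 0 < P s" "!!s. 0 \<le> s ==> s \<le> 1 ==> P s < 1"
  and C1: "pos_cont C1" and C2: "pos_cont C2" and H: "pos_cont H"
  and r1: "!!s. 0 < s ==> s < 1 ==> r1 s = C1 s * s powr P 0"
  and r2: "!!s. 0 < s ==> s < 1 ==> r2 s = C2 s * (1 - s) powr P 1"
  and w: "!!s. 0 < s ==> s < 1 ==> w s = H s * (s powr k0 * (1 - s) powr k1)"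
  and dr1: "!!s. 0 < s ==> s < 1 ==> (r1 has_real_derivative r1 s * P s / s) (at s)"
  and dr2: "!!s. 0 < s ==> s < 1 ==> (r2 has_real_derivative - (r2 s * P s / (1 - s))) (at s)"
  and k0: "\<bar>k0\<bar> < 1" and k1: "\<bar>k1\<bar> < 1"
begin

lemma P_pos_cont: "pos_cont P" using P by (auto simp: pos_cont_def)

lemma r1_pos: "0 < s ==> s < 1 ==> 0 < r1 s" using C1 by (auto simp: r1 pos_cont_def)
lemma r2_pos: "0 < s ==> s < 1 ==> 0 < r2 s" using C2 by (auto simp: r2 pos_cont_def)
lemma w_pos: "0 < s ==> s < 1 ==> 0 < w s" using H by (auto simp: w pos_cont_def)

lemma r1_cont: "continuous_on {0<..<1} r1"
 by (rule continuous_at_imp_continuous_on) (auto intro!: DERIV_isCont[OF dr1])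
lemma r2_cont: "continuous_on {0<..<1} r2"
 by (rule continuous_at_imp_continuous_on) (auto intro!: DERIV_isCont[OF dr2])
lemma w_cont: "continuous_on {0<..<1} w"
proof -
 have "continuous_on {0<..<1} (%s. H s * (s powr k0 * (1 - s) powr k1))"
  using H by (auto intro!: continuous_intros continuous_on_subset[of "{0..1}" H] simp: pos_cont_def)
 then show ?thesis by (rule continuous_on_eq) (auto simp: w)
qed

text \<open>The functions s / r1 and (1 - s) / r2 are the coefficients of the linear form in the
  Leray kernel, so the norm of u_nm is the integral \<open>I\<close> of this profile. If P = 1/p
  then 1 - P is the reciprocal of the conjugate exponent.\<close>

lemma dual: "leray_profile (%s. 1 - P s) (%s. inverse (C1 s)) (%s. inverse (C2 s)) (%s. inverse (H s))
 (%s. s / r1 s) (%s. (1 - s) / r2 s) (%s. inverse (w s)) (- k0) (- k1)"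
proof
 show "pos_cont (%s. inverse (C1 s))" "pos_cont (%s. inverse (C2 s))" "pos_cont (%s. inverse (H s))"
  using C1 C2 H by (force simp: pos_cont_def intro!: continuous_intros)+
 fix s :: real assume s: "0 < s" "s < 1"
 show "s / r1 s = inverse (C1 s) * s powr (1 - P 0)"
  using s pos_contD(2)[OF C1, of s] by (simp add: r1 powr_diff field_simps)
 show "(1 - s) / r2 s = inverse (C2 s) * (1 - s) powr (1 - P 1)"
  using s pos_contD(2)[OF C2, of s] by (simp add: r2 powr_diff field_simps)
 show "inverse (w s) = inverse (H s) * (s powr - k0 * (1 - s) powr - k1)"
  using s by (simp add: w powr_minus)
 show "((%s. s / r1 s) has_real_derivative s / r1 s * (1 - P s) / s) (at s)"
  using s r1_pos[OF s] by (auto intro!: derivative_eq_intros dr1 simp: field_simps)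
 show "((%s. (1 - s) / r2 s) has_real_derivative - ((1 - s) / r2 s * (1 - P s) / (1 - s))) (at s)"
  using s r2_pos[OF s] by (auto intro!: derivative_eq_intros dr2 simp: field_simps)
qed (use P k0 k1 in \<open>auto intro!: continuous_intros\<close>)

text \<open>This is the exchange of the two complex coordinates; it carries every statement at the
  corner s = 0 to the corner s = 1.\<close>

lemma swap: "leray_profile (%s. P (1 - s)) (%s. C2 (1 - s)) (%s. C1 (1 - s)) (%s. H (1 - s))
 (%s. r2 (1 - s)) (%s. r1 (1 - s)) (%s. w (1 - s)) k1 k0"
proof
 have c: "continuous_on {0..1} (%s. f (1 - s))" if "continuous_on {0..1} f" for f :: "real \<Rightarrow> real"
  by (rule continuous_on_compose2[OF that]) (auto intro!: continuous_intros)
 show "continuous_on {0..1} (%s. P (1 - s))" using c P by blast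
 show "pos_cont (%s. C2 (1 - s))" "pos_cont (%s. C1 (1 - s))" "pos_cont (%s. H (1 - s))"
  using C1 C2 H c by (auto simp: pos_cont_def)
 fix s :: real assume s: "0 < s" "s < 1"
 show "r2 (1 - s) = C2 (1 - s) * s powr P (1 - 0)" "r1 (1 - s) = C1 (1 - s) * (1 - s) powr P (1 - 1)"
  "w (1 - s) = H (1 - s) * (s powr k1 * (1 - s) powr k0)" using s by (auto simp: r1 r2 w)
 show "((%s. r2 (1 - s)) has_real_derivative r2 (1 - s) * P (1 - s) / s) (at s)"
  using s by (intro DERIV_cong[OF DERIV_chain2[of r2 _ "%s. 1 - s", OF dr2]]) (auto intro!: derivative_eq_intros)
 show "((%s. r1 (1 - s)) has_real_derivative - (r1 (1 - s) * P (1 - s) / (1 - s))) (at s)"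
  using s by (intro DERIV_cong[OF DERIV_chain2[of r1 _ "%s. 1 - s", OF dr1]]) (auto intro!: derivative_eq_intros)
qed (use P k0 k1 in auto)

text \<open>Up to the factor 4 pi^2 of the two angles, the squared norm of the monomial z1^n
  z2^m.\<close>

definition I :: "nat \<Rightarrow> nat \<Rightarrow> real" where
 "I n m = (LBINT s:{0<..<1}. r1 s ^ (2 * n) * r2 s ^ (2 * m) * w s)"

lemma P_lower: obtains p where "0 < p" "!!s. 0 \<le> s ==> s \<le> 1 ==> p \<le> P s"
 using pos_cont_bounds[OF P_pos_cont] by metis

lemma ln_r1_deriv: "0 < s ==> s < 1 ==> ((%s. ln (r1 s)) has_real_derivative P s / s) (at s)"
 using dr1[of s] r1_pos[of s] by (auto intro!: derivative_eq_intros simp: field_simps)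

lemma ln_r2_deriv: "0 < s ==> s < 1 ==> ((%s. ln (r2 s)) has_real_derivative - (P s / (1 - s))) (at s)"
 using dr2[of s] r2_pos[of s] by (auto intro!: derivative_eq_intros simp: field_simps)

lemma integrand_integrable: "set_integrable lborel {0<..<1} (%s. r1 s ^ (2 * n) * r2 s ^ (2 * m) * w s)"
proof -
 obtain B1 where B1: "0 < B1" "!!s. 0 \<le> s ==> s \<le> 1 ==> C1 s \<le> B1" using pos_cont_bounds[OF C1] by metis
 obtain B2 where B2: "0 < B2" "!!s. 0 \<le> s ==> s \<le> 1 ==> C2 s \<le> B2" using pos_cont_bounds[OF C2] by metis
 obtain B3 where B3: "0 < B3" "!!s. 0 \<le> s ==> s \<le> 1 ==> H s \<le> B3" using pos_cont_bounds[OF H] by metis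
 have "set_integrable lborel {0<..<1} (%s. (B1 ^ (2 * n) * B2 ^ (2 * m) * B3) * (s powr k0 * (1 - s) powr k1))"
  using k0 k1 by (intro set_integrable_mult_right integrable_powr_01) auto
 then show ?thesis
 proof (rule set_integrable_bound)
  show "set_borel_measurable lborel {0<..<1} (%s. r1 s ^ (2 * n) * r2 s ^ (2 * m) * w s)"
   unfolding set_borel_measurable_def measurable_lborel2
   by (intro set_borel_measurable_cont continuous_intros r1_cont r2_cont w_cont)
  show "AE s\<in>{0<..<1} in lborel. norm (r1 s ^ (2 * n) * r2 s ^ (2 * m) * w s)
   \<le> norm ((B1 ^ (2 * n) * B2 ^ (2 * m) * B3) * (s powr k0 * (1 - s) powr k1))"
  proof (intro AE_I2 impI)
   fix s :: real assume "s \<in> {0<..<1}" then have s: "0 < s" "s < 1" by auto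
   have a: "0 \<le> r1 s" "r1 s \<le> B1 * 1"
    using r1_pos[OF s] s B1 P(2)[of 0] pos_contD(2)[OF C1, of s] unfolding r1[OF s] by (intro order.refl mult_mono powr_le1 | simp)+
   have b: "0 \<le> r2 s" "r2 s \<le> B2 * 1"
    using r2_pos[OF s] s B2 P(2)[of 1] pos_contD(2)[OF C2, of s] unfolding r2[OF s] by (intro order.refl mult_mono powr_le1 | simp)+
   have c: "0 \<le> w s" "w s \<le> B3 * (s powr k0 * (1 - s) powr k1)"
    using w_pos[OF s] s B3 by (auto simp: w intro!: mult_right_mono)
   have "r1 s ^ (2 * n) * r2 s ^ (2 * m) * w s \<le> B1 ^ (2 * n) * B2 ^ (2 * m) * (B3 * (s powr k0 * (1 - s) powr k1))"
    using a b c B1 B2 by (intro mult_mono power_mono) auto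
   then show "norm (r1 s ^ (2 * n) * r2 s ^ (2 * m) * w s)
   \<le> norm ((B1 ^ (2 * n) * B2 ^ (2 * m) * B3) * (s powr k0 * (1 - s) powr k1))"
    using a b c B1 B2 B3 by (simp add: abs_mult mult.assoc)
  qed
 qed
qed

end

section \<open>Watson's lemma at the corner s = 0\<close>

lemma Gamma_integral_scaled:
 fixes a c :: real assumes "0 < a" "0 < c"
 shows "has_bochner_integral lborel (%u. indicator {0<..} u * (u powr (a - 1) * exp (- (c * u)))) (Gamma a * c powr (- a))"
proof -
 define g where "g = (%t::real. indicator {0<..} t *\<^sub>R (t powr (a - 1) / exp t))"
 have h: "((%t. t powr (a - 1) / exp t) has_integral Gamma a) {0<..}"
 proof -
  have "((%t. t powr (a - 1) / exp t) has_integral Gamma a) {0..}" using Gamma_integral_real assms by blast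
  then show ?thesis
   by (rule iffD1[OF has_integral_spike_set_eq, rotated 2]; intro negligible_subset[OF negligible_sing[of 0]]) auto
 qed
 then have "(%t. t powr (a - 1) / exp t) absolutely_integrable_on {0<..}"
  by (intro nonnegative_absolutely_integrable_1) auto
 then have si: "set_integrable lborel {0<..} (%t. t powr (a - 1) / exp t)"
  unfolding set_integrable_def by (subst (asm) integrable_completion) auto
 have "(LINT t:{0<..}|lborel. t powr (a - 1) / exp t) = Gamma a"
  using set_borel_integral_eq_integral(2)[OF si] h by (simp add: has_integral_iff)
 with si have g: "has_bochner_integral lborel g (Gamma a)"
  by (simp add: g_def has_bochner_integral_iff set_integrable_def set_lebesgue_integral_def)
 have "has_bochner_integral lborel (%x. g (0 + c * x)) (Gamma a /\<^sub>R \<bar>c\<bar>)"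
  using g lborel_has_bochner_integral_real_affine_iff[of c g "Gamma a" 0] assms by simp
 then have "has_bochner_integral lborel (%x. c powr (1 - a) * g (c * x)) (c powr (1 - a) * (Gamma a / c))"
  using assms by (auto intro!: has_bochner_integral_mult_right simp: divide_inverse_commute)
 moreover have "c powr (1 - a) * (Gamma a / c) = Gamma a * c powr (- a)"
  using assms by (simp add: powr_diff powr_minus field_simps)
 moreover have "c powr (1 - a) * g (c * x) = indicator {0<..} x * (x powr (a - 1) * exp (- (c * x)))" for x
 proof (cases "0 < x")
  case True
  then have "(c * x) powr (a - 1) = c powr (a - 1) * x powr (a - 1)" using assms by (simp add: powr_mult)
  moreover have "c powr (1 - a) * c powr (a - 1) = 1" using assms by (simp flip: powr_add)
  ultimately show ?thesis using True assms
   by (simp add: g_def zero_less_mult_iff exp_minus field_simps)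
 next
  case False then show ?thesis using assms by (simp add: g_def zero_less_mult_iff)
 qed
 ultimately show ?thesis by simp
qed

lemma exp_minus_ge_one_minus: "1 - x \<le> exp (- x)" for x :: real
 using exp_ge_add_one_self[of "- x"] by simp

context leray_profile begin

text \<open>The mean value theorem replaces an expansion of r2 at 0, since P has no more than
  continuity there. The parameter c serves two purposes: c = 0 gives the limit of (r2 / C2 0)^(2m),
  and c = p, a lower bound of P, gives the domination.\<close>

lemma ln_r2_mvt:
 assumes s: "0 < s" "s < 1"
 shows "\<exists>\<xi>. 0 < \<xi> \<and> \<xi> < s \<and> ln (r2 s) - c * ln (1 - s) = ln (C2 0) - s * ((P \<xi> - c) / (1 - \<xi>))"
proof -
 \<comment> \<open>The locale controls r2 only inside the interval; the extension to the end point 0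
   is written with \<open>C2\<close>.\<close>
 define g where "g = (%s. ln (C2 s) + P 1 * ln (1 - s) - c * ln (1 - s))"
 have eq: "g t = ln (r2 t) - c * ln (1 - t)" if "0 < t" "t < 1" for t
  using that pos_contD(2)[OF C2, of t] by (simp add: g_def r2 ln_mult ln_powr)
 have dg: "(g has_real_derivative - ((P t - c) / (1 - t))) (at t)" if "0 < t" "t < 1" for t
 proof -
  have "((%t. ln (r2 t) - c * ln (1 - t)) has_real_derivative - ((P t - c) / (1 - t))) (at t)"
  proof -
   have "((%t. ln (1 - t)) has_real_derivative - (1 / (1 - t))) (at t)"
    using that by (auto intro!: derivative_eq_intros)
   from DERIV_diff[OF ln_r2_deriv[OF that] DERIV_cmult[OF this, of c]] show ?thesis
    by (rule DERIV_cong) (simp add: diff_divide_distrib)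
  qed
  then show ?thesis
   by (rule has_field_derivative_transform_within_open[of _ _ _ "{0<..<1}"]) (use that eq in auto)
 qed
 have "continuous_on {0..s} g" unfolding g_def
  using s pos_contD(2)[OF C2] continuous_on_subset[OF pos_contD(1)[OF C2], of "{0..s}"]
  by (auto intro!: continuous_intros simp: less_imp_neq) (smt (verit))
 moreover have "!!x. 0 < x ==> x < s ==> g differentiable (at x)"
  using dg s by (meson real_differentiable_def order.strict_trans)
 ultimately obtain l z where z: "0 < z" "z < s" "DERIV g z :> l" "g s - g 0 = (s - 0) * l"
  using MVT[OF s(1), of g] by blast
 have "l = - ((P z - c) / (1 - z))" using DERIV_unique[OF z(3) dg] z s by auto
 then have "g s = ln (C2 0) - s * ((P z - c) / (1 - z))" using z by (simp add: g_def)
 then show ?thesis using z eq[OF s] by auto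
qed

lemma r2_upper:
 assumes p: "!!s. 0 \<le> s ==> s \<le> 1 ==> p \<le> P s" and s: "0 < s" "s < 1"
 shows "r2 s \<le> C2 0 * (1 - s) powr p"
proof -
 obtain \<xi> where x: "0 < \<xi>" "\<xi> < s" "ln (r2 s) - p * ln (1 - s) = ln (C2 0) - s * ((P \<xi> - p) / (1 - \<xi>))"
  using ln_r2_mvt[OF s] by blast
 have "0 \<le> s * ((P \<xi> - p) / (1 - \<xi>))" using x s p[of \<xi>] by simp
 then have "ln (r2 s) \<le> ln (C2 0) + p * ln (1 - s)" using x by linarith
 also have "\<dots> = ln (C2 0 * (1 - s) powr p)" using s pos_contD(2)[OF C2, of 0] by (simp add: ln_mult ln_powr)
 finally show ?thesis using r2_pos[OF s] s pos_contD(2)[OF C2, of 0] by (subst (asm) ln_le_cancel_iff) auto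
qed

text \<open>After s = u / m the factors r1^(2n) w become u^(a - 1) up to constants, and r2^(2m)
  tends to an exponential of rate 2 P(0); dominated convergence leaves a Gamma integral.\<close>

theorem corner_limit:
 fixes n :: nat
 defines "a \<equiv> 2 * real n * P 0 + k0 + 1"
 shows "(%m. I n m / C2 0 ^ (2 * m) * real m powr a) \<longlonglongrightarrow> C1 0 ^ (2 * n) * H 0 * (Gamma a * (2 * P 0) powr (- a))"
proof -
 have P0: "0 < P 0" using P(2)[of 0] by auto
 then have "0 \<le> 2 * real n * P 0" by simp
 then have a: "0 < a" unfolding a_def using k0 by linarith
 have C20: "0 < C2 0" using pos_contD(2)[OF C2, of 0] by simp
 obtain p where p: "0 < p" "!!s. 0 \<le> s ==> s \<le> 1 ==> p \<le> P s" using P_lower by metis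
 obtain B1 where B1: "0 < B1" "!!s. 0 \<le> s ==> s \<le> 1 ==> C1 s \<le> B1" using pos_cont_bounds[OF C1] by metis
 obtain B3 where B3: "0 < B3" "!!s. 0 \<le> s ==> s \<le> 1 ==> H s \<le> B3" using pos_cont_bounds[OF H] by metis
 \<comment> \<open>From m \<ge> K on, m p is at least 1, which outweighs a negative exponent
   \<open>k1\<close> of the weight at the far end s = 1.\<close>
 obtain K :: nat where K: "1 \<le> real K * p" "K \<noteq> 0"
 proof -
  obtain K :: nat where "1 / p < real K" using reals_Archimedean2 by blast
  with p(1) have "1 \<le> real K * p" "K \<noteq> 0" by (auto simp: field_simps intro!: gr0I)
  with that show ?thesis by blast
 qed
 define F where "F = (%m u. indicator {0<..<real m} u *
   (C1 (u / m) ^ (2 * n) * H (u / m) * u powr (a - 1) * ((1 - u / m) powr k1 * (r2 (u / m) / C2 0) ^ (2 * m))))"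
 define f where "f = (%u. C1 0 ^ (2 * n) * H 0 * (indicator {0<..} u * (u powr (a - 1) * exp (- (2 * P 0 * u)))))"
 have IF: "I n m / C2 0 ^ (2 * m) * real m powr a = (LBINT u. F m u)" if m: "0 < m" for m :: nat
 proof -
  have "I n m = (LBINT s. indicator {0<..<1} s *\<^sub>R (r1 s ^ (2 * n) * r2 s ^ (2 * m) * w s))"
   by (simp add: I_def set_lebesgue_integral_def)
  also have "\<dots> = (1 / m) * (LBINT u. indicator {0<..<1} (u / m) * (r1 (u / m) ^ (2 * n) * r2 (u / m) ^ (2 * m) * w (u / m)))"
   using m by (subst lborel_integral_real_affine[of "1 / m" _ 0]) auto
  finally have "I n m / C2 0 ^ (2 * m) * real m powr a =
   (LBINT u. (indicator {0<..<1} (u / m) * (r1 (u / m) ^ (2 * n) * r2 (u / m) ^ (2 * m) * w (u / m))) * (real m powr (a - 1) / C2 0 ^ (2 * m)))"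
   using m by (simp add: powr_diff)
  also have "(%u. (indicator {0<..<1} (u / m) * (r1 (u / m) ^ (2 * n) * r2 (u / m) ^ (2 * m) * w (u / m))) * (real m powr (a - 1) / C2 0 ^ (2 * m))) = F m"
  proof
   fix u :: real
   show "(indicator {0<..<1} (u / m) * (r1 (u / m) ^ (2 * n) * r2 (u / m) ^ (2 * m) * w (u / m))) * (real m powr (a - 1) / C2 0 ^ (2 * m)) = F m u"
   proof (cases "0 < u \<and> u < m")
    case True
    define s where "s = u / m"
    have s: "0 < s" "s < 1" using True m by (auto simp: s_def)
    have "r1 s ^ (2 * n) * w s * real m powr (a - 1) =
      C1 s ^ (2 * n) * H s * (1 - s) powr k1 * (s powr (real (2 * n) * P 0) * s powr k0 * real m powr (a - 1))"
     using s by (simp add: r1 w power_mult_distrib powr_power mult_ac)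
    also have "s powr (real (2 * n) * P 0) * s powr k0 = s powr (a - 1)" by (simp add: a_def powr_add)
    also have "s powr (a - 1) * real m powr (a - 1) = u powr (a - 1)" using True m by (simp add: s_def powr_divide)
    finally have "r1 s ^ (2 * n) * w s * real m powr (a - 1) = C1 s ^ (2 * n) * H s * (1 - s) powr k1 * u powr (a - 1)" .
    then have "(r1 s ^ (2 * n) * w s * real m powr (a - 1)) * (r2 s ^ (2 * m) / C2 0 ^ (2 * m)) =
      (C1 s ^ (2 * n) * H s * (1 - s) powr k1 * u powr (a - 1)) * (r2 s ^ (2 * m) / C2 0 ^ (2 * m))" by simp
    then show ?thesis using True m by (simp add: F_def s_def[symmetric] power_divide mult_ac) (simp add: s_def)
   next
    case False then show ?thesis using m by (auto simp: F_def field_simps split: split_indicator)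
   qed
  qed
  finally show ?thesis .
 qed
 have bound: "norm (F m u) \<le> B1 ^ (2 * n) * B3 * (indicator {0<..} u * (u powr (a - 1) * exp (- (p * u))))" if m: "K \<le> m" for m u
 proof (cases "0 < u \<and> u < m")
  case True
  define s where "s = u / m"
  have s: "0 < s" "s < 1" using True m K by (auto simp: s_def)
  have mp: "1 \<le> real m * p" using m K(1) p(1) by (smt (verit) mult_right_mono of_nat_mono)
  have "r2 s / C2 0 \<le> (1 - s) powr p" using r2_upper[OF p(2) s] C20 by (simp add: field_simps)
  then have "(r2 s / C2 0) ^ (2 * m) \<le> ((1 - s) powr p) ^ (2 * m)" using r2_pos[OF s] C20 by (intro power_mono) auto
  also have "\<dots> = (1 - s) powr (2 * (real m * p))" using s by (simp add: powr_power mult_ac)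
  finally have "(1 - s) powr k1 * (r2 s / C2 0) ^ (2 * m) \<le> (1 - s) powr k1 * (1 - s) powr (2 * (real m * p))"
   by (intro mult_left_mono) auto
  also have "\<dots> = (1 - s) powr (k1 + 2 * (real m * p))" by (simp add: powr_add)
  \<comment> \<open>Half of the exponent 2 m p is kept for the decay; the other half is at least 1
    and absorbs k1 > -1.\<close>
  also have "\<dots> \<le> (1 - s) powr (real m * p)"
  proof (intro powr_mono')
   show "real m * p \<le> k1 + 2 * (real m * p)" using mp k1 by linarith
  qed (use s in auto)
  also have "\<dots> \<le> exp (- s) powr (real m * p)" using s mp exp_minus_ge_one_minus[of s] by (intro powr_mono2) auto
  also have "\<dots> = exp (- (p * u))" using True by (simp add: powr_def s_def)
  finally have 1: "(1 - s) powr k1 * (r2 s / C2 0) ^ (2 * m) \<le> exp (- (p * u))" .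
  have nn: "0 \<le> C1 s" "0 \<le> H s" "0 \<le> (1 - s) powr k1 * (r2 s / C2 0) ^ (2 * m)"
   using s pos_contD(2)[OF C1, of s] pos_contD(2)[OF H, of s] r2_pos[OF s] C20 by auto
  have "C1 s ^ (2 * n) * H s * u powr (a - 1) * ((1 - s) powr k1 * (r2 s / C2 0) ^ (2 * m)) \<le> B1 ^ (2 * n) * B3 * u powr (a - 1) * exp (- (p * u))"
   using 1 nn s B1 B3 True by (intro mult_mono power_mono) auto
  moreover have "norm (F m u) = C1 s ^ (2 * n) * H s * u powr (a - 1) * ((1 - s) powr k1 * (r2 s / C2 0) ^ (2 * m))"
   using True nn by (simp add: F_def s_def[symmetric] abs_mult)
  ultimately show ?thesis using True by (simp add: mult_ac)
 next
  case False then show ?thesis using B1 B3 by (auto simp: F_def)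
 qed
 have lim: "(%m. F m u) \<longlonglongrightarrow> f u" for u
 proof (cases "0 < u")
  case True
  have ev: "\<forall>\<^sub>F m in sequentially. u < real m" using reals_Archimedean2[of u]
   by (metis eventually_sequentiallyI le_less_trans nle_le not_le of_nat_mono)
  have s0: "(%m. u / real m) \<longlonglongrightarrow> 0" by real_asymp
  have ev01: "\<forall>\<^sub>F m in sequentially. 0 \<le> u / real m \<and> u / real m \<le> 1"
   using ev by eventually_elim (use True in auto)
  have e2: "(%m. (r2 (u / m) / C2 0) ^ (2 * m)) \<longlonglongrightarrow> exp (- (2 * P 0 * u))"
  proof -
   \<comment> \<open>The intermediate point of the mean value theorem for each m; it lies between 0
     and u / m, hence tends to 0, and continuity of P at 0 suffices.\<close>
   define \<xi> where "\<xi> = (%m. SOME x. 0 < x \<and> x < u / real m \<and> ln (r2 (u / m)) - 0 * ln (1 - u / m) = ln (C2 0) - (u / m) * ((P x - 0) / (1 - x)))"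
   have \<xi>: "0 < \<xi> m \<and> \<xi> m < u / m \<and> ln (r2 (u / m)) - 0 * ln (1 - u / m) = ln (C2 0) - (u / m) * ((P (\<xi> m) - 0) / (1 - \<xi> m))"
    if "u < real m" for m
    unfolding \<xi>_def by (rule someI_ex, rule ln_r2_mvt) (use that True in auto)
   have x0: "\<xi> \<longlonglongrightarrow> 0"
    by (rule tendsto_sandwich[OF _ _ tendsto_const s0]; use ev in eventually_elim) (use \<xi> in \<open>auto intro: less_imp_le\<close>)
   have "(%m. P (\<xi> m)) \<longlonglongrightarrow> P 0"
   proof (rule continuous_on_01_tendsto[OF P(1) _ _ x0])
    show "\<forall>\<^sub>F m in sequentially. 0 \<le> \<xi> m \<and> \<xi> m \<le> 1" using ev ev01 by eventually_elim (use \<xi> in force)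
   qed auto
   then have "(%m. exp (- (2 * u * (P (\<xi> m) / (1 - \<xi> m))))) \<longlonglongrightarrow> exp (- (2 * u * (P 0 / (1 - 0))))"
    by (intro tendsto_intros x0) auto
   moreover have "\<forall>\<^sub>F m in sequentially. exp (- (2 * u * (P (\<xi> m) / (1 - \<xi> m)))) = (r2 (u / m) / C2 0) ^ (2 * m)"
    using ev
   proof eventually_elim
    case (elim m)
    have r: "0 < r2 (u / m)" using elim True by (intro r2_pos) auto
    have "(r2 (u / m) / C2 0) ^ (2 * m) = exp (real (2 * m) * ln (r2 (u / m) / C2 0))"
     using r C20 by (subst exp_of_nat_mult) auto
    also have "ln (r2 (u / m) / C2 0) = - ((u / m) * (P (\<xi> m) / (1 - \<xi> m)))" using \<xi>[OF elim] r C20 by (simp add: ln_div)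
    also have "real (2 * m) * (- ((u / m) * (P (\<xi> m) / (1 - \<xi> m)))) = - (2 * u * (P (\<xi> m) / (1 - \<xi> m)))"
    proof -
     have "real (2 * m) * (- ((u / m) * X)) = - (2 * u * X)" if "real m \<noteq> 0" for X using that by simp
     then show ?thesis using elim True by simp
    qed
    finally show ?case by simp
   qed
   ultimately show ?thesis using Lim_transform_eventually by (fastforce simp: mult_ac)
  qed
  have "(%m. C1 (u / m) ^ (2 * n) * H (u / m) * u powr (a - 1) * ((1 - u / m) powr k1 * (r2 (u / m) / C2 0) ^ (2 * m)))
    \<longlonglongrightarrow> C1 0 ^ (2 * n) * H 0 * u powr (a - 1) * ((1 - 0) powr k1 * exp (- (2 * P 0 * u)))"
   by (intro tendsto_intros e2 s0 continuous_on_01_tendsto[OF pos_contD(1)[OF C1]] continuous_on_01_tendsto[OF pos_contD(1)[OF H]] ev01) auto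
  then have "(%m. C1 (u / m) ^ (2 * n) * H (u / m) * u powr (a - 1) * ((1 - u / m) powr k1 * (r2 (u / m) / C2 0) ^ (2 * m))) \<longlonglongrightarrow> f u"
   using True by (simp add: f_def mult_ac)
  moreover have "\<forall>\<^sub>F m in sequentially. C1 (u / m) ^ (2 * n) * H (u / m) * u powr (a - 1) * ((1 - u / m) powr k1 * (r2 (u / m) / C2 0) ^ (2 * m)) = F m u"
   using ev by eventually_elim (use True in \<open>simp add: F_def\<close>)
  ultimately show ?thesis by (rule Lim_transform_eventually)
 next
  case False then show ?thesis by (simp add: F_def f_def)
 qed
 have meas: "F m \<in> borel_measurable lborel" if "0 < m" for m
 proof -
  have "continuous_on {0<..<real m} (%u. C1 (u / m) ^ (2 * n) * H (u / m) * u powr (a - 1) * ((1 - u / m) powr k1 * (r2 (u / m) / C2 0) ^ (2 * m)))"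
   using that C20
   by (intro continuous_intros continuous_on_compose2[OF pos_contD(1)[OF C1]] continuous_on_compose2[OF pos_contD(1)[OF H]]
    continuous_on_compose2[OF r2_cont]) (auto simp: field_simps)
  then have "(%u. indicator {0<..<real m} u *\<^sub>R (C1 (u / m) ^ (2 * n) * H (u / m) * u powr (a - 1) * ((1 - u / m) powr k1 * (r2 (u / m) / C2 0) ^ (2 * m)))) \<in> borel_measurable borel"
   by (intro borel_measurable_continuous_on_indicator) auto
  then show ?thesis by (simp add: F_def)
 qed
 have fi: "has_bochner_integral lborel f (C1 0 ^ (2 * n) * H 0 * (Gamma a * (2 * P 0) powr (- a)))"
  unfolding f_def using P0 a by (intro has_bochner_integral_mult_right Gamma_integral_scaled) auto
 \<comment> \<open>The index is shifted because the majorant is valid only from K on.\<close>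
 have "(%m. LBINT u. F (m + K) u) \<longlonglongrightarrow> (LBINT u. f u)"
 proof (rule integral_dominated_convergence)
  show "integrable lborel (%u. B1 ^ (2 * n) * B3 * (indicator {0<..} u * (u powr (a - 1) * exp (- (p * u)))))"
   using Gamma_integral_scaled[OF a p(1)] by (intro integrable_mult_right) (simp add: has_bochner_integral_iff)
  show "!!m. F (m + K) \<in> borel_measurable lborel" using meas K by auto
  show "f \<in> borel_measurable lborel" using fi unfolding has_bochner_integral_iff by (blast intro: borel_measurable_integrable)
  show "AE u in lborel. (%m. F (m + K) u) \<longlonglongrightarrow> f u" using lim LIMSEQ_ignore_initial_segment by blast
  show "!!m. AE u in lborel. norm (F (m + K) u) \<le> B1 ^ (2 * n) * B3 * (indicator {0<..} u * (u powr (a - 1) * exp (- (p * u))))"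
   using bound by auto
 qed
 moreover have "(%m. I n (m + K) / C2 0 ^ (2 * (m + K)) * real (m + K) powr a) = (%m. LBINT u. F (m + K) u)"
  by (intro ext IF) (use K in auto)
 ultimately have "(%m. I n (m + K) / C2 0 ^ (2 * (m + K)) * real (m + K) powr a) \<longlonglongrightarrow> C1 0 ^ (2 * n) * H 0 * (Gamma a * (2 * P 0) powr (- a))"
  using has_bochner_integral_integral_eq[OF fi] by simp
 then show ?thesis by (rule LIMSEQ_offset)
qed

end

section \<open>Laplace's method at the saddle n / (n + m)\<close>

lemma gaussian_integral_scaled:
 fixes c :: real assumes "0 < c"
 shows "has_bochner_integral lborel (%u. exp (- (c * u\<^sup>2))) (sqrt (pi / c))"
proof -
 define s where "s = sqrt (1 / (2 * c))"
 have s: "0 < s" "s\<^sup>2 = 1 / (2 * c)" using assms by (auto simp: s_def)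
 have "has_bochner_integral lborel (%u. sqrt (pi / c) * normal_density 0 s u) (sqrt (pi / c) * 1)"
  by (intro has_bochner_integral_mult_right) (use s in \<open>simp add: has_bochner_integral_iff\<close>)
 moreover have "sqrt (pi / c) * normal_density 0 s u = exp (- (c * u\<^sup>2))" for u
  unfolding normal_density_def s(2) using assms by (simp add: mult_ac)
 ultimately show ?thesis by simp
qed

lemma integrable_exp_minus_abs:
 fixes d :: real assumes "0 < d" shows "integrable lborel (%u. exp (- (d * \<bar>u\<bar>)))"
proof -
 let ?g = "%u. indicator {0<..} u * (u powr (1 - 1) * exp (- (d * u)))"
 have g: "integrable lborel ?g"
  using Gamma_integral_scaled[of 1 d] assms by (simp add: has_bochner_integral_iff)
 have "integrable lborel (%u. ?g (0 + (- 1) * u))" using g by (subst lborel_integrable_real_affine_iff) auto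
 with g have "integrable lborel (%u. ?g u + ?g (0 + (- 1) * u))" by (rule Bochner_Integration.integrable_add)
 then show ?thesis
 proof (rule integrable_cong_AE_imp)
  show "AE u in lborel. ?g u + ?g (0 + (- 1) * u) = exp (- (d * \<bar>u\<bar>))"
   using AE_lborel_singleton[of 0] by eventually_elim (auto split: split_indicator)
  show "(%u. exp (- (d * \<bar>u\<bar>))) \<in> borel_measurable lborel" by simp
 qed
qed

text \<open>Controls the ratio of the weight at two points for every admissible corner exponent at
  once, whatever its sign.\<close>

lemma powr_le_add_inverse:
 fixes x k :: real assumes "0 < x" "\<bar>k\<bar> < 1" shows "x powr k \<le> x + 1 / x"
proof (cases "1 \<le> x")
 case True
 then have "x powr k \<le> x powr 1" using assms by (intro powr_mono) auto
 then show ?thesis using assms by (simp add: add_increasing2)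
next
 case False
 then have "x powr k \<le> x powr (- 1)" using assms by (intro powr_mono') auto
 then have "x powr k \<le> 1 / x" using assms by (simp add: powr_minus inverse_eq_divide)
 then show ?thesis using assms by simp
qed

text \<open>The standard deviation scale at the saddle point \<open>n / (n + m)\<close>, relative to the distances
 to the end points of the interval.\<close>

definition sdev0 :: "nat \<Rightarrow> nat \<Rightarrow> real" where "sdev0 n m = sqrt (m / (n * (real n + m)))"
definition sdev1 :: "nat \<Rightarrow> nat \<Rightarrow> real" where "sdev1 n m = sqrt (n / (m * (real n + m)))"

context
 fixes n m :: nat and sg a b h :: real
 assumes nm: "0 < n" "0 < m"
 defines "sg \<equiv> n / (real n + m)" and "a \<equiv> sdev0 n m" and "b \<equiv> sdev1 n m" and "h \<equiv> sqrt (sg * (1 - sg) / (real n + m))"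
begin

lemma saddle_01: "0 < sg" "sg < 1" using nm by (auto simp: sg_def)
lemma saddle_compl: "1 - sg = m / (real n + m)" using nm by (simp add: sg_def field_simps)
lemma sdev_pos: "0 < a" "0 < b" "0 < h" using nm saddle_01 by (auto simp: a_def b_def h_def sdev0_def sdev1_def)

text \<open>h is the standard deviation of the mean of n + m Bernoulli trials with success
  probability sg. Dividing it by the distances sg and 1 - sg to the end points gives a and b, the
  quantities that must be small for a Gaussian limit.\<close>

lemma sdev_scale: "h = sg * a" "h = (1 - sg) * b" "(real n + m) * h\<^sup>2 = sg * (1 - sg)"
proof -
 have h2: "h\<^sup>2 = sg * (1 - sg) / (real n + m)" using saddle_01 by (simp add: h_def)
 have "(sg * a)\<^sup>2 = h\<^sup>2" using nm unfolding h2 saddle_compl power_mult_distrib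
  by (simp add: a_def sdev0_def sg_def power2_eq_square mult_ac)
 then show "h = sg * a" using sdev_pos saddle_01 by (simp add: power2_eq_iff_nonneg)
 have "((1 - sg) * b)\<^sup>2 = h\<^sup>2" using nm unfolding h2 saddle_compl power_mult_distrib
  by (simp add: b_def sdev1_def sg_def power2_eq_square mult_ac)
 then show "h = (1 - sg) * b" using sdev_pos saddle_01 by (simp add: power2_eq_iff_nonneg)
 show "(real n + m) * h\<^sup>2 = sg * (1 - sg)" unfolding h2 using nm by simp
qed

lemma sdev_balance: "n * a = m * b"
proof -
 have "n * a = (real n + m) * h" using nm unfolding sdev_scale(1) by (simp add: sg_def)
 moreover have "m * b = (real n + m) * h" using nm unfolding sdev_scale(2) saddle_compl by simp
 ultimately show ?thesis by simp
qed

lemma saddle_shift: "sg + h * u = sg * (1 + a * u)" "1 - (sg + h * u) = (1 - sg) * (1 - b * u)"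
proof -
 show "sg + h * u = sg * (1 + a * u)" unfolding sdev_scale(1) by (simp add: algebra_simps)
 have "(1 - sg) * (1 - b * u) = (1 - sg) - ((1 - sg) * b) * u" by (simp add: algebra_simps)
 then show "1 - (sg + h * u) = (1 - sg) * (1 - b * u)" using sdev_scale(2) by simp
qed

lemma sdev_le: "a \<le> sqrt (1 / n)" "b \<le> sqrt (1 / m)"
 unfolding a_def b_def sdev0_def sdev1_def using nm by (simp_all add: divide_simps)

lemma sdev_le1: "a \<le> 1" "b \<le> 1"
proof -
 have "sqrt (1 / n) \<le> 1" "sqrt (1 / m) \<le> 1" using nm by auto
 then show "a \<le> 1" "b \<le> 1" using sdev_le by linarith+
qed

lemma saddle_01_iff: "0 < sg + h * u \<and> sg + h * u < 1 \<longleftrightarrow> - 1 < a * u \<and> b * u < 1"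
proof -
 have "0 < sg + h * u \<longleftrightarrow> - 1 < a * u" unfolding saddle_shift(1) using saddle_01 by (auto simp: zero_less_mult_iff)
 moreover have "0 < 1 - (sg + h * u) \<longleftrightarrow> b * u < 1" unfolding saddle_shift(2) using saddle_01 by (auto simp: zero_less_mult_iff)
 ultimately show ?thesis by auto
qed

end

context leray_profile begin

text \<open>The integrand of \<open>I\<close>, divided by its value at the saddle sg and written in
  the variable u with s = sg + h u; it is cut off outside the interval so that it can be integrated
  over the whole line.\<close>

definition bulk :: "nat \<Rightarrow> nat \<Rightarrow> real \<Rightarrow> real" where
 "bulk n m u = (let sg = n / (real n + m); s = sg + sqrt (sg * (1 - sg) / (real n + m)) * u in
   indicator {0<..<1} s * (exp (2 * n * (ln (r1 s) - ln (r1 sg)) + 2 * m * (ln (r2 s) - ln (r2 sg))) * (w s / w sg)))"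

text \<open>The square root is 1 / h, the Jacobian of s = sg + h u.\<close>

lemma bulk_integral:
 fixes n m :: nat assumes nm: "0 < n" "0 < m"
 defines "sg \<equiv> n / (real n + m)"
 shows "I n m / (r1 sg ^ (2 * n) * r2 sg ^ (2 * m) * w sg) * sqrt ((real n + m) / (sg * (1 - sg))) = (LBINT u. bulk n m u)"
proof -
 define h where "h = sqrt (sg * (1 - sg) / (real n + m))"
 have sg: "0 < sg" "sg < 1" using saddle_01[OF nm] by (auto simp: sg_def)
 have h: "0 < h" using sdev_pos[OF nm] by (auto simp: h_def sg_def)
 have hs: "sqrt ((real n + m) / (sg * (1 - sg))) = 1 / h" by (simp add: h_def real_sqrt_divide)
 define D where "D = r1 sg ^ (2 * n) * r2 sg ^ (2 * m) * w sg"
 have "I n m = (LBINT s. indicator {0<..<1} s *\<^sub>R (r1 s ^ (2 * n) * r2 s ^ (2 * m) * w s))"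
  by (simp add: I_def set_lebesgue_integral_def)
 also have "\<dots> = h * (LBINT u. indicator {0<..<1} (sg + h * u) * (r1 (sg + h * u) ^ (2 * n) * r2 (sg + h * u) ^ (2 * m) * w (sg + h * u)))"
  using h by (subst lborel_integral_real_affine[of h _ sg]) auto
 finally have "I n m / D * (1 / h) = (LBINT u. (indicator {0<..<1} (sg + h * u) * (r1 (sg + h * u) ^ (2 * n) * r2 (sg + h * u) ^ (2 * m) * w (sg + h * u))) / D)"
  using h by simp
 also have "(%u. (indicator {0<..<1} (sg + h * u) * (r1 (sg + h * u) ^ (2 * n) * r2 (sg + h * u) ^ (2 * m) * w (sg + h * u))) / D) = bulk n m"
 proof
  fix u
  define s where "s = sg + h * u"
  show "(indicator {0<..<1} (sg + h * u) * (r1 (sg + h * u) ^ (2 * n) * r2 (sg + h * u) ^ (2 * m) * w (sg + h * u))) / D = bulk n m u"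
  proof (cases "0 < s \<and> s < 1")
   case True
   have e: "exp (real (2 * k) * (ln x - ln y)) = x ^ (2 * k) / y ^ (2 * k)" if "0 < x" "0 < y" for x y and k :: nat
    using that unfolding exp_of_nat_mult by (simp add: exp_diff power_divide)
   have "exp (2 * n * (ln (r1 s) - ln (r1 sg)) + 2 * m * (ln (r2 s) - ln (r2 sg))) = r1 s ^ (2 * n) / r1 sg ^ (2 * n) * (r2 s ^ (2 * m) / r2 sg ^ (2 * m))"
    using e[of "r1 s" "r1 sg" n] e[of "r2 s" "r2 sg" m] r1_pos r2_pos True sg by (simp add: exp_add)
   then show ?thesis using True by (simp add: bulk_def Let_def D_def h_def s_def sg_def)
  next
   case False then show ?thesis by (auto simp: bulk_def Let_def h_def s_def sg_def)
  qed
 qed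
 finally show ?thesis by (simp add: hs D_def)
qed

text \<open>The difference of the two sides has a derivative in s of the form (P - p) times a
  positive factor times sg - s, because the profile with constant exponent p has the same stationary
  point. So the difference is largest at sg, where it vanishes. This reduces all profiles to the
  Bernoulli entropy.\<close>

lemma log_concave_domination:
 fixes n m :: nat assumes nm: "0 < n" "0 < m"
 defines "sg \<equiv> n / (real n + m)"
 assumes p: "!!s. 0 \<le> s ==> s \<le> 1 ==> p \<le> P s" and s: "0 < s" "s < 1"
 shows "n * (ln (r1 s) - ln (r1 sg)) + m * (ln (r2 s) - ln (r2 sg)) \<le> p * (n * (ln s - ln sg) + m * (ln (1 - s) - ln (1 - sg)))"
proof -
 define D where "D = (%s. n * (ln (r1 s) - p * ln s) + m * (ln (r2 s) - p * ln (1 - s)))"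
 have sg: "0 < sg" "sg < 1" using saddle_01[OF nm] by (auto simp: sg_def)
 have d: "(D has_real_derivative ((P t - p) / (t * (1 - t))) * ((real n + m) * (sg - t))) (at t)" if t: "0 < t" "t < 1" for t
 proof -
  have 0: "((%t. ln (1 - t)) has_real_derivative - (1 / (1 - t))) (at t)"
   using that by (auto intro!: derivative_eq_intros)
  note 1 = DERIV_diff[OF ln_r1_deriv[OF t] DERIV_cmult[OF DERIV_ln_divide[OF t(1)], of p]]
  note 2 = DERIV_diff[OF ln_r2_deriv[OF t] DERIV_cmult[OF 0, of p]]
  have "(D has_real_derivative n * (P t / t - p * (1 / t)) + m * (- (P t / (1 - t)) - p * (- (1 / (1 - t))))) (at t)"
   unfolding D_def by (intro DERIV_add DERIV_cmult 1 2)
  moreover have "n * (P t / t - p * (1 / t)) + m * (- (P t / (1 - t)) - p * (- (1 / (1 - t)))) = ((P t - p) / (t * (1 - t))) * ((real n + m) * (sg - t))"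
  proof -
   have "(real n + m) * (sg - t) = n * (1 - t) - m * t" using nm by (simp add: sg_def field_simps)
   then show ?thesis using t by (simp only:) (simp add: divide_simps, simp add: algebra_simps)
  qed
  ultimately show ?thesis by simp
 qed
 have "D s \<le> D sg"
 proof (cases "s \<le> sg")
  case True
  show ?thesis
  proof (rule DERIV_nonneg_imp_nondecreasing[OF True])
   fix x assume "s \<le> x" "x \<le> sg"
   then show "\<exists>y. (D has_real_derivative y) (at x) \<and> 0 \<le> y"
    using d[of x] s sg p[of x] by (intro exI[of _ "((P x - p) / (x * (1 - x))) * ((real n + m) * (sg - x))"]) auto
  qed
 next
  case False
  show ?thesis
  proof (rule DERIV_nonpos_imp_nonincreasing[of sg s])
   fix x assume "sg \<le> x" "x \<le> s"
   then show "\<exists>y. (D has_real_derivative y) (at x) \<and> y \<le> 0"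
    using d[of x] s sg p[of x] by (intro exI[of _ "((P x - p) / (x * (1 - x))) * ((real n + m) * (sg - x))"] conjI mult_nonneg_nonpos divide_nonneg_nonneg) auto
  qed (use False in simp)
 qed
 then show ?thesis by (simp add: D_def algebra_simps)
qed

text \<open>The exponent is at most 2 p q with q the negative entropy. One factor exp (p q) cancels
  the poles of the weight ratio at the ends of the interval; the other one supplies the exponential
  decay.\<close>

lemma bulk_bound:
 "\<exists>B c p. 0 < c \<and> 0 < p \<and> (\<forall>n m u. 1 \<le> p * real n \<longrightarrow> 1 \<le> p * real m \<longrightarrow> norm (bulk n m u) \<le> B * exp (- (c * \<bar>u\<bar>)))"
proof -
 obtain p where p: "0 < p" "!!s. 0 \<le> s ==> s \<le> 1 ==> p \<le> P s" using P_lower by metis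
 obtain c3 B3 where B3: "0 < c3" "0 < B3" "!!s. 0 \<le> s ==> s \<le> 1 ==> c3 \<le> H s \<and> H s \<le> B3" using pos_cont_bounds[OF H] by metis
 \<comment> \<open>Chosen so that 1 + |u| is at most K exp (p |u| / 32). The fourth power then costs
   exp (p |u| / 8), half of the decay exp (- p |u| / 4) that is available.\<close>
 define K where "K = max 1 (32 / p)"
 then have K0: "0 \<le> K" by simp
 have "norm (bulk n m u) \<le> (B3 / c3 * exp 2 * exp (p / 4) * (4 * K ^ 4)) * exp (- (p / 8 * \<bar>u\<bar>))"
  if pn: "1 \<le> p * real n" "1 \<le> p * real m" for n m :: nat and u
 proof -
  have nm: "0 < n" "0 < m" using pn by (auto intro!: gr0I)
  define sg where "sg = n / (real n + m)"
  define h where "h = sqrt (sg * (1 - sg) / (real n + m))"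
  define a where "a = sdev0 n m"
  define b where "b = sdev1 n m"
  note defs = sg_def h_def a_def b_def
  define s where "s = sg + h * u"
  have sg: "0 < sg" "sg < 1" using saddle_01[OF nm] by (auto simp: sg_def)
  show ?thesis
  proof (cases "0 < s \<and> s < 1")
   case False
   then have "bulk n m u = 0" by (auto simp: bulk_def Let_def s_def sg_def h_def)
   then show ?thesis using B3 p by (simp add: K_def)
  next
   case True
   then have s: "0 < s" "s < 1" by auto
   define x where "x = 1 + a * u"
   define y where "y = 1 - b * u"
   have sx: "s = sg * x" "1 - s = (1 - sg) * y" using saddle_shift[OF nm, of u] by (auto simp: defs s_def x_def y_def)
   have au: "- 1 < a * u" "b * u < 1" using True saddle_01_iff[OF nm, of u] by (auto simp: defs s_def)
   then have xy: "0 < x" "0 < y" by (auto simp: x_def y_def)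
   have ab1: "0 < a" "0 < b" "a \<le> 1" "b \<le> 1" using sdev_le1[OF nm] sdev_pos[OF nm] by (auto simp: defs)
   have xu: "x \<le> 1 + \<bar>u\<bar>" "y \<le> 1 + \<bar>u\<bar>"
   proof -
    have "\<bar>a * u\<bar> \<le> \<bar>u\<bar>" "\<bar>b * u\<bar> \<le> \<bar>u\<bar>" using ab1 by (auto simp: abs_mult mult_left_le_one_le)
    then show "x \<le> 1 + \<bar>u\<bar>" "y \<le> 1 + \<bar>u\<bar>" by (auto simp: x_def y_def)
   qed
   define q where "q = n * ln x + m * ln y"
   have q: "q \<le> - (\<bar>u\<bar> - 1) / 4" unfolding q_def x_def y_def
    by (rule bernoulli_entropy_bound) (use nm au in \<open>auto simp: a_def b_def sdev0_def sdev1_def\<close>)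
   have e: "2 * n * (ln (r1 s) - ln (r1 sg)) + 2 * m * (ln (r2 s) - ln (r2 sg)) \<le> 2 * (p * q)"
   proof -
    have "ln s - ln sg = ln x" "ln (1 - s) - ln (1 - sg) = ln y" using sx xy sg by (auto simp: ln_mult)
    then have "n * (ln (r1 s) - ln (r1 sg)) + m * (ln (r2 s) - ln (r2 sg)) \<le> p * q"
     using log_concave_domination[OF nm p(2) s] by (simp add: sg_def q_def)
    then show ?thesis by (simp add: algebra_simps)
   qed
   have ratio: "w s / w sg \<le> B3 / c3 * ((x + 1 / x) * (y + 1 / y))"
   proof -
    have "w s / w sg = (H s / H sg) * (x powr k0 * y powr k1)"
    proof -
     have "s powr k0 = sg powr k0 * x powr k0" "(1 - s) powr k1 = (1 - sg) powr k1 * y powr k1"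
      unfolding sx(2) unfolding sx(1) using sg xy by (auto simp: powr_mult)
     then show ?thesis using sg unfolding w[OF s] w[OF sg] by simp
    qed
    also have "\<dots> \<le> B3 / c3 * ((x + 1 / x) * (y + 1 / y))"
     using B3(1,2) B3(3)[of s] B3(3)[of sg] s sg xy k0 k1
     by (intro mult_mono frac_le powr_le_add_inverse) auto
    finally show ?thesis .
   qed
   \<comment> \<open>Since p n and p m are at least 1, ln x \<le> x - 1 applies with nonnegative
     coefficients. The terms linear in u cancel by n a = m b, and what remains is at most 2 because
     x and y are positive.\<close>
   have "p * q - ln x - ln y \<le> 2"
   proof -
    have "p * q - ln x - ln y = (p * n - 1) * ln x + (p * m - 1) * ln y" by (simp add: q_def algebra_simps)
    also have "\<dots> \<le> (p * n - 1) * (x - 1) + (p * m - 1) * (y - 1)"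
     using pn xy by (intro add_mono mult_left_mono ln_le_minus_one) auto
    also have "\<dots> = p * u * (n * a - m * b) - (x - 1) - (y - 1)" by (simp add: x_def y_def algebra_simps)
    also have "n * a - m * b = 0" using sdev_balance[OF nm] by (simp add: defs)
    finally show ?thesis using xy by simp
   qed
   then have "exp (p * q - ln x - ln y) \<le> exp 2" by simp
   moreover have "exp (p * q - ln x - ln y) = exp (p * q) / (x * y)" using xy by (simp add: exp_diff)
   ultimately have "exp (p * q) \<le> exp 2 * (x * y)" using xy by (simp add: pos_divide_le_eq)
   have e1: "(x + 1 / x) * (y + 1 / y) * exp (p * q) \<le> exp 2 * (4 * K ^ 4 * exp (p / 8 * \<bar>u\<bar>))"
   proof -
    have "1 + \<bar>u\<bar> \<le> K * exp (p / 32 * \<bar>u\<bar>)"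
    proof -
     have "1 + \<bar>u\<bar> \<le> K * (1 + p / 32 * \<bar>u\<bar>)"
     proof -
      have "1 \<le> K" "32 / p \<le> K" by (auto simp: K_def)
      then have "1 \<le> K * (p / 32)" using p by (simp add: field_simps)
      then have "1 * \<bar>u\<bar> \<le> K * (p / 32) * \<bar>u\<bar>" by (intro mult_right_mono) auto
      then show ?thesis using \<open>1 \<le> K\<close> by (simp add: algebra_simps)
     qed
     also have "\<dots> \<le> K * exp (p / 32 * \<bar>u\<bar>)" by (intro mult_left_mono exp_ge_add_one_self) (auto simp: K_def)
     finally show ?thesis .
    qed
    then have k1: "(1 + \<bar>u\<bar>)\<^sup>2 \<le> (K * exp (p / 32 * \<bar>u\<bar>))\<^sup>2" by (intro power_mono) auto
    have k2: "1 + z\<^sup>2 \<le> 2 * (K * exp (p / 32 * \<bar>u\<bar>))\<^sup>2" if "0 < z" "z \<le> 1 + \<bar>u\<bar>" for z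
    proof -
     have "z\<^sup>2 \<le> (1 + \<bar>u\<bar>)\<^sup>2" using that by (intro power_mono) auto
     moreover have "1 \<le> (1 + \<bar>u\<bar>)\<^sup>2" by (rule one_le_power) auto
     ultimately show ?thesis using k1 by linarith
    qed
    have "x + 1 / x = (1 + x\<^sup>2) / x" "y + 1 / y = (1 + y\<^sup>2) / y"
     using xy by (auto simp: add_divide_distrib power2_eq_square)
    then have "(x + 1 / x) * (y + 1 / y) = (1 + x\<^sup>2) * (1 + y\<^sup>2) / (x * y)" by simp
    then have "(x + 1 / x) * (y + 1 / y) * exp (p * q) \<le> (1 + x\<^sup>2) * (1 + y\<^sup>2) / (x * y) * (exp 2 * (x * y))"
     using xy \<open>exp (p * q) \<le> exp 2 * (x * y)\<close> by (simp only:, intro mult_left_mono divide_nonneg_pos mult_nonneg_nonneg) auto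
    also have "\<dots> = exp 2 * ((1 + x\<^sup>2) * (1 + y\<^sup>2))" using xy by simp
    also have "\<dots> \<le> exp 2 * ((2 * (K * exp (p / 32 * \<bar>u\<bar>))\<^sup>2) * (2 * (K * exp (p / 32 * \<bar>u\<bar>))\<^sup>2))"
     by (intro mult_left_mono mult_mono k2 xu xy) auto
    also have "(2 * (K * exp (p / 32 * \<bar>u\<bar>))\<^sup>2) * (2 * (K * exp (p / 32 * \<bar>u\<bar>))\<^sup>2) = 4 * (K * exp (p / 32 * \<bar>u\<bar>)) ^ 4"
     by (simp add: power2_eq_square power4_eq_xxxx)
    also have "\<dots> = 4 * K ^ 4 * exp (p / 8 * \<bar>u\<bar>)" by (simp add: power_mult_distrib flip: exp_of_nat_mult)
    finally show ?thesis .
   qed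
   have pq: "exp (p * q) \<le> exp (p / 4) * exp (- (p / 4 * \<bar>u\<bar>))"
   proof -
    have "p * q \<le> p * (- (\<bar>u\<bar> - 1) / 4)" using q p by (intro mult_left_mono) auto
    also have "\<dots> = p / 4 + - (p / 4 * \<bar>u\<bar>)" by (simp add: diff_divide_distrib algebra_simps)
    finally show ?thesis by (simp flip: exp_add)
   qed
   have "norm (bulk n m u) = exp (2 * n * (ln (r1 s) - ln (r1 sg)) + 2 * m * (ln (r2 s) - ln (r2 sg))) * (w s / w sg)"
    using s w_pos[OF s] w_pos[OF sg] by (simp add: bulk_def Let_def s_def sg_def h_def abs_mult)
   also have "\<dots> \<le> exp (2 * (p * q)) * (B3 / c3 * ((x + 1 / x) * (y + 1 / y)))"
    using e ratio w_pos[OF s] w_pos[OF sg] by (intro mult_mono) auto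
   also have "\<dots> = B3 / c3 * ((x + 1 / x) * (y + 1 / y) * exp (p * q)) * exp (p * q)"
    by (simp add: exp_double power2_eq_square)
   also have "\<dots> \<le> B3 / c3 * (exp 2 * (4 * K ^ 4 * exp (p / 8 * \<bar>u\<bar>))) * (exp (p / 4) * exp (- (p / 4 * \<bar>u\<bar>)))"
    using B3 K0 by (intro mult_mono[OF mult_left_mono[OF e1] pq]) auto
   also have "\<dots> = (B3 / c3 * exp 2 * exp (p / 4) * (4 * K ^ 4)) * (exp (p / 8 * \<bar>u\<bar>) * exp (- (p / 4 * \<bar>u\<bar>)))"
    by (simp add: mult_ac)
   also have "exp (p / 8 * \<bar>u\<bar>) * exp (- (p / 4 * \<bar>u\<bar>)) = exp (- (p / 8 * \<bar>u\<bar>))" by (simp flip: exp_add)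
   finally show ?thesis .
  qed
 qed
 then show ?thesis
  using p by (intro exI[of _ "B3 / c3 * exp 2 * exp (p / 4) * (4 * K ^ 4)"] exI[of _ "p / 8"] exI[of _ p]) auto
qed

text \<open>A second-order expansion that needs only continuity of P: along the segment from sg the
  derivative of the exponent carries an explicit factor v, so Cauchy's mean value theorem against
  v^2 removes it and leaves P at an intermediate point.\<close>

lemma bulk_exponent:
 fixes n m :: nat assumes nm: "0 < n" "0 < m"
 defines "sg \<equiv> n / (real n + m)" and "h \<equiv> sqrt (n / (real n + m) * (1 - n / (real n + m)) / (real n + m))"
 assumes s: "0 < sg + h * u" "sg + h * u < 1"
 shows "\<exists>v. 0 < v \<and> v < 1 \<and> 2 * n * (ln (r1 (sg + h * u)) - ln (r1 sg)) + 2 * m * (ln (r2 (sg + h * u)) - ln (r2 sg)) =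
   - u\<^sup>2 * (P (sg * (1 + sdev0 n m * (u * v))) / ((1 + sdev0 n m * (u * v)) * (1 - sdev1 n m * (u * v))))"
proof -
 define a where "a = sdev0 n m"
 define b where "b = sdev1 n m"
 note defs = sg_def h_def a_def b_def
 have sg: "0 < sg" "sg < 1" using saddle_01[OF nm] by (auto simp: sg_def)
 define t where "t = (%v. sg + h * (u * v))"
 have t01: "0 < t v" "t v < 1" if "0 \<le> v" "v \<le> 1" for v
 proof -
  have "t v = (1 - v) * sg + v * (sg + h * u)" "1 - t v = (1 - v) * (1 - sg) + v * (1 - (sg + h * u))"
   by (auto simp: t_def algebra_simps)
  moreover have "0 < (1 - v) * x + v * y" if "0 < x" "0 < y" for x y
   using that \<open>0 \<le> v\<close> \<open>v \<le> 1\<close> by (cases "v = 0") (auto intro!: add_nonneg_pos)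
  ultimately have "0 < t v" "0 < 1 - t v" using sg s by auto
  then show "0 < t v" "t v < 1" by auto
 qed
 define f where "f = (%v. 2 * n * ln (r1 (t v)) + 2 * m * ln (r2 (t v)))"
 define f' where "f' = (%v. - 2 * u\<^sup>2 * v * (P (t v) * (sg * (1 - sg)) / (t v * (1 - t v))))"
 have dt: "(t has_real_derivative h * u) (at v)" for v unfolding t_def by (auto intro!: derivative_eq_intros)
 have df: "(f has_real_derivative f' v) (at v)" if v: "0 \<le> v" "v \<le> 1" for v
 proof -
  note T = t01[OF v]
  have "(f has_real_derivative 2 * n * (P (t v) / t v * (h * u)) + 2 * m * (- (P (t v) / (1 - t v)) * (h * u))) (at v)"
   unfolding f_def by (intro DERIV_add DERIV_cmult DERIV_chain2[OF ln_r1_deriv dt] DERIV_chain2[OF ln_r2_deriv dt] T)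
  moreover have "2 * n * (P (t v) / t v * (h * u)) + 2 * m * (- (P (t v) / (1 - t v)) * (h * u)) = f' v"
  proof -
   have "2 * n * (P (t v) / t v * (h * u)) + 2 * m * (- (P (t v) / (1 - t v)) * (h * u)) =
     2 * (h * u) * P (t v) * (n * (1 - t v) - m * t v) / (t v * (1 - t v))"
    using T by (simp add: divide_simps) (simp add: algebra_simps)
   also have "n * (1 - t v) - m * t v = (real n + m) * (sg - t v)" using nm by (simp add: sg_def field_simps)
   also have "sg - t v = - (h * (u * v))" by (simp add: t_def)
   also have "2 * (h * u) * P (t v) * ((real n + m) * (- (h * (u * v)))) = - 2 * u\<^sup>2 * v * (P (t v) * ((real n + m) * h\<^sup>2))"
    by (simp add: power2_eq_square)
   also have "(real n + m) * h\<^sup>2 = sg * (1 - sg)" using sdev_scale(3)[OF nm] by (simp add: defs)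
   finally show ?thesis by (simp add: f'_def)
  qed
  ultimately show ?thesis by simp
 qed
 \<comment> \<open>Cauchy's form with v^2 as second function; the factor 2 c cancels against the one
   in \<open>f'\<close>.\<close>
 have "\<exists>c>0. c < 1 \<and> (f 1 - f 0) * (2 * c) = (1\<^sup>2 - 0\<^sup>2) * f' c"
  by (rule GMVT'[where f = f and g = "%v. v\<^sup>2" and f' = f' and g' = "%v. 2 * v"])
   (auto intro!: DERIV_isCont[OF df] df derivative_eq_intros)
 then obtain c where c: "0 < c" "c < 1" "(f 1 - f 0) * (2 * c) = f' c" by auto
 have T: "t c = sg * (1 + a * (u * c))" "1 - t c = (1 - sg) * (1 - b * (u * c))"
  using saddle_shift[OF nm, of "u * c"] by (auto simp: defs t_def)
 have "sg * (1 - sg) / (t c * (1 - t c)) = 1 / ((1 + a * (u * c)) * (1 - b * (u * c)))"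
  unfolding T(2) unfolding T(1) using sg by simp
 moreover have "f' c = (- u\<^sup>2 * (P (t c) * (sg * (1 - sg) / (t c * (1 - t c))))) * (2 * c)" by (simp add: f'_def)
 ultimately have "(f 1 - f 0) * (2 * c) = (- u\<^sup>2 * (P (t c) / ((1 + a * (u * c)) * (1 - b * (u * c))))) * (2 * c)"
  using c(3) by simp
 then have "f 1 - f 0 = - u\<^sup>2 * (P (t c) / ((1 + a * (u * c)) * (1 - b * (u * c))))" using c(1) by (subst (asm) mult_right_cancel) auto
 moreover have "f 1 - f 0 = 2 * n * (ln (r1 (sg + h * u)) - ln (r1 sg)) + 2 * m * (ln (r2 (sg + h * u)) - ln (r2 sg))"
  by (simp add: f_def t_def algebra_simps)
 ultimately show ?thesis using c T(1) by (intro exI[of _ c]) (simp add: a_def b_def)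
qed

text \<open>The limit z may be 0 or 1. What matters is that the window of width h is small against
  both distances sg and 1 - sg, and this holds as soon as n and m tend to infinity
  separately.\<close>

theorem bulk_limit:
 fixes N M :: "nat \<Rightarrow> nat"
 assumes N: "filterlim N at_top sequentially" and M: "filterlim M at_top sequentially"
  and lim: "(%k. N k / (real (N k) + M k)) \<longlonglongrightarrow> z"
 defines "sg \<equiv> %k. N k / (real (N k) + M k)"
 shows "(%k. I (N k) (M k) / (r1 (sg k) ^ (2 * N k) * r2 (sg k) ^ (2 * M k) * w (sg k)) * sqrt ((real (N k) + M k) / (sg k * (1 - sg k))))
   \<longlonglongrightarrow> sqrt (pi / P z)"
proof -
 obtain c p B where B: "0 < c" "0 < p" "!!n m u. 1 \<le> p * real n ==> 1 \<le> p * real m ==> norm (bulk n m u) \<le> B * exp (- (c * \<bar>u\<bar>))"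
  using bulk_bound by metis
 have large: "\<forall>\<^sub>F k in sequentially. 1 \<le> p * real (F k)" if "filterlim F at_top sequentially" for F :: "nat \<Rightarrow> nat"
 proof -
  have "filterlim (%k. real (F k)) at_top sequentially"
   using filterlim_compose[OF filterlim_real_sequentially that] .
  then have "\<forall>\<^sub>F k in sequentially. 1 / p \<le> real (F k)" by (simp add: filterlim_at_top)
  then show ?thesis
  proof eventually_elim
   case (elim k) then show ?case using B(2) by (simp add: pos_divide_le_eq mult.commute)
  qed
 qed
 obtain K where K: "!!k. K \<le> k ==> 1 \<le> p * real (N k) \<and> 1 \<le> p * real (M k)"
  using eventually_conj[OF large[OF N] large[OF M]] unfolding eventually_sequentially by blast
 have pos: "0 < N k" "0 < M k" if "K \<le> k" for k using K[OF that] by (cases "N k"; cases "M k"; simp)+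
 have ev: "\<forall>\<^sub>F k in sequentially. K \<le> k" by (rule eventually_ge_at_top)
 have sg01: "0 < sg k" "sg k < 1" if "K \<le> k" for k using saddle_01[OF pos[OF that]] by (auto simp: sg_def)
 have lim': "sg \<longlonglongrightarrow> z" using lim by (simp add: sg_def)
 have z01: "0 \<le> z" "z \<le> 1"
 proof -
  have "0 \<le> sg k" "sg k \<le> 1" for k by (auto simp: sg_def divide_le_eq_1)
  then show "0 \<le> z" "z \<le> 1" using LIMSEQ_le_const[OF lim'] LIMSEQ_le_const2[OF lim'] by auto
 qed
 have Pz: "0 < P z" using P z01 by auto
 have a0: "(%k. sdev0 (N k) (M k)) \<longlonglongrightarrow> 0"
 proof (rule tendsto_sandwich)
  show "\<forall>\<^sub>F k in sequentially. 0 \<le> sdev0 (N k) (M k)" by (auto simp: sdev0_def)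
  show "\<forall>\<^sub>F k in sequentially. sdev0 (N k) (M k) \<le> sqrt (1 / N k)" using ev by eventually_elim (use sdev_le pos in auto)
  have "(%n. sqrt (1 / real n)) \<longlonglongrightarrow> 0" by real_asymp
  then show "(%k. sqrt (1 / N k)) \<longlonglongrightarrow> 0" using N by (rule filterlim_compose)
 qed simp
 have b0: "(%k. sdev1 (N k) (M k)) \<longlonglongrightarrow> 0"
 proof (rule tendsto_sandwich)
  show "\<forall>\<^sub>F k in sequentially. 0 \<le> sdev1 (N k) (M k)" by (auto simp: sdev1_def)
  show "\<forall>\<^sub>F k in sequentially. sdev1 (N k) (M k) \<le> sqrt (1 / M k)" using ev by eventually_elim (use sdev_le pos in auto)
  have "(%n. sqrt (1 / real n)) \<longlonglongrightarrow> 0" by real_asymp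
  then show "(%k. sqrt (1 / M k)) \<longlonglongrightarrow> 0" using M by (rule filterlim_compose)
 qed simp
 have pw: "(%k. bulk (N k) (M k) u) \<longlonglongrightarrow> exp (- (P z * u\<^sup>2))" for u
 proof -
  define h where "h = (%k. sqrt (sg k * (1 - sg k) / (real (N k) + M k)))"
  define s where "s = (%k. sg k + h k * u)"
  define a where "a = (%k. sdev0 (N k) (M k))"
  define b where "b = (%k. sdev1 (N k) (M k))"
  define x where "x = (%k. 1 + a k * u)"
  define y where "y = (%k. 1 - b k * u)"
  have x1: "x \<longlonglongrightarrow> 1" unfolding x_def a_def using tendsto_add[OF tendsto_const tendsto_mult[OF a0 tendsto_const]] by simp
  have y1: "y \<longlonglongrightarrow> 1" unfolding y_def b_def using tendsto_diff[OF tendsto_const tendsto_mult[OF b0 tendsto_const]] by simp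
  have sx: "s k = sg k * x k" "1 - s k = (1 - sg k) * y k" if "K \<le> k" for k
   using saddle_shift[OF pos[OF that], of u] by (simp_all add: s_def h_def x_def y_def a_def b_def sg_def)
  have exy: "\<forall>\<^sub>F k in sequentially. 0 < x k \<and> 0 < y k"
   using order_tendstoD(1)[OF x1, of 0] order_tendstoD(1)[OF y1, of 0] by (simp add: eventually_conj)
  have es: "\<forall>\<^sub>F k in sequentially. 0 < s k \<and> s k < 1"
   using ev exy
  proof eventually_elim
   case (elim k)
   have "0 < s k" "0 < 1 - s k" using elim sx[of k] sg01[of k] by auto
   then show ?case by simp
  qed
  have s0: "s \<longlonglongrightarrow> z"
  proof -
   have "(%k. sg k * x k) \<longlonglongrightarrow> z * 1" by (intro tendsto_mult lim' x1)
   moreover have "\<forall>\<^sub>F k in sequentially. sg k * x k = s k" using ev by eventually_elim (use sx in simp)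
   ultimately show ?thesis using Lim_transform_eventually by fastforce
  qed
  \<comment> \<open>The ratio tends to 1 even if z is a corner at which w itself is unbounded or
    tends to 0: the power factors are x^k0 y^k1 with x and y tending to 1.\<close>
  have ratio: "(%k. w (s k) / w (sg k)) \<longlonglongrightarrow> 1"
  proof -
   have Hz: "H z \<noteq> 0" using pos_contD(2)[OF H z01] by simp
   have "(%k. H (s k) / H (sg k) * (x k powr k0 * y k powr k1)) \<longlonglongrightarrow> H z / H z * (1 powr k0 * 1 powr k1)"
   proof (intro tendsto_intros x1 y1 Hz)
    show "(%k. H (s k)) \<longlonglongrightarrow> H z" by (rule continuous_on_01_tendsto[OF pos_contD(1)[OF H] z01 s0]) (use es in eventually_elim, auto)
    show "(%k. H (sg k)) \<longlonglongrightarrow> H z"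
     by (rule continuous_on_01_tendsto[OF pos_contD(1)[OF H] z01 lim'], use ev in eventually_elim) (use sg01 in \<open>auto intro: less_imp_le\<close>)
   qed auto
   moreover have "\<forall>\<^sub>F k in sequentially. H (s k) / H (sg k) * (x k powr k0 * y k powr k1) = w (s k) / w (sg k)"
    using ev exy es
   proof eventually_elim
    case (elim k)
    have "s k powr k0 = sg k powr k0 * x k powr k0" "(1 - s k) powr k1 = (1 - sg k) powr k1 * y k powr k1"
     unfolding sx(2)[OF elim(1)] unfolding sx(1)[OF elim(1)] using sg01[OF elim(1)] elim by (auto simp: powr_mult)
    then show ?case using sg01[OF elim(1)] elim w[of "s k"] w[of "sg k"] by simp
   qed
   ultimately show ?thesis using Lim_transform_eventually Hz by fastforce
  qed
  define E where "E = (%k. 2 * N k * (ln (r1 (s k)) - ln (r1 (sg k))) + 2 * M k * (ln (r2 (s k)) - ln (r2 (sg k))))"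
  define v where "v = (%k. SOME v. 0 < v \<and> v < 1 \<and> E k = - u\<^sup>2 * (P (sg k * (1 + a k * (u * v))) / ((1 + a k * (u * v)) * (1 - b k * (u * v)))))"
  have v: "0 < v k \<and> v k < 1 \<and> E k = - u\<^sup>2 * (P (sg k * (1 + a k * (u * v k))) / ((1 + a k * (u * v k)) * (1 - b k * (u * v k))))"
   if "K \<le> k" "0 < s k" "s k < 1" for k
   unfolding v_def
  proof (rule someI_ex)
   show "\<exists>v. 0 < v \<and> v < 1 \<and> E k = - u\<^sup>2 * (P (sg k * (1 + a k * (u * v))) / ((1 + a k * (u * v)) * (1 - b k * (u * v))))"
    using bulk_exponent[OF pos[OF that(1)], of u] that(2,3) by (simp add: E_def a_def b_def s_def h_def sg_def)
  qed
  \<comment> \<open>The intermediate point is s = sg (1 + a u v) with 0 < v < 1; nothing more is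
    known of v, so only the bound by |u| is used.\<close>
  have small: "(%k. f k * (u * v k)) \<longlonglongrightarrow> 0" if "f \<longlonglongrightarrow> 0" for f
  proof (rule Lim_null_comparison)
   show "\<forall>\<^sub>F k in sequentially. norm (f k * (u * v k)) \<le> \<bar>f k\<bar> * \<bar>u\<bar>"
    using ev es
   proof eventually_elim
    case (elim k)
    then have "0 < v k" "v k < 1" using v[of k] by auto
    then have "\<bar>u\<bar> * \<bar>v k\<bar> \<le> \<bar>u\<bar> * 1" by (intro mult_left_mono) auto
    then show ?case by (simp add: abs_mult mult_left_mono)
   qed
   show "(%k. \<bar>f k\<bar> * \<bar>u\<bar>) \<longlonglongrightarrow> 0" using that by (intro tendsto_mult_left_zero tendsto_rabs_zero)
  qed
  have av: "(%k. a k * (u * v k)) \<longlonglongrightarrow> 0" "(%k. b k * (u * v k)) \<longlonglongrightarrow> 0" using small a0 b0 by (auto simp: a_def b_def)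
  have tz: "(%k. sg k * (1 + a k * (u * v k))) \<longlonglongrightarrow> z"
   using tendsto_mult[OF lim' tendsto_add[OF tendsto_const[of 1] av(1)]] by simp
  have Pt: "(%k. P (sg k * (1 + a k * (u * v k)))) \<longlonglongrightarrow> P z"
  proof (rule continuous_on_01_tendsto[OF P(1) z01 tz])
   show "\<forall>\<^sub>F k in sequentially. 0 \<le> sg k * (1 + a k * (u * v k)) \<and> sg k * (1 + a k * (u * v k)) \<le> 1"
    using ev es
   proof eventually_elim
    case (elim k)
    have vk: "0 < v k" "v k < 1" using v[of k] elim by auto
    have "sg k * (1 + a k * (u * v k)) = (1 - v k) * sg k + v k * s k" using sx(1)[OF elim(1)] by (simp add: x_def algebra_simps)
    moreover have "0 \<le> (1 - v k) * sg k + v k * s k" using vk sg01[OF elim(1)] elim by simp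
    moreover have "(1 - v k) * sg k + v k * s k \<le> (1 - v k) * 1 + v k * 1" using vk sg01[OF elim(1)] elim by (intro add_mono mult_left_mono) auto
    ultimately show ?case by simp
   qed
  qed
  have "(%k. - u\<^sup>2 * (P (sg k * (1 + a k * (u * v k))) / ((1 + a k * (u * v k)) * (1 - b k * (u * v k))))) \<longlonglongrightarrow> - u\<^sup>2 * (P z / ((1 + 0) * (1 - 0)))"
   by (intro tendsto_intros Pt av) auto
  moreover have "\<forall>\<^sub>F k in sequentially. - u\<^sup>2 * (P (sg k * (1 + a k * (u * v k))) / ((1 + a k * (u * v k)) * (1 - b k * (u * v k)))) = E k"
   using ev es by eventually_elim (use v in auto)
  ultimately have "E \<longlonglongrightarrow> - u\<^sup>2 * (P z / ((1 + 0) * (1 - 0)))" by (rule Lim_transform_eventually)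
  then have "(%k. exp (E k) * (w (s k) / w (sg k))) \<longlonglongrightarrow> exp (- u\<^sup>2 * (P z / ((1 + 0) * (1 - 0)))) * 1"
   by (intro tendsto_intros ratio)
  moreover have "\<forall>\<^sub>F k in sequentially. exp (E k) * (w (s k) / w (sg k)) = bulk (N k) (M k) u"
   using es by eventually_elim (simp add: bulk_def Let_def E_def s_def h_def sg_def)
  ultimately have "(%k. bulk (N k) (M k) u) \<longlonglongrightarrow> exp (- u\<^sup>2 * (P z / ((1 + 0) * (1 - 0)))) * 1" by (rule Lim_transform_eventually)
  then show ?thesis by (simp add: mult.commute)
 qed
 have meas: "bulk n m \<in> borel_measurable lborel" if "0 < n" "0 < m" for n m
 proof -
  define t where "t = n / (real n + m)"
  define h where "h = sqrt (t * (1 - t) / (real n + m))"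
  have t01: "0 < t" "t < 1" using saddle_01[OF that] by (auto simp: t_def)
  define g where "g = (%s. indicator {0<..<1} s *\<^sub>R (exp (2 * n * (ln (r1 s) - ln (r1 t)) + 2 * m * (ln (r2 s) - ln (r2 t))) * (w s / w t)))"
  have "g \<in> borel_measurable borel" unfolding g_def
  proof (rule set_borel_measurable_cont, intro continuous_intros r1_cont r2_cont w_cont ballI)
   show "r1 x \<noteq> 0" "r2 x \<noteq> 0" if "x \<in> {0<..<1}" for x using r1_pos[of x] r2_pos[of x] that by auto
   show "w t \<noteq> 0" using w_pos[OF t01] by simp
  qed
  then have "(%u. g (t + h * u)) \<in> borel_measurable borel" by (rule measurable_compose_rev) simp
  moreover have "(%u. g (t + h * u)) = bulk n m" by (intro ext) (simp add: g_def bulk_def Let_def t_def h_def)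
  ultimately show ?thesis by simp
 qed
 have gi: "has_bochner_integral lborel (%u. exp (- (P z * u\<^sup>2))) (sqrt (pi / P z))" by (rule gaussian_integral_scaled[OF Pz])
 have "(%k. LBINT u. bulk (N (k + K)) (M (k + K)) u) \<longlonglongrightarrow> (LBINT u. exp (- (P z * u\<^sup>2)))"
 proof (rule integral_dominated_convergence)
  show "integrable lborel (%u. B * exp (- (c * \<bar>u\<bar>)))" by (intro integrable_mult_right integrable_exp_minus_abs B)
  show "bulk (N (k + K)) (M (k + K)) \<in> borel_measurable lborel" for k using meas pos by auto
  show "AE u in lborel. (%k. bulk (N (k + K)) (M (k + K)) u) \<longlonglongrightarrow> exp (- (P z * u\<^sup>2))"
   using pw LIMSEQ_ignore_initial_segment by blast
  show "AE u in lborel. norm (bulk (N (k + K)) (M (k + K)) u) \<le> B * exp (- (c * \<bar>u\<bar>))" for k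
   using B(3) K[of "k + K"] by auto
 qed simp
 then have "(%k. LBINT u. bulk (N k) (M k) u) \<longlonglongrightarrow> sqrt (pi / P z)"
  using has_bochner_integral_integral_eq[OF gi] by (simp add: LIMSEQ_offset[where k = K])
 moreover have "\<forall>\<^sub>F k in sequentially. (LBINT u. bulk (N k) (M k) u) =
   I (N k) (M k) / (r1 (sg k) ^ (2 * N k) * r2 (sg k) ^ (2 * M k) * w (sg k)) * sqrt ((real (N k) + M k) / (sg k * (1 - sg k)))"
  using ev by eventually_elim (use bulk_integral pos in \<open>simp add: sg_def\<close>)
 ultimately show ?thesis by (rule Lim_transform_eventually)
qed

end

section \<open>Limit points of the eigenvalues\<close>

text \<open>This is lambda_{p,q,n} in the parameters of a profile: the argument \<open>p\<close> is
  the reciprocal of the exponent, and \<open>k\<close> is the corner exponent of the weight.\<close>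

definition corner_value :: "real \<Rightarrow> real \<Rightarrow> nat \<Rightarrow> real" where
 "corner_value p k n = (let a = 2 * real n * p + k + 1; b = 2 * real n * (1 - p) - k + 1
   in Gamma a * Gamma b / ((Gamma (real n + 1))\<^sup>2 * (2 * p) powr a * (2 * (1 - p)) powr b))"

text \<open>The profile of the unit ball, for which s = r1^2. It is self-dual, so its integral can
  be compared with I and with J alike.\<close>

lemma constant_profile:
 "leray_profile (%_. 1 / 2) (%_. 1) (%_. 1) (%_. 1) (%s. s powr (1 / 2)) (%s. (1 - s) powr (1 / 2)) (%_. 1) 0 0"
proof
 fix s :: real assume s: "0 < s" "s < 1"
 have e: "x powr (1 / 2 - 1) = x powr (1 / 2) / x" if "0 < x" for x :: real using that by (subst powr_diff) simp
 have 1: "((%s. s powr (1 / 2)) has_real_derivative (1 / 2) * s powr (1 / 2 - 1)) (at s)" if "0 < s" for s :: real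
  using that by (auto intro!: derivative_eq_intros)
 show "((%s. s powr (1 / 2)) has_real_derivative s powr (1 / 2) * (1 / 2) / s) (at s)"
  using 1[OF s(1)] unfolding e[OF s(1)] by simp
 have d: "((%s. (1 - s) powr (1 / 2)) has_real_derivative (1 / 2) * (1 - s) powr (1 / 2 - 1) * (- 1)) (at s)"
  by (rule DERIV_chain2[OF 1]) (use s in \<open>auto intro!: derivative_eq_intros\<close>)
 have e1: "(1 / 2) * (1 - s) powr (1 / 2 - 1) * (- 1) = - ((1 - s) powr (1 / 2) * (1 / 2) / (1 - s))"
  using s by (subst e) (auto simp: field_simps)
 show "((%s. (1 - s) powr (1 / 2)) has_real_derivative - ((1 - s) powr (1 / 2) * (1 / 2) / (1 - s))) (at s)"
  using d unfolding e1 .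
qed (auto simp: pos_cont_def)

interpretation const: leray_profile "%_. 1 / 2" "%_. 1" "%_. 1" "%_. 1" "%s. s powr (1 / 2)" "%s. (1 - s) powr (1 / 2)" "%_. 1" 0 0
 by (rule constant_profile)

text \<open>The value is the reciprocal of c_nm. Hence the asymptotics of the factorials are
  instances of the two limit theorems, applied to the model, and Stirling's formula does not
  enter.\<close>

lemma const_I: "const.I n m = fact n * fact m / fact (n + m + 1)"
proof -
 have "const.I n m = (LBINT s:{0<..<1}. s powr real n * (1 - s) powr real m)"
  unfolding const.I_def
 proof (rule set_lebesgue_integral_cong, simp, intro allI impI)
  fix s :: real assume s: "s \<in> {0<..<1}"
  have "(x powr (1 / 2)) ^ (2 * k) = x powr real k" if "0 < x" for x :: real and k :: nat using that by (simp add: powr_power)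
  then show "(s powr (1 / 2)) ^ (2 * n) * ((1 - s) powr (1 / 2)) ^ (2 * m) * 1 = s powr real n * (1 - s) powr real m"
   using s by simp
 qed
 also have "\<dots> = integral {0<..<1} (%s. s powr real n * (1 - s) powr real m)"
  by (rule set_borel_integral_eq_integral(2)) (rule integrable_powr_01, auto)
 also have "\<dots> = Beta (real n + 1) (real m + 1)"
  using has_integral_Beta_real[of "real n + 1" "real m + 1"] by (intro integral_unique) (simp add: has_integral_Icc_iff_Ioo)
 also have "\<dots> = fact n * fact m / fact (n + m + 1)"
  using Gamma_fact[of n, where 'a=real] Gamma_fact[of m, where 'a=real] Gamma_fact[of "n + m + 1", where 'a=real]
  by (simp add: Beta_def add_ac)
 finally show ?thesis .
qed

lemma at_top_of_finite_fibres:
 fixes g :: "nat \<Rightarrow> nat" assumes "!!c. finite {k. g k = c}"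
 shows "filterlim g at_top sequentially"
 unfolding filterlim_at_top
proof
 fix Z
 have "{k. \<not> Z \<le> g k} = (\<Union>c<Z. {k. g k = c})" by auto
 then have "finite {k. \<not> Z \<le> g k}" using assms by simp
 then show "\<forall>\<^sub>F k in sequentially. Z \<le> g k" by (simp add: eventually_cofinite flip: cofinite_eq_sequentially)
qed

lemma at_top_of_inj: "inj g ==> filterlim g at_top sequentially" for g :: "nat \<Rightarrow> nat"
proof (rule at_top_of_finite_fibres)
 fix c assume "inj g"
 then have "finite (g -` {c})" by (intro finite_vimageI) auto
 then show "finite {k. g k = c}" by (simp add: vimage_def)
qed

context leray_profile begin

interpretation dual: leray_profile "%s. 1 - P s" "%s. inverse (C1 s)" "%s. inverse (C2 s)" "%s. inverse (H s)"
 "%s. s / r1 s" "%s. (1 - s) / r2 s" "%s. inverse (w s)" "- k0" "- k1"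
 by (rule dual)

text \<open>The factors 4 pi^2 and 1 / (4 pi^2) of the two squared norms cancel;
  \<open>tau_sq\<close> identifies this number with the eigenvalue.\<close>

definition lam :: "nat \<Rightarrow> nat \<Rightarrow> real" where
 "lam n m = (fact (n + m + 1) / (fact n * fact m))\<^sup>2 * (I n m * dual.I n m)"

lemma lam_eq: "lam n m = I n m * dual.I n m / (const.I n m)\<^sup>2"
 unfolding lam_def const_I by (simp add: power_divide)

text \<open>The powers of m cancel since a + b = 2 (n + 1), and the constants C1(0), C2(0), H(0) of
  the profile cancel against their inverses in the dual. Only P(0) and k0 survive, which makes the
  limit the same for all domains and densities with these corner exponents.\<close>

lemma lam_corner: "(%m. lam n m) \<longlonglongrightarrow> corner_value (P 0) k0 n"
proof -
 define a where "a = 2 * real n * P 0 + k0 + 1"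
 define b where "b = 2 * real n * (1 - P 0) - k0 + 1"
 have ab: "a + b = 2 * (real n + 1)" by (simp add: a_def b_def algebra_simps)
 have P0: "0 < P 0" "P 0 < 1" using P by auto
 have pos: "0 < C1 0" "0 < C2 0" "0 < H 0" using C1 C2 H by (auto simp: pos_cont_def)
 have A: "(%m. I n m / C2 0 ^ (2 * m) * real m powr a) \<longlonglongrightarrow> C1 0 ^ (2 * n) * H 0 * (Gamma a * (2 * P 0) powr (- a))"
  unfolding a_def by (rule corner_limit)
 have B: "(%m. dual.I n m / inverse (C2 0) ^ (2 * m) * real m powr b) \<longlonglongrightarrow> inverse (C1 0) ^ (2 * n) * inverse (H 0) * (Gamma b * (2 * (1 - P 0)) powr (- b))"
  unfolding b_def using dual.corner_limit[of n] by simp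
 have C: "(%m. const.I n m * real m powr (real n + 1)) \<longlonglongrightarrow> Gamma (real n + 1)"
  using const.corner_limit[of n] by simp
 have G: "Gamma (real n + 1) \<noteq> 0" using Gamma_fact[of n, where 'a=real] by (simp add: add.commute)
 have "(%m. (I n m / C2 0 ^ (2 * m) * real m powr a) * (dual.I n m / inverse (C2 0) ^ (2 * m) * real m powr b) / (const.I n m * real m powr (real n + 1))\<^sup>2)
  \<longlonglongrightarrow> (C1 0 ^ (2 * n) * H 0 * (Gamma a * (2 * P 0) powr (- a))) * (inverse (C1 0) ^ (2 * n) * inverse (H 0) * (Gamma b * (2 * (1 - P 0)) powr (- b))) / (Gamma (real n + 1))\<^sup>2"
  by (intro tendsto_intros A B C) (use G in simp)
 also have "(C1 0 ^ (2 * n) * H 0 * (Gamma a * (2 * P 0) powr (- a))) * (inverse (C1 0) ^ (2 * n) * inverse (H 0) * (Gamma b * (2 * (1 - P 0)) powr (- b))) / (Gamma (real n + 1))\<^sup>2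
   = corner_value (P 0) k0 n"
  using pos P0 unfolding corner_value_def Let_def a_def[symmetric] b_def[symmetric] by (simp add: powr_minus field_simps)
 finally have L: "(%m. (I n m / C2 0 ^ (2 * m) * real m powr a) * (dual.I n m / inverse (C2 0) ^ (2 * m) * real m powr b) / (const.I n m * real m powr (real n + 1))\<^sup>2)
  \<longlonglongrightarrow> corner_value (P 0) k0 n" .
 have "\<forall>\<^sub>F m in sequentially. (I n m / C2 0 ^ (2 * m) * real m powr a) * (dual.I n m / inverse (C2 0) ^ (2 * m) * real m powr b) / (const.I n m * real m powr (real n + 1))\<^sup>2 = lam n m"
  using eventually_gt_at_top[of 0]
 proof eventually_elim
  case (elim m)
  have "(real m powr (real n + 1))\<^sup>2 = real m powr (2 * (real n + 1))" using elim by (simp add: powr_power mult.commute)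
  also have "\<dots> = real m powr a * real m powr b" unfolding ab[symmetric] by (simp add: powr_add)
  finally have e: "(real m powr (real n + 1))\<^sup>2 = real m powr a * real m powr b" .
  have "real m powr a * real m powr b \<noteq> 0" using elim by simp
  then show ?case unfolding lam_eq power_mult_distrib e using pos by (simp add: power_inverse field_simps)
 qed
 then show ?thesis by (rule Lim_transform_eventually[OF L])
qed

text \<open>The values at the saddle and the Jacobians drop out of the quotient I J / model^2,
  because r1 (s / r1) = s and r2 (1 - s) / r2 = 1 - s. There remain the three Gaussian integrals for
  P, 1 - P and 1/2.\<close>

lemma lam_bulk:
 fixes N M :: "nat \<Rightarrow> nat"
 assumes N: "filterlim N at_top sequentially" and M: "filterlim M at_top sequentially"
  and lim: "(%k. N k / (real (N k) + M k)) \<longlonglongrightarrow> z" and z: "0 \<le> z" "z \<le> 1"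
 shows "(%k. lam (N k) (M k)) \<longlonglongrightarrow> 1 / (2 * sqrt (P z * (1 - P z)))"
proof -
 define sg where "sg = (%k. N k / (real (N k) + M k))"
 define Q where "Q = (%k. sqrt ((real (N k) + M k) / (sg k * (1 - sg k))))"
 have Pz: "0 < P z" "P z < 1" using P z by auto
 have A: "(%k. I (N k) (M k) / (r1 (sg k) ^ (2 * N k) * r2 (sg k) ^ (2 * M k) * w (sg k)) * Q k) \<longlonglongrightarrow> sqrt (pi / P z)"
  unfolding Q_def sg_def by (rule bulk_limit[OF N M lim])
 have B: "(%k. dual.I (N k) (M k) / ((sg k / r1 (sg k)) ^ (2 * N k) * ((1 - sg k) / r2 (sg k)) ^ (2 * M k) * inverse (w (sg k))) * Q k) \<longlonglongrightarrow> sqrt (pi / (1 - P z))"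
  unfolding Q_def sg_def by (rule dual.bulk_limit[OF N M lim])
 have C: "(%k. const.I (N k) (M k) / ((sg k powr (1 / 2)) ^ (2 * N k) * ((1 - sg k) powr (1 / 2)) ^ (2 * M k) * 1) * Q k) \<longlonglongrightarrow> sqrt (pi / (1 / 2))"
  unfolding Q_def sg_def by (rule const.bulk_limit[OF N M lim])
 have ev: "\<forall>\<^sub>F k in sequentially. 0 < N k \<and> 0 < M k"
 proof -
  have "\<forall>\<^sub>F k in sequentially. 1 \<le> N k" "\<forall>\<^sub>F k in sequentially. 1 \<le> M k" using N M unfolding filterlim_at_top by blast+
  then show ?thesis by eventually_elim auto
 qed
 have "(%k. lam (N k) (M k)) \<longlonglongrightarrow> sqrt (pi / P z) * sqrt (pi / (1 - P z)) / (sqrt (pi / (1 / 2)))\<^sup>2"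
 proof (rule Lim_transform_eventually[OF tendsto_divide[OF tendsto_mult[OF A B] tendsto_power[OF C, of 2]]])
  show "\<forall>\<^sub>F k in sequentially.
    I (N k) (M k) / (r1 (sg k) ^ (2 * N k) * r2 (sg k) ^ (2 * M k) * w (sg k)) * Q k *
    (dual.I (N k) (M k) / ((sg k / r1 (sg k)) ^ (2 * N k) * ((1 - sg k) / r2 (sg k)) ^ (2 * M k) * inverse (w (sg k))) * Q k) /
    (const.I (N k) (M k) / ((sg k powr (1 / 2)) ^ (2 * N k) * ((1 - sg k) powr (1 / 2)) ^ (2 * M k) * 1) * Q k)\<^sup>2 = lam (N k) (M k)"
   using ev
  proof eventually_elim
   case (elim k)
   have s: "0 < sg k" "sg k < 1" using saddle_01[of "N k" "M k"] elim by (auto simp: sg_def)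
   have q: "Q k \<noteq> 0" using s elim by (simp add: Q_def)
   have p: "(x powr (1 / 2)) ^ (2 * j) = x ^ j" if "0 < x" for x :: real and j :: nat using that by (simp add: powr_power powr_realpow)
   have c: "const.I (N k) (M k) \<noteq> 0" by (simp add: const_I)
   have gen: "(i / (a * b * c)) * t * (j / ((x / a) * (y / b) * inverse c) * t) / (l / (X * Y * 1) * t)\<^sup>2 = i * j / l\<^sup>2"
    if "a \<noteq> 0" "b \<noteq> 0" "c \<noteq> 0" "t \<noteq> 0" "x = X\<^sup>2" "y = Y\<^sup>2" "X \<noteq> 0" "Y \<noteq> 0" "l \<noteq> 0" for i j a b c t x y X Y l :: real
    using that by (simp add: field_simps power2_eq_square)
   show ?case unfolding p[OF s(1)] p[of "1 - sg k", simplified, OF s(2)] lam_eq power_divide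
    by (rule gen) (use s q elim r1_pos[OF s] r2_pos[OF s] w_pos[OF s] c in \<open>auto simp: power_even_eq\<close>)
  qed
 qed simp
 also have "sqrt (pi / P z) * sqrt (pi / (1 - P z)) / (sqrt (pi / (1 / 2)))\<^sup>2 = 1 / (2 * sqrt (P z * (1 - P z)))"
  using Pz by (simp add: real_sqrt_divide real_sqrt_mult power_mult_distrib)
 finally show ?thesis .
qed

interpretation swap: leray_profile "%s. P (1 - s)" "%s. C2 (1 - s)" "%s. C1 (1 - s)" "%s. H (1 - s)"
 "%s. r2 (1 - s)" "%s. r1 (1 - s)" "%s. w (1 - s)" k1 k0
 by (rule swap)

interpretation swap_dual: leray_profile "%s. 1 - P (1 - s)" "%s. inverse (C2 (1 - s))" "%s. inverse (C1 (1 - s))" "%s. inverse (H (1 - s))"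
 "%s. s / r2 (1 - s)" "%s. (1 - s) / r1 (1 - s)" "%s. inverse (w (1 - s))" "- k1" "- k0"
 by (rule swap.dual)

lemma LBINT_reflect: "(LBINT s:{0<..<1}. f (1 - s)) = (LBINT s:{0<..<1}. f s)" for f :: "real \<Rightarrow> real"
proof -
 have "(LBINT s:{0<..<1}. f s) = (LBINT s. indicator {0<..<1} (1 + (- 1) * s) *\<^sub>R f (1 + (- 1) * s))"
  unfolding set_lebesgue_integral_def by (subst lborel_integral_real_affine[of "- 1" _ 1]) auto
 also have "\<dots> = (LBINT s:{0<..<1}. f (1 - s))"
  unfolding set_lebesgue_integral_def by (intro Bochner_Integration.integral_cong) (auto split: split_indicator)
 finally show ?thesis ..
qed

lemma swap_lam: "swap.lam m n = lam n m"
proof -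
 have 1: "swap.I m n = I n m"
  unfolding swap.I_def I_def by (subst LBINT_reflect[symmetric]) (simp add: mult_ac)
 have 2: "swap_dual.I m n = dual.I n m"
  unfolding swap_dual.I_def dual.I_def by (subst LBINT_reflect[symmetric]) (simp add: mult_ac)
 show ?thesis unfolding swap.lam_def lam_def 1 2 by (simp add: add_ac mult_ac)
qed

lemma lam_corner': "(%n. lam n m) \<longlonglongrightarrow> corner_value (P 1) k1 m"
 using swap.lam_corner[of m] by (simp add: swap_lam)

definition limit_set :: "real set" where
 "limit_set = {1 / (2 * sqrt (P z * (1 - P z))) | z. 0 \<le> z \<and> z \<le> 1} \<union> range (corner_value (P 0) k0) \<union> range (corner_value (P 1) k1)"

text \<open>Along an injective sequence of index pairs either some value of n recurs infinitely
  often, or some value of m does, or both tend to infinity; in the last case n / (n + m) has a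
  convergent subsequence by compactness. The three cases lead to the three parts of
  \<open>limit_set\<close>.\<close>

lemma lam_subseq:
 fixes f :: "nat \<Rightarrow> nat \<times> nat" assumes "inj f"
 shows "\<exists>r c. strict_mono r \<and> c \<in> limit_set \<and> (%k. case_prod lam (f (r k))) \<longlonglongrightarrow> c"
proof -
 define N where "N = fst \<circ> f"
 define M where "M = snd \<circ> f"
 have f: "f k = (N k, M k)" for k by (simp add: N_def M_def)
 show ?thesis
 proof (cases "\<exists>c. infinite {k. N k = c}")
  case True
  then obtain c where c: "infinite {k. N k = c}" by blast
  define r where "r = enumerate {k. N k = c}"
  have r: "strict_mono r" "!!k. N (r k) = c" using c enumerate_in_set[OF c] by (auto simp: r_def strict_mono_enumerate)
  have "inj (M \<circ> r)"
  proof (rule injI)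
   fix x y assume "(M \<circ> r) x = (M \<circ> r) y"
   then have "f (r x) = f (r y)" using r(2) by (simp add: f)
   then show "x = y" using assms strict_mono_imp_inj_on[OF r(1)] by (auto dest!: injD)
  qed
  then have "(%k. lam c ((M \<circ> r) k)) \<longlonglongrightarrow> corner_value (P 0) k0 c"
   by (intro filterlim_compose[OF lam_corner] at_top_of_inj)
  then show ?thesis using r by (intro exI[of _ r] exI[of _ "corner_value (P 0) k0 c"]) (auto simp: f limit_set_def)
 next
  case N: False
  show ?thesis
  proof (cases "\<exists>c. infinite {k. M k = c}")
   case True
   then obtain c where c: "infinite {k. M k = c}" by blast
   define r where "r = enumerate {k. M k = c}"
   have r: "strict_mono r" "!!k. M (r k) = c" using c enumerate_in_set[OF c] by (auto simp: r_def strict_mono_enumerate)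
   have "inj (N \<circ> r)"
   proof (rule injI)
    fix x y assume "(N \<circ> r) x = (N \<circ> r) y"
    then have "f (r x) = f (r y)" using r(2) by (simp add: f)
    then show "x = y" using assms strict_mono_imp_inj_on[OF r(1)] by (auto dest!: injD)
   qed
   then have "(%k. lam ((N \<circ> r) k) c) \<longlonglongrightarrow> corner_value (P 1) k1 c"
    by (intro filterlim_compose[OF lam_corner'] at_top_of_inj)
   then show ?thesis using r by (intro exI[of _ r] exI[of _ "corner_value (P 1) k1 c"]) (auto simp: f limit_set_def)
  next
   case M: False
   have NM: "filterlim N at_top sequentially" "filterlim M at_top sequentially"
    using N M by (auto intro: at_top_of_finite_fibres)
   define sg where "sg = (%k. N k / (real (N k) + M k))"
   have "sg k \<in> {0..1}" for k by (auto simp: sg_def divide_le_eq_1)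
   then obtain z r where z: "z \<in> {0..1}" "strict_mono r" "(sg \<circ> r) \<longlonglongrightarrow> z"
    using compact_imp_seq_compact[OF compact_Icc[of 0 "1::real"]] unfolding seq_compact_def by blast
   have "(%k. lam ((N \<circ> r) k) ((M \<circ> r) k)) \<longlonglongrightarrow> 1 / (2 * sqrt (P z * (1 - P z)))"
   proof (rule lam_bulk)
    show "filterlim (N \<circ> r) at_top sequentially" "filterlim (M \<circ> r) at_top sequentially"
     using NM filterlim_subseq[OF z(2)] by (auto simp: o_def intro: filterlim_compose)
   qed (use z in \<open>auto simp: sg_def o_def\<close>)
   then show ?thesis using z by (intro exI[of _ r] exI[of _ "1 / (2 * sqrt (P z * (1 - P z)))"]) (auto simp: f limit_set_def)
  qed
 qed
qed

lemma lam_attained: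
 assumes "c \<in> limit_set"
 shows "\<exists>f :: nat \<Rightarrow> nat \<times> nat. inj f \<and> (%k. case_prod lam (f k)) \<longlonglongrightarrow> c"
proof -
 consider z where "0 \<le> z" "z \<le> 1" "c = 1 / (2 * sqrt (P z * (1 - P z)))" | n where "c = corner_value (P 0) k0 n"
  | n where "c = corner_value (P 1) k1 n" using assms by (auto simp: limit_set_def)
 then show ?thesis
 proof cases
  case 1
  \<comment> \<open>The square makes the ratio tend to z; the added k forces both indices to
    infinity and makes the sequence injective even for z = 0 or z = 1.\<close>
  define N where "N = (%k::nat. nat \<lfloor>z * (real k)\<^sup>2\<rfloor> + k)"
  define M where "M = (%k::nat. nat \<lfloor>(1 - z) * (real k)\<^sup>2\<rfloor> + k)"
  have top: "filterlim (%k. g k + k) at_top sequentially" for g :: "nat \<Rightarrow> nat"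
   by (rule filterlim_at_top_mono[OF filterlim_ident]) auto
  have dens: "(%k. real (nat \<lfloor>y * (real k)\<^sup>2\<rfloor> + k) / (real k)\<^sup>2) \<longlonglongrightarrow> y" if "0 \<le> y" for y
  proof (rule tendsto_sandwich)
   show "\<forall>\<^sub>F k in sequentially. (y * (real k)\<^sup>2 + real k - 1) / (real k)\<^sup>2 \<le> real (nat \<lfloor>y * (real k)\<^sup>2\<rfloor> + k) / (real k)\<^sup>2"
   proof (intro always_eventually allI divide_right_mono)
    fix k :: nat
    have "0 \<le> y * (real k)\<^sup>2" using that by simp
    then show "y * (real k)\<^sup>2 + real k - 1 \<le> real (nat \<lfloor>y * (real k)\<^sup>2\<rfloor> + k)"
     using real_of_int_floor_gt_diff_one[of "y * (real k)\<^sup>2"] by simp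
   qed simp
   show "\<forall>\<^sub>F k in sequentially. real (nat \<lfloor>y * (real k)\<^sup>2\<rfloor> + k) / (real k)\<^sup>2 \<le> (y * (real k)\<^sup>2 + real k) / (real k)\<^sup>2"
    by (intro always_eventually allI divide_right_mono) (use that in auto)
   show "(%k. (y * (real k)\<^sup>2 + real k - 1) / (real k)\<^sup>2) \<longlonglongrightarrow> y" "(%k. (y * (real k)\<^sup>2 + real k) / (real k)\<^sup>2) \<longlonglongrightarrow> y"
    by real_asymp+
  qed
  have "(%k. (N k / (real k)\<^sup>2) / (N k / (real k)\<^sup>2 + M k / (real k)\<^sup>2)) \<longlonglongrightarrow> z / (z + (1 - z))"
   unfolding N_def M_def using 1 by (intro tendsto_intros dens) auto
  moreover have "\<forall>\<^sub>F k in sequentially. (N k / (real k)\<^sup>2) / (N k / (real k)\<^sup>2 + M k / (real k)\<^sup>2) = N k / (real (N k) + M k)"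
   using eventually_gt_at_top[of 0] by eventually_elim (simp flip: add_divide_distrib)
  ultimately have "(%k. N k / (real (N k) + M k)) \<longlonglongrightarrow> z" using Lim_transform_eventually by fastforce
  then have "(%k. lam (N k) (M k)) \<longlonglongrightarrow> c"
   unfolding 1(3) using 1(1,2) top by (intro lam_bulk) (auto simp: N_def M_def)
  moreover have "inj (%k. (N k, M k))"
  proof -
   have "strict_mono N"
   proof (rule strict_monoI)
    fix x y :: nat assume "x < y"
    then have "z * (real x)\<^sup>2 \<le> z * (real y)\<^sup>2" using 1 by (intro mult_left_mono power_mono) auto
    then have "nat \<lfloor>z * (real x)\<^sup>2\<rfloor> \<le> nat \<lfloor>z * (real y)\<^sup>2\<rfloor>" by (intro nat_mono floor_mono)
    then show "N x < N y" using \<open>x < y\<close> by (simp add: N_def)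
   qed
   from strict_mono_imp_inj_on[OF this] show ?thesis by (auto simp: inj_def)
  qed
  ultimately show ?thesis by (intro exI[of _ "%k. (N k, M k)"]) auto
 next
  case 2
  then show ?thesis using lam_corner[of n] by (intro exI[of _ "%k. (n, k)"]) (auto simp: inj_def)
 next
  case 3
  then show ?thesis using lam_corner'[of n] by (intro exI[of _ "%k. (k, n)"]) (auto simp: inj_def)
 qed
qed

end

section \<open>The seminorm geometry of square integrable functions\<close>

lemma L2_iff: "f \<in> L2 M \<longleftrightarrow> f \<in> borel_measurable M \<and> integrable M (%x. (cmod (f x))\<^sup>2)"
 by (simp add: L2_def)

lemma L2_measurable[measurable_dest]: "f \<in> L2 M ==> f \<in> borel_measurable M" by (simp add: L2_iff)
lemma L2_integrable: "f \<in> L2 M ==> integrable M (%x. (cmod (f x))\<^sup>2)" by (simp add: L2_iff)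

lemma L2_zero[simp]: "(%_. 0) \<in> L2 M" by (simp add: L2_iff)

lemma L2_cmult: "f \<in> L2 M ==> (%x. c * f x) \<in> L2 M"
 by (auto simp: L2_iff norm_mult power_mult_distrib intro: borel_measurable_times)

lemma cnj_measurable[measurable]: "cnj \<in> borel_measurable borel"
 by (intro borel_measurable_continuous_onI continuous_intros)

lemma L2_add: assumes "f \<in> L2 M" "g \<in> L2 M" shows "(%x. f x + g x) \<in> L2 M"
 unfolding L2_iff
proof
 have [measurable]: "f \<in> borel_measurable M" "g \<in> borel_measurable M" using assms by (auto simp: L2_iff)
 show "(%x. f x + g x) \<in> borel_measurable M" by measurable
 have "integrable M (%x. 2 * (cmod (f x))\<^sup>2 + 2 * (cmod (g x))\<^sup>2)"
  using assms by (auto simp: L2_iff)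
 then show "integrable M (%x. (cmod (f x + g x))\<^sup>2)"
 proof (rule Bochner_Integration.integrable_bound)
  show "AE x in M. norm ((cmod (f x + g x))\<^sup>2) \<le> norm (2 * (cmod (f x))\<^sup>2 + 2 * (cmod (g x))\<^sup>2)"
  proof (rule AE_I2)
   fix x
   have "(cmod (f x + g x))\<^sup>2 \<le> (cmod (f x) + cmod (g x))\<^sup>2" by (intro power_mono norm_triangle_ineq) auto
   also have "\<dots> \<le> 2 * (cmod (f x))\<^sup>2 + 2 * (cmod (g x))\<^sup>2"
    using sum_squares_bound[of "cmod (f x)" "cmod (g x)"] by (simp add: power2_sum)
   finally show "norm ((cmod (f x + g x))\<^sup>2) \<le> norm (2 * (cmod (f x))\<^sup>2 + 2 * (cmod (g x))\<^sup>2)" by simp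
  qed
 qed measurable
qed

lemma L2_lincomb: "f \<in> L2 M ==> g \<in> L2 M ==> (%x. c * f x + d * g x) \<in> L2 M"
 by (intro L2_add L2_cmult)

lemma L2_diff: "f \<in> L2 M ==> g \<in> L2 M ==> (%x. f x - g x) \<in> L2 M"
 using L2_lincomb[of f M g 1 "-1"] by simp

lemma L2_sum: "(!!i. i \<in> X ==> f i \<in> L2 M) ==> (%x. \<Sum>i\<in>X. f i x) \<in> L2 M"
proof (induction X rule: infinite_finite_induct)
 case (insert i X) then show ?case using L2_add[of "f i" M "%x. \<Sum>i\<in>X. f i x"] by simp
qed auto

lemma L2_cong_AE: "f \<in> L2 M ==> g \<in> borel_measurable M ==> (AE x in M. f x = g x) ==> g \<in> L2 M"
 unfolding L2_iff by (auto elim!: integrable_cong_AE_imp elim: AE_mp)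

lemma integrable_inner: assumes "f \<in> L2 M" "g \<in> L2 M" shows "integrable M (%x. f x * cnj (g x))"
proof -
 have [measurable]: "f \<in> borel_measurable M" "g \<in> borel_measurable M" using assms by (auto simp: L2_iff)
 have "integrable M (%x. (cmod (f x))\<^sup>2 + (cmod (g x))\<^sup>2)" using assms by (auto simp: L2_iff)
 then show ?thesis
 proof (rule Bochner_Integration.integrable_bound)
  show "(%x. f x * cnj (g x)) \<in> borel_measurable M" by measurable
  show "AE x in M. norm (f x * cnj (g x)) \<le> norm ((cmod (f x))\<^sup>2 + (cmod (g x))\<^sup>2)"
  proof (rule AE_I2)
   fix x
   have "2 * (cmod (f x) * cmod (g x)) \<le> (cmod (f x))\<^sup>2 + (cmod (g x))\<^sup>2"
    using sum_squares_bound[of "cmod (f x)" "cmod (g x)"] by simp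
   moreover have "0 \<le> cmod (f x) * cmod (g x)" by simp
   ultimately show "norm (f x * cnj (g x)) \<le> norm ((cmod (f x))\<^sup>2 + (cmod (g x))\<^sup>2)"
    by (simp only: norm_mult complex_mod_cnj real_norm_def)
  qed
 qed
qed

lemma inner_commute: "l2_inner M g f = cnj (l2_inner M f g)"
 unfolding l2_inner_def by (subst Bochner_Integration.integral_cnj[symmetric]) (simp add: mult.commute)

lemma inner_lincomb_left:
 "f \<in> L2 M ==> g \<in> L2 M ==> h \<in> L2 M ==> l2_inner M (%x. c * f x + d * g x) h = c * l2_inner M f h + d * l2_inner M g h"
 unfolding l2_inner_def by (simp add: distrib_right mult.assoc integrable_inner)

lemma inner_lincomb_right:
 "f \<in> L2 M ==> g \<in> L2 M ==> h \<in> L2 M ==> l2_inner M h (%x. c * f x + d * g x) = cnj c * l2_inner M h f + cnj d * l2_inner M h g"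
 using inner_lincomb_left[of f M g h c d] inner_commute[of M h] by (metis complex_cnj_add complex_cnj_mult)

lemma inner_cmult_left: "l2_inner M (%x. c * f x) h = c * l2_inner M f h"
 unfolding l2_inner_def by (simp add: mult.assoc)

lemma inner_cmult_right: "l2_inner M f (%x. c * h x) = cnj c * l2_inner M f h"
 by (metis inner_cmult_left inner_commute complex_cnj_mult)

lemma inner_diff_left:
 "f \<in> L2 M ==> g \<in> L2 M ==> h \<in> L2 M ==> l2_inner M (%x. f x - g x) h = l2_inner M f h - l2_inner M g h"
 using inner_lincomb_left[of f M g h 1 "-1"] by simp

lemma inner_diff_right:
 "f \<in> L2 M ==> g \<in> L2 M ==> h \<in> L2 M ==> l2_inner M h (%x. f x - g x) = l2_inner M h f - l2_inner M h g"
 using inner_lincomb_right[of f M g h 1 "-1"] by simp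

lemma inner_add_left:
 "f \<in> L2 M ==> g \<in> L2 M ==> h \<in> L2 M ==> l2_inner M (%x. f x + g x) h = l2_inner M f h + l2_inner M g h"
 using inner_lincomb_left[of f M g h 1 1] by simp

lemma inner_sum_left:
 "(!!i. i \<in> X ==> f i \<in> L2 M) ==> h \<in> L2 M ==> l2_inner M (%x. \<Sum>i\<in>X. f i x) h = (\<Sum>i\<in>X. l2_inner M (f i) h)"
proof (induction X rule: infinite_finite_induct)
 case (insert i X)
 then show ?case using inner_add_left[of "f i" M "%x. \<Sum>i\<in>X. f i x" h] L2_sum[of X f M] by simp
qed (auto simp: l2_inner_def)

lemma inner_sum_right:
 "(!!i. i \<in> X ==> f i \<in> L2 M) ==> h \<in> L2 M ==> l2_inner M h (%x. \<Sum>i\<in>X. f i x) = (\<Sum>i\<in>X. l2_inner M h (f i))"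
proof -
 assume f: "!!i. i \<in> X ==> f i \<in> L2 M" and h: "h \<in> L2 M"
 have "l2_inner M h (%x. \<Sum>i\<in>X. f i x) = cnj (\<Sum>i\<in>X. l2_inner M (f i) h)"
  by (subst inner_commute) (simp add: inner_sum_left f h)
 also have "\<dots> = (\<Sum>i\<in>X. l2_inner M h (f i))" unfolding cnj_sum by (rule sum.cong) (auto simp: inner_commute[symmetric])
 finally show ?thesis .
qed

lemma norm_nonneg[simp]: "0 \<le> l2_norm M f" by (simp add: l2_norm_def)

lemma norm_sq: "(l2_norm M f)\<^sup>2 = (\<integral>x. (cmod (f x))\<^sup>2 \<partial>M)"
 by (simp add: l2_norm_def)

lemma inner_self: "l2_inner M f f = of_real ((l2_norm M f)\<^sup>2)"
 unfolding norm_sq l2_inner_def complex_norm_square[symmetric] by (rule integral_complex_of_real)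

lemma norm_cmult: "l2_norm M (%x. c * f x) = cmod c * l2_norm M f"
 by (simp add: l2_norm_def norm_mult power_mult_distrib real_sqrt_mult)

lemma norm_minus: "l2_norm M (%x. - f x) = l2_norm M f" by (simp add: l2_norm_def)

lemma norm_diff_commute: "l2_norm M (%x. f x - g x) = l2_norm M (%x. g x - f x)"
 by (simp add: l2_norm_def norm_minus_commute)

lemma norm_zero_iff: "f \<in> L2 M ==> l2_norm M f = 0 \<longleftrightarrow> (AE x in M. f x = 0)"
 unfolding l2_norm_def using integral_nonneg_eq_0_iff_AE[OF L2_integrable[of f M]] by simp

lemma norm_zero[simp]: "l2_norm M (%_. 0) = 0" by (simp add: l2_norm_def)

lemma norm_cong_AE: "f \<in> borel_measurable M ==> g \<in> borel_measurable M ==> (AE x in M. f x = g x) ==> l2_norm M f = l2_norm M g"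
 unfolding l2_norm_def by (intro arg_cong[where f = sqrt] integral_cong_AE) (auto elim: AE_mp)

lemma inner_cong_AE: "f \<in> borel_measurable M ==> f' \<in> borel_measurable M ==> g \<in> borel_measurable M ==> (AE x in M. f x = f' x) ==> l2_inner M f g = l2_inner M f' g"
 unfolding l2_inner_def by (intro integral_cong_AE) (measurable, auto elim: AE_mp)

lemma inner_zero_AE: "(AE x in M. f x = 0) ==> l2_inner M f g = 0"
 unfolding l2_inner_def by (intro integral_eq_zero_AE) (auto elim: AE_mp)

text \<open>The common source of Cauchy-Schwarz, Pythagoras, the parallelogram law and the
  minimality argument for projections.\<close>

lemma norm_sq_lincomb:
 assumes "f \<in> L2 M" "g \<in> L2 M"
 shows "(l2_norm M (%x. f x + c * g x))\<^sup>2 = (l2_norm M f)\<^sup>2 + 2 * Re (cnj c * l2_inner M f g) + (cmod c)\<^sup>2 * (l2_norm M g)\<^sup>2"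
proof -
 have "of_real ((l2_norm M (%x. f x + c * g x))\<^sup>2) = l2_inner M (%x. 1 * f x + c * g x) (%x. 1 * f x + c * g x)"
  by (simp add: inner_self)
 also have "\<dots> = l2_inner M f f + cnj c * l2_inner M f g + c * cnj (l2_inner M f g) + c * cnj c * l2_inner M g g"
  using assms inner_commute[of M g f] by (simp only: inner_lincomb_left inner_lincomb_right L2_lincomb) (simp add: algebra_simps)
 also have "c * cnj c = of_real ((cmod c)\<^sup>2)" by (rule complex_norm_square[symmetric])
 finally have "Re (of_real ((l2_norm M (%x. f x + c * g x))\<^sup>2)) = Re (l2_inner M f f + cnj c * l2_inner M f g + c * cnj (l2_inner M f g) + of_real ((cmod c)\<^sup>2) * l2_inner M g g)"
  by (rule arg_cong)
 moreover have "Re (c * cnj (l2_inner M f g)) = Re (cnj c * l2_inner M f g)" by simp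
 ultimately show ?thesis unfolding inner_self by (simp del: of_real_power)
qed

lemma Cauchy_Schwarz_L2:
 assumes "f \<in> L2 M" "g \<in> L2 M" shows "cmod (l2_inner M f g) \<le> l2_norm M f * l2_norm M g"
proof (cases "l2_norm M g = 0")
 case True
 then have "l2_inner M g f = 0" using assms by (intro inner_zero_AE) (simp add: norm_zero_iff)
 then show ?thesis by (subst inner_commute) simp
next
 case False
 define z where "z = l2_inner M f g"
 define N where "N = (l2_norm M g)\<^sup>2"
 have N: "0 < N" using False by (simp add: N_def)
 \<comment> \<open>The coefficient - z / N is the one that minimises the norm.\<close>
 have "0 \<le> (l2_norm M (%x. f x + (- z / N) * g x))\<^sup>2" by simp
 also have "\<dots> = (l2_norm M f)\<^sup>2 + 2 * Re (cnj (- z / N) * z) + (cmod (- z / N))\<^sup>2 * N"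
  using norm_sq_lincomb[OF assms, of "- z / N"] by (simp add: z_def N_def)
 also have "cnj (- z / N) * z = - of_real ((cmod z)\<^sup>2 / N)"
  unfolding of_real_divide complex_norm_square by simp
 also have "(cmod (- z / N))\<^sup>2 * N = (cmod z)\<^sup>2 / N" using N by (simp add: norm_divide power_divide power2_eq_square)
 finally have "(cmod z)\<^sup>2 / N \<le> (l2_norm M f)\<^sup>2" by simp
 then have "(cmod z)\<^sup>2 \<le> (l2_norm M f * l2_norm M g)\<^sup>2" using N by (simp add: pos_divide_le_eq power_mult_distrib N_def)
 then show ?thesis unfolding z_def by (rule power2_le_imp_le) simp
qed

lemma norm_triangle_L2:
 assumes "f \<in> L2 M" "g \<in> L2 M" shows "l2_norm M (%x. f x + g x) \<le> l2_norm M f + l2_norm M g"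
proof (rule power2_le_imp_le)
 have "(l2_norm M (%x. f x + g x))\<^sup>2 = (l2_norm M f)\<^sup>2 + 2 * Re (l2_inner M f g) + (l2_norm M g)\<^sup>2"
  using norm_sq_lincomb[OF assms, of 1] by simp
 also have "Re (l2_inner M f g) \<le> l2_norm M f * l2_norm M g"
  using Cauchy_Schwarz_L2[OF assms] complex_Re_le_cmod order_trans by blast
 finally show "(l2_norm M (%x. f x + g x))\<^sup>2 \<le> (l2_norm M f + l2_norm M g)\<^sup>2" by (simp add: power2_sum)
qed simp

lemma norm_triangle_diff:
 assumes "f \<in> L2 M" "g \<in> L2 M" "h \<in> L2 M"
 shows "l2_norm M (%x. f x - h x) \<le> l2_norm M (%x. f x - g x) + l2_norm M (%x. g x - h x)"
 using norm_triangle_L2[OF L2_diff[OF assms(1,2)] L2_diff[OF assms(2,3)]] by simp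

lemma Pythagoras_L2:
 assumes "f \<in> L2 M" "g \<in> L2 M" "l2_inner M f g = 0"
 shows "(l2_norm M (%x. f x + g x))\<^sup>2 = (l2_norm M f)\<^sup>2 + (l2_norm M g)\<^sup>2"
 using norm_sq_lincomb[OF assms(1,2), of 1] assms(3) by simp

lemma parallelogram_L2:
 assumes "f \<in> L2 M" "g \<in> L2 M"
 shows "(l2_norm M (%x. f x + g x))\<^sup>2 + (l2_norm M (%x. f x - g x))\<^sup>2 = 2 * (l2_norm M f)\<^sup>2 + 2 * (l2_norm M g)\<^sup>2"
 using norm_sq_lincomb[OF assms, of 1] norm_sq_lincomb[OF assms, of "-1"] by simp

section \<open>Completeness and orthogonal projection\<close>

definition l2_Cauchy :: "'a measure \<Rightarrow> (nat \<Rightarrow> 'a \<Rightarrow> complex) \<Rightarrow> bool" where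
 "l2_Cauchy M u \<longleftrightarrow> (\<forall>e>0. \<exists>N. \<forall>m\<ge>N. \<forall>n\<ge>N. l2_norm M (%x. u m x - u n x) < e)"

text \<open>The limit is taken pointwise along a subsequence, so that it inherits pointwise properties of
 the sequence, such as being a monomial.\<close>

theorem L2_complete:
 assumes u: "!!n. u n \<in> L2 M" and c: "l2_Cauchy M u"
 shows "\<exists>k h. strict_mono k \<and> h = (%x. if convergent (%j. u (k j) x) then lim (%j. u (k j) x) else 0) \<and>
   h \<in> L2 M \<and> (%n. l2_norm M (%x. u n x - h x)) \<longlonglongrightarrow> 0"
proof -
 have [measurable]: "u n \<in> borel_measurable M" for n using u by (simp add: L2_iff)
 have "\<forall>j. \<exists>N. \<forall>m\<ge>N. \<forall>n\<ge>N. l2_norm M (%x. u m x - u n x) < (1 / 2) ^ j"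
  using c unfolding l2_Cauchy_def by simp
 then obtain K where K: "!!j m n. K j \<le> m ==> K j \<le> n ==> l2_norm M (%x. u m x - u n x) < (1 / 2) ^ j" by metis
 \<comment> \<open>Partial sums of the thresholds make k strictly increasing and still beyond every
   earlier threshold.\<close>
 define k where "k = (%j. (\<Sum>i\<le>j. K i) + j)"
 have sm: "strict_mono k" by (rule strict_monoI_Suc) (simp add: k_def)
 have kK: "K j \<le> k i" if "j \<le> i" for i j
  unfolding k_def using member_le_sum[of j "{..i}" K] that by simp
 have dist: "l2_norm M (%x. u n x - u (k i) x) < (1 / 2) ^ j" if "k j \<le> n" "j \<le> i" for n i j
  using K[of j n "k i"] kK[of j j] kK[of j i] that by simp
 define h where "h = (%x. if convergent (%j. u (k j) x) then lim (%j. u (k j) x) else 0)"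
 have [measurable]: "h \<in> borel_measurable M"
  unfolding h_def Cauchy_convergent_iff[symmetric] by measurable
 \<comment> \<open>The weights 2^j in the next estimate prepare the inequality 2 d \<le> 2^j d^2 +
   2^(-j), which turns square integrability into pointwise summability of the increments without a
   triangle inequality for infinite sums.\<close>
 define d where "d = (%j x. cmod (u (k (Suc j)) x - u (k j) x))"
 have [measurable]: "d j \<in> borel_measurable M" for j unfolding d_def by measurable
 have nnd: "(\<integral>\<^sup>+x. ennreal (2 ^ j * (d j x)\<^sup>2) \<partial>M) \<le> ennreal ((1 / 2) ^ j)" for j
 proof -
  have i: "integrable M (%x. (d j x)\<^sup>2)" unfolding d_def by (intro L2_integrable L2_diff u)
  have "(\<integral>\<^sup>+x. ennreal (2 ^ j * (d j x)\<^sup>2) \<partial>M) = ennreal (\<integral>x. 2 ^ j * (d j x)\<^sup>2 \<partial>M)"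
   using i by (intro nn_integral_eq_integral) auto
  also have "(\<integral>x. 2 ^ j * (d j x)\<^sup>2 \<partial>M) = 2 ^ j * (l2_norm M (%x. u (k (Suc j)) x - u (k j) x))\<^sup>2"
   by (simp add: norm_sq d_def)
  also have "\<dots> \<le> 2 ^ j * ((1 / 2) ^ j)\<^sup>2"
   using dist[of j "k (Suc j)" j] sm by (intro mult_left_mono power_mono) (auto simp: strict_mono_less_eq less_imp_le)
  also have "\<dots> = (1 / 2) ^ j" by (simp add: power2_eq_square power_divide)
  finally show ?thesis by (simp add: ennreal_leI)
 qed
 have "(\<integral>\<^sup>+x. (\<Sum>j. ennreal (2 ^ j * (d j x)\<^sup>2)) \<partial>M) = (\<Sum>j. \<integral>\<^sup>+x. ennreal (2 ^ j * (d j x)\<^sup>2) \<partial>M)"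
  by (intro nn_integral_suminf) measurable
 also have "\<dots> \<le> (\<Sum>j. ennreal ((1 / 2) ^ j))" by (intro suminf_le nnd) auto
 also have "\<dots> < \<infinity>" by (subst suminf_ennreal2) (auto intro: summable_geometric)
 finally have fin: "(\<integral>\<^sup>+x. (\<Sum>j. ennreal (2 ^ j * (d j x)\<^sup>2)) \<partial>M) < \<infinity>" .
 have "AE x in M. (\<Sum>j. ennreal (2 ^ j * (d j x)\<^sup>2)) \<noteq> \<infinity>"
  by (rule nn_integral_PInf_AE) (use fin in auto)
 then have conv: "AE x in M. (%j. u (k j) x) \<longlonglongrightarrow> h x"
 proof eventually_elim
  case (elim x)
  have "summable (%j. 2 ^ j * (d j x)\<^sup>2)" by (rule summable_suminf_not_top) (use elim in auto)
  then have "summable (%j. (2 ^ j * (d j x)\<^sup>2 + (1 / 2) ^ j) / 2)"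
   by (intro summable_divide summable_add summable_geometric) auto
  then have "summable (%j. d j x)"
  proof (rule summable_comparison_test')
   fix j :: nat
   have "2 * (sqrt (2 ^ j) * d j x) * sqrt ((1 / 2) ^ j) \<le> (sqrt (2 ^ j) * d j x)\<^sup>2 + (sqrt ((1 / 2) ^ j))\<^sup>2"
    by (rule sum_squares_bound)
   also have "\<dots> = 2 ^ j * (d j x)\<^sup>2 + (1 / 2) ^ j" by (simp add: power_mult_distrib)
   also have "2 * (sqrt (2 ^ j) * d j x) * sqrt ((1 / 2) ^ j) = 2 * d j x * sqrt (2 ^ j * (1 / 2) ^ j)"
    by (simp only: real_sqrt_mult mult_ac)
   also have "2 ^ j * (1 / 2 :: real) ^ j = 1" by (simp add: power_divide)
   finally show "norm (d j x) \<le> (2 ^ j * (d j x)\<^sup>2 + (1 / 2) ^ j) / 2" by (simp add: d_def)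
  qed
  then have "summable (%j. u (k (Suc j)) x - u (k j) x)" unfolding d_def by (rule summable_norm_cancel)
  then have "(%n. \<Sum>j<n. u (k (Suc j)) x - u (k j) x) \<longlonglongrightarrow> (\<Sum>j. u (k (Suc j)) x - u (k j) x)" by (rule summable_LIMSEQ)
  then have "(%n. (u (k n) x - u (k 0) x) + u (k 0) x) \<longlonglongrightarrow> (\<Sum>j. u (k (Suc j)) x - u (k j) x) + u (k 0) x"
   unfolding sum_lessThan_telescope[of "%j. u (k j) x"] by (intro tendsto_intros)
  then have "convergent (%j. u (k j) x)" by (auto simp: convergent_def)
  then show ?case by (simp add: h_def convergent_LIMSEQ_iff)
 qed
 \<comment> \<open>Fatou's lemma along the subsequence transfers the Cauchy estimate to the limit
   function, for all indices n and not only those of the subsequence.\<close>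
 have fatou: "(\<integral>\<^sup>+x. ennreal ((cmod (u n x - h x))\<^sup>2) \<partial>M) \<le> ennreal (((1 / 2) ^ j)\<^sup>2)" if n: "k j \<le> n" for n j
 proof -
  have "(\<integral>\<^sup>+x. ennreal ((cmod (u n x - h x))\<^sup>2) \<partial>M) = (\<integral>\<^sup>+x. liminf (%i. ennreal ((cmod (u n x - u (k i) x))\<^sup>2)) \<partial>M)"
   using conv
  proof (intro nn_integral_cong_AE, eventually_elim)
   case (elim x)
   then have "(%i. ennreal ((cmod (u n x - u (k i) x))\<^sup>2)) \<longlonglongrightarrow> ennreal ((cmod (u n x - h x))\<^sup>2)"
    by (intro tendsto_ennrealI tendsto_intros)
   from lim_imp_Liminf[OF _ this] show ?case by simp
  qed
  also have "\<dots> \<le> liminf (%i. \<integral>\<^sup>+x. ennreal ((cmod (u n x - u (k i) x))\<^sup>2) \<partial>M)" by (intro nn_integral_liminf) measurable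
  also have "\<dots> \<le> ennreal (((1 / 2) ^ j)\<^sup>2)"
  proof (rule Liminf_le)
   show "\<forall>\<^sub>F i in sequentially. (\<integral>\<^sup>+x. ennreal ((cmod (u n x - u (k i) x))\<^sup>2) \<partial>M) \<le> ennreal (((1 / 2) ^ j)\<^sup>2)"
    using eventually_ge_at_top[of j]
   proof eventually_elim
    case (elim i)
    have "(\<integral>\<^sup>+x. ennreal ((cmod (u n x - u (k i) x))\<^sup>2) \<partial>M) = ennreal ((l2_norm M (%x. u n x - u (k i) x))\<^sup>2)"
     unfolding norm_sq by (intro nn_integral_eq_integral L2_integrable L2_diff u) auto
    also have "\<dots> \<le> ennreal (((1 / 2) ^ j)\<^sup>2)"
     using dist[OF n elim] by (intro ennreal_leI power_mono) auto
    finally show ?case .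
   qed
  qed simp
  finally show ?thesis .
 qed
 have dL2: "(%x. u n x - h x) \<in> L2 M" if "k j \<le> n" for n j
  unfolding L2_iff
 proof
  show "integrable M (%x. (cmod (u n x - h x))\<^sup>2)"
   by (rule integrableI_nonneg) (use le_less_trans[OF fatou[OF that]] in auto)
 qed measurable
 have hL2: "h \<in> L2 M" using L2_diff[OF u[of "k 0"] dL2[of 0 "k 0"]] by simp
 moreover have "(%n. l2_norm M (%x. u n x - h x)) \<longlonglongrightarrow> 0"
 proof (rule LIMSEQ_I)
  fix r :: real assume "0 < r"
  then obtain j where j: "(1 / 2 :: real) ^ j < r" using real_arch_pow_inv[of r "1 / 2"] by auto
  have "norm (l2_norm M (%x. u n x - h x) - 0) < r" if "k j \<le> n" for n
  proof -
   have "ennreal ((l2_norm M (%x. u n x - h x))\<^sup>2) = (\<integral>\<^sup>+x. ennreal ((cmod (u n x - h x))\<^sup>2) \<partial>M)"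
    unfolding norm_sq using L2_integrable[OF dL2[OF that]] by (intro nn_integral_eq_integral[symmetric]) auto
   also have "\<dots> \<le> ennreal (((1 / 2) ^ j)\<^sup>2)" by (rule fatou[OF that])
   finally have "(l2_norm M (%x. u n x - h x))\<^sup>2 \<le> ((1 / 2) ^ j)\<^sup>2" by (simp add: ennreal_le_iff)
   then have "l2_norm M (%x. u n x - h x) \<le> (1 / 2) ^ j" by (rule power2_le_imp_le) simp
   then show ?thesis using j by simp
  qed
  then show "\<exists>no. \<forall>n\<ge>no. norm (l2_norm M (%x. u n x - h x) - 0) < r" by blast
 qed
 ultimately show ?thesis using sm h_def by blast
qed

definition l2_subspace :: "'a measure \<Rightarrow> ('a \<Rightarrow> complex) set \<Rightarrow> bool" where
 "l2_subspace M V \<longleftrightarrow> V \<subseteq> L2 M \<and> V \<noteq> {} \<and> (\<forall>f\<in>V. \<forall>g\<in>V. \<forall>c d. (%x. c * f x + d * g x) \<in> V)"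

definition l2_closed :: "'a measure \<Rightarrow> ('a \<Rightarrow> complex) set \<Rightarrow> bool" where
 "l2_closed M V \<longleftrightarrow> (\<forall>u. (\<forall>n. u n \<in> V) \<longrightarrow> l2_Cauchy M u \<longrightarrow> (\<exists>g\<in>V. (%n. l2_norm M (%x. u n x - g x)) \<longlonglongrightarrow> 0))"

lemma l2_subspaceD:
 assumes "l2_subspace M V"
 shows "V \<subseteq> L2 M" "f \<in> V ==> f \<in> L2 M" "f \<in> V ==> g \<in> V ==> (%x. c * f x + d * g x) \<in> V"
  "f \<in> V ==> (%x. c * f x) \<in> V"
proof -
 show 1: "f \<in> V ==> g \<in> V ==> (%x. c * f x + d * g x) \<in> V" for g d using assms by (auto simp: l2_subspace_def)
 show "f \<in> V ==> (%x. c * f x) \<in> V" using 1[of f 0] by simp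
qed (use assms in \<open>auto simp: l2_subspace_def\<close>)

text \<open>A minimising sequence is Cauchy by the parallelogram law, since midpoints stay in V. Its
  limit is a nearest point, and a nonzero inner product with an element of V would allow a still
  nearer one.\<close>

theorem projection_L2:
 assumes V: "l2_subspace M V" "l2_closed M V" and f: "f \<in> L2 M"
 shows "\<exists>g\<in>V. \<forall>v\<in>V. l2_inner M (%x. f x - g x) v = 0"
proof -
 note Vd = l2_subspaceD[OF V(1)]
 define D where "D = (%v. (l2_norm M (%x. f x - v x))\<^sup>2)"
 define d where "d = Inf (D ` V)"
 have bdd: "bdd_below (D ` V)" by (rule bdd_belowI2[of _ 0]) (simp add: D_def)
 have d_le: "d \<le> D v" if "v \<in> V" for v unfolding d_def by (rule cINF_lower[OF bdd that])
 have "\<exists>v\<in>V. D v < d + e" if "0 < e" for e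
 proof -
  have "V \<noteq> {}" using V(1) by (simp add: l2_subspace_def)
  then have "\<exists>z\<in>D ` V. z < d + e" unfolding d_def using that by (intro cInf_lessD) auto
  then show ?thesis by blast
 qed
 then have "\<exists>v. v \<in> V \<and> D v < d + 1 / real (Suc n)" for n by (meson divide_pos_pos of_nat_0_less_iff zero_less_Suc zero_less_one)
 then obtain v where v: "!!n. v n \<in> V" "!!n. D (v n) < d + 1 / real (Suc n)" by metis
 have dist: "(l2_norm M (%x. v m x - v n x))\<^sup>2 \<le> 2 / real (Suc m) + 2 / real (Suc n)" for m n
 proof -
  have mid: "(%x. (1 / 2) * v m x + (1 / 2) * v n x) \<in> V" using Vd(3) v(1) by blast
  have "(l2_norm M (%x. (f x - v n x) + (f x - v m x)))\<^sup>2 + (l2_norm M (%x. (f x - v n x) - (f x - v m x)))\<^sup>2 = 2 * D (v n) + 2 * D (v m)"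
   unfolding D_def by (intro parallelogram_L2 L2_diff f Vd(2) v)
  moreover have "(l2_norm M (%x. (f x - v n x) + (f x - v m x)))\<^sup>2 = 4 * D (%x. (1 / 2) * v m x + (1 / 2) * v n x)"
  proof -
   have "(%x. (f x - v n x) + (f x - v m x)) = (%x. 2 * (f x - ((1 / 2) * v m x + (1 / 2) * v n x)))"
    by (auto simp: field_simps)
   then show ?thesis unfolding D_def by (simp only: norm_cmult) (simp add: power_mult_distrib)
  qed
  moreover have "(%x. (f x - v n x) - (f x - v m x)) = (%x. v m x - v n x)" by auto
  ultimately have "4 * D (%x. (1 / 2) * v m x + (1 / 2) * v n x) + (l2_norm M (%x. v m x - v n x))\<^sup>2 = 2 * D (v n) + 2 * D (v m)" by simp
  moreover have "2 * D (v n) \<le> 2 * d + 2 / real (Suc n)" "2 * D (v m) \<le> 2 * d + 2 / real (Suc m)" using v(2)[of n] v(2)[of m] by (simp_all add: field_simps)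
  ultimately show ?thesis using d_le[OF mid] by linarith
 qed
 have "l2_Cauchy M v"
  unfolding l2_Cauchy_def
 proof (intro allI impI)
  fix e :: real assume e: "0 < e"
  obtain N where N: "4 / e\<^sup>2 < real N" using reals_Archimedean2 by blast
  have "l2_norm M (%x. v m x - v n x) < e" if "N \<le> m" "N \<le> n" for m n
  proof -
   have e2: "0 < e\<^sup>2" using e by simp
   have "4 < e\<^sup>2 * real (Suc j)" if "N \<le> j" for j
   proof -
    have "4 < e\<^sup>2 * real N" using N e2 by (simp add: pos_divide_less_eq mult.commute)
    also have "\<dots> \<le> e\<^sup>2 * real (Suc j)" using that e2 by (intro mult_left_mono) auto
    finally show ?thesis .
   qed
   then have "2 / real (Suc j) < e\<^sup>2 / 2" if "N \<le> j" for j using that by (simp add: pos_divide_less_eq field_simps)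
   then have "(l2_norm M (%x. v m x - v n x))\<^sup>2 < e\<^sup>2" using dist[of m n] that by (smt (verit) field_sum_of_halves)
   then show ?thesis using e by (intro power2_less_imp_less[of _ e]) auto
  qed
  then show "\<exists>N. \<forall>m\<ge>N. \<forall>n\<ge>N. l2_norm M (%x. v m x - v n x) < e" by blast
 qed
 then obtain g where g: "g \<in> V" "(%n. l2_norm M (%x. v n x - g x)) \<longlonglongrightarrow> 0"
  using V(2) v(1) unfolding l2_closed_def by blast
 have Dg: "D g \<le> d"
 proof -
  have "(%n. sqrt (d + 1 / real (Suc n)) + l2_norm M (%x. v n x - g x)) \<longlonglongrightarrow> sqrt (d + 0) + 0"
   by (intro tendsto_intros g(2) LIMSEQ_Suc[OF lim_1_over_n])
  moreover have "l2_norm M (%x. f x - g x) \<le> sqrt (d + 1 / real (Suc n)) + l2_norm M (%x. v n x - g x)" for n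
  proof -
   have "l2_norm M (%x. f x - v n x) \<le> sqrt (d + 1 / real (Suc n))"
    using v(2)[of n] by (intro real_le_rsqrt) (simp add: D_def)
   then show ?thesis using norm_triangle_diff[OF f Vd(2)[OF v(1)[of n]] Vd(2)[OF g(1)]] by linarith
  qed
  ultimately have "l2_norm M (%x. f x - g x) \<le> sqrt d" by (intro LIMSEQ_le_const) auto
  then have "D g \<le> (sqrt d)\<^sup>2" unfolding D_def by (intro power_mono) auto
  moreover have "0 \<le> d" unfolding d_def using V(1) by (intro cINF_greatest) (auto simp: D_def l2_subspace_def)
  ultimately show ?thesis by simp
 qed
 have "l2_inner M (%x. f x - g x) w = 0" if w: "w \<in> V" for w
 proof (rule ccontr)
  assume nz: "l2_inner M (%x. f x - g x) w \<noteq> 0"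
  define z where "z = l2_inner M (%x. f x - g x) w"
  define N where "N = (l2_norm M w)\<^sup>2"
  have fg: "(%x. f x - g x) \<in> L2 M" by (intro L2_diff f Vd(2) g)
  have N: "0 < N" using Cauchy_Schwarz_L2[OF fg Vd(2)[OF w]] nz by (auto simp: N_def)
  \<comment> \<open>Moving g by the projection of f - g onto w lowers the squared distance by |z|^2
    / N.\<close>
  have "(%x. 1 * g x + (z / N) * w x) \<in> V" by (intro Vd(3) g w)
  then have "d \<le> D (%x. 1 * g x + (z / N) * w x)" by (rule d_le)
  also have "D (%x. 1 * g x + (z / N) * w x) = (l2_norm M (%x. (f x - g x) + (- z / N) * w x))\<^sup>2"
   unfolding D_def by (simp add: algebra_simps)
  also have "\<dots> = D g + 2 * Re (cnj (- z / N) * z) + (cmod (- z / N))\<^sup>2 * N"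
   using norm_sq_lincomb[OF fg Vd(2)[OF w], of "- z / N"] by (simp add: z_def N_def D_def)
  also have "cnj (- z / N) * z = - of_real ((cmod z)\<^sup>2 / N)"
   unfolding of_real_divide complex_norm_square by simp
  also have "(cmod (- z / N))\<^sup>2 * N = (cmod z)\<^sup>2 / N" using N by (simp add: norm_divide power_divide power2_eq_square)
  finally have "(cmod z)\<^sup>2 / N \<le> 0" using Dg by simp
  moreover have "0 < (cmod z)\<^sup>2 / N" using N nz by (simp add: z_def)
  ultimately show False by linarith
 qed
 then show ?thesis using g(1) by blast
qed

lemma l2_closed_L2: "l2_closed M (L2 M)"
 unfolding l2_closed_def
proof (intro allI impI)
 fix u assume u: "\<forall>n. u n \<in> L2 M" "l2_Cauchy M u"
 obtain k h where "h \<in> L2 M" "(%n. l2_norm M (%x. u n x - h x)) \<longlonglongrightarrow> 0"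
  using L2_complete[OF spec[OF u(1)] u(2)] by metis
 then show "\<exists>g\<in>L2 M. (%n. l2_norm M (%x. u n x - g x)) \<longlonglongrightarrow> 0" by blast
qed

lemma l2_lim_unique:
 assumes "!!n. u n \<in> L2 M" "g \<in> L2 M" "h \<in> L2 M"
  "(%n. l2_norm M (%x. u n x - g x)) \<longlonglongrightarrow> 0" "(%n. l2_norm M (%x. u n x - h x)) \<longlonglongrightarrow> 0"
 shows "AE x in M. g x = h x"
proof -
 have "(%n. l2_norm M (%x. u n x - g x) + l2_norm M (%x. u n x - h x)) \<longlonglongrightarrow> 0 + 0" by (intro tendsto_intros assms)
 moreover have "l2_norm M (%x. g x - h x) \<le> l2_norm M (%x. u n x - g x) + l2_norm M (%x. u n x - h x)" for n
  using norm_triangle_diff[OF assms(2) assms(1)[of n] assms(3)] norm_diff_commute[of M g "u n"] by simp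
 ultimately have "l2_norm M (%x. g x - h x) \<le> 0 + 0" by (intro LIMSEQ_le_const) auto
 then have "l2_norm M (%x. g x - h x) = 0" using norm_nonneg[of M "%x. g x - h x"] by linarith
 then show ?thesis using norm_zero_iff[OF L2_diff[OF assms(2,3)]] by simp
qed

section \<open>Unconditional sums\<close>

lemma l2_has_sum_L2: "l2_has_sum M F A h ==> h \<in> L2 M" "l2_has_sum M F A h ==> i \<in> A ==> F i \<in> L2 M"
 by (auto simp: l2_has_sum_def)

text \<open>Continuity of the inner product turns a sum of functions into a sum of numbers;
  uniqueness, coefficients and adjoints are all read off from it.\<close>

lemma l2_has_sum_inner:
 assumes h: "l2_has_sum M F A h" and g: "g \<in> L2 M"
 shows "((%i. l2_inner M (F i) g) has_sum l2_inner M h g) A"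
 unfolding has_sum_def
proof (rule Lim_transform)
 show "((%X. l2_inner M h g) \<longlongrightarrow> l2_inner M h g) (finite_subsets_at_top A)" by simp
 show "((%X. (\<Sum>i\<in>X. l2_inner M (F i) g) - l2_inner M h g) \<longlongrightarrow> 0) (finite_subsets_at_top A)"
 proof (rule Lim_null_comparison)
  show "((%X. l2_norm M (%x. h x - (\<Sum>i\<in>X. F i x)) * l2_norm M g) \<longlongrightarrow> 0) (finite_subsets_at_top A)"
   using h unfolding l2_has_sum_def by (intro tendsto_mult_left_zero) auto
  show "\<forall>\<^sub>F X in finite_subsets_at_top A. norm ((\<Sum>i\<in>X. l2_inner M (F i) g) - l2_inner M h g) \<le> l2_norm M (%x. h x - (\<Sum>i\<in>X. F i x)) * l2_norm M g"
   unfolding eventually_finite_subsets_at_top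
  proof (rule exI[of _ "{}"], intro conjI allI impI)
   fix X assume "finite X \<and> {} \<subseteq> X \<and> X \<subseteq> A"
   then have F: "!!i. i \<in> X ==> F i \<in> L2 M" using h by (auto simp: l2_has_sum_def)
   have hs: "(%x. \<Sum>i\<in>X. F i x) \<in> L2 M" by (intro L2_sum F)
   have "l2_inner M h g - (\<Sum>i\<in>X. l2_inner M (F i) g) = l2_inner M (%x. h x - (\<Sum>i\<in>X. F i x)) g"
    using inner_diff_left[OF l2_has_sum_L2(1)[OF h] hs g] inner_sum_left[of X F M g, OF F g] by simp
   then show "norm ((\<Sum>i\<in>X. l2_inner M (F i) g) - l2_inner M h g) \<le> l2_norm M (%x. h x - (\<Sum>i\<in>X. F i x)) * l2_norm M g"
    using Cauchy_Schwarz_L2[OF L2_diff[OF l2_has_sum_L2(1)[OF h] hs] g] by (simp add: norm_minus_commute)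
  qed simp_all
 qed
qed

lemma inner_separates:
 assumes "f \<in> L2 M" "g \<in> L2 M" "!!v. v \<in> L2 M ==> l2_inner M f v = l2_inner M g v"
 shows "AE x in M. f x = g x"
proof -
 have d: "(%x. f x - g x) \<in> L2 M" by (intro L2_diff assms)
 have "l2_inner M (%x. f x - g x) (%x. f x - g x) = 0"
  using inner_diff_left[OF assms(1,2) d] assms(3)[OF d] by simp
 then have "l2_norm M (%x. f x - g x) = 0" by (simp add: inner_self)
 then show ?thesis using norm_zero_iff[OF d] by simp
qed

lemma l2_has_sum_unique:
 assumes "l2_has_sum M F A h" "l2_has_sum M G A k" "!!i. i \<in> A ==> AE x in M. F i x = G i x"
 shows "AE x in M. h x = k x"
proof (rule inner_separates)
 fix v assume v: "v \<in> L2 M"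
 have "l2_inner M (F i) v = l2_inner M (G i) v" if "i \<in> A" for i
  using that assms v by (intro inner_cong_AE) (auto simp: l2_has_sum_def L2_measurable)
 then have "((%i. l2_inner M (F i) v) has_sum l2_inner M k v) A"
  using l2_has_sum_inner[OF assms(2) v] by (simp cong: has_sum_cong)
 then show "l2_inner M h v = l2_inner M k v" using l2_has_sum_inner[OF assms(1) v] has_sum_unique by blast
qed (use assms in \<open>auto simp: l2_has_sum_def\<close>)

lemma norm_sq_orthogonal_sum:
 assumes "finite X" "!!i. i \<in> X ==> G i \<in> L2 M" "!!i j. i \<in> X ==> j \<in> X ==> i \<noteq> j ==> l2_inner M (G i) (G j) = 0"
 shows "(l2_norm M (%x. \<Sum>i\<in>X. G i x))\<^sup>2 = (\<Sum>i\<in>X. (l2_norm M (G i))\<^sup>2)"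
 using assms
proof (induction X rule: finite_induct)
 case (insert i X)
 have s: "(%x. \<Sum>i\<in>X. G i x) \<in> L2 M" using insert by (intro L2_sum) auto
 have "l2_inner M (G i) (%x. \<Sum>j\<in>X. G j x) = (\<Sum>j\<in>X. l2_inner M (G i) (G j))"
  using insert by (intro inner_sum_right) auto
 also have "\<dots> = 0" using insert by (intro sum.neutral) auto
 finally have "(l2_norm M (%x. G i x + (\<Sum>i\<in>X. G i x)))\<^sup>2 = (l2_norm M (G i))\<^sup>2 + (l2_norm M (%x. \<Sum>i\<in>X. G i x))\<^sup>2"
  using insert by (intro Pythagoras_L2 s) auto
 then show ?case using insert by simp
qed simp

text \<open>By Pythagoras the tails of the sum of functions are those of the numerical sum. The
  index set is arbitrary, so a sequence of finite sets with small tails is chosen first,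
  completeness is applied to it, and the limit is compared with all larger finite sets.\<close>

theorem orthogonal_sum_exists:
 assumes G: "!!i. i \<in> A ==> G i \<in> L2 M" and o: "!!i j. i \<in> A ==> j \<in> A ==> i \<noteq> j ==> l2_inner M (G i) (G j) = 0"
  and s: "(%i. (l2_norm M (G i))\<^sup>2) summable_on A"
 shows "\<exists>h. l2_has_sum M G A h"
proof -
 define a where "a = (%i. (l2_norm M (G i))\<^sup>2)"
 define S where "S = infsum a A"
 have S: "(sum a \<longlongrightarrow> S) (finite_subsets_at_top A)"
  using s has_sum_infsum[of a A] unfolding has_sum_def a_def S_def by simp
 have "\<exists>X. finite X \<and> X \<subseteq> A \<and> (\<forall>Y. finite Y \<and> X \<subseteq> Y \<and> Y \<subseteq> A \<longrightarrow> \<bar>sum a Y - S\<bar> < e)" if "0 < e" for e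
  using tendstoD[OF S that] unfolding eventually_finite_subsets_at_top dist_real_def .
 then have "\<exists>X. finite X \<and> X \<subseteq> A \<and> (\<forall>Y. finite Y \<and> X \<subseteq> Y \<and> Y \<subseteq> A \<longrightarrow> \<bar>sum a Y - S\<bar> < 1 / real (Suc n))" for n by simp
 then obtain X where X: "!!n. finite (X n)" "!!n. X n \<subseteq> A" "!!n Y. finite Y ==> X n \<subseteq> Y ==> Y \<subseteq> A ==> \<bar>sum a Y - S\<bar> < 1 / real (Suc n)"
  by metis
 \<comment> \<open>Unions make the chosen sets increasing, so that differences of partial sums are
   again sums over a set.\<close>
 define Z where "Z = (%n. \<Union>i\<le>n. X i)"
 have Z: "finite (Z n)" "Z n \<subseteq> A" "X n \<subseteq> Z n" "m \<le> n ==> Z m \<subseteq> Z n" for m n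
  using X(1,2) unfolding Z_def by (blast, blast, blast, fastforce)
 define u where "u = (%n x. \<Sum>i\<in>Z n. G i x)"
 have u: "u n \<in> L2 M" for n unfolding u_def using G Z by (intro L2_sum) auto
 have tail: "(l2_norm M (%x. (\<Sum>i\<in>Y. G i x) - u n x))\<^sup>2 < 2 / real (Suc n)" if Y: "finite Y" "Z n \<subseteq> Y" "Y \<subseteq> A" for Y n
 proof -
  have "(\<Sum>i\<in>Y. G i x) - u n x = (\<Sum>i\<in>Y - Z n. G i x)" for x
   unfolding u_def using Y by (simp add: sum_diff)
  then have "(l2_norm M (%x. (\<Sum>i\<in>Y. G i x) - u n x))\<^sup>2 = sum a (Y - Z n)"
   unfolding a_def using Y by (simp, intro norm_sq_orthogonal_sum G o) auto
  also have "\<dots> = sum a Y - sum a (Z n)" using Y by (intro sum_diff) auto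
  also have "\<dots> < 2 / real (Suc n)"
  proof -
   have "\<bar>sum a Y - S\<bar> < 1 / real (Suc n)" using Y Z(3)[of n] by (intro X(3)) auto
   moreover have "\<bar>sum a (Z n) - S\<bar> < 1 / real (Suc n)" using Z by (intro X(3)) auto
   moreover have "2 / real (Suc n) = 1 / real (Suc n) + 1 / real (Suc n)" by simp
   ultimately show ?thesis by linarith
  qed
  finally show ?thesis .
 qed
 have "l2_Cauchy M u"
  unfolding l2_Cauchy_def
 proof (intro allI impI)
  fix e :: real assume e: "0 < e"
  obtain N where N: "2 / (e / 2)\<^sup>2 < real N" using reals_Archimedean2 by blast
  have close: "l2_norm M (%x. u m x - u N x) < e / 2" if "N \<le> m" for m
  proof -
   have "(l2_norm M (%x. u m x - u N x))\<^sup>2 < 2 / real (Suc N)" using tail[of "Z m" N] Z that by (simp add: u_def)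
   also have "\<dots> < (e / 2)\<^sup>2"
   proof -
    have e2: "0 < (e / 2)\<^sup>2" using e by simp
    have "2 < (e / 2)\<^sup>2 * real N" using N e2 by (simp add: pos_divide_less_eq mult.commute)
    also have "\<dots> \<le> (e / 2)\<^sup>2 * real (Suc N)" using e2 by (intro mult_left_mono) auto
    finally show ?thesis by (simp add: pos_divide_less_eq)
   qed
   finally show ?thesis using e by (intro power2_less_imp_less[of _ "e / 2"]) auto
  qed
  have "l2_norm M (%x. u m x - u n x) < e" if "N \<le> m" "N \<le> n" for m n
   using norm_triangle_diff[OF u u u, of m n N] close[OF that(1)] close[OF that(2)] norm_diff_commute[of M "u N" "u n"] by simp
  then show "\<exists>N. \<forall>m\<ge>N. \<forall>n\<ge>N. l2_norm M (%x. u m x - u n x) < e" by blast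
 qed
 then obtain h where h: "h \<in> L2 M" "(%n. l2_norm M (%x. u n x - h x)) \<longlonglongrightarrow> 0"
  using l2_closed_L2 u unfolding l2_closed_def by blast
 have "((%Y. l2_norm M (%x. h x - (\<Sum>i\<in>Y. G i x))) \<longlongrightarrow> 0) (finite_subsets_at_top A)"
 proof (rule tendstoI)
  fix e :: real assume e: "0 < e"
  have "(%n. l2_norm M (%x. u n x - h x) + sqrt (2 / real (Suc n))) \<longlonglongrightarrow> 0 + sqrt (2 * 0)"
   unfolding divide_inverse by (intro tendsto_intros h(2) LIMSEQ_inverse_real_of_nat)
  then have "\<forall>\<^sub>F n in sequentially. l2_norm M (%x. u n x - h x) + sqrt (2 / real (Suc n)) < e"
   using e by (intro order_tendstoD(2)) auto
  then obtain n where n: "l2_norm M (%x. u n x - h x) + sqrt (2 / real (Suc n)) < e" by (auto simp: eventually_sequentially)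
  have "dist (l2_norm M (%x. h x - (\<Sum>i\<in>Y. G i x))) 0 < e" if Y: "finite Y \<and> Z n \<subseteq> Y \<and> Y \<subseteq> A" for Y
  proof -
   have gs: "(%x. \<Sum>i\<in>Y. G i x) \<in> L2 M" using G Y by (intro L2_sum) auto
   have "l2_norm M (%x. (\<Sum>i\<in>Y. G i x) - u n x) \<le> sqrt (2 / real (Suc n))"
    using tail[of Y n] Y by (intro real_le_rsqrt) auto
   then have "l2_norm M (%x. (\<Sum>i\<in>Y. G i x) - h x) < e" using norm_triangle_diff[OF gs u h(1), of n] n by linarith
   then show ?thesis by (simp add: norm_diff_commute[of M h])
  qed
  then show "\<forall>\<^sub>F Y in finite_subsets_at_top A. dist (l2_norm M (%x. h x - (\<Sum>i\<in>Y. G i x))) 0 < e"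
   unfolding eventually_finite_subsets_at_top using Z(1,2) by (intro exI[of _ "Z n"]) auto
 qed
 then show ?thesis using G h(1) by (auto simp: l2_has_sum_def)
qed

lemma norm_sum_le:
 "(!!i. i \<in> X ==> f i \<in> L2 M) ==> l2_norm M (%x. \<Sum>i\<in>X. f i x) \<le> (\<Sum>i\<in>X. l2_norm M (f i))"
proof (induction X rule: infinite_finite_induct)
 case (insert i X)
 then have "l2_norm M (%x. f i x + (\<Sum>i\<in>X. f i x)) \<le> l2_norm M (f i) + l2_norm M (%x. \<Sum>i\<in>X. f i x)"
  by (intro norm_triangle_L2 L2_sum) auto
 then show ?case using insert by force
qed auto

section \<open>Orthogonal bases\<close>

text \<open>V is written exactly as the density clause of \<open>orthogonal_basis\<close>; being a
  closed subspace, it admits projections, and this is used to show that a maximal orthogonal system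
  is dense.\<close>

lemma span_closure_closed:
 fixes E :: "('a \<Rightarrow> complex) set"
 assumes E: "E \<subseteq> L2 M"
 defines "V \<equiv> {f \<in> L2 M. \<forall>\<epsilon>>0. \<exists>F c. finite F \<and> F \<subseteq> E \<and> l2_norm M (%x. f x - (\<Sum>e\<in>F. c e * e x)) < \<epsilon>}"
 shows "l2_subspace M V" "l2_closed M V" "E \<subseteq> V"
proof -
 have sL: "(%x. \<Sum>e\<in>F. c e * e x) \<in> L2 M" if "F \<subseteq> E" for F c
  using that E by (intro L2_sum L2_cmult) auto
 have VD: "\<exists>F c. finite F \<and> F \<subseteq> E \<and> l2_norm M (%x. f x - (\<Sum>e\<in>F. c e * e x)) < \<epsilon>" if "f \<in> V" "0 < \<epsilon>" for f \<epsilon>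
  using that by (simp add: V_def)
 show "l2_subspace M V"
  unfolding l2_subspace_def
 proof (intro conjI ballI allI)
  show "V \<subseteq> L2 M" by (auto simp: V_def)
  have "\<exists>F c. finite F \<and> F \<subseteq> E \<and> l2_norm M (%x. 0 - (\<Sum>e\<in>F. c e * e x)) < \<epsilon>" if "0 < \<epsilon>" for \<epsilon>
   by (rule exI[of _ "{}"]) (use that in simp)
  then have "(%_. 0) \<in> V" unfolding V_def by simp
  then show "V \<noteq> {}" by auto
  fix f g c d assume f: "f \<in> V" and g: "g \<in> V"
  show "(%x. c * f x + d * g x) \<in> V"
   unfolding V_def
  proof (intro CollectI conjI allI impI)
   show L: "(%x. c * f x + d * g x) \<in> L2 M" using f g by (intro L2_lincomb) (auto simp: V_def)
   fix \<epsilon> :: real assume e: "0 < \<epsilon>"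
   define K where "K = cmod c + cmod d + 1"
   have K: "0 < K" by (simp add: K_def add_nonneg_pos)
   have "0 < \<epsilon> / K" using e K by simp
   then obtain F a where F: "finite F" "F \<subseteq> E" "l2_norm M (%x. f x - (\<Sum>e\<in>F. a e * e x)) < \<epsilon> / K"
    using VD[OF f \<open>0 < \<epsilon> / K\<close>] by (elim exE conjE)
   obtain G b where G: "finite G" "G \<subseteq> E" "l2_norm M (%x. g x - (\<Sum>e\<in>G. b e * e x)) < \<epsilon> / K"
    using VD[OF g \<open>0 < \<epsilon> / K\<close>] by (elim exE conjE)
   \<comment> \<open>Both coefficient families are extended by 0 to the union, as F and G may
     overlap.\<close>
   define a' where "a' = (%e. c * (if e \<in> F then a e else 0) + d * (if e \<in> G then b e else 0))"
   have "(\<Sum>e\<in>F \<union> G. a' e * e x) = c * (\<Sum>e\<in>F. a e * e x) + d * (\<Sum>e\<in>G. b e * e x)" for x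
   proof -
    have "(\<Sum>e\<in>F. a e * e x) = (\<Sum>e\<in>F \<union> G. (if e \<in> F then a e else 0) * e x)"
     by (rule sum.mono_neutral_cong_left) (use F G in auto)
    moreover have "(\<Sum>e\<in>G. b e * e x) = (\<Sum>e\<in>F \<union> G. (if e \<in> G then b e else 0) * e x)"
     by (rule sum.mono_neutral_cong_left) (use F G in auto)
    ultimately show ?thesis by (simp add: a'_def sum_distrib_left sum.distrib distrib_right mult.assoc)
   qed
   then have "l2_norm M (%x. (c * f x + d * g x) - (\<Sum>e\<in>F \<union> G. a' e * e x)) =
     l2_norm M (%x. c * (f x - (\<Sum>e\<in>F. a e * e x)) + d * (g x - (\<Sum>e\<in>G. b e * e x)))"
    by (simp add: algebra_simps)
   also have "\<dots> \<le> cmod c * l2_norm M (%x. f x - (\<Sum>e\<in>F. a e * e x)) + cmod d * l2_norm M (%x. g x - (\<Sum>e\<in>G. b e * e x))"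
    unfolding norm_cmult[symmetric] using f g F G by (intro norm_triangle_L2 L2_cmult L2_diff sL) (auto simp: V_def)
   also have "\<dots> \<le> cmod c * (\<epsilon> / K) + cmod d * (\<epsilon> / K)" using F G by (intro add_mono mult_left_mono) auto
   also have "\<dots> < K * (\<epsilon> / K)" using \<open>0 < \<epsilon> / K\<close> unfolding K_def by (simp only: distrib_right)
   also have "\<dots> = \<epsilon>" using K by simp
   finally show "\<exists>F c'. finite F \<and> F \<subseteq> E \<and> l2_norm M (%x. (c * f x + d * g x) - (\<Sum>e\<in>F. c' e * e x)) < \<epsilon>"
    using F G by (intro exI[of _ "F \<union> G"] exI[of _ a']) auto
  qed
 qed
 show "l2_closed M V"
  unfolding l2_closed_def
 proof (intro allI impI)
  fix u assume u: "\<forall>n. u n \<in> V" "l2_Cauchy M u"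
  have uL: "u n \<in> L2 M" for n using u by (auto simp: V_def)
  have "\<exists>g\<in>L2 M. (%n. l2_norm M (%x. u n x - g x)) \<longlonglongrightarrow> 0"
   by (rule l2_closed_L2[of M, unfolded l2_closed_def, rule_format, of u]) (use uL u(2) in auto)
  then obtain h where h: "h \<in> L2 M" "(%n. l2_norm M (%x. u n x - h x)) \<longlonglongrightarrow> 0" by (elim bexE)
  have "h \<in> V"
   unfolding V_def
  proof (intro CollectI conjI allI impI h(1))
   fix \<epsilon> :: real assume e: "0 < \<epsilon>"
   obtain n where n: "l2_norm M (%x. u n x - h x) < \<epsilon> / 2"
    using order_tendstoD(2)[OF h(2), of "\<epsilon> / 2"] e by (auto simp: eventually_sequentially)
   have "0 < \<epsilon> / 2" using e by simp
   then obtain F a where F: "finite F" "F \<subseteq> E" "l2_norm M (%x. u n x - (\<Sum>e\<in>F. a e * e x)) < \<epsilon> / 2"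
    using VD[OF spec[OF u(1), of n] \<open>0 < \<epsilon> / 2\<close>] by (elim exE conjE)
   have "l2_norm M (%x. h x - (\<Sum>e\<in>F. a e * e x)) < \<epsilon>"
    using norm_triangle_diff[OF h(1) uL[of n] sL[OF F(2), of a]] n F(3) norm_diff_commute[of M h "u n"] by simp
   then show "\<exists>F c'. finite F \<and> F \<subseteq> E \<and> l2_norm M (%x. h x - (\<Sum>e\<in>F. c' e * e x)) < \<epsilon>" using F by blast
  qed
  then show "\<exists>g\<in>V. (%n. l2_norm M (%x. u n x - g x)) \<longlonglongrightarrow> 0" using h by blast
 qed
 show "E \<subseteq> V"
 proof
  fix e assume "e \<in> E"
  have "\<exists>F c. finite F \<and> F \<subseteq> E \<and> l2_norm M (%x. e x - (\<Sum>e\<in>F. c e * e x)) < \<epsilon>" if "0 < \<epsilon>" for \<epsilon>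
   by (rule exI[of _ "{e}"], rule exI[of _ "%_. 1"]) (use that \<open>e \<in> E\<close> in simp)
  then show "e \<in> V" unfolding V_def using E \<open>e \<in> E\<close> by blast
 qed
qed

definition orthogonal_system :: "'a measure \<Rightarrow> ('a \<Rightarrow> complex) set \<Rightarrow> bool" where
 "orthogonal_system M E \<longleftrightarrow> E \<subseteq> L2 M \<and> (\<forall>e\<in>E. l2_norm M e \<noteq> 0) \<and> pairwise (%e e'. l2_inner M e e' = 0) E"

text \<open>Zorn's lemma: if a maximal system did not span, the residual of a projection onto its
  closed span could be adjoined. It supplies the part of an eigenbasis that lies in the kernel,
  which is not described explicitly.\<close>

theorem orthogonal_basis_extend:
 assumes "orthogonal_system M E0"
 shows "\<exists>E. E0 \<subseteq> E \<and> orthogonal_basis M E"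
proof -
 define Q where "Q = {E. E0 \<subseteq> E \<and> orthogonal_system M E}"
 have "\<exists>E\<in>Q. \<forall>X\<in>Q. E \<subseteq> X \<longrightarrow> X = E"
 proof (rule subset_Zorn_nonempty)
  show "Q \<noteq> {}" using assms by (auto simp: Q_def)
  fix C assume C: "C \<noteq> {}" "subset.chain Q C"
  then have CQ: "C \<subseteq> Q" and ch: "!!X Y. X \<in> C ==> Y \<in> C ==> X \<subseteq> Y \<or> Y \<subseteq> X" by (auto simp: subset_chain_def)
  have "pairwise (%e e'. l2_inner M e e' = 0) (\<Union>C)"
  proof (rule pairwiseI)
   fix x y assume "x \<in> \<Union>C" "y \<in> \<Union>C" and ne: "x \<noteq> y"
   then obtain X Y where XY: "X \<in> C" "Y \<in> C" "x \<in> X" "y \<in> Y" by auto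
   obtain W where W: "W \<in> C" "x \<in> W" "y \<in> W" using ch[OF XY(1,2)] XY by blast
   then have "pairwise (%e e'. l2_inner M e e' = 0) W" using CQ by (auto simp: Q_def orthogonal_system_def)
   then show "l2_inner M x y = 0" using W ne by (auto simp: pairwise_def)
  qed
  then show "\<Union>C \<in> Q" using C(1) CQ by (fastforce simp: Q_def orthogonal_system_def)
 qed
 then obtain E where E: "E0 \<subseteq> E" "orthogonal_system M E" and max: "!!X. E0 \<subseteq> X ==> orthogonal_system M X ==> E \<subseteq> X ==> X = E"
  by (auto simp: Q_def)
 have EL: "E \<subseteq> L2 M" using E by (auto simp: orthogonal_system_def)
 define V where "V = {f \<in> L2 M. \<forall>\<epsilon>>0. \<exists>F c. finite F \<and> F \<subseteq> E \<and> l2_norm M (%x. f x - (\<Sum>e\<in>F. c e * e x)) < \<epsilon>}"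
 note sc = span_closure_closed[OF EL, folded V_def]
 have "f \<in> V" if f: "f \<in> L2 M" for f
 proof -
  obtain g where g: "g \<in> V" "\<forall>v\<in>V. l2_inner M (%x. f x - g x) v = 0" using projection_L2[OF sc(1,2) f] by blast
  have gL: "g \<in> L2 M" using g by (auto simp: V_def)
  define h where "h = (%x. f x - g x)"
  have h: "h \<in> L2 M" "!!e. e \<in> E ==> l2_inner M h e = 0" using g sc(3) L2_diff[OF f gL] by (auto simp: h_def)
  have "l2_norm M h = 0"
  proof (rule ccontr)
   assume nz: "l2_norm M h \<noteq> 0"
   have "l2_inner M e h = 0" if "e \<in> E" for e using h(2)[OF that] by (subst inner_commute) simp
   then have "orthogonal_system M (insert h E)"
    using E(2) h nz by (auto simp: orthogonal_system_def pairwise_insert)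
   then have "h \<in> E" using max[of "insert h E"] E(1) by auto
   then have "l2_inner M h h = 0" using h by simp
   then show False using nz by (simp add: inner_self)
  qed
  show "f \<in> V"
   unfolding V_def
  proof (intro CollectI conjI f allI impI)
   fix \<epsilon> :: real assume "0 < \<epsilon>"
   then obtain F c where F: "finite F" "F \<subseteq> E" "l2_norm M (%x. g x - (\<Sum>e\<in>F. c e * e x)) < \<epsilon>"
    using g(1) unfolding V_def by blast
   have "(%x. \<Sum>e\<in>F. c e * e x) \<in> L2 M" using F EL by (intro L2_sum L2_cmult) auto
   from norm_triangle_diff[OF f gL this] have "l2_norm M (%x. f x - (\<Sum>e\<in>F. c e * e x)) < \<epsilon>"
    using F(3) \<open>l2_norm M h = 0\<close> by (simp add: h_def)
   then show "\<exists>F c. finite F \<and> F \<subseteq> E \<and> l2_norm M (%x. f x - (\<Sum>e\<in>F. c e * e x)) < \<epsilon>" using F by blast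
  qed
 qed
 then have "orthogonal_basis M E" using E unfolding orthogonal_basis_def orthogonal_system_def V_def by blast
 then show ?thesis using E by blast
qed

section \<open>Operators that are diagonal between two orthonormal systems\<close>

definition orthonormal_on :: "'a measure \<Rightarrow> ('i \<Rightarrow> 'a \<Rightarrow> complex) \<Rightarrow> 'i set \<Rightarrow> bool" where
 "orthonormal_on M e A \<longleftrightarrow> (\<forall>i\<in>A. e i \<in> L2 M) \<and> (\<forall>i\<in>A. \<forall>j\<in>A. l2_inner M (e i) (e j) = (if i = j then 1 else 0))"

lemma orthonormal_onD:
 assumes "orthonormal_on M e A"
 shows "i \<in> A ==> e i \<in> L2 M" "i \<in> A ==> j \<in> A ==> l2_inner M (e i) (e j) = (if i = j then 1 else 0)"
  "i \<in> A ==> l2_norm M (e i) = 1"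
proof -
 show "l2_norm M (e i) = 1" if "i \<in> A"
 proof -
  have "l2_inner M (e i) (e i) = 1" using assms that by (auto simp: orthonormal_on_def)
  then have "(l2_norm M (e i))\<^sup>2 = 1" by (simp add: inner_self flip: of_real_power)
  then show ?thesis using norm_nonneg[of M "e i"] by (simp add: power2_eq_1_iff)
 qed
qed (use assms in \<open>auto simp: orthonormal_on_def\<close>)

lemma norm_sq_orthonormal_sum:
 assumes "orthonormal_on M e A" "finite X" "X \<subseteq> A"
 shows "(l2_norm M (%x. \<Sum>i\<in>X. c i * e i x))\<^sup>2 = (\<Sum>i\<in>X. (cmod (c i))\<^sup>2)"
proof -
 note o = orthonormal_onD[OF assms(1)]
 have "(l2_norm M (%x. \<Sum>i\<in>X. c i * e i x))\<^sup>2 = (\<Sum>i\<in>X. (l2_norm M (%x. c i * e i x))\<^sup>2)"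
  using assms(2,3) o by (intro norm_sq_orthogonal_sum L2_cmult) (auto simp: inner_cmult_left inner_cmult_right subset_iff)
 also have "\<dots> = (\<Sum>i\<in>X. (cmod (c i))\<^sup>2)" using assms(3) o by (intro sum.cong) (auto simp: norm_cmult)
 finally show ?thesis .
qed

lemma Bessel_finite:
 assumes e: "orthonormal_on M e A" and X: "finite X" "X \<subseteq> A" and f: "f \<in> L2 M"
 shows "(\<Sum>i\<in>X. (cmod (l2_inner M f (e i)))\<^sup>2) \<le> (l2_norm M f)\<^sup>2"
proof -
 note o = orthonormal_onD[OF e]
 define g where "g = (%x. \<Sum>i\<in>X. l2_inner M f (e i) * e i x)"
 have g: "g \<in> L2 M" unfolding g_def using o X by (intro L2_sum L2_cmult) auto
 have "l2_inner M g (e j) = l2_inner M f (e j)" if "j \<in> X" for j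
 proof -
  have "l2_inner M g (e j) = (\<Sum>i\<in>X. l2_inner M f (e i) * l2_inner M (e i) (e j))"
   unfolding g_def using o X that by (subst inner_sum_left) (auto intro!: L2_cmult simp: inner_cmult_left)
  also have "\<dots> = (\<Sum>i\<in>X. if i = j then l2_inner M f (e i) else 0)"
   using o X that by (intro sum.cong) (auto simp: subset_iff)
  finally show ?thesis using X that by simp
 qed
 then have z: "l2_inner M (%x. f x - g x) (e j) = 0" if "j \<in> X" for j
  using inner_diff_left[OF f g, of "e j"] o X that by auto
 have fg: "(%x. f x - g x) \<in> L2 M" by (intro L2_diff f g)
 have "l2_inner M (%x. f x - g x) g = (\<Sum>i\<in>X. cnj (l2_inner M f (e i)) * l2_inner M (%x. f x - g x) (e i))"
  using inner_sum_right[OF _ fg, of X "%i x. l2_inner M f (e i) * e i x"] o X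
  by (simp add: L2_cmult inner_cmult_right subset_iff flip: g_def)
 also have "\<dots> = 0" using z by (intro sum.neutral) auto
 finally have "(l2_norm M (%x. (f x - g x) + g x))\<^sup>2 = (l2_norm M (%x. f x - g x))\<^sup>2 + (l2_norm M g)\<^sup>2"
  by (intro Pythagoras_L2 fg g)
 then have "(l2_norm M g)\<^sup>2 \<le> (l2_norm M f)\<^sup>2" by simp
 then show ?thesis unfolding g_def using norm_sq_orthonormal_sum[OF e X] by simp
qed

lemma l2_has_sum_lincomb:
 assumes F: "l2_has_sum M F A h" and G: "l2_has_sum M G A k"
 shows "l2_has_sum M (%i x. c * F i x + d * G i x) A (%x. c * h x + d * k x)"
 unfolding l2_has_sum_def
proof (intro conjI ballI)
 show "(%x. c * F i x + d * G i x) \<in> L2 M" if "i \<in> A" for i using F G that by (intro L2_lincomb) (auto simp: l2_has_sum_def)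
 show "(%x. c * h x + d * k x) \<in> L2 M" using F G by (intro L2_lincomb) (auto simp: l2_has_sum_def)
 show "((%X. l2_norm M (%x. c * h x + d * k x - (\<Sum>i\<in>X. c * F i x + d * G i x))) \<longlongrightarrow> 0) (finite_subsets_at_top A)"
 proof (rule tendsto_sandwich[OF _ _ tendsto_const])
  show "((%X. cmod c * l2_norm M (%x. h x - (\<Sum>i\<in>X. F i x)) + cmod d * l2_norm M (%x. k x - (\<Sum>i\<in>X. G i x))) \<longlongrightarrow> 0) (finite_subsets_at_top A)"
   using F G unfolding l2_has_sum_def by (intro tendsto_add_zero tendsto_mult_right_zero) auto
  show "\<forall>\<^sub>F X in finite_subsets_at_top A. l2_norm M (%x. c * h x + d * k x - (\<Sum>i\<in>X. c * F i x + d * G i x)) \<le>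
    cmod c * l2_norm M (%x. h x - (\<Sum>i\<in>X. F i x)) + cmod d * l2_norm M (%x. k x - (\<Sum>i\<in>X. G i x))"
   unfolding eventually_finite_subsets_at_top
  proof (rule exI[of _ "{}"], intro conjI allI impI)
   fix X assume X: "finite X \<and> {} \<subseteq> X \<and> X \<subseteq> A"
   have "l2_norm M (%x. c * h x + d * k x - (\<Sum>i\<in>X. c * F i x + d * G i x)) =
    l2_norm M (%x. c * (h x - (\<Sum>i\<in>X. F i x)) + d * (k x - (\<Sum>i\<in>X. G i x)))"
    by (simp add: sum.distrib sum_distrib_left algebra_simps)
   also have "\<dots> \<le> cmod c * l2_norm M (%x. h x - (\<Sum>i\<in>X. F i x)) + cmod d * l2_norm M (%x. k x - (\<Sum>i\<in>X. G i x))"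
    unfolding norm_cmult[symmetric] using X F G by (intro norm_triangle_L2 L2_cmult L2_diff L2_sum) (auto simp: l2_has_sum_def)
   finally show "l2_norm M (%x. c * h x + d * k x - (\<Sum>i\<in>X. c * F i x + d * G i x)) \<le>
    cmod c * l2_norm M (%x. h x - (\<Sum>i\<in>X. F i x)) + cmod d * l2_norm M (%x. k x - (\<Sum>i\<in>X. G i x))" .
  qed simp_all
 qed simp_all
qed

lemma l2_has_sum_finite_support:
 assumes "finite B" "B \<subseteq> A" "!!i. i \<in> A ==> F i \<in> L2 M" "!!i x. i \<in> A - B ==> F i x = 0"
 shows "l2_has_sum M F A (%x. \<Sum>i\<in>B. F i x)"
 unfolding l2_has_sum_def
proof (intro conjI ballI)
 show "(%x. \<Sum>i\<in>B. F i x) \<in> L2 M" using assms by (intro L2_sum) auto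
 show "((%X. l2_norm M (%x. (\<Sum>i\<in>B. F i x) - (\<Sum>i\<in>X. F i x))) \<longlongrightarrow> 0) (finite_subsets_at_top A)"
 proof (rule tendsto_eventually)
  show "\<forall>\<^sub>F X in finite_subsets_at_top A. l2_norm M (%x. (\<Sum>i\<in>B. F i x) - (\<Sum>i\<in>X. F i x)) = 0"
   unfolding eventually_finite_subsets_at_top
  proof (rule exI[of _ B], intro conjI allI impI assms)
   fix X assume X: "finite X \<and> B \<subseteq> X \<and> X \<subseteq> A"
   have "(\<Sum>i\<in>X. F i x) = (\<Sum>i\<in>B. F i x)" for x using X assms by (intro sum.mono_neutral_right) auto
   then show "l2_norm M (%x. (\<Sum>i\<in>B. F i x) - (\<Sum>i\<in>X. F i x)) = 0" by simp
  qed
 qed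
qed (use assms in auto)

lemma l2_has_sum_coeff:
 assumes v: "orthonormal_on M v A" and h: "l2_has_sum M (%i x. c i * v i x) A h" and k: "k \<in> A"
 shows "l2_inner M h (v k) = c k"
proof -
 have "((%i. l2_inner M (%x. c i * v i x) (v k)) has_sum l2_inner M h (v k)) A"
  by (rule l2_has_sum_inner[OF h]) (use v k in \<open>auto simp: orthonormal_on_def\<close>)
 moreover have "((%i. l2_inner M (%x. c i * v i x) (v k)) has_sum c k) A"
 proof (rule has_sum_finite_neutralI[of "{k}"])
  show "c k = (\<Sum>i\<in>{k}. l2_inner M (%x. c i * v i x) (v k))"
   using orthonormal_onD(2)[OF v k k] by (simp add: inner_cmult_left)
 qed (use orthonormal_onD(2)[OF v] k in \<open>auto simp: inner_cmult_left\<close>)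
 ultimately show ?thesis by (rule has_sum_unique)
qed

text \<open>The sum is determined only up to equality almost everywhere, hence the choice of a
  representative; linearity then holds almost everywhere, as \<open>bounded_op\<close> asks.\<close>

definition diag_op :: "'a measure \<Rightarrow> 'i set \<Rightarrow> ('i \<Rightarrow> complex) \<Rightarrow> ('i \<Rightarrow> 'a \<Rightarrow> complex) \<Rightarrow> ('i \<Rightarrow> 'a \<Rightarrow> complex) \<Rightarrow> 'a l2op" where
 "diag_op M A t e v f = (SOME h. l2_has_sum M (%k x. t k * l2_inner M f (e k) * v k x) A h)"

lemma diag_op_has_sum:
 assumes e: "orthonormal_on M e A" and v: "orthonormal_on M v A" and t: "\<forall>k\<in>A. cmod (t k) \<le> C" and f: "f \<in> L2 M"
 shows "l2_has_sum M (%k x. t k * l2_inner M f (e k) * v k x) A (diag_op M A t e v f)"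
proof -
 have "\<exists>h. l2_has_sum M (%k x. t k * l2_inner M f (e k) * v k x) A h"
proof (rule orthogonal_sum_exists)
 show "(%x. t i * l2_inner M f (e i) * v i x) \<in> L2 M" if "i \<in> A" for i using v that by (intro L2_cmult) (auto simp: orthonormal_on_def)
 show "l2_inner M (%x. t i * l2_inner M f (e i) * v i x) (%x. t j * l2_inner M f (e j) * v j x) = 0" if "i \<in> A" "j \<in> A" "i \<noteq> j" for i j
  using orthonormal_onD(2)[OF v] that by (simp add: inner_cmult_left inner_cmult_right)
 show "(%i. (l2_norm M (%x. t i * l2_inner M f (e i) * v i x))\<^sup>2) summable_on A"
 proof (rule nonneg_bdd_above_summable_on)
  show "bdd_above (sum (%i. (l2_norm M (%x. t i * l2_inner M f (e i) * v i x))\<^sup>2) ` {F. F \<subseteq> A \<and> finite F})"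
  proof (rule bdd_aboveI2)
   fix X assume X: "X \<in> {F. F \<subseteq> A \<and> finite F}"
   have "(\<Sum>i\<in>X. (l2_norm M (%x. t i * l2_inner M f (e i) * v i x))\<^sup>2) \<le> (\<Sum>i\<in>X. C\<^sup>2 * (cmod (l2_inner M f (e i)))\<^sup>2)"
   proof (rule sum_mono)
    fix i assume i: "i \<in> X"
    then have "(cmod (t i))\<^sup>2 \<le> C\<^sup>2" using X t by (intro power_mono) auto
    then show "(l2_norm M (%x. t i * l2_inner M f (e i) * v i x))\<^sup>2 \<le> C\<^sup>2 * (cmod (l2_inner M f (e i)))\<^sup>2"
    proof -
     have "l2_norm M (v i) = 1" using i X by (intro orthonormal_onD(3)[OF v]) auto
     then show ?thesis using \<open>(cmod (t i))\<^sup>2 \<le> C\<^sup>2\<close> by (simp add: norm_cmult norm_mult power_mult_distrib mult_right_mono)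
    qed
   qed
   also have "\<dots> \<le> C\<^sup>2 * (l2_norm M f)\<^sup>2"
    unfolding sum_distrib_left[symmetric] using X by (intro mult_left_mono Bessel_finite[OF e _ _ f]) auto
   finally show "(\<Sum>i\<in>X. (l2_norm M (%x. t i * l2_inner M f (e i) * v i x))\<^sup>2) \<le> C\<^sup>2 * (l2_norm M f)\<^sup>2" .
  qed
 qed simp
qed
 then show ?thesis unfolding diag_op_def by (rule someI_ex)
qed

text \<open>On finite partial sums this is Bessel's inequality; an arbitrary loss r covers the
  passage to the limit. It speaks of any sum h of the series, so it applies also to operators that
  are not given as \<open>diag_op\<close>, such as the product of L with an adjoint.\<close>

lemma diag_op_norm:
 assumes e: "orthonormal_on M e A" and v: "orthonormal_on M v A" and t: "\<forall>k\<in>A. cmod (t k) \<le> C" and f: "f \<in> L2 M"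
  and C: "0 \<le> C" and h: "l2_has_sum M (%k x. t k * l2_inner M f (e k) * v k x) A h"
 shows "l2_norm M h \<le> C * l2_norm M f"
proof (rule field_le_epsilon)
 fix r :: real assume r: "0 < r"
 have "((%X. l2_norm M (%x. h x - (\<Sum>k\<in>X. t k * l2_inner M f (e k) * v k x))) \<longlongrightarrow> 0) (finite_subsets_at_top A)"
  using h by (simp add: l2_has_sum_def)
 then have "\<forall>\<^sub>F X in finite_subsets_at_top A. l2_norm M (%x. h x - (\<Sum>k\<in>X. t k * l2_inner M f (e k) * v k x)) < r"
  using r by (rule order_tendstoD(2))
 then obtain X where X: "finite X" "X \<subseteq> A"
   "\<forall>Y. finite Y \<and> X \<subseteq> Y \<and> Y \<subseteq> A \<longrightarrow> l2_norm M (%x. h x - (\<Sum>k\<in>Y. t k * l2_inner M f (e k) * v k x)) < r"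
  unfolding eventually_finite_subsets_at_top by (elim exE conjE)
 have Xr: "l2_norm M (%x. h x - (\<Sum>k\<in>X. t k * l2_inner M f (e k) * v k x)) < r"
  using X(1,2) by (intro X(3)[rule_format]) simp
 define g where "g = (%x. \<Sum>k\<in>X. t k * l2_inner M f (e k) * v k x)"
 have g: "g \<in> L2 M" unfolding g_def using X orthonormal_onD(1)[OF v] by (intro L2_sum L2_cmult) auto
 have "(l2_norm M g)\<^sup>2 = (\<Sum>k\<in>X. (cmod (t k * l2_inner M f (e k)))\<^sup>2)"
  unfolding g_def by (rule norm_sq_orthonormal_sum[OF v X(1,2)])
 also have "\<dots> \<le> (\<Sum>k\<in>X. C\<^sup>2 * (cmod (l2_inner M f (e k)))\<^sup>2)"
  unfolding norm_mult power_mult_distrib using X t by (intro sum_mono mult_right_mono power_mono) auto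
 also have "\<dots> \<le> C\<^sup>2 * (l2_norm M f)\<^sup>2"
  unfolding sum_distrib_left[symmetric] using X by (intro mult_left_mono Bessel_finite[OF e _ _ f]) auto
 finally have "(l2_norm M g)\<^sup>2 \<le> (C * l2_norm M f)\<^sup>2" by (simp add: power_mult_distrib)
 then have "l2_norm M g \<le> C * l2_norm M f" by (rule power2_le_imp_le) (use C in auto)
 moreover have "l2_norm M (%x. (h x - g x) + g x) \<le> l2_norm M (%x. h x - g x) + l2_norm M g"
  using h g by (intro norm_triangle_L2 L2_diff) (auto simp: l2_has_sum_def)
 moreover have "(%x. (h x - g x) + g x) = h" by simp
 moreover have "l2_norm M (%x. h x - g x) < r" using Xr unfolding g_def .
 ultimately show "l2_norm M h \<le> C * l2_norm M f + r" by (simp only:)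
qed

lemma diag_op_bounded:
 assumes e: "orthonormal_on M e A" and v: "orthonormal_on M v A" and t: "\<forall>k\<in>A. cmod (t k) \<le> C" and C: "0 \<le> C"
 shows "bounded_op M (diag_op M A t e v)"
 unfolding bounded_op_def
proof (intro conjI ballI allI)
 show "diag_op M A t e v f \<in> L2 M" if "f \<in> L2 M" for f
  using diag_op_has_sum[OF e v t that] by (auto simp: l2_has_sum_def)
 show "\<exists>C. \<forall>f\<in>L2 M. l2_norm M (diag_op M A t e v f) \<le> C * l2_norm M f"
  by (rule exI[of _ C], intro ballI, rule diag_op_norm[OF e v t _ C]) (auto intro: diag_op_has_sum[OF e v t])
 fix f g c d assume f: "f \<in> L2 M" and g: "g \<in> L2 M"
 have fg: "(%y. c * f y + d * g y) \<in> L2 M" by (intro L2_lincomb f g)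
 show "AE x in M. diag_op M A t e v (%y. c * f y + d * g y) x = c * diag_op M A t e v f x + d * diag_op M A t e v g x"
 proof (rule l2_has_sum_unique[OF diag_op_has_sum[OF e v t fg] l2_has_sum_lincomb[OF diag_op_has_sum[OF e v t f] diag_op_has_sum[OF e v t g]]])
  fix i assume i: "i \<in> A"
  show "AE x in M. t i * l2_inner M (%y. c * f y + d * g y) (e i) * v i x =
    c * (t i * l2_inner M f (e i) * v i x) + d * (t i * l2_inner M g (e i) * v i x)"
   using inner_lincomb_left[OF f g orthonormal_onD(1)[OF e i], of c d] by (simp add: algebra_simps)
 qed
qed

text \<open>Both inner products are the same numerical sum over k, read once through the first
  system and once, after conjugation, through the second.\<close>

theorem diag_op_adjoint:
 assumes e: "orthonormal_on M e A" and v: "orthonormal_on M v A" and t: "\<forall>k\<in>A. cmod (t k) \<le> C" and C: "0 \<le> C"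
 shows "is_adjoint M (diag_op M A t e v) (diag_op M A (%k. cnj (t k)) v e)"
 unfolding is_adjoint_def
proof (intro conjI ballI)
 have t': "\<forall>k\<in>A. cmod (cnj (t k)) \<le> C" using t by simp
 show "bounded_op M (diag_op M A (%k. cnj (t k)) v e)" by (rule diag_op_bounded[OF v e t' C])
 fix f g assume f: "f \<in> L2 M" and g: "g \<in> L2 M"
 have 1: "((%k. l2_inner M (%x. t k * l2_inner M f (e k) * v k x) g) has_sum l2_inner M (diag_op M A t e v f) g) A"
  by (rule l2_has_sum_inner[OF diag_op_has_sum[OF e v t f] g])
 have "((%k. l2_inner M (%x. cnj (t k) * l2_inner M g (v k) * e k x) f) has_sum l2_inner M (diag_op M A (%k. cnj (t k)) v e g) f) A"
  by (rule l2_has_sum_inner[OF diag_op_has_sum[OF v e t' g] f])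
 then have "((%k. cnj (l2_inner M (%x. cnj (t k) * l2_inner M g (v k) * e k x) f)) has_sum cnj (l2_inner M (diag_op M A (%k. cnj (t k)) v e g) f)) A"
  by (simp only: has_sum_cnj_iff)
 moreover have "cnj (l2_inner M (%x. cnj (t k) * l2_inner M g (v k) * e k x) f) = l2_inner M (%x. t k * l2_inner M f (e k) * v k x) g" for k
  unfolding inner_cmult_left using inner_commute[of M f "e k"] inner_commute[of M g "v k"] by simp
 moreover have "cnj (l2_inner M (diag_op M A (%k. cnj (t k)) v e g) f) = l2_inner M f (diag_op M A (%k. cnj (t k)) v e g)"
  by (rule inner_commute[symmetric])
 ultimately have "((%k. l2_inner M (%x. t k * l2_inner M f (e k) * v k x) g) has_sum l2_inner M f (diag_op M A (%k. cnj (t k)) v e g)) A"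
  by simp
 then show "l2_inner M (diag_op M A t e v f) g = l2_inner M f (diag_op M A (%k. cnj (t k)) v e g)"
  using 1 has_sum_unique by blast
qed

section \<open>Compact operators and the essential spectrum of a diagonal operator\<close>

lemma bounded_op_finite_rank:
 assumes B: "finite B" and ev: "!!k. k \<in> B ==> e k \<in> L2 M" "!!k. k \<in> B ==> v k \<in> L2 M"
  and U: "!!f. f \<in> L2 M ==> U f \<in> L2 M" "!!f. f \<in> L2 M ==> AE x in M. U f x = (\<Sum>k\<in>B. a k * l2_inner M f (e k) * v k x)"
 shows "bounded_op M U"
 unfolding bounded_op_def
proof (intro conjI ballI allI U)
 have sL: "(%x. \<Sum>k\<in>B. c k * v k x) \<in> L2 M" for c using ev by (intro L2_sum L2_cmult) auto
 show "\<exists>C. \<forall>f\<in>L2 M. l2_norm M (U f) \<le> C * l2_norm M f"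
 proof (rule exI[of _ "\<Sum>k\<in>B. cmod (a k) * l2_norm M (e k) * l2_norm M (v k)"], intro ballI)
  fix f assume f: "f \<in> L2 M"
  have "l2_norm M (U f) = l2_norm M (%x. \<Sum>k\<in>B. (a k * l2_inner M f (e k)) * v k x)"
   using U(1)[OF f] sL[of "%k. a k * l2_inner M f (e k)"] by (intro norm_cong_AE U(2)[OF f]) (auto simp: L2_iff)
  also have "\<dots> \<le> (\<Sum>k\<in>B. l2_norm M (%x. (a k * l2_inner M f (e k)) * v k x))"
   by (intro norm_sum_le L2_cmult ev)
  also have "\<dots> \<le> (\<Sum>k\<in>B. cmod (a k) * l2_norm M (e k) * l2_norm M (v k) * l2_norm M f)"
  proof (rule sum_mono)
   fix k assume k: "k \<in> B"
   have "cmod (a k) * cmod (l2_inner M f (e k)) * l2_norm M (v k) \<le> cmod (a k) * (l2_norm M f * l2_norm M (e k)) * l2_norm M (v k)"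
    by (intro mult_right_mono mult_left_mono Cauchy_Schwarz_L2 f ev(1)[OF k]) auto
   then show "l2_norm M (%x. (a k * l2_inner M f (e k)) * v k x) \<le> cmod (a k) * l2_norm M (e k) * l2_norm M (v k) * l2_norm M f"
    unfolding norm_cmult norm_mult by (simp add: mult_ac)
  qed
  finally show "l2_norm M (U f) \<le> (\<Sum>k\<in>B. cmod (a k) * l2_norm M (e k) * l2_norm M (v k)) * l2_norm M f"
   by (simp add: sum_distrib_right)
 qed
 fix f g c d assume f: "f \<in> L2 M" and g: "g \<in> L2 M"
 show "AE x in M. U (%y. c * f y + d * g y) x = c * U f x + d * U g x"
  using U(2)[OF f] U(2)[OF g] U(2)[OF L2_lincomb[OF f g, of c d]]
 proof eventually_elim
  case (elim x)
  have "l2_inner M (%x. c * f x + d * g x) (e k) = c * l2_inner M f (e k) + d * l2_inner M g (e k)" if "k \<in> B" for k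
   by (rule inner_lincomb_left[OF f g ev(1)[OF that]])
  then have "(\<Sum>k\<in>B. a k * l2_inner M (%x. c * f x + d * g x) (e k) * v k x) =
   (\<Sum>k\<in>B. c * (a k * l2_inner M f (e k) * v k x) + d * (a k * l2_inner M g (e k) * v k x))"
   by (intro sum.cong) (auto simp: algebra_simps)
  then show ?case unfolding elim by (simp add: sum.distrib sum_distrib_left)
 qed
qed

lemma bounded_family_convergent_subsequence:
 fixes g :: "'k \<Rightarrow> nat \<Rightarrow> complex"
 assumes "finite B" "!!k. k \<in> B ==> bounded (range (g k))"
 shows "\<exists>r. strict_mono r \<and> (\<forall>k\<in>B. convergent (%n. g k (r n)))"
 using assms
proof (induction B rule: finite_induct)
 case empty
 show ?case by (rule exI[of _ id]) (auto simp: strict_mono_def)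
next
 case (insert b B)
 then obtain r where r: "strict_mono r" "\<forall>k\<in>B. convergent (%n. g k (r n))" by auto
 have "bounded (range (g b \<circ> r))" using insert.prems[of b] by (rule bounded_subset) auto
 then obtain l s where s: "strict_mono s" "((g b \<circ> r) \<circ> s) \<longlonglongrightarrow> l" using bounded_imp_convergent_subsequence by blast
 show ?case
 proof (intro exI[of _ "r \<circ> s"] conjI ballI)
  show "strict_mono (r \<circ> s)" using r s by (simp add: strict_mono_o)
  fix k assume "k \<in> insert b B"
  then show "convergent (%n. g k ((r \<circ> s) n))"
   using s(2) r(2) convergent_subseq_convergent[OF _ s(1), of "%n. g k (r n)"] by (auto simp: o_def convergent_def)
 qed
qed

text \<open>The coefficients of a bounded sequence are finitely many bounded numerical sequences, so
  they converge along a common subsequence. The formula for U is asked for almost everywhere only,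
  which is all that is known of sums in L2.\<close>

lemma compact_op_finite_rank:
 fixes M :: "'a measure"
 assumes B: "finite B" and ev: "!!k. k \<in> B ==> e k \<in> L2 M" "!!k. k \<in> B ==> v k \<in> L2 M"
  and U: "!!f. f \<in> L2 M ==> U f \<in> L2 M" "!!f. f \<in> L2 M ==> AE x in M. U f x = (\<Sum>k\<in>B. a k * l2_inner M f (e k) * v k x)"
 shows "compact_op M U"
 unfolding compact_op_def
proof (intro conjI allI impI)
 show "bounded_op M U" by (rule bounded_op_finite_rank[OF B ev U])
 fix u :: "nat \<Rightarrow> 'a \<Rightarrow> complex" assume u: "\<forall>n. u n \<in> L2 M \<and> l2_norm M (u n) \<le> 1"
 have "bounded (range (%n. l2_inner M (u n) (e k)))" if k: "k \<in> B" for k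
 proof (rule boundedI)
  fix z assume "z \<in> range (%n. l2_inner M (u n) (e k))"
  then obtain n where "z = l2_inner M (u n) (e k)" by auto
  then have "norm z \<le> l2_norm M (u n) * l2_norm M (e k)" using Cauchy_Schwarz_L2 u ev(1)[OF k] by blast
  also have "\<dots> \<le> 1 * l2_norm M (e k)" using u by (intro mult_right_mono) auto
  finally show "norm z \<le> 1 * l2_norm M (e k)" .
 qed
 then obtain r where r: "strict_mono r" "\<forall>k\<in>B. convergent (%n. l2_inner M (u (r n)) (e k))"
  using bounded_family_convergent_subsequence[OF B, of "%k n. l2_inner M (u n) (e k)"] by auto
 define z where "z = (%k. lim (%n. l2_inner M (u (r n)) (e k)))"
 have z: "(%n. l2_inner M (u (r n)) (e k)) \<longlonglongrightarrow> z k" if "k \<in> B" for k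
  using r(2) that by (simp add: z_def convergent_LIMSEQ_iff)
 define w where "w = (%x. \<Sum>k\<in>B. (a k * z k) * v k x)"
 have w: "w \<in> L2 M" unfolding w_def using ev by (intro L2_sum L2_cmult) auto
 have "(%n. l2_norm M (%x. U (u (r n)) x - w x)) \<longlonglongrightarrow> 0"
 proof (rule tendsto_sandwich[OF _ _ tendsto_const])
  show "(%n. \<Sum>k\<in>B. cmod (a k * (l2_inner M (u (r n)) (e k) - z k)) * l2_norm M (v k)) \<longlonglongrightarrow> 0"
   using z by (intro tendsto_null_sum tendsto_mult_left_zero tendsto_norm_zero tendsto_mult_right_zero LIM_zero)
  show "\<forall>\<^sub>F n in sequentially. l2_norm M (%x. U (u (r n)) x - w x) \<le> (\<Sum>k\<in>B. cmod (a k * (l2_inner M (u (r n)) (e k) - z k)) * l2_norm M (v k))"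
  proof (intro always_eventually allI)
   fix n
   have ur: "u (r n) \<in> L2 M" using u by auto
   have s: "(%x. \<Sum>k\<in>B. (a k * (l2_inner M (u (r n)) (e k) - z k)) * v k x) \<in> L2 M" using ev by (intro L2_sum L2_cmult) auto
   have "l2_norm M (%x. U (u (r n)) x - w x) = l2_norm M (%x. \<Sum>k\<in>B. (a k * (l2_inner M (u (r n)) (e k) - z k)) * v k x)"
   proof (rule norm_cong_AE)
    show "AE x in M. U (u (r n)) x - w x = (\<Sum>k\<in>B. (a k * (l2_inner M (u (r n)) (e k) - z k)) * v k x)"
     using U(2)[OF ur] by eventually_elim (simp add: w_def algebra_simps sum_subtractf)
   qed (use L2_diff[OF U(1)[OF ur] w] s in \<open>auto simp: L2_iff\<close>)
   also have "\<dots> \<le> (\<Sum>k\<in>B. l2_norm M (%x. (a k * (l2_inner M (u (r n)) (e k) - z k)) * v k x))"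
    by (intro norm_sum_le L2_cmult ev)
   finally show "l2_norm M (%x. U (u (r n)) x - w x) \<le> (\<Sum>k\<in>B. cmod (a k * (l2_inner M (u (r n)) (e k) - z k)) * l2_norm M (v k))"
    unfolding norm_cmult .
  qed
 qed simp
 then show "\<exists>v\<in>L2 M. \<exists>k. strict_mono k \<and> (%n. l2_norm M (%x. U (u (k n)) x - v x)) \<longlonglongrightarrow> 0"
  using w r(1) by blast
qed

lemma bounded_opD:
 assumes "bounded_op M T"
 shows "f \<in> L2 M ==> T f \<in> L2 M" "f \<in> L2 M ==> g \<in> L2 M ==> AE x in M. T (%y. c * f y + d * g y) x = c * T f x + d * T g x"
 using assms by (auto simp: bounded_op_def)

lemma bounded_op_bound: "bounded_op M T ==> \<exists>N. \<forall>f\<in>L2 M. l2_norm M (T f) \<le> N * l2_norm M f"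
 by (simp add: bounded_op_def)

lemma l2_has_sum_cong:
 assumes F: "l2_has_sum M F A h" and eq: "!!k x. k \<in> A ==> F k x = G k x" and h: "!!x. h x = h' x"
 shows "l2_has_sum M G A h'"
proof -
 have 1: "F k = G k" if "k \<in> A" for k using eq[OF that] by auto
 have 2: "h = h'" using h by auto
 show ?thesis
  unfolding l2_has_sum_def
 proof (intro conjI ballI)
  have "((%X. l2_norm M (%x. h x - (\<Sum>i\<in>X. F i x))) \<longlongrightarrow> 0) (finite_subsets_at_top A)" using F by (simp add: l2_has_sum_def)
  moreover have "\<forall>\<^sub>F X in finite_subsets_at_top A. l2_norm M (%x. h x - (\<Sum>i\<in>X. F i x)) = l2_norm M (%x. h' x - (\<Sum>i\<in>X. G i x))"
  proof (rule eventually_finite_subsets_at_top_weakI)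
   fix X assume "X \<subseteq> A"
   then have "(\<Sum>i\<in>X. F i x) = (\<Sum>i\<in>X. G i x)" for x using eq by (intro sum.cong) auto
   then show "l2_norm M (%x. h x - (\<Sum>i\<in>X. F i x)) = l2_norm M (%x. h' x - (\<Sum>i\<in>X. G i x))" by (simp add: 2)
  qed
  ultimately show "((%X. l2_norm M (%x. h' x - (\<Sum>i\<in>X. G i x))) \<longlongrightarrow> 0) (finite_subsets_at_top A)"
   by (rule Lim_transform_eventually)
  show "G i \<in> L2 M" if "i \<in> A" for i
  proof -
   have "F i \<in> L2 M" using F that by (simp add: l2_has_sum_def)
   then show ?thesis using 1[OF that] by simp
  qed
  show "h' \<in> L2 M" using F 2 by (simp add: l2_has_sum_def)
 qed
qed

text \<open>Infinite sets leave room after finitely many choices. This converts statements of the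
  form infinitely many indices into sequences without repetition, as needed for Weyl sequences and
  for limits of eigenvalues.\<close>

lemma injective_selection:
 fixes S :: "nat \<Rightarrow> 'a set"
 assumes inf: "!!n. infinite (S n)"
 shows "\<exists>f. (\<forall>n. f n \<in> S n) \<and> inj f"
proof -
 have "\<exists>f. \<forall>n. f n \<in> S n - f ` {..<n}"
 proof (rule dependent_wellorder_choice[where P = "%f n r. r \<in> S n - f ` {..<n}"])
  fix r :: 'a and f g :: "nat \<Rightarrow> 'a" and n assume "!!y. y < n ==> f y = g y"
  then have "f ` {..<n} = g ` {..<n}" by auto
  then show "(r \<in> S n - f ` {..<n}) = (r \<in> S n - g ` {..<n})" by simp
 next
  fix n and f :: "nat \<Rightarrow> 'a"
  have "infinite (S n - f ` {..<n})" using inf by (intro Diff_infinite_finite) auto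
  then have "S n - f ` {..<n} \<noteq> {}" by (rule infinite_imp_nonempty)
  then show "\<exists>r. r \<in> S n - f ` {..<n}" by (simp only: ex_in_conv not_False_eq_True)
 qed
 then obtain f where f: "\<forall>n. f n \<in> S n - f ` {..<n}" by (elim exE)
 have ne: "f m \<noteq> f n" if "m < n" for m n
 proof
  assume "f m = f n"
  moreover have "f m \<in> f ` {..<n}" using that by simp
  ultimately show False using f[rule_format, of n] by simp
 qed
 have "inj f" by (rule linorder_injI) (rule ne)
 then show ?thesis using f by (intro exI[of _ f]) simp
qed

text \<open>The vectors \<open>e\<close> are eigenvectors, but they span only part of the space. The
  infinite orthonormal system \<open>z\<close> in their complement lies in the kernel of T and
  forces 0 into the essential spectrum.\<close>

locale diagonal_operator =
 fixes M :: "'a measure" and A :: "'k set" and e :: "'k \<Rightarrow> 'a \<Rightarrow> complex" and lam :: "'k \<Rightarrow> real" and T :: "'a l2op" and z :: "nat \<Rightarrow> 'a \<Rightarrow> complex" and C :: real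
 assumes e: "orthonormal_on M e A" and bT: "bounded_op M T"
  and T: "!!f. f \<in> L2 M ==> l2_has_sum M (%k x. of_real (lam k) * l2_inner M f (e k) * e k x) A (T f)"
  and bdd: "!!k. k \<in> A ==> \<bar>lam k\<bar> \<le> C"
  and z: "orthonormal_on M z UNIV" "!!j k. k \<in> A ==> l2_inner M (z j) (e k) = 0"
begin

text \<open>Indices are counted, not values, so an eigenvalue of infinite multiplicity is a cluster
  point as well.\<close>

definition cluster :: "complex \<Rightarrow> bool" where
 "cluster c \<longleftrightarrow> (\<forall>\<epsilon>>0. infinite {k\<in>A. cmod (of_real (lam k) - c) < \<epsilon>})"

lemma eL: "k \<in> A ==> e k \<in> L2 M" using e by (auto simp: orthonormal_on_def)

text \<open>Only the finitely many e_k with k in B have eigenvalues near c. The parametrix S is 1 /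
  (lam - c) on the other e_k, -1 / c on the orthogonal complement and 0 on the span over B; both
  products with T - c differ from the identity by minus the projection onto that finite-dimensional
  span.\<close>

lemma invertible_off_cluster:
 assumes c: "c \<noteq> 0" "\<not> cluster c"
 shows "calkin_invertible M (%f x. T f x - c * f x)"
proof -
 obtain \<epsilon> where eps: "0 < \<epsilon>" "finite {k\<in>A. cmod (of_real (lam k) - c) < \<epsilon>}" using c(2) by (auto simp: cluster_def)
 define B where "B = {k\<in>A. cmod (of_real (lam k) - c) < \<epsilon>}"
 have B: "finite B" "B \<subseteq> A" using eps by (auto simp: B_def)
 \<comment> \<open>S is built as -1 / c plus a diagonal operator, so the diagonal entries have to
   compensate -1 / c; therefore 1 / c is added everywhere.\<close>
 define s where "s = (%k. (if k \<in> B then 0 else 1 / (of_real (lam k) - c)) + 1 / c)"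
 define K where "K = 1 / \<epsilon> + 1 / cmod c"
 have K: "0 \<le> K" using eps by (simp add: K_def)
 have sK: "\<forall>k\<in>A. cmod (s k) \<le> K"
 proof
  fix k assume k: "k \<in> A"
  have "cmod (if k \<in> B then 0 else 1 / (of_real (lam k) - c)) \<le> 1 / \<epsilon>"
   using k eps by (auto simp: B_def norm_divide intro!: divide_left_mono mult_pos_pos)
  then show "cmod (s k) \<le> K"
   unfolding s_def K_def using norm_triangle_ineq[of "if k \<in> B then 0 else 1 / (of_real (lam k) - c)" "1 / c"] by (simp add: norm_divide)
 qed
 define D where "D = diag_op M A s e e"
 note Ds = diag_op_has_sum[OF e e sK, folded D_def]
 have bD: "bounded_op M D" unfolding D_def by (rule diag_op_bounded[OF e e sK K])
 define S where "S = (%f x. (- 1 / c) * f x + 1 * D f x)"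
 have DL: "D f \<in> L2 M" if "f \<in> L2 M" for f using bounded_opD(1)[OF bD that] .
 have TL: "T f \<in> L2 M" if "f \<in> L2 M" for f using bounded_opD(1)[OF bT that] .
 have SL: "S f \<in> L2 M" if "f \<in> L2 M" for f unfolding S_def by (intro L2_lincomb DL that)
 have De: "l2_inner M (D f) (e k) = s k * l2_inner M f (e k)" if "f \<in> L2 M" "k \<in> A" for f k
  using l2_has_sum_coeff[OF e Ds[OF that(1)] that(2)] .
 have Te: "l2_inner M (T f) (e k) = of_real (lam k) * l2_inner M f (e k)" if "f \<in> L2 M" "k \<in> A" for f k
  using l2_has_sum_coeff[OF e T[OF that(1)] that(2)] .
 have coeff: "of_real (lam k) * (- 1 / c + s k) - c * s k = (if k \<in> B then - 1 else 0)" if "k \<in> A" for k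
 proof (cases "k \<in> B")
  case True then show ?thesis using c by (simp add: s_def field_simps)
 next
  case False
  then have "of_real (lam k) - c \<noteq> 0" using that eps by (auto simp: B_def)
  moreover have "x * (- 1 / c + (1 / d + 1 / c)) - c * (1 / d + 1 / c) = 0" if "x - c = d" "d \<noteq> 0" for x d
  proof -
   have "x = d + c" using that(1) by (simp add: algebra_simps)
   then show ?thesis using that(2) c by (simp add: field_simps)
  qed
  ultimately show ?thesis using False by (simp add: s_def)
 qed
 have bS: "bounded_op M S"
  unfolding bounded_op_def
 proof (intro conjI ballI allI SL)
  obtain N where N0: "\<forall>f\<in>L2 M. l2_norm M (D f) \<le> N * l2_norm M f" using bounded_op_bound[OF bD] by (elim exE)
  then have N: "l2_norm M (D f) \<le> N * l2_norm M f" if "f \<in> L2 M" for f using that by auto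
  show "\<exists>C. \<forall>f\<in>L2 M. l2_norm M (S f) \<le> C * l2_norm M f"
  proof (rule exI[of _ "cmod (- 1 / c) + N"], intro ballI)
   fix f assume f: "f \<in> L2 M"
   have "l2_norm M (S f) \<le> l2_norm M (%x. (- 1 / c) * f x) + l2_norm M (%x. 1 * D f x)"
    unfolding S_def by (intro norm_triangle_L2 L2_cmult f DL)
   also have "\<dots> \<le> (cmod (- 1 / c) + N) * l2_norm M f" unfolding norm_cmult using N[OF f] by (simp add: distrib_right)
   finally show "l2_norm M (S f) \<le> (cmod (- 1 / c) + N) * l2_norm M f" .
  qed
  fix f g a b assume f: "f \<in> L2 M" and g: "g \<in> L2 M"
  show "AE x in M. S (%y. a * f y + b * g y) x = a * S f x + b * S g x"
   using bounded_opD(2)[OF bD f g, of a b] by eventually_elim (simp add: S_def algebra_simps add_divide_distrib)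
 qed
 define fr where "fr = (%f k x. (if k \<in> B then - 1 else 0) * l2_inner M f (e k) * e k x)"
 have fin: "l2_has_sum M (fr f) A (%x. \<Sum>k\<in>B. fr f k x)" for f
 proof (rule l2_has_sum_finite_support[OF B])
  show "fr f k \<in> L2 M" if "k \<in> A" for k unfolding fr_def by (intro L2_cmult eL that)
 qed (simp add: fr_def)
 have compact: "compact_op M U" if U: "!!f. f \<in> L2 M ==> l2_has_sum M (fr f) A (U f)" for U
 proof (rule compact_op_finite_rank[OF B(1)])
  show "e k \<in> L2 M" if "k \<in> B" for k using that B eL by auto
  then show "e k \<in> L2 M" if "k \<in> B" for k using that by auto
  show "U f \<in> L2 M" if "f \<in> L2 M" for f using l2_has_sum_L2(1)[OF U[OF that]] .
  show "AE x in M. U f x = (\<Sum>k\<in>B. - 1 * l2_inner M f (e k) * e k x)" if "f \<in> L2 M" for f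
   using l2_has_sum_unique[OF U[OF that] fin] by (simp add: fr_def)
 qed
 have 1: "calkin_eq M ((%f x. T f x - c * f x) \<circ> S) id"
  unfolding calkin_eq_def
 proof (rule compact)
  fix f assume f: "f \<in> L2 M"
  have "l2_has_sum M (%k x. 1 * (of_real (lam k) * l2_inner M (S f) (e k) * e k x) + (- c) * (s k * l2_inner M f (e k) * e k x)) A (%x. 1 * T (S f) x + (- c) * D f x)"
   by (rule l2_has_sum_lincomb[OF T[OF SL[OF f]] Ds[OF f]])
  then show "l2_has_sum M (fr f) A (%x. ((%f x. T f x - c * f x) \<circ> S) f x - id f x)"
  proof (rule l2_has_sum_cong)
  show "1 * (of_real (lam k) * l2_inner M (S f) (e k) * e k x) + (- c) * (s k * l2_inner M f (e k) * e k x) = fr f k x" if k: "k \<in> A" for k x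
  proof -
   have "l2_inner M (S f) (e k) = (- 1 / c) * l2_inner M f (e k) + 1 * (s k * l2_inner M f (e k))"
    unfolding S_def De[OF f k, symmetric] by (rule inner_lincomb_left[OF f DL[OF f] eL[OF k]])
   moreover have "1 * (L * (i * p + 1 * (t * p)) * E) + (- c) * (t * p * E) = (L * (i + t) - c * t) * p * E" for L i p t E :: complex
    by (simp add: algebra_simps)
   ultimately have "1 * (of_real (lam k) * l2_inner M (S f) (e k) * e k x) + (- c) * (s k * l2_inner M f (e k) * e k x) =
    (of_real (lam k) * (- 1 / c + s k) - c * s k) * l2_inner M f (e k) * e k x" by (simp only:)
   then show ?thesis unfolding coeff[OF k] fr_def .
  qed
  show "1 * T (S f) x + (- c) * D f x = ((%f x. T f x - c * f x) \<circ> S) f x - id f x" for x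
  proof -
   have "c * S f x = - f x + c * D f x" using c(1) by (simp add: S_def algebra_simps)
   then show ?thesis by simp
  qed
  qed
 qed
 have 2: "calkin_eq M (S \<circ> (%f x. T f x - c * f x)) id"
  unfolding calkin_eq_def
 proof (rule compact)
  fix f assume f: "f \<in> L2 M"
  define g where "g = (%x. T f x - c * f x)"
  have g: "g \<in> L2 M" unfolding g_def by (intro L2_diff L2_cmult TL f)
  have "l2_has_sum M (%k x. (- 1 / c) * (of_real (lam k) * l2_inner M f (e k) * e k x) + 1 * (s k * l2_inner M g (e k) * e k x)) A (%x. (- 1 / c) * T f x + 1 * D g x)"
   by (rule l2_has_sum_lincomb[OF T[OF f] Ds[OF g]])
  then show "l2_has_sum M (fr f) A (%x. (S \<circ> (%f x. T f x - c * f x)) f x - id f x)"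
  proof (rule l2_has_sum_cong)
  show "(- 1 / c) * (of_real (lam k) * l2_inner M f (e k) * e k x) + 1 * (s k * l2_inner M g (e k) * e k x) = fr f k x" if k: "k \<in> A" for k x
  proof -
   have "l2_inner M g (e k) = l2_inner M (T f) (e k) - l2_inner M (%x. c * f x) (e k)"
    unfolding g_def by (rule inner_diff_left[OF TL[OF f] L2_cmult[OF f] eL[OF k]])
   then have "l2_inner M g (e k) = of_real (lam k) * l2_inner M f (e k) - c * l2_inner M f (e k)"
    unfolding Te[OF f k] inner_cmult_left .
   moreover have "i * (L * p * E) + 1 * (t * (L * p - c * p) * E) = (L * (i + t) - c * t) * p * E" for L i p t E :: complex
    by (simp add: algebra_simps)
   ultimately have "(- 1 / c) * (of_real (lam k) * l2_inner M f (e k) * e k x) + 1 * (s k * l2_inner M g (e k) * e k x) =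
    (of_real (lam k) * (- 1 / c + s k) - c * s k) * l2_inner M f (e k) * e k x" by (simp only:)
   then show ?thesis unfolding coeff[OF k] fr_def .
  qed
  show "(- 1 / c) * T f x + 1 * D g x = (S \<circ> (%f x. T f x - c * f x)) f x - id f x" for x
  proof -
   have "(- 1 / c) * g x = (- 1 / c) * T f x + f x" using c(1) by (simp add: g_def field_simps)
   then show ?thesis by (simp add: S_def flip: g_def)
  qed
  qed
 qed
 show ?thesis unfolding calkin_invertible_def using bS 1 2 by blast
qed

text \<open>Let K = S (T - c) - 1 be compact. As S (T - c) x_j tends to 0, a subsequence of the x_j
  would converge together with that of K x_j, whereas distinct orthonormal vectors have distance
  sqrt 2.\<close>

lemma not_invertible_of_Weyl_sequence:
 assumes x: "orthonormal_on M x (UNIV :: nat set)" and lim: "(%j. l2_norm M (%y. T (x j) y - c * x j y)) \<longlonglongrightarrow> 0"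
 shows "\<not> calkin_invertible M (%f x. T f x - c * f x)"
proof
 assume "calkin_invertible M (%f x. T f x - c * f x)"
 then obtain S where S: "bounded_op M S" "compact_op M (%f y. (S \<circ> (%f x. T f x - c * f x)) f y - id f y)"
  unfolding calkin_invertible_def calkin_eq_def by blast
 have xL: "x j \<in> L2 M" for j using x by (auto simp: orthonormal_on_def)
 define g where "g = (%j y. T (x j) y - c * x j y)"
 have g: "g j \<in> L2 M" for j unfolding g_def by (intro L2_diff L2_cmult xL bounded_opD(1)[OF bT])
 have SgL: "S (g j) \<in> L2 M" for j by (rule bounded_opD(1)[OF S(1) g])
 obtain N where N0: "\<forall>f\<in>L2 M. l2_norm M (S f) \<le> N * l2_norm M f" using bounded_op_bound[OF S(1)] by (elim exE)
 then have N: "l2_norm M (S f) \<le> N * l2_norm M f" if "f \<in> L2 M" for f using that by auto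
 have Sg: "(%j. l2_norm M (S (g j))) \<longlonglongrightarrow> 0"
 proof (rule tendsto_sandwich[OF _ _ tendsto_const])
  show "(%j. N * l2_norm M (g j)) \<longlonglongrightarrow> 0" using lim unfolding g_def by (intro tendsto_mult_right_zero)
 qed (use N g in auto)
 have "\<forall>n. x n \<in> L2 M \<and> l2_norm M (x n) \<le> 1" using xL orthonormal_onD(3)[OF x] by simp
 then obtain v k where v: "v \<in> L2 M" "strict_mono k" "(%n. l2_norm M (%y. (S (g (k n)) y - x (k n) y) - v y)) \<longlonglongrightarrow> 0"
  using S(2) unfolding compact_op_def g_def o_def id_def by blast
 define a where "a = (%n. l2_norm M (%y. (S (g (k n)) y - x (k n) y) - v y) + l2_norm M (S (g (k n))))"
 have "(%n. l2_norm M (S (g (k n)))) \<longlonglongrightarrow> 0" using LIMSEQ_subseq_LIMSEQ[OF Sg v(2)] by (simp add: o_def)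
 then have a0: "a \<longlonglongrightarrow> 0" unfolding a_def using tendsto_add[OF v(3)] by fastforce
 have near: "l2_norm M (%y. x (k n) y - (- v y)) \<le> a n" for n
 proof -
  have "(%y. x (k n) y - (- v y)) = (%y. S (g (k n)) y - ((S (g (k n)) y - x (k n) y) - v y))"
   by (rule ext) (simp add: algebra_simps)
  then have "l2_norm M (%y. x (k n) y - (- v y)) = l2_norm M (%y. S (g (k n)) y - ((S (g (k n)) y - x (k n) y) - v y))"
   by (simp only:)
  also have "\<dots> = l2_norm M (%y. S (g (k n)) y + (- 1) * ((S (g (k n)) y - x (k n) y) - v y))" by (simp add: add.commute)
  also have "\<dots> \<le> l2_norm M (S (g (k n))) + l2_norm M (%y. (- 1) * ((S (g (k n)) y - x (k n) y) - v y))"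
   by (intro norm_triangle_L2 L2_cmult L2_diff SgL xL v)
  finally show ?thesis unfolding norm_cmult a_def by simp
 qed
 \<comment> \<open>The squared distance 2 of consecutive vectors is bounded by a sequence that tends
   to 0.\<close>
 have sep: "2 \<le> (a n + a (Suc n))\<^sup>2" for n
 proof -
  have ne: "k n \<noteq> k (Suc n)" using v(2) by (metis n_not_Suc_n strict_mono_eq)
  have vL: "(%y. - v y) \<in> L2 M" using L2_cmult[OF v(1), of "- 1"] by simp
  have eq: "2 = (l2_norm M (%y. x (k n) y + (- 1) * x (k (Suc n)) y))\<^sup>2"
   using norm_sq_lincomb[OF xL xL, of "k n" "- 1" "k (Suc n)"] orthonormal_onD[OF x] ne by simp
  have "(%y. x (k n) y + (- 1) * x (k (Suc n)) y) = (%y. x (k n) y - x (k (Suc n)) y)" by simp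
  then have "l2_norm M (%y. x (k n) y + (- 1) * x (k (Suc n)) y) = l2_norm M (%y. x (k n) y - x (k (Suc n)) y)" by (rule arg_cong)
  also have "l2_norm M (%y. x (k n) y - x (k (Suc n)) y) \<le> l2_norm M (%y. x (k n) y - (- v y)) + l2_norm M (%y. (- v y) - x (k (Suc n)) y)"
   by (rule norm_triangle_diff[OF xL vL xL])
  also have "\<dots> \<le> a n + a (Suc n)"
   using near[of n] near[of "Suc n"] norm_diff_commute[of M "%y. - v y" "x (k (Suc n))"] by (intro add_mono) auto
  finally show ?thesis unfolding eq by (rule power_mono) simp
 qed
 have "(%n. (a n + a (Suc n))\<^sup>2) \<longlonglongrightarrow> (0 + 0)\<^sup>2" by (intro tendsto_intros a0 LIMSEQ_Suc)
 from LIMSEQ_le_const[OF this, of 2] sep show False by auto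
qed

lemma T_e: "k \<in> A ==> AE x in M. T (e k) x = of_real (lam k) * e k x"
proof -
 assume k: "k \<in> A"
 have "l2_has_sum M (%j x. of_real (lam j) * l2_inner M (e k) (e j) * e j x) A (%x. \<Sum>j\<in>{k}. of_real (lam j) * l2_inner M (e k) (e j) * e j x)"
  using k orthonormal_onD(2)[OF e] by (intro l2_has_sum_finite_support L2_cmult eL) auto
 from l2_has_sum_unique[OF T[OF eL[OF k]] this] show ?thesis
  using orthonormal_onD(2)[OF e k k] by simp
qed

lemma T_orthogonal: "f \<in> L2 M ==> (!!k. k \<in> A ==> l2_inner M f (e k) = 0) ==> AE x in M. T f x = 0"
proof -
 assume f: "f \<in> L2 M" and o: "!!k. k \<in> A ==> l2_inner M f (e k) = 0"
 have "l2_has_sum M (%j x. of_real (lam j) * l2_inner M f (e j) * e j x) A (%x. \<Sum>j\<in>{}. of_real (lam j) * l2_inner M f (e j) * e j x)"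
  using o by (intro l2_has_sum_finite_support L2_cmult eL) auto
 from l2_has_sum_unique[OF T[OF f] this] show ?thesis by simp
qed

theorem essential_spectrum_diagonal: "essential_spectrum M T = insert 0 {c. cluster c}"
proof -
 have W0: "\<not> calkin_invertible M (%f x. T f x - 0 * f x)"
 proof (rule not_invertible_of_Weyl_sequence[OF z(1)])
  have "l2_norm M (%y. T (z j) y - 0 * z j y) = 0" for j
  proof -
   have zj: "z j \<in> L2 M" using z(1) by (auto simp: orthonormal_on_def)
   have "AE x in M. T (z j) x = 0" by (rule T_orthogonal[OF zj]) (rule z(2))
   then have "l2_norm M (T (z j)) = 0" by (subst norm_zero_iff[OF bounded_opD(1)[OF bT zj]])
   then show ?thesis by simp
  qed
  then show "(%j. l2_norm M (%y. T (z j) y - 0 * z j y)) \<longlonglongrightarrow> 0" by simp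
 qed
 have W1: "\<not> calkin_invertible M (%f x. T f x - c * f x)" if "cluster c" for c
 proof -
  have inf: "infinite {k\<in>A. cmod (of_real (lam k) - c) < 1 / real (Suc j)}" for j using that by (simp add: cluster_def)
  obtain k :: "nat \<Rightarrow> 'k" where k0: "\<forall>n. k n \<in> {k\<in>A. cmod (of_real (lam k) - c) < 1 / real (Suc n)}" "inj k"
   using injective_selection[of "%n. {k\<in>A. cmod (of_real (lam k) - c) < 1 / real (Suc n)}", OF inf] by (elim exE conjE)
  have k: "k n \<in> A" "cmod (of_real (lam (k n)) - c) < 1 / real (Suc n)" for n
   using spec[OF k0(1), of n] unfolding mem_Collect_eq by (blast, blast)
  have kinj: "k m = k n \<longleftrightarrow> m = n" for m n using k0(2) by (rule inj_eq)
  have o: "orthonormal_on M (%n. e (k n)) UNIV"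
   using k(1) e kinj by (auto simp: orthonormal_on_def)
  show ?thesis
  proof (rule not_invertible_of_Weyl_sequence[OF o])
   show "(%j. l2_norm M (%y. T (e (k j)) y - c * e (k j) y)) \<longlonglongrightarrow> 0"
   proof (rule tendsto_sandwich[OF _ _ tendsto_const LIMSEQ_Suc[OF lim_1_over_n]])
    show "\<forall>\<^sub>F n in sequentially. l2_norm M (%y. T (e (k n)) y - c * e (k n) y) \<le> 1 / real (Suc n)"
    proof (intro always_eventually allI)
     fix n
     have L: "e (k n) \<in> L2 M" by (rule eL[OF k(1)])
     have "l2_norm M (%y. T (e (k n)) y - c * e (k n) y) = l2_norm M (%y. (of_real (lam (k n)) - c) * e (k n) y)"
     proof (rule norm_cong_AE)
      show "AE y in M. T (e (k n)) y - c * e (k n) y = (of_real (lam (k n)) - c) * e (k n) y"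
       using T_e[OF k(1)[of n]] by eventually_elim (simp add: algebra_simps)
     qed (use L2_measurable[OF L2_diff[OF bounded_opD(1)[OF bT L] L2_cmult[OF L]]] L2_measurable[OF L2_cmult[OF L]] in auto)
     also have "\<dots> = cmod (of_real (lam (k n)) - c)" unfolding norm_cmult using orthonormal_onD(3)[OF o, of n] by simp
     finally show "l2_norm M (%y. T (e (k n)) y - c * e (k n) y) \<le> 1 / real (Suc n)" using k(2)[of n] by simp
    qed
   qed simp
  qed
 qed
 show ?thesis
 proof (rule set_eqI)
  fix c
  have mem: "c \<in> essential_spectrum M T \<longleftrightarrow> \<not> calkin_invertible M (%f x. T f x - c * f x)"
   by (simp only: essential_spectrum_def mem_Collect_eq)
  show "c \<in> essential_spectrum M T \<longleftrightarrow> c \<in> insert 0 {c. cluster c}"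
  proof (cases "c = 0")
   case True then show ?thesis unfolding mem using W0 by (simp only: insertI1 not_False_eq_True)
  next
   case False
   have "calkin_invertible M (%f x. T f x - c * f x) \<longleftrightarrow> \<not> cluster c"
   proof
    show "calkin_invertible M (%f x. T f x - c * f x)" if "\<not> cluster c" by (rule invertible_off_cluster[OF False that])
    show "\<not> cluster c" if "calkin_invertible M (%f x. T f x - c * f x)"
    proof
     assume "cluster c"
     from W1[OF this] that show False by (rule notE)
    qed
   qed
   then show ?thesis unfolding mem using False by simp
  qed
 qed
qed

text \<open>Vectors added to the system \<open>e\<close> by the extension to a basis are orthogonal
  to it, so T annihilates them and they are eigenfunctions for 0.\<close>

lemma eigenbasis: "\<exists>E. orthogonal_basis M E \<and> (\<forall>f\<in>E. is_eigenfunction M T f)"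
proof -
 have "orthogonal_system M (e ` A)"
  unfolding orthogonal_system_def pairwise_def using orthonormal_onD[OF e] by fastforce
 then obtain E where E: "e ` A \<subseteq> E" "orthogonal_basis M E" using orthogonal_basis_extend by blast
 have EL: "E \<subseteq> L2 M" "\<forall>f\<in>E. l2_norm M f \<noteq> 0" "pairwise (%e e'. l2_inner M e e' = 0) E" using E by (auto simp: orthogonal_basis_def)
 have "is_eigenfunction M T f" if f: "f \<in> E" for f
 proof -
  have fL: "f \<in> L2 M" "\<not> (AE x in M. f x = 0)" using EL f norm_zero_iff[of f M] by auto
  have "\<exists>c. AE x in M. T f x = c * f x"
  proof (cases "f \<in> e ` A")
   case True then show ?thesis using T_e by auto
  next
   case False
   have "l2_inner M f (e k) = 0" if "k \<in> A" for k
    using EL(3) f E(1) that False unfolding pairwise_def by (metis image_eqI subsetD)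
   from T_orthogonal[OF fL(1) this] show ?thesis by (intro exI[of _ 0]) simp
  qed
  then show ?thesis using fL by (simp add: is_eigenfunction_def)
 qed
 then show ?thesis using E by blast
qed

end

lemma adjoint_unique:
 assumes "is_adjoint M L A1" "is_adjoint M L A2" "g \<in> L2 M"
 shows "AE x in M. A1 g x = A2 g x"
proof (rule inner_separates)
 show L: "A1 g \<in> L2 M" "A2 g \<in> L2 M" using assms by (auto simp: is_adjoint_def bounded_op_def)
 fix v assume v: "v \<in> L2 M"
 have "l2_inner M v (A1 g) = l2_inner M v (A2 g)" using assms v by (simp add: is_adjoint_def)
 then show "l2_inner M (A1 g) v = l2_inner M (A2 g) v"
  using inner_commute[of M "A1 g" v] inner_commute[of M "A2 g" v] by simp
qed

section \<open>The radial function near an end point\<close>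

text \<open>The exponent p(zeta) as a function of the radius, for a general f so that it can also be
  formed with the inverse function, that is, with the coordinates exchanged.\<close>

definition p_profile :: "(real \<Rightarrow> real) \<Rightarrow> real \<Rightarrow> real" where
 "p_profile f r = 1 + r * f r * deriv (deriv f) r / (deriv f r * (f r - r * deriv f r))"

text \<open>Integrates the bound on the second derivative of the remainder: a constant times r^(p -
  1), with either sign of e1 added, is increasing from the value 0.\<close>

lemma small_oh_antiderivative:
 fixes e1 e2 :: "real \<Rightarrow> real"
 assumes p: "1 < p" and d: "0 < d" and cont: "continuous_on {0..<d} e1"
  and der: "!!r. 0 < r ==> r < d ==> (e1 has_real_derivative e2 r) (at r)"
  and z: "e1 0 = 0" and o: "e2 \<in> o[at_right 0](%r. r powr (p - 2))"
 shows "((%r. e1 r / r powr (p - 1)) \<longlongrightarrow> 0) (at_right 0)"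
proof (rule tendstoI)
 fix \<epsilon> :: real assume eps: "0 < \<epsilon>"
 \<comment> \<open>With this c the derivative of (\<epsilon> / 2) r^(p - 1) is exactly c r^(p -
   2).\<close>
 define c where "c = \<epsilon> * (p - 1) / 2"
 have c: "0 < c" using eps p by (simp add: c_def)
 have "\<forall>\<^sub>F r in at_right 0. norm (e2 r) \<le> c * norm (r powr (p - 2))" using landau_o.smallD[OF o c] .
 then obtain a where a: "0 < a" "!!r. 0 < r ==> r < a ==> \<bar>e2 r\<bar> \<le> c * r powr (p - 2)"
  unfolding eventually_at_right_field by auto
 have bound: "\<bar>e1 x\<bar> \<le> (\<epsilon> / 2) * x powr (p - 1)" if x: "0 < x" "x < min a d" for x
 proof -
  define f where "f = (%s r. (\<epsilon> / 2) * r powr (p - 1) + s * e1 r)"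
  have "f s 0 \<le> f s x" if s: "s = 1 \<or> s = - 1" for s
  proof (rule DERIV_nonneg_imp_increasing_open[of 0 x "f s"])
   show "0 \<le> x" using x by simp
   have cs: "continuous_on {0..x} e1" by (rule continuous_on_subset[OF cont]) (use x in auto)
   have "continuous_on {0..x} (%r. r powr (p - 1))"
    by (rule continuous_on_powr') (use p in \<open>auto intro!: continuous_intros\<close>)
   then show "continuous_on {0..x} (f s)" unfolding f_def using cs
    by (intro continuous_on_add continuous_on_mult continuous_on_const)
   fix y assume y: "0 < y" "y < x"
   have "((%r. r powr (p - 1)) has_real_derivative (p - 1) * y powr (p - 2)) (at y)"
    using y has_real_derivative_powr[of y "p - 1"] by simp
   then have "(f s has_real_derivative (\<epsilon> / 2) * ((p - 1) * y powr (p - 2)) + s * e2 y) (at y)"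
    unfolding f_def using y x by (intro DERIV_add DERIV_cmult der) auto
   moreover have "0 \<le> (\<epsilon> / 2) * ((p - 1) * y powr (p - 2)) + s * e2 y"
    using a(2)[of y] y x s by (auto simp: c_def)
   ultimately show "\<exists>z. (f s has_real_derivative z) (at y) \<and> 0 \<le> z" by blast
  qed
  from this[of 1] this[of "- 1"] show ?thesis using z p by (simp add: f_def)
 qed
 have "\<forall>\<^sub>F r in at_right 0. 0 < r \<and> r < min a d"
  unfolding eventually_at_right_field using a(1) d by (intro exI[of _ "min a d"]) auto
 then show "\<forall>\<^sub>F r in at_right 0. dist (e1 r / r powr (p - 1)) 0 < \<epsilon>"
 proof eventually_elim
  case (elim r)
  then have "\<bar>e1 r\<bar> / r powr (p - 1) \<le> \<epsilon> / 2" using bound[of r] by (simp add: pos_divide_le_eq)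
  moreover have "dist (e1 r / r powr (p - 1)) 0 = \<bar>e1 r\<bar> / r powr (p - 1)" by (simp add: abs_divide)
  ultimately show ?case using eps by linarith
 qed
qed

text \<open>The conditions on the remainder are such that the leading term may be differentiated
  twice.\<close>

lemma power_expansion_asymptotics:
 assumes pe: "power_expansion f p" and p: "1 < p"
 shows "\<exists>b c. 0 < b \<and> 0 < c \<and> f 0 = b \<and> (f \<longlongrightarrow> b) (at_right 0) \<and>
  ((%r. deriv f r / r powr (p - 1)) \<longlongrightarrow> - (c * p)) (at_right 0) \<and>
  ((%r. deriv (deriv f) r / r powr (p - 2)) \<longlongrightarrow> - (c * p * (p - 1))) (at_right 0)"
proof -
 obtain b c d e e1 e2 where *: "0 < b" "0 < c" "0 < d" "\<forall>r\<in>{0..<d}. f r = b - c * r powr p + e r"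
   "\<forall>r\<in>{0..<d}. (e has_real_derivative e1 r) (at r within {0..<d})" "continuous_on {0..<d} e1"
   "\<forall>r\<in>{0<..<d}. (e1 has_real_derivative e2 r) (at r)" "continuous_on {0<..<d} e2" "e 0 = 0" "e1 0 = 0"
   "e2 \<in> o[at_right 0](%r. r powr (p - 2))"
  using pe unfolding power_expansion_def by (elim exE conjE bexE) auto
 have ev: "\<forall>\<^sub>F r in at_right 0. 0 < r \<and> r < d"
  unfolding eventually_at_right_field using *(3) by (intro exI[of _ d]) auto
 have de: "(e has_real_derivative e1 r) (at r)" if "0 < r" "r < d" for r
 proof -
  have "(e has_real_derivative e1 r) (at r within {0<..<d})"
   by (rule DERIV_subset[where s = "{0..<d}"]) (use *(5) that in auto)
  then show ?thesis using that by (simp add: at_within_open[of r "{0<..<d}"])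
 qed
 have df: "deriv f r = - (c * (p * r powr (p - 1))) + e1 r" if r: "0 < r" "r < d" for r
 proof (rule DERIV_imp_deriv)
  have "((%r. b - c * r powr p + e r) has_real_derivative 0 - c * (p * r powr (p - 1)) + e1 r) (at r)"
   using r by (intro DERIV_add DERIV_diff DERIV_const DERIV_cmult de has_real_derivative_powr) auto
  then have "((%r. b - c * r powr p + e r) has_real_derivative - (c * (p * r powr (p - 1))) + e1 r) (at r)" by simp
  then show "(f has_real_derivative - (c * (p * r powr (p - 1))) + e1 r) (at r)"
   by (rule has_field_derivative_transform_within_open[of _ _ _ "{0<..<d}"]) (use r *(4) in auto)
 qed
 have ddf: "deriv (deriv f) r = - (c * (p * ((p - 1) * r powr (p - 2)))) + e2 r" if r: "0 < r" "r < d" for r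
 proof (rule DERIV_imp_deriv)
  have "((%r. r powr (p - 1)) has_real_derivative (p - 1) * r powr (p - 2)) (at r)"
   using r has_real_derivative_powr[of r "p - 1"] by simp
  then have "((%r. - (c * (p * r powr (p - 1))) + e1 r) has_real_derivative - (c * (p * ((p - 1) * r powr (p - 2)))) + e2 r) (at r)"
   using r *(7) by (intro DERIV_add DERIV_minus DERIV_cmult) auto
  then show "(deriv f has_real_derivative - (c * (p * ((p - 1) * r powr (p - 2)))) + e2 r) (at r)"
   by (rule has_field_derivative_transform_within_open[of _ _ _ "{0<..<d}"]) (use r df in auto)
 qed
 have f0: "f 0 = b" using *(3,4,9) p by simp
 have fl: "(f \<longlongrightarrow> b) (at_right 0)"
 proof -
  have "(e has_real_derivative e1 0) (at 0 within {0..<d})" using *(3,5) by auto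
  then have "continuous (at 0 within {0..<d}) e" by (rule DERIV_continuous)
  then have "(e \<longlongrightarrow> 0) (at 0 within {0..<d})" using *(9) by (simp add: continuous_within)
  then have "(e \<longlongrightarrow> 0) (at 0 within {0..d / 2})" by (rule tendsto_within_subset) (use *(3) in auto)
  then have e0: "(e \<longlongrightarrow> 0) (at_right 0)" using *(3) by (simp add: at_within_Icc_at_right)
  have "((%r. b - c * r powr p + e r) \<longlongrightarrow> b - c * 0 + 0) (at_right 0)"
  proof (intro tendsto_intros e0)
   show "((%r. r powr p) \<longlongrightarrow> 0) (at_right 0)" using p by real_asymp
  qed
  moreover have "\<forall>\<^sub>F r in at_right 0. b - c * r powr p + e r = f r" using ev by eventually_elim (use *(4) in auto)
  ultimately show ?thesis using Lim_transform_eventually by fastforce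
 qed
 have "((%r. - (c * p) + e1 r / r powr (p - 1)) \<longlongrightarrow> - (c * p) + 0) (at_right 0)"
  by (intro tendsto_intros small_oh_antiderivative[OF p *(3,6) _ *(10,11)]) (use *(7) in auto)
 moreover have "\<forall>\<^sub>F r in at_right 0. - (c * p) + e1 r / r powr (p - 1) = deriv f r / r powr (p - 1)"
  using ev by eventually_elim (simp add: df field_simps)
 ultimately have 1: "((%r. deriv f r / r powr (p - 1)) \<longlongrightarrow> - (c * p)) (at_right 0)"
  using Lim_transform_eventually by fastforce
 have "((%r. e2 r / r powr (p - 2)) \<longlongrightarrow> 0) (at_right 0)" using smalloD_tendsto[OF *(11)] .
 then have "((%r. - (c * p * (p - 1)) + e2 r / r powr (p - 2)) \<longlongrightarrow> - (c * p * (p - 1)) + 0) (at_right 0)"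
  by (intro tendsto_intros)
 moreover have "\<forall>\<^sub>F r in at_right 0. - (c * p * (p - 1)) + e2 r / r powr (p - 2) = deriv (deriv f) r / r powr (p - 2)"
  using ev by eventually_elim (simp add: ddf field_simps)
 ultimately have 2: "((%r. deriv (deriv f) r / r powr (p - 2)) \<longlongrightarrow> - (c * p * (p - 1))) (at_right 0)"
  using Lim_transform_eventually by fastforce
 show ?thesis using *(1,2) f0 fl 1 2 by blast
qed

text \<open>In terms of the leading coefficient, s is asymptotic to (c p / b) r^p; the quotient of
  the second by the first derivative contributes p - 1 to the limit of the exponent. It is applied
  to phi at 0 and, through the inverse function, at the other corner.\<close>

lemma coordinate_asymptotics:
 assumes pe: "power_expansion f p" and p: "1 < p"
 shows "\<exists>k>0. ((%r. s_coord f r / r powr p) \<longlongrightarrow> k) (at_right 0)"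
  "(p_profile f \<longlongrightarrow> p) (at_right 0)" "(deriv f \<longlongrightarrow> 0) (at_right 0)" "0 < f 0" "(f \<longlongrightarrow> f 0) (at_right 0)"
proof -
 obtain b c where *: "0 < b" "0 < c" "f 0 = b" "(f \<longlongrightarrow> b) (at_right 0)"
  "((%r. deriv f r / r powr (p - 1)) \<longlongrightarrow> - (c * p)) (at_right 0)"
  "((%r. deriv (deriv f) r / r powr (p - 2)) \<longlongrightarrow> - (c * p * (p - 1))) (at_right 0)"
  using power_expansion_asymptotics[OF pe p] by (elim exE conjE)
 show "0 < f 0" "(f \<longlongrightarrow> f 0) (at_right 0)" using * by auto
 have ev: "\<forall>\<^sub>F r in at_right (0::real). 0 < r" by (simp add: eventually_at_right_less)
 have "((%r. r powr (p - 1)) \<longlongrightarrow> 0) (at_right 0)" using p by real_asymp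
 from tendsto_mult[OF *(5) this] have "((%r. deriv f r / r powr (p - 1) * r powr (p - 1)) \<longlongrightarrow> 0) (at_right 0)" by simp
 moreover have "\<forall>\<^sub>F r in at_right 0. deriv f r / r powr (p - 1) * r powr (p - 1) = deriv f r" using ev by eventually_elim simp
 ultimately show d0: "(deriv f \<longlongrightarrow> 0) (at_right 0)" by (rule Lim_transform_eventually)
 have rd: "((%r. f r - r * deriv f r) \<longlongrightarrow> b - 0 * 0) (at_right 0)" by (intro tendsto_intros * d0)
 have "((%r. - (deriv f r / r powr (p - 1)) / (f r - r * deriv f r)) \<longlongrightarrow> - (- (c * p)) / (b - 0 * 0)) (at_right 0)"
  by (intro tendsto_intros * rd) (use * in auto)
 moreover have "\<forall>\<^sub>F r in at_right 0. - (deriv f r / r powr (p - 1)) / (f r - r * deriv f r) = s_coord f r / r powr p"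
  using ev by eventually_elim (simp add: s_coord_def powr_diff mult.commute)
 ultimately have "((%r. s_coord f r / r powr p) \<longlongrightarrow> c * p / b) (at_right 0)" using Lim_transform_eventually by fastforce
 then show "\<exists>k>0. ((%r. s_coord f r / r powr p) \<longlongrightarrow> k) (at_right 0)" using * p by (intro exI[of _ "c * p / b"]) auto
 have "((%r. 1 + (deriv (deriv f) r / r powr (p - 2)) / (deriv f r / r powr (p - 1)) * (f r / (f r - r * deriv f r))) \<longlongrightarrow>
   1 + (- (c * p * (p - 1))) / (- (c * p)) * (b / (b - 0 * 0))) (at_right 0)"
  by (intro tendsto_intros * rd) (use * p in auto)
 moreover have "\<forall>\<^sub>F r in at_right 0. 1 + (deriv (deriv f) r / r powr (p - 2)) / (deriv f r / r powr (p - 1)) * (f r / (f r - r * deriv f r)) = p_profile f r"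
  using ev
 proof eventually_elim
  case (elim r)
  have "r powr (p - 1) = r * r powr (p - 2)" using elim powr_add[of r 1 "p - 2"] by simp
  then show ?case using elim by (simp add: p_profile_def)
 qed
 ultimately have "(p_profile f \<longlongrightarrow> 1 + (- (c * p * (p - 1))) / (- (c * p)) * (b / (b - 0 * 0))) (at_right 0)"
  by (rule Lim_transform_eventually)
 then show "(p_profile f \<longlongrightarrow> p) (at_right 0)" using * p by simp
qed

section \<open>The coordinate s on the boundary\<close>

locale reinhardt_domain =
 fixes b1 :: real and \<phi> :: "real \<Rightarrow> real" and p1 p2 :: real
 assumes class_R: "class_R b1 \<phi> p1 p2"
begin

abbreviation "\<phi>' \<equiv> deriv \<phi>"
abbreviation "\<phi>'' \<equiv> deriv (deriv \<phi>)"
abbreviation "sc \<equiv> s_coord \<phi>"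
abbreviation "pf \<equiv> p_profile \<phi>"

lemma basic: "0 < b1" "1 < p1" "1 < p2" "continuous_on {0..b1} \<phi>" "antimono_on {0..b1} \<phi>" "\<phi> b1 = 0"
 "continuous_on {0<..<b1} \<phi>''" "0 < r ==> r < b1 ==> \<phi>'' r < 0"
 "power_expansion \<phi> p1" "power_expansion (inv_into {0..b1} \<phi>) p2"
 using class_R by (auto simp: class_R_def)

lemma dphi: "0 < r ==> r < b1 ==> (\<phi> has_real_derivative \<phi>' r) (at r)"
 using class_R by (auto simp: class_R_def DERIV_deriv_iff_real_differentiable)

lemma dphi': "0 < r ==> r < b1 ==> (\<phi>' has_real_derivative \<phi>'' r) (at r)"
 using class_R by (auto simp: class_R_def DERIV_deriv_iff_real_differentiable)

text \<open>Since phi' is strictly decreasing, phi'(r) \<ge> 0 would make phi strictly increasing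
  somewhere on the interval from r / 2 to r, against monotonicity.\<close>

lemma phi'_neg: assumes r: "0 < r" "r < b1" shows "\<phi>' r < 0"
proof (rule ccontr)
 assume "\<not> \<phi>' r < 0"
 then have r0: "0 \<le> \<phi>' r" by simp
 obtain x where x: "r / 2 < x" "x < r" "\<phi> r - \<phi> (r / 2) = (r - r / 2) * \<phi>' x"
  using MVT2[of "r / 2" r \<phi> \<phi>'] dphi r by auto
 have "\<phi>' r < \<phi>' x"
 proof (rule DERIV_neg_imp_decreasing[OF x(2)])
  fix y assume "x \<le> y" "y \<le> r"
  then have "0 < y" "y < b1" using x r by auto
  then show "\<exists>z. (\<phi>' has_real_derivative z) (at y) \<and> z < 0" by (intro exI[of _ "\<phi>'' y"] conjI dphi' basic(8))
 qed
 then have "0 < (r - r / 2) * \<phi>' x" using r r0 by (intro mult_pos_pos) auto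
 then have "0 < \<phi> r - \<phi> (r / 2)" using x(3) by linarith
 moreover have "\<phi> r \<le> \<phi> (r / 2)" using monotone_onD[OF basic(5), of "r / 2" r] r by simp
 ultimately show False by simp
qed

lemma phi_strict: assumes "0 \<le> a" "a < b" "b \<le> b1" shows "\<phi> b < \<phi> a"
proof (rule DERIV_neg_imp_decreasing_open[OF assms(2)])
 fix x assume "a < x" "x < b"
 then have "0 < x" "x < b1" using assms by auto
 then show "\<exists>y. (\<phi> has_real_derivative y) (at x) \<and> y < 0" by (intro exI[of _ "\<phi>' x"] conjI dphi phi'_neg)
next
 show "continuous_on {a..b} \<phi>" by (rule continuous_on_subset[OF basic(4)]) (use assms in auto)
qed

lemma phi_pos: "0 \<le> r ==> r < b1 ==> 0 < \<phi> r" using phi_strict[of r b1] basic by simp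

lemma denom_pos: assumes "0 < r" "r < b1" shows "0 < \<phi> r - r * \<phi>' r"
proof -
 have "r * \<phi>' r < 0" using phi'_neg assms by (simp add: mult_pos_neg)
 then show ?thesis using phi_pos assms by (smt (verit))
qed

lemma sc_01: assumes r: "0 < r" "r < b1" shows "0 < sc r" "sc r < 1"
 "1 - sc r = \<phi> r / (\<phi> r - r * \<phi>' r)" "sc r = - r * \<phi>' r / (\<phi> r - r * \<phi>' r)"
proof -
 show "sc r = - r * \<phi>' r / (\<phi> r - r * \<phi>' r)" by (simp add: s_coord_def)
 have neg: "r * \<phi>' r < 0" using phi'_neg r by (simp add: mult_pos_neg)
 then show "0 < sc r" unfolding s_coord_def using denom_pos[OF r] by (intro divide_pos_pos) auto
 show e: "1 - sc r = \<phi> r / (\<phi> r - r * \<phi>' r)" unfolding s_coord_def using denom_pos[OF r] by (simp add: field_simps)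
 have "0 < 1 - sc r" unfolding e using denom_pos[OF r] phi_pos[of r] r by simp
 then show "sc r < 1" by simp
qed

lemma pf_gt_1: assumes r: "0 < r" "r < b1" shows "1 < pf r"
proof -
 have "0 < r * \<phi> r" using phi_pos[of r] r by simp
 then have "r * \<phi> r * \<phi>'' r < 0" using basic(8)[OF r] by (rule mult_pos_neg)
 moreover have "\<phi>' r * (\<phi> r - r * \<phi>' r) < 0" using phi'_neg[OF r] denom_pos[OF r] by (rule mult_neg_pos)
 ultimately have "0 < r * \<phi> r * \<phi>'' r / (\<phi>' r * (\<phi> r - r * \<phi>' r))" by (rule divide_neg_neg)
 then show ?thesis unfolding p_profile_def by simp
qed

text \<open>The exponent p(zeta) is the logarithmic derivative of s with respect to r1. This is
  where the equation for r1 in a profile, with P = 1/p, comes from.\<close>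

lemma dsc: assumes r: "0 < r" "r < b1" shows "(sc has_real_derivative pf r * sc r / r) (at r)"
proof -
 have d: "\<phi> r - r * \<phi>' r \<noteq> 0" using denom_pos[OF r] by simp
 have n: "\<phi>' r \<noteq> 0" using phi'_neg[OF r] by simp
 have num: "((%r. - r * \<phi>' r) has_real_derivative - \<phi>' r - r * \<phi>'' r) (at r)"
  by (rule DERIV_cong[OF DERIV_mult[OF DERIV_minus[OF DERIV_ident] dphi'[OF r]]]) simp
 have den: "((%r. \<phi> r - r * \<phi>' r) has_real_derivative - (r * \<phi>'' r)) (at r)"
  by (rule DERIV_cong[OF DERIV_diff[OF dphi[OF r] DERIV_mult[OF DERIV_ident dphi'[OF r]]]]) simp
 have "((%r. - r * \<phi>' r / (\<phi> r - r * \<phi>' r)) has_real_derivative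
   ((- \<phi>' r - r * \<phi>'' r) * (\<phi> r - r * \<phi>' r) - (- r * \<phi>' r) * (- (r * \<phi>'' r))) / ((\<phi> r - r * \<phi>' r) * (\<phi> r - r * \<phi>' r))) (at r)"
  by (rule DERIV_divide[OF num den d])
 moreover have "((- f1 - x * f2) * (f - x * f1) - (- x * f1) * (- (x * f2))) / ((f - x * f1) * (f - x * f1))
   = (1 + x * f * f2 / (f1 * (f - x * f1))) * (- x * f1 / (f - x * f1)) / x"
  if "f - x * f1 \<noteq> 0" "f1 \<noteq> 0" "x \<noteq> 0" for f f1 f2 x :: real
 proof -
  define D where "D = f - x * f1"
  have D: "D \<noteq> 0" using that by (simp add: D_def)
  have "(1 + x * f * f2 / (f1 * D)) * (- x * f1 / D) / x = - (f1 * D + x * f * f2) / (D * D)"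
   using D that(2,3) by (simp add: field_simps)
  moreover have "(- f1 - x * f2) * D - (- x * f1) * (- (x * f2)) = - (f1 * D + x * f * f2)"
   unfolding D_def by (simp add: algebra_simps)
  ultimately show ?thesis unfolding D_def[symmetric] by simp
 qed
 ultimately show ?thesis using d n r by (simp add: s_coord_def[abs_def] p_profile_def)
qed

lemma dsc_pos: "0 < r ==> r < b1 ==> 0 < pf r * sc r / r" using pf_gt_1[of r] sc_01(1)[of r] by simp

lemma sc_strict: assumes "0 < a" "a < b" "b < b1" shows "sc a < sc b"
proof (rule DERIV_pos_imp_increasing[OF assms(2)])
 fix x assume "a \<le> x" "x \<le> b"
 then have "0 < x" "x < b1" using assms by auto
 then show "\<exists>y. (sc has_real_derivative y) (at x) \<and> 0 < y" by (intro exI[of _ "pf x * sc x / x"] conjI dsc dsc_pos)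
qed

lemma pf_cont: "continuous_on {0<..<b1} pf"
proof -
 have "continuous_on {0<..<b1} \<phi>" "continuous_on {0<..<b1} \<phi>'"
  by (auto intro!: continuous_at_imp_continuous_on DERIV_isCont[OF dphi] DERIV_isCont[OF dphi'])
 then show ?thesis unfolding p_profile_def[abs_def]
 proof (intro continuous_intros basic(7) ballI)
  fix x assume "x \<in> {0<..<b1}"
  then have "\<phi>' x < 0" "0 < \<phi> x - x * \<phi>' x" using phi'_neg[of x] denom_pos[of x] by auto
  then show "\<phi>' x * (\<phi> x - x * \<phi>' x) \<noteq> 0" by simp
 qed
qed

end

section \<open>The inverse radial function and the inverse of s\<close>

context reinhardt_domain begin

definition b2 :: real where "b2 = \<phi> 0"
abbreviation "\<psi> \<equiv> inv_into {0..b1} \<phi>"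

lemma b2_pos: "0 < b2" unfolding b2_def using phi_pos[of 0] basic(1) by simp

lemma phi_inj: "inj_on \<phi> {0..b1}"
proof (rule linorder_inj_onI')
 fix i j assume "i \<in> {0..b1}" "j \<in> {0..b1}" "i < j"
 then show "\<phi> i \<noteq> \<phi> j" using phi_strict[of i j] by simp
qed

lemma psi_phi: "0 \<le> r ==> r \<le> b1 ==> \<psi> (\<phi> r) = r"
 using inv_into_f_f[OF phi_inj, of r] by simp

lemma phi_surj: assumes "0 \<le> y" "y \<le> b2" shows "\<exists>r. 0 \<le> r \<and> r \<le> b1 \<and> \<phi> r = y"
 by (rule IVT2') (use assms basic in \<open>auto simp: b2_def\<close>)

lemma psi_bounds: assumes "0 < y" "y < b2" shows "0 < \<psi> y" "\<psi> y < b1" "\<phi> (\<psi> y) = y"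
proof -
 obtain r where r: "0 \<le> r" "r \<le> b1" "\<phi> r = y" using phi_surj[of y] assms by auto
 have "r \<noteq> 0" "r \<noteq> b1" using r(3) assms basic(6) by (auto simp: b2_def)
 moreover have "\<psi> y = r" using psi_phi[OF r(1,2)] r(3) by simp
 ultimately show "0 < \<psi> y" "\<psi> y < b1" "\<phi> (\<psi> y) = y" using r by auto
qed

lemma phi_lt_b2: "0 < r ==> r \<le> b1 ==> \<phi> r < b2" using phi_strict[of 0 r] by (simp add: b2_def)

lemma phi_isCont: "0 < r ==> r < b1 ==> isCont \<phi> r" by (rule DERIV_isCont[OF dphi])

lemma psi_isCont: assumes y: "0 < y" "y < b2" shows "isCont \<psi> y"
proof -
 have p: "0 < \<psi> y" "\<psi> y < b1" "\<phi> (\<psi> y) = y" using psi_bounds[OF y] by auto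
 define d where "d = min (\<psi> y) (b1 - \<psi> y) / 2"
 have d: "0 < d" using p by (simp add: d_def)
 have "isCont \<psi> (\<phi> (\<psi> y))"
 proof (rule isCont_inverse_function[where f = \<phi> and g = \<psi>, OF d])
  fix z assume "\<bar>z - \<psi> y\<bar> \<le> d"
  then have "0 < z" "z < b1" using p unfolding d_def by (auto simp: min_def abs_if split: if_splits)
  then show "\<psi> (\<phi> z) = z" "isCont \<phi> z" by (auto intro: psi_phi phi_isCont)
 qed
 then show ?thesis using p by simp
qed

lemma dpsi: assumes y: "0 < y" "y < b2" shows "(\<psi> has_real_derivative inverse (\<phi>' (\<psi> y))) (at y)"
proof (rule DERIV_inverse_function[where f = \<phi> and a = 0 and b = b2])
 show "(\<phi> has_real_derivative \<phi>' (\<psi> y)) (at (\<psi> y))" using psi_bounds[OF y] by (intro dphi)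
 show "\<phi>' (\<psi> y) \<noteq> 0" using phi'_neg[OF psi_bounds(1,2)[OF y]] by simp
qed (use y psi_bounds psi_isCont in auto)

lemma deriv_psi: "0 < y ==> y < b2 ==> deriv \<psi> y = inverse (\<phi>' (\<psi> y))"
 by (rule DERIV_imp_deriv[OF dpsi])

lemma deriv2_psi: assumes y: "0 < y" "y < b2" shows "deriv (deriv \<psi>) y = - \<phi>'' (\<psi> y) / (\<phi>' (\<psi> y)) ^ 3"
proof (rule DERIV_imp_deriv)
 have p: "0 < \<psi> y" "\<psi> y < b1" "\<phi>' (\<psi> y) \<noteq> 0" using psi_bounds[OF y] phi'_neg[of "\<psi> y"] by auto
 have "((%y. \<phi>' (\<psi> y)) has_real_derivative \<phi>'' (\<psi> y) * inverse (\<phi>' (\<psi> y))) (at y)"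
  by (rule DERIV_chain2[OF dphi'[OF p(1,2)] dpsi[OF y]])
 from DERIV_inverse'[OF this p(3)]
 have "((%y. inverse (\<phi>' (\<psi> y))) has_real_derivative - (inverse (\<phi>' (\<psi> y)) * (\<phi>'' (\<psi> y) * inverse (\<phi>' (\<psi> y))) * inverse (\<phi>' (\<psi> y)))) (at y)" .
 moreover have "- (inverse a * (b * inverse a) * inverse a) = - b / a ^ 3" for a b :: real
  by (simp add: power3_eq_cube divide_inverse)
 ultimately have "((%y. inverse (\<phi>' (\<psi> y))) has_real_derivative - \<phi>'' (\<psi> y) / (\<phi>' (\<psi> y)) ^ 3) (at y)" by simp
 then show "(deriv \<psi> has_real_derivative - \<phi>'' (\<psi> y) / (\<phi>' (\<psi> y)) ^ 3) (at y)"
  by (rule has_field_derivative_transform_within_open[of _ _ _ "{0<..<b2}"]) (use y deriv_psi in auto)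
qed

text \<open>Describing the same curve with the axes exchanged turns s into 1 - s and leaves the
  osculating exponent alone. So the behaviour at r1 = b1 follows from the expansion of the inverse
  function at 0.\<close>

lemma coords_psi:
 assumes r: "0 < r" "r < b1" shows "s_coord \<psi> (\<phi> r) = 1 - sc r" "p_profile \<psi> (\<phi> r) = pf r"
proof -
 have y: "0 < \<phi> r" "\<phi> r < b2" using phi_pos[of r] phi_lt_b2[of r] r by auto
 have p: "\<psi> (\<phi> r) = r" using psi_phi[of r] r by simp
 have n: "\<phi>' r \<noteq> 0" "\<phi> r - r * \<phi>' r \<noteq> 0" using phi'_neg[OF r] denom_pos[OF r] by auto
 have D: "r - \<phi> r * inverse (\<phi>' r) = - (\<phi> r - r * \<phi>' r) / \<phi>' r" using n by (simp add: field_simps)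
 show "s_coord \<psi> (\<phi> r) = 1 - sc r"
  unfolding s_coord_def[of \<psi>] deriv_psi[OF y] p D sc_01(3)[OF r] using n by (simp add: field_simps)
 have "\<phi> r * r * (- \<phi>'' r / \<phi>' r ^ 3) / (inverse (\<phi>' r) * (- (\<phi> r - r * \<phi>' r) / \<phi>' r)) = r * \<phi> r * \<phi>'' r / (\<phi>' r * (\<phi> r - r * \<phi>' r))"
  using n by (simp add: power3_eq_cube divide_simps) (simp add: algebra_simps)
 then show "p_profile \<psi> (\<phi> r) = pf r"
  unfolding p_profile_def deriv_psi[OF y] deriv2_psi[OF y] p D by simp
qed

lemma at_left_b1: "filterlim \<phi> (at_right 0) (at_left b1)"
 unfolding filterlim_at
proof
 have "(\<phi> \<longlongrightarrow> \<phi> b1) (at b1 within {0..b1})" using basic(1,4) by (simp add: continuous_on_def)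
 then show "(\<phi> \<longlongrightarrow> 0) (at_left b1)" using basic(1,6) by (simp add: at_within_Icc_at_left)
 have "\<forall>\<^sub>F r in at_left b1. 0 < r \<and> r < b1"
  unfolding eventually_at_left_field using basic(1) by (intro exI[of _ 0]) auto
 then show "\<forall>\<^sub>F r in at_left b1. \<phi> r \<in> {0<..} \<and> \<phi> r \<noteq> 0"
 proof eventually_elim
  case (elim r) then show ?case using phi_pos[of r] by simp
 qed
qed

lemma ev_left: "\<forall>\<^sub>F r in at_left b1. 0 < r \<and> r < b1"
 unfolding eventually_at_left_field using basic(1) by (intro exI[of _ 0]) auto

lemma ev_right: "\<forall>\<^sub>F r in at_right 0. 0 < r \<and> r < b1"
 unfolding eventually_at_right_field using basic(1) by (intro exI[of _ b1]) auto

lemma limits_0: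
 "\<exists>k>0. ((%r. sc r / r powr p1) \<longlongrightarrow> k) (at_right 0)" "(pf \<longlongrightarrow> p1) (at_right 0)" "(\<phi>' \<longlongrightarrow> 0) (at_right 0)" "(\<phi> \<longlongrightarrow> b2) (at_right 0)"
 using coordinate_asymptotics[OF basic(9,2)] by (auto simp: b2_def)

lemma limits_1:
 "\<exists>k>0. ((%r. (1 - sc r) / \<phi> r powr p2) \<longlongrightarrow> k) (at_left b1)" "(pf \<longlongrightarrow> p2) (at_left b1)" "((%r. 1 / \<phi>' r) \<longlongrightarrow> 0) (at_left b1)"
proof -
 note ca = coordinate_asymptotics[OF basic(10,3)]
 obtain k where k: "0 < k" "((%y. s_coord \<psi> y / y powr p2) \<longlongrightarrow> k) (at_right 0)" using ca(1) by (elim exE conjE)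
 have "((%r. s_coord \<psi> (\<phi> r) / \<phi> r powr p2) \<longlongrightarrow> k) (at_left b1)" by (rule filterlim_compose[OF k(2) at_left_b1])
 moreover have "\<forall>\<^sub>F r in at_left b1. s_coord \<psi> (\<phi> r) / \<phi> r powr p2 = (1 - sc r) / \<phi> r powr p2"
  using ev_left by eventually_elim (simp add: coords_psi)
 ultimately have "((%r. (1 - sc r) / \<phi> r powr p2) \<longlongrightarrow> k) (at_left b1)" by (rule Lim_transform_eventually)
 then show "\<exists>k>0. ((%r. (1 - sc r) / \<phi> r powr p2) \<longlongrightarrow> k) (at_left b1)" using k(1) by blast
 have "((%r. p_profile \<psi> (\<phi> r)) \<longlongrightarrow> p2) (at_left b1)" by (rule filterlim_compose[OF ca(2) at_left_b1])
 moreover have "\<forall>\<^sub>F r in at_left b1. p_profile \<psi> (\<phi> r) = pf r"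
  using ev_left by eventually_elim (simp add: coords_psi)
 ultimately show "(pf \<longlongrightarrow> p2) (at_left b1)" by (rule Lim_transform_eventually)
 have "((%r. deriv \<psi> (\<phi> r)) \<longlongrightarrow> 0) (at_left b1)" by (rule filterlim_compose[OF ca(3) at_left_b1])
 moreover have "\<forall>\<^sub>F r in at_left b1. deriv \<psi> (\<phi> r) = 1 / \<phi>' r"
  using ev_left
 proof eventually_elim
  case (elim r)
  then show ?case using deriv_psi[of "\<phi> r"] phi_pos[of r] phi_lt_b2[of r] psi_phi[of r] by (simp add: inverse_eq_divide)
 qed
 ultimately show "((%r. 1 / \<phi>' r) \<longlongrightarrow> 0) (at_left b1)" by (rule Lim_transform_eventually)
qed

lemma sc_lim_0: "(sc \<longlongrightarrow> 0) (at_right 0)"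
proof -
 obtain k where k: "0 < k" "((%r. sc r / r powr p1) \<longlongrightarrow> k) (at_right 0)" using limits_0(1) by (elim exE conjE)
 have "((%r. r powr p1) \<longlongrightarrow> 0) (at_right 0)" using basic(2) by real_asymp
 from tendsto_mult[OF k(2) this] have "((%r. sc r / r powr p1 * r powr p1) \<longlongrightarrow> 0) (at_right 0)" by simp
 moreover have "\<forall>\<^sub>F r in at_right 0. sc r / r powr p1 * r powr p1 = sc r" using ev_right by eventually_elim simp
 ultimately show ?thesis by (rule Lim_transform_eventually)
qed

lemma sc_lim_1: "(sc \<longlongrightarrow> 1) (at_left b1)"
proof -
 obtain k where k: "0 < k" "((%r. (1 - sc r) / \<phi> r powr p2) \<longlongrightarrow> k) (at_left b1)" using limits_1(1) by (elim exE conjE)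
 have "((%r. r powr p2) \<longlongrightarrow> 0) (at_right 0)" using basic(3) by real_asymp
 from filterlim_compose[OF this at_left_b1] have "((%r. \<phi> r powr p2) \<longlongrightarrow> 0) (at_left b1)" .
 from tendsto_mult[OF k(2) this] have "((%r. (1 - sc r) / \<phi> r powr p2 * \<phi> r powr p2) \<longlongrightarrow> 0) (at_left b1)" by simp
 moreover have "\<forall>\<^sub>F r in at_left b1. (1 - sc r) / \<phi> r powr p2 * \<phi> r powr p2 = 1 - sc r"
  using ev_left
 proof eventually_elim
  case (elim r) then show ?case using phi_pos[of r] by simp
 qed
 ultimately have "((%r. 1 - sc r) \<longlongrightarrow> 0) (at_left b1)" by (rule Lim_transform_eventually)
 from tendsto_diff[OF tendsto_const this, of 1] show ?thesis by simp
qed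

text \<open>The radius r1 as a function of the coordinate s.\<close>

definition rr :: "real \<Rightarrow> real" where "rr = inv_into {0<..<b1} sc"

lemma sc_inj: "inj_on sc {0<..<b1}"
proof (rule linorder_inj_onI')
 fix i j assume "i \<in> {0<..<b1}" "j \<in> {0<..<b1}" "i < j"
 then show "sc i \<noteq> sc j" using sc_strict[of i j] by simp
qed

lemma sc_surj: assumes s: "0 < s" "s < 1" shows "\<exists>r. 0 < r \<and> r < b1 \<and> sc r = s"
proof -
 have "\<forall>\<^sub>F r in at_right 0. sc r < s" using order_tendstoD(2)[OF sc_lim_0 s(1)] .
 from eventually_happens'[OF trivial_limit_at_right_real eventually_conj[OF this ev_right]]
 obtain a where a: "sc a < s" "0 < a" "a < b1" by auto
 have "\<forall>\<^sub>F r in at_left b1. s < sc r" using order_tendstoD(1)[OF sc_lim_1 s(2)] .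
 from eventually_happens'[OF trivial_limit_at_left_real eventually_conj[OF this ev_left]]
 obtain b where b: "s < sc b" "0 < b" "b < b1" by auto
 have ab: "a \<le> b" using sc_strict[of b a] a b by force
 have "\<exists>x\<ge>a. x \<le> b \<and> sc x = s"
 proof (rule IVT'[OF _ _ ab])
  show "continuous_on {a..b} sc"
   by (rule continuous_at_imp_continuous_on) (use a b in \<open>auto intro!: DERIV_isCont[OF dsc]\<close>)
 qed (use a b in auto)
 then obtain x where "a \<le> x" "x \<le> b" "sc x = s" by auto
 then show ?thesis using a b by (intro exI[of _ x]) auto
qed

lemma rr_props: assumes s: "0 < s" "s < 1" shows "0 < rr s" "rr s < b1" "sc (rr s) = s"
proof -
 have "s \<in> sc ` {0<..<b1}" using sc_surj[OF s] by force
 from inv_into_into[OF this] f_inv_into_f[OF this] show "0 < rr s" "rr s < b1" "sc (rr s) = s" by (auto simp: rr_def)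
qed

lemma rr_sc: "0 < r ==> r < b1 ==> rr (sc r) = r"
 unfolding rr_def using inv_into_f_f[OF sc_inj, of r] by simp

lemma rr_isCont: assumes s: "0 < s" "s < 1" shows "isCont rr s"
proof -
 have p: "0 < rr s" "rr s < b1" "sc (rr s) = s" using rr_props[OF s] by auto
 define d where "d = min (rr s) (b1 - rr s) / 2"
 have d: "0 < d" using p by (simp add: d_def)
 have "isCont rr (sc (rr s))"
 proof (rule isCont_inverse_function[where f = sc and g = rr, OF d])
  fix z assume "\<bar>z - rr s\<bar> \<le> d"
  then have "0 < z" "z < b1" using p unfolding d_def by (auto simp: min_def abs_if split: if_splits)
  then show "rr (sc z) = z" "isCont sc z" by (auto intro: rr_sc DERIV_isCont[OF dsc])
 qed
 then show ?thesis using p by simp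
qed

lemma drr: assumes s: "0 < s" "s < 1" shows "(rr has_real_derivative rr s / (pf (rr s) * s)) (at s)"
proof -
 note p = rr_props[OF s]
 have "(rr has_real_derivative inverse (pf (rr s) * sc (rr s) / rr s)) (at s)"
 proof (rule DERIV_inverse_function[where f = sc and a = 0 and b = 1])
  show "(sc has_real_derivative pf (rr s) * sc (rr s) / rr s) (at (rr s))" by (rule dsc[OF p(1,2)])
  show "pf (rr s) * sc (rr s) / rr s \<noteq> 0" using dsc_pos[OF p(1,2)] by (metis less_irrefl)
 qed (use s rr_props rr_isCont in auto)
 then show ?thesis using p by simp
qed

lemma rr_strict: assumes "0 < s" "s < t" "t < 1" shows "rr s < rr t"
proof (rule ccontr)
 assume n: "\<not> rr s < rr t"
 have p: "0 < rr s" "rr s < b1" "sc (rr s) = s" "0 < rr t" "rr t < b1" "sc (rr t) = t"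
  using rr_props[of s] rr_props[of t] assms by auto
 show False using sc_strict[of "rr t" "rr s"] n p assms by (cases "rr t = rr s") auto
qed

lemma rr_lim_0: "filterlim rr (at_right 0) (at_right 0)"
 unfolding filterlim_at
proof
 have ev: "\<forall>\<^sub>F s in at_right (0::real). 0 < s \<and> s < 1" unfolding eventually_at_right_field by (intro exI[of _ 1]) auto
 then show "\<forall>\<^sub>F s in at_right 0. rr s \<in> {0<..} \<and> rr s \<noteq> 0" by eventually_elim (use rr_props in force)
 show "(rr \<longlongrightarrow> 0) (at_right 0)"
 proof (rule order_tendstoI)
  fix a :: real assume "a < 0"
  show "\<forall>\<^sub>F s in at_right 0. a < rr s" using ev by eventually_elim (use rr_props \<open>a < 0\<close> in force)
 next
  fix a :: real assume a: "0 < a"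
  define c where "c = min a b1 / 2"
  have c: "0 < c" "c < b1" "c < a" using a basic(1) by (auto simp: c_def)
  have "\<forall>\<^sub>F s in at_right 0. 0 < s \<and> s < sc c" using sc_01[OF c(1,2)] unfolding eventually_at_right_field by (intro exI[of _ "sc c"]) auto
  then show "\<forall>\<^sub>F s in at_right 0. rr s < a"
  proof eventually_elim
   case (elim s)
   then have "rr s < rr (sc c)" using sc_01[OF c(1,2)] by (intro rr_strict) auto
   then show ?case using rr_sc[OF c(1,2)] c by simp
  qed
 qed
qed

lemma rr_lim_1: "filterlim rr (at_left b1) (at_left 1)"
 unfolding filterlim_at
proof
 have ev: "\<forall>\<^sub>F s in at_left (1::real). 0 < s \<and> s < 1" unfolding eventually_at_left_field by (intro exI[of _ 0]) auto
 then show "\<forall>\<^sub>F s in at_left 1. rr s \<in> {..<b1} \<and> rr s \<noteq> b1" by eventually_elim (use rr_props in force)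
 show "(rr \<longlongrightarrow> b1) (at_left 1)"
 proof (rule order_tendstoI)
  fix a :: real assume "b1 < a"
  show "\<forall>\<^sub>F s in at_left 1. rr s < a" using ev by eventually_elim (use rr_props \<open>b1 < a\<close> in force)
 next
  fix a :: real assume a: "a < b1"
  define c where "c = (max a 0 + b1) / 2"
  have c: "0 < c" "c < b1" "a < c" using a basic(1) by (auto simp: c_def max_def)
  have "\<forall>\<^sub>F s in at_left 1. sc c < s \<and> s < 1" using sc_01[OF c(1,2)] unfolding eventually_at_left_field by (intro exI[of _ "sc c"]) auto
  then show "\<forall>\<^sub>F s in at_left 1. a < rr s"
  proof eventually_elim
   case (elim s)
   then have "rr (sc c) < rr s" using sc_01[OF c(1,2)] by (intro rr_strict) auto
   then show ?case using rr_sc[OF c(1,2)] c by simp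
  qed
 qed
qed

end

section \<open>The profile of a domain with a measure of order q\<close>

definition ext01 :: "real \<Rightarrow> real \<Rightarrow> (real \<Rightarrow> real) \<Rightarrow> real \<Rightarrow> real" where
 "ext01 l0 l1 f s = (if s = 0 then l0 else if s = 1 then l1 else f s)"

lemma ext01_simps[simp]: "ext01 l0 l1 f 0 = l0" "ext01 l0 l1 f 1 = l1" "0 < s ==> s < 1 ==> ext01 l0 l1 f s = f s"
 by (auto simp: ext01_def)

lemma continuous_on_ext01:
 assumes c: "continuous_on {0<..<1} f" and l0: "(f \<longlongrightarrow> l0) (at_right 0)" and l1: "(f \<longlongrightarrow> l1) (at_left 1)"
 shows "continuous_on {0..1} (ext01 l0 l1 f)"
proof (rule continuous_on_IccI)
 have "\<forall>\<^sub>F s in at_right (0::real). 0 < s \<and> s < 1" unfolding eventually_at_right_field by (intro exI[of _ 1]) auto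
 then have "\<forall>\<^sub>F s in at_right 0. f s = ext01 l0 l1 f s" by eventually_elim simp
 from Lim_transform_eventually[OF l0 this] show "(ext01 l0 l1 f \<longlongrightarrow> ext01 l0 l1 f 0) (at_right 0)" by simp
 have "\<forall>\<^sub>F s in at_left (1::real). 0 < s \<and> s < 1" unfolding eventually_at_left_field by (intro exI[of _ 0]) auto
 then have "\<forall>\<^sub>F s in at_left 1. f s = ext01 l0 l1 f s" by eventually_elim simp
 from Lim_transform_eventually[OF l1 this] show "(ext01 l0 l1 f \<longlongrightarrow> ext01 l0 l1 f 1) (at_left 1)" by simp
 fix x :: real assume x: "0 < x" "x < 1"
 have "f \<midarrow>x\<rightarrow> f x" using c x by (simp add: continuous_on_eq_continuous_at isCont_def)
 moreover have "\<forall>\<^sub>F s in at x. f s = ext01 l0 l1 f s"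
 proof -
  have "\<forall>\<^sub>F s in nhds x. s \<in> {0<..<1}" by (rule eventually_nhds_in_open) (use x in auto)
  then have "\<forall>\<^sub>F s in at x. s \<in> {0<..<1}" unfolding eventually_at_filter by eventually_elim simp
  then show ?thesis by eventually_elim simp
 qed
 ultimately have "ext01 l0 l1 f \<midarrow>x\<rightarrow> f x" by (rule Lim_transform_eventually)
 then show "ext01 l0 l1 f \<midarrow>x\<rightarrow> ext01 l0 l1 f x" using x by simp
qed simp

lemma pos_cont_ext01:
 assumes "continuous_on {0<..<1} f" "(f \<longlongrightarrow> l0) (at_right 0)" "(f \<longlongrightarrow> l1) (at_left 1)" "0 < l0" "0 < l1" "!!s. 0 < s ==> s < 1 ==> 0 < f s"
 shows "pos_cont (ext01 l0 l1 f)"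
 unfolding pos_cont_def using continuous_on_ext01[OF assms(1-3)] assms(4-6) by (auto simp: ext01_def)

context reinhardt_domain begin

lemma at_right_01: "\<forall>\<^sub>F s in at_right (0::real). 0 < s \<and> s < 1" unfolding eventually_at_right_field by (intro exI[of _ 1]) auto
lemma at_left_01: "\<forall>\<^sub>F s in at_left (1::real). 0 < s \<and> s < 1" unfolding eventually_at_left_field by (intro exI[of _ 0]) auto

lemma rr_cont: "continuous_on {0<..<1} rr"
 by (rule continuous_at_imp_continuous_on) (auto intro: rr_isCont)

lemma comp_rr_cont: assumes "continuous_on {0<..<b1} f" shows "continuous_on {0<..<1} (%s. f (rr s))"
 by (rule continuous_on_compose2[OF assms rr_cont]) (use rr_props in auto)

lemma phi_cont: "continuous_on {0<..<b1} \<phi>" by (rule continuous_on_subset[OF basic(4)]) auto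
lemma phi'_cont: "continuous_on {0<..<b1} \<phi>'"
 by (auto intro!: continuous_at_imp_continuous_on DERIV_isCont[OF dphi'])

text \<open>The distance from the origin to the tangent line of the curve r2 = phi(r1) at the point
  over r. It stays between positive bounds up to both corners, with limits b2 and b1.\<close>

definition sp :: "real \<Rightarrow> real" where "sp r = (\<phi> r - r * \<phi>' r) / sqrt (1 + (\<phi>' r)\<^sup>2)"

lemma sqrt_pos: "0 < sqrt (1 + x\<^sup>2)" for x :: real by (simp add: add_pos_nonneg)

lemma sp_pos: "0 < r ==> r < b1 ==> 0 < sp r"
 unfolding sp_def using denom_pos sqrt_pos by (intro divide_pos_pos) auto

lemma sp_cont: "continuous_on {0<..<b1} sp"
 unfolding sp_def[abs_def] using sqrt_pos by (intro continuous_intros phi_cont phi'_cont ballI) (metis less_irrefl)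

lemma sp_lim_0: "(sp \<longlongrightarrow> b2) (at_right 0)"
proof -
 have "((%r. (\<phi> r - r * \<phi>' r) / sqrt (1 + (\<phi>' r)\<^sup>2)) \<longlongrightarrow> (b2 - 0 * 0) / sqrt (1 + 0\<^sup>2)) (at_right 0)"
  by (intro tendsto_intros limits_0) auto
 then show ?thesis by (simp add: sp_def[abs_def])
qed

lemma sp_lim_1: "(sp \<longlongrightarrow> b1) (at_left b1)"
proof -
 have p0: "(\<phi> \<longlongrightarrow> 0) (at_left b1)" using at_left_b1 by (simp add: filterlim_at)
 have "((%r. (r - \<phi> r * (1 / \<phi>' r)) / sqrt ((1 / \<phi>' r)\<^sup>2 + 1)) \<longlongrightarrow> (b1 - 0 * 0) / sqrt (0\<^sup>2 + 1)) (at_left b1)"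
  by (intro tendsto_intros limits_1 p0) auto
 moreover have "\<forall>\<^sub>F r in at_left b1. (r - \<phi> r * (1 / \<phi>' r)) / sqrt ((1 / \<phi>' r)\<^sup>2 + 1) = sp r"
  using ev_left
 proof eventually_elim
  case (elim r)
  have n: "\<phi>' r < 0" using phi'_neg elim by simp
  have "(1 / \<phi>' r)\<^sup>2 + 1 = (1 + (\<phi>' r)\<^sup>2) / (\<phi>' r)\<^sup>2" using n by (simp add: field_simps)
  then have "sqrt ((1 / \<phi>' r)\<^sup>2 + 1) = sqrt (1 + (\<phi>' r)\<^sup>2) / (- \<phi>' r)" using n by (simp add: real_sqrt_divide)
  moreover have "r - \<phi> r * (1 / \<phi>' r) = (\<phi> r - r * \<phi>' r) / (- \<phi>' r)" using n by (simp add: field_simps)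
  moreover have "(x / c) / (y / c) = x / y" if "c \<noteq> 0" for x y c :: real using that by simp
  ultimately show ?case unfolding sp_def using n by (metis less_irrefl neg_equal_0_iff_equal)
 qed
 ultimately show ?thesis using Lim_transform_eventually by fastforce
qed

text \<open>The norm of the Levi form as a function of the radius, see \<open>levi_norm_eq\<close>.
  Likewise \<open>SD\<close> below is the density of surface measure.\<close>

definition LV :: "real \<Rightarrow> real" where
 "LV r = (\<phi> r - r * \<phi>' r)\<^sup>2 * (pf r * sc r / r) / (4 * (1 + (\<phi>' r)\<^sup>2) * sqrt (1 + (\<phi>' r)\<^sup>2) * r * \<phi> r)"

definition SD :: "real \<Rightarrow> real" where "SD r = r * \<phi> r * sqrt (1 + (\<phi>' r)\<^sup>2)"

text \<open>Two forms for two purposes. The first one displays the corner behaviour of the Levi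
  form, of order s^(1 - 2/p1) at s = 0. The last one, in which r / (p s) is dr/ds, shows that |Levi
  form| times surface measure, the case q = 0, has a density in s that is bounded above and below; a
  measure of order q differs from it by the power -q of the Levi form.\<close>

lemma LV_eq: assumes r: "0 < r" "r < b1"
 shows "LV r = sp r ^ 3 / 4 * pf r * (sc r * (1 - sc r)) / (r * \<phi> r)\<^sup>2" "0 < LV r" "0 < SD r"
  "LV r * SD r * (r / (pf r * sc r)) = (sp r)\<^sup>2 / 4"
proof -
 define D where "D = \<phi> r - r * \<phi>' r"
 define T where "T = sqrt (1 + (\<phi>' r)\<^sup>2)"
 have T: "0 < T" "1 + (\<phi>' r)\<^sup>2 = T\<^sup>2" using sqrt_pos by (auto simp: T_def)
 have D: "0 < D" using denom_pos[OF r] by (simp add: D_def)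
 have f: "0 < \<phi> r" using phi_pos r by simp
 have p: "0 < pf r" "0 < sc r" using pf_gt_1[OF r] sc_01[OF r] by auto
 have S: "sp r = D / T" by (simp add: sp_def D_def T_def)
 have sc1: "1 - sc r = \<phi> r / D" unfolding sc_01(3)[OF r] D_def ..
 have LV: "LV r = D\<^sup>2 * (pf r * sc r / r) / (4 * T\<^sup>2 * T * r * \<phi> r)"
  unfolding LV_def D_def[symmetric] T_def[symmetric] unfolding T(2) ..
 show "LV r = sp r ^ 3 / 4 * pf r * (sc r * (1 - sc r)) / (r * \<phi> r)\<^sup>2"
  unfolding LV S sc1 using D T(1) f r by (simp add: field_simps power2_eq_square power3_eq_cube)
 show "0 < LV r" unfolding LV using D T(1) f r p by simp
 show "0 < SD r" unfolding SD_def using sqrt_pos f r by simp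
 show "LV r * SD r * (r / (pf r * sc r)) = (sp r)\<^sup>2 / 4"
  unfolding LV S SD_def T_def[symmetric] using D T(1) f r p by (simp add: field_simps power2_eq_square)
qed

definition prof_P :: "real \<Rightarrow> real" where "prof_P = ext01 (1 / p1) (1 / p2) (%s. 1 / pf (rr s))"

text \<open>The asymptotics of s in terms of r, solved for r.\<close>

lemma c1_limit: "\<exists>l>0. ((%s. rr s * s powr (- (1 / p1))) \<longlongrightarrow> l) (at_right 0)"
proof -
 obtain k where k: "0 < k" "((%r. sc r / r powr p1) \<longlongrightarrow> k) (at_right 0)" using limits_0(1) by (elim exE conjE)
 have "((%s. (sc (rr s) / rr s powr p1) powr (- (1 / p1))) \<longlongrightarrow> k powr (- (1 / p1))) (at_right 0)"
  by (intro tendsto_powr filterlim_compose[OF k(2) rr_lim_0] tendsto_const) (use k in auto)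
 moreover have "\<forall>\<^sub>F s in at_right 0. (sc (rr s) / rr s powr p1) powr (- (1 / p1)) = rr s * s powr (- (1 / p1))"
  using at_right_01
 proof eventually_elim
  case (elim s)
  have r: "0 < rr s" "rr s < b1" "sc (rr s) = s" using rr_props elim by auto
  have "(s / rr s powr p1) powr (- (1 / p1)) = s powr (- (1 / p1)) / (rr s powr p1) powr (- (1 / p1))"
   using elim by (simp add: powr_divide)
  also have "(rr s powr p1) powr (- (1 / p1)) = rr s powr (- 1)" using basic(2) by (simp add: powr_powr)
  finally show ?case using r by (simp add: powr_minus field_simps)
 qed
 ultimately have "((%s. rr s * s powr (- (1 / p1))) \<longlongrightarrow> k powr (- (1 / p1))) (at_right 0)" by (rule Lim_transform_eventually)
 then show ?thesis using k(1) by (intro exI[of _ "k powr (- (1 / p1))"]) auto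
qed

lemma c2_limit: "\<exists>l>0. ((%s. \<phi> (rr s) * (1 - s) powr (- (1 / p2))) \<longlongrightarrow> l) (at_left 1)"
proof -
 obtain k where k: "0 < k" "((%r. (1 - sc r) / \<phi> r powr p2) \<longlongrightarrow> k) (at_left b1)" using limits_1(1) by (elim exE conjE)
 have "((%s. ((1 - sc (rr s)) / \<phi> (rr s) powr p2) powr (- (1 / p2))) \<longlongrightarrow> k powr (- (1 / p2))) (at_left 1)"
  by (intro tendsto_powr filterlim_compose[OF k(2) rr_lim_1] tendsto_const) (use k in auto)
 moreover have "\<forall>\<^sub>F s in at_left 1. ((1 - sc (rr s)) / \<phi> (rr s) powr p2) powr (- (1 / p2)) = \<phi> (rr s) * (1 - s) powr (- (1 / p2))"
  using at_left_01
 proof eventually_elim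
  case (elim s)
  have r: "0 < rr s" "rr s < b1" "sc (rr s) = s" using rr_props elim by auto
  have f: "0 < \<phi> (rr s)" using phi_pos r by simp
  have "((1 - s) / \<phi> (rr s) powr p2) powr (- (1 / p2)) = (1 - s) powr (- (1 / p2)) / (\<phi> (rr s) powr p2) powr (- (1 / p2))"
   using elim by (simp add: powr_divide)
  also have "(\<phi> (rr s) powr p2) powr (- (1 / p2)) = \<phi> (rr s) powr (- 1)" using basic(3) by (simp add: powr_powr)
  finally show ?case using r f by (simp add: powr_minus field_simps)
 qed
 ultimately have "((%s. \<phi> (rr s) * (1 - s) powr (- (1 / p2))) \<longlongrightarrow> k powr (- (1 / p2))) (at_left 1)" by (rule Lim_transform_eventually)
 then show ?thesis using k(1) by (intro exI[of _ "k powr (- (1 / p2))"]) auto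
qed

definition c1 :: real where "c1 = (SOME l. 0 < l \<and> ((%s. rr s * s powr (- (1 / p1))) \<longlongrightarrow> l) (at_right 0))"
definition c2 :: real where "c2 = (SOME l. 0 < l \<and> ((%s. \<phi> (rr s) * (1 - s) powr (- (1 / p2))) \<longlongrightarrow> l) (at_left 1))"

lemma c1: "0 < c1" "((%s. rr s * s powr (- (1 / p1))) \<longlongrightarrow> c1) (at_right 0)"
 using someI_ex[OF c1_limit] by (auto simp: c1_def)
lemma c2: "0 < c2" "((%s. \<phi> (rr s) * (1 - s) powr (- (1 / p2))) \<longlongrightarrow> c2) (at_left 1)"
 using someI_ex[OF c2_limit] by (auto simp: c2_def)

definition prof_C1 :: "real \<Rightarrow> real" where "prof_C1 = ext01 c1 b1 (%s. rr s * s powr (- (1 / p1)))"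
definition prof_C2 :: "real \<Rightarrow> real" where "prof_C2 = ext01 b2 c2 (%s. \<phi> (rr s) * (1 - s) powr (- (1 / p2)))"

lemma rr_tendsto: "(rr \<longlongrightarrow> 0) (at_right 0)" "(rr \<longlongrightarrow> b1) (at_left 1)"
 using rr_lim_0 rr_lim_1 by (auto simp: filterlim_at)

lemma prof_pos_cont: "pos_cont prof_P" "pos_cont prof_C1" "pos_cont prof_C2"
proof -
 show "pos_cont prof_P" unfolding prof_P_def
 proof (rule pos_cont_ext01)
  show "continuous_on {0<..<1} (%s. 1 / pf (rr s))"
  proof (intro continuous_intros comp_rr_cont pf_cont ballI)
   fix s :: real assume "s \<in> {0<..<1}"
   then show "pf (rr s) \<noteq> 0" using pf_gt_1[of "rr s"] rr_props[of s] by auto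
  qed
  show "((%s. 1 / pf (rr s)) \<longlongrightarrow> 1 / p1) (at_right 0)"
   by (intro tendsto_divide tendsto_const filterlim_compose[OF limits_0(2) rr_lim_0]) (use basic in auto)
  show "((%s. 1 / pf (rr s)) \<longlongrightarrow> 1 / p2) (at_left 1)"
   by (intro tendsto_divide tendsto_const filterlim_compose[OF limits_1(2) rr_lim_1]) (use basic in auto)
  show "0 < 1 / pf (rr s)" if "0 < s" "s < 1" for s using pf_gt_1[of "rr s"] rr_props[OF that] by auto
 qed (use basic in auto)
 show "pos_cont prof_C1" unfolding prof_C1_def
 proof (rule pos_cont_ext01[OF _ c1(2) _ c1(1) basic(1)])
  show "continuous_on {0<..<1} (%s. rr s * s powr - (1 / p1))" by (intro continuous_intros rr_cont) auto
  have "((%s. rr s * s powr - (1 / p1)) \<longlongrightarrow> b1 * 1 powr - (1 / p1)) (at_left 1)"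
   by (intro tendsto_intros rr_tendsto) auto
  then show "((%s. rr s * s powr - (1 / p1)) \<longlongrightarrow> b1) (at_left 1)" by simp
  show "0 < rr s * s powr - (1 / p1)" if "0 < s" "s < 1" for s using rr_props[OF that] that by simp
 qed
 show "pos_cont prof_C2" unfolding prof_C2_def
 proof (rule pos_cont_ext01[OF _ _ c2(2) b2_pos c2(1)])
  show "continuous_on {0<..<1} (%s. \<phi> (rr s) * (1 - s) powr - (1 / p2))" by (intro continuous_intros comp_rr_cont phi_cont) auto
  have "((%s. \<phi> (rr s) * (1 - s) powr - (1 / p2)) \<longlongrightarrow> b2 * (1 - 0) powr - (1 / p2)) (at_right 0)"
   by (intro tendsto_mult tendsto_powr tendsto_diff tendsto_const tendsto_ident_at filterlim_compose[OF limits_0(4) rr_lim_0]) auto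
  then show "((%s. \<phi> (rr s) * (1 - s) powr - (1 / p2)) \<longlongrightarrow> b2) (at_right 0)" by simp
  show "0 < \<phi> (rr s) * (1 - s) powr - (1 / p2)" if "0 < s" "s < 1" for s using rr_props[OF that] that phi_pos by simp
 qed
qed

definition weight :: "(real \<Rightarrow> real) \<Rightarrow> real \<Rightarrow> real \<Rightarrow> real" where
 "weight h q r = h r * LV r powr (1 - q) * SD r"

text \<open>The density of the measure in s: the density in r times dr/ds = r / (p s).\<close>

definition prof_w :: "(real \<Rightarrow> real) \<Rightarrow> real \<Rightarrow> real \<Rightarrow> real" where
 "prof_w h q s = weight h q (rr s) * (rr s / (pf (rr s) * s))"

definition prof_sup :: "real \<Rightarrow> real" where "prof_sup = ext01 b2 b1 (%s. sp (rr s))"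

text \<open>What remains of \<open>prof_w\<close> once the powers of s and 1 - s are split off: sp^2
  / 4 from the case q = 0, and the power -q of the Levi form with r phi written through
  \<open>prof_C1\<close> and \<open>prof_C2\<close>.\<close>

definition prof_H :: "(real \<Rightarrow> real) \<Rightarrow> real \<Rightarrow> real \<Rightarrow> real" where
 "prof_H h q s = h (ext01 0 b1 rr s) * ((prof_sup s)\<^sup>2 / 4) * (prof_sup s ^ 3 / 4 / prof_P s) powr (- q) * (prof_C1 s * prof_C2 s) powr (2 * q)"

text \<open>The hypothesis on q enters only through the corner exponents -q (1 - 2/p_j), whose
  absolute values it makes smaller than 1.\<close>

theorem profile:
 assumes h: "continuous_on {0..b1} h" "!!r. 0 \<le> r ==> r \<le> b1 ==> 0 < h r"
  and q: "p1 \<noteq> 2 ==> \<bar>q\<bar> < \<bar>p1 / (p1 - 2)\<bar>" "p2 \<noteq> 2 ==> \<bar>q\<bar> < \<bar>p2 / (p2 - 2)\<bar>"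
 shows "leray_profile prof_P prof_C1 prof_C2 (prof_H h q) rr (%s. \<phi> (rr s)) (prof_w h q) (- (q * (1 - 2 / p1))) (- (q * (1 - 2 / p2)))"
proof
 have P01: "prof_P s < 1" if "0 \<le> s" "s \<le> 1" for s
  using that basic(2,3) pf_gt_1[of "rr s"] rr_props[of s] by (auto simp: prof_P_def ext01_def)
 show "continuous_on {0..1} prof_P" "!!s. 0 \<le> s ==> s \<le> 1 ==> 0 < prof_P s" using prof_pos_cont by (auto simp: pos_cont_def)
 show "!!s. 0 \<le> s ==> s \<le> 1 ==> prof_P s < 1" using P01 .
 show "pos_cont prof_C1" "pos_cont prof_C2" using prof_pos_cont by auto
 have sup: "pos_cont prof_sup" unfolding prof_sup_def
 proof (rule pos_cont_ext01)
  show "continuous_on {0<..<1} (%s. sp (rr s))" by (intro comp_rr_cont sp_cont)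
  show "((%s. sp (rr s)) \<longlongrightarrow> b2) (at_right 0)" by (rule filterlim_compose[OF sp_lim_0 rr_lim_0])
  show "((%s. sp (rr s)) \<longlongrightarrow> b1) (at_left 1)" by (rule filterlim_compose[OF sp_lim_1 rr_lim_1])
  show "0 < sp (rr s)" if "0 < s" "s < 1" for s using sp_pos rr_props[OF that] by simp
 qed (use b2_pos basic in auto)
 have rx: "continuous_on {0..1} (ext01 0 b1 rr)" by (rule continuous_on_ext01[OF rr_cont rr_tendsto])
 have rx01: "0 \<le> ext01 0 b1 rr s" "ext01 0 b1 rr s \<le> b1" if "0 \<le> s" "s \<le> 1" for s
  using that rr_props[of s] basic(1) by (auto simp: ext01_def intro: less_imp_le)
 show "pos_cont (prof_H h q)"
  unfolding pos_cont_def
 proof (intro conjI ballI)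
  have hc: "continuous_on {0..1} (%s. h (ext01 0 b1 rr s))"
   by (rule continuous_on_compose2[OF h(1) rx]) (use rx01 in auto)
  have c: "continuous_on {0..1} prof_sup" "continuous_on {0..1} prof_P" "continuous_on {0..1} prof_C1" "continuous_on {0..1} prof_C2"
   using sup prof_pos_cont by (auto simp: pos_cont_def)
  have nz: "prof_sup s ^ 3 / 4 / prof_P s \<noteq> 0" "prof_C1 s * prof_C2 s \<noteq> 0" "prof_P s \<noteq> 0" if "s \<in> {0..1}" for s
  proof -
   have "0 < prof_sup s" "0 < prof_P s" "0 < prof_C1 s" "0 < prof_C2 s" using that sup prof_pos_cont by (auto simp: pos_cont_def)
   then show "prof_sup s ^ 3 / 4 / prof_P s \<noteq> 0" "prof_C1 s * prof_C2 s \<noteq> 0" "prof_P s \<noteq> 0" by auto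
  qed
  have four: "(4 :: real) \<noteq> 0" by simp
  show "continuous_on {0..1} (prof_H h q)" unfolding prof_H_def[abs_def]
   by (intro continuous_intros hc c ballI nz four)
  fix s :: real assume "s \<in> {0..1}"
  then have "0 < prof_sup s" "0 < prof_P s" "0 < prof_C1 s" "0 < prof_C2 s" "0 < h (ext01 0 b1 rr s)"
   using sup prof_pos_cont h(2)[OF rx01, of s] by (auto simp: pos_cont_def)
  then show "0 < prof_H h q s" by (simp add: prof_H_def)
 qed
 fix s :: real assume s: "0 < s" "s < 1"
 note r = rr_props[OF s]
 have f: "0 < \<phi> (rr s)" using phi_pos r by simp
 show e1: "rr s = prof_C1 s * s powr prof_P 0" using s r by (simp add: prof_C1_def prof_P_def powr_minus)
 show e2: "\<phi> (rr s) = prof_C2 s * (1 - s) powr prof_P 1" using s f by (simp add: prof_C2_def prof_P_def powr_minus)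
 show "(rr has_real_derivative rr s * prof_P s / s) (at s)" using drr[OF s] s by (simp add: prof_P_def)
 have "((%s. \<phi> (rr s)) has_real_derivative \<phi>' (rr s) * (rr s / (pf (rr s) * s))) (at s)"
  by (rule DERIV_chain2[OF dphi[OF r(1,2)] drr[OF s]])
 \<comment> \<open>With D = phi - r phi' one has r phi' = - s D and phi = (1 - s) D, hence r phi' /
   s = - phi / (1 - s). This is why both radii have the same P.\<close>
 moreover have "\<phi>' (rr s) * (rr s / (pf (rr s) * s)) = - (\<phi> (rr s) * prof_P s / (1 - s))"
 proof -
  have D: "0 < \<phi> (rr s) - rr s * \<phi>' (rr s)" by (rule denom_pos[OF r(1,2)])
  have a: "s = - rr s * \<phi>' (rr s) / (\<phi> (rr s) - rr s * \<phi>' (rr s))" using sc_01(4)[OF r(1,2)] r by simp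
  have b: "1 - s = \<phi> (rr s) / (\<phi> (rr s) - rr s * \<phi>' (rr s))" using sc_01(3)[OF r(1,2)] r by simp
  have "rr s * \<phi>' (rr s) = - (s * (\<phi> (rr s) - rr s * \<phi>' (rr s)))" using a D by (simp add: field_simps)
  moreover have "\<phi> (rr s) = (1 - s) * (\<phi> (rr s) - rr s * \<phi>' (rr s))" using b D by (simp add: field_simps)
  ultimately have "\<phi>' (rr s) * rr s / s = - (\<phi> (rr s) / (1 - s))" using s by (simp add: field_simps)
  moreover have "\<phi>' (rr s) * (rr s / (pf (rr s) * s)) = (\<phi>' (rr s) * rr s / s) * prof_P s" using s by (simp add: prof_P_def)
  ultimately show ?thesis by simp
 qed
 ultimately show "((%s. \<phi> (rr s)) has_real_derivative - (\<phi> (rr s) * prof_P s / (1 - s))) (at s)" by simp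
 show "prof_w h q s = prof_H h q s * (s powr (- (q * (1 - 2 / p1))) * (1 - s) powr (- (q * (1 - 2 / p2))))"
 proof -
  have LV: "0 < LV (rr s)" "0 < SD (rr s)" using LV_eq[OF r(1,2)] by auto
  have Sp: "0 < sp (rr s)" using sp_pos r by simp
  have Pp: "prof_P s = 1 / pf (rr s)" "0 < prof_P s" using s pf_gt_1[OF r(1,2)] by (auto simp: prof_P_def)
  have C: "0 < prof_C1 s" "0 < prof_C2 s" using prof_pos_cont s by (auto simp: pos_cont_def)
  have "prof_w h q s = h (rr s) * (LV (rr s) powr (- q) * (LV (rr s) * SD (rr s) * (rr s / (pf (rr s) * s))))"
  proof -
   have "LV (rr s) powr (1 - q) = LV (rr s) powr (- q) * LV (rr s)" using LV powr_add[of "LV (rr s)" "- q" 1] by simp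
   then show ?thesis by (simp add: prof_w_def weight_def)
  qed
  also have "LV (rr s) * SD (rr s) * (rr s / (pf (rr s) * s)) = (sp (rr s))\<^sup>2 / 4" using LV_eq(4)[OF r(1,2)] r by simp
  also have "LV (rr s) powr (- q) = (sp (rr s) ^ 3 / 4 / prof_P s) powr (- q) * (prof_C1 s * prof_C2 s) powr (2 * q) * (s powr (- (q * (1 - 2 / p1))) * (1 - s) powr (- (q * (1 - 2 / p2))))"
  proof -
   have "LV (rr s) = (sp (rr s) ^ 3 / 4 / prof_P s) * (s * (1 - s)) / (rr s * \<phi> (rr s))\<^sup>2"
    using LV_eq(1)[OF r(1,2)] r Pp by simp
   also have "(rr s * \<phi> (rr s))\<^sup>2 = (prof_C1 s * prof_C2 s)\<^sup>2 * (s powr (2 / p1) * (1 - s) powr (2 / p2))"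
   proof -
    have "(x powr a)\<^sup>2 = x powr (2 * a)" if "0 < x" for x a :: real using that by (simp add: powr_power mult.commute)
    then have "(s powr (1 / p1))\<^sup>2 = s powr (2 / p1)" "((1 - s) powr (1 / p2))\<^sup>2 = (1 - s) powr (2 / p2)" using s by simp_all
    moreover have "(rr s)\<^sup>2 = (prof_C1 s)\<^sup>2 * (s powr (1 / p1))\<^sup>2"
     using arg_cong[OF e1, of "%x. x\<^sup>2"] by (simp add: power_mult_distrib prof_P_def)
    moreover have "(\<phi> (rr s))\<^sup>2 = (prof_C2 s)\<^sup>2 * ((1 - s) powr (1 / p2))\<^sup>2"
     using arg_cong[OF e2, of "%x. x\<^sup>2"] by (simp add: power_mult_distrib prof_P_def)
    ultimately show ?thesis by (simp add: power_mult_distrib)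
   qed
   also have "(sp (rr s) ^ 3 / 4 / prof_P s) * (s * (1 - s)) / ((prof_C1 s * prof_C2 s)\<^sup>2 * (s powr (2 / p1) * (1 - s) powr (2 / p2))) =
    (sp (rr s) ^ 3 / 4 / prof_P s) * (prof_C1 s * prof_C2 s) powr (- 2) * (s powr (1 - 2 / p1) * (1 - s) powr (1 - 2 / p2))"
    using s C by (simp add: powr_diff powr_minus_divide)
   finally have "LV (rr s) powr (- q) = ((sp (rr s) ^ 3 / 4 / prof_P s) * (prof_C1 s * prof_C2 s) powr (- 2) * (s powr (1 - 2 / p1) * (1 - s) powr (1 - 2 / p2))) powr (- q)" by simp
   also have "\<dots> = (sp (rr s) ^ 3 / 4 / prof_P s) powr (- q) * ((prof_C1 s * prof_C2 s) powr (- 2)) powr (- q) * ((s powr (1 - 2 / p1)) powr (- q) * ((1 - s) powr (1 - 2 / p2)) powr (- q))"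
    using s C Sp Pp(2) by (simp only: powr_mult)
   finally show ?thesis by (simp add: powr_powr mult.commute)
  qed
  finally show ?thesis using s by (simp add: prof_H_def prof_sup_def mult_ac)
 qed
next
 \<comment> \<open>The assumed inequality multiplied by |p - 2| / p.\<close>
 have aux: "\<bar>- (q * (1 - 2 / p))\<bar> < 1" if p: "1 < p" and qp: "p \<noteq> 2 ==> \<bar>q\<bar> < \<bar>p / (p - 2)\<bar>" for p
 proof (cases "p = 2")
  case False
  have "1 - 2 / p = (p - 2) / p" using p by (simp add: field_simps)
  then have "\<bar>- (q * (1 - 2 / p))\<bar> = \<bar>q\<bar> * (\<bar>p - 2\<bar> / p)" using p by (simp add: abs_mult)
  also have "\<dots> < \<bar>p / (p - 2)\<bar> * (\<bar>p - 2\<bar> / p)" using qp[OF False] False p by (intro mult_strict_right_mono) auto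
  also have "\<dots> = 1" using False p by (simp add: abs_divide)
  finally show ?thesis .
 qed simp
 show "\<bar>- (q * (1 - 2 / p1))\<bar> < 1" "\<bar>- (q * (1 - 2 / p2))\<bar> < 1" using aux basic(2,3) q by auto
qed

end

section \<open>Change of variables between r and s; the boundary as a set\<close>

context reinhardt_domain begin

text \<open>The substitution is improper at both ends, as dr/ds may be unbounded there; for
  nonnegative integrands the substitution theorem delivers integrability along with the
  value.\<close>

lemma transfer_integral:
 assumes c: "continuous_on {0<..<b1} f" and nn: "!!r. 0 < r ==> r < b1 ==> 0 \<le> f r"
  and i: "set_integrable lborel {0<..<1} (%s. f (rr s) * (rr s / (pf (rr s) * s)))"
 shows "set_integrable lborel {0<..<b1} f"
  "(LBINT r:{0<..<b1}. f r) = (LBINT s:{0<..<1}. f (rr s) * (rr s / (pf (rr s) * s)))"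
proof -
 define g' where "g' = (%s. if 0 < s \<and> s < 1 then rr s / (pf (rr s) * s) else 0)"
 have pos: "0 < rr s / (pf (rr s) * s)" if "0 < s" "s < 1" for s
  using rr_props[OF that] pf_gt_1[of "rr s"] that by simp
 have e1: "einterval 0 (ereal 1) = {0<..<1}" and e2: "einterval 0 (ereal b1) = {0<..<b1}" unfolding zero_ereal_def by simp_all
 have fg: "set_integrable lborel (einterval 0 (ereal 1)) (%s. f (rr s) * g' s)"
  unfolding e1 using i by (rule set_integrable_cong[THEN iffD1, rotated 3]) (auto simp: g'_def)
 have cont_g': "isCont g' x" if "0 < x" "x < 1" for x
 proof -
  have "continuous_on {0<..<1} (%s. rr s / (pf (rr s) * s))"
  proof (intro continuous_intros rr_cont comp_rr_cont pf_cont ballI)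
   fix s :: real assume "s \<in> {0<..<1}"
   then show "pf (rr s) * s \<noteq> 0" using pf_gt_1[of "rr s"] rr_props[of s] by auto
  qed
  then have "isCont (%s. rr s / (pf (rr s) * s)) x" using that by (simp add: continuous_on_eq_continuous_at)
  moreover have "\<forall>\<^sub>F s in nhds x. rr s / (pf (rr s) * s) = g' s"
  proof -
   have "\<forall>\<^sub>F s in nhds x. s \<in> {0<..<1}" by (rule eventually_nhds_in_open) (use that in auto)
   then show ?thesis by eventually_elim (simp add: g'_def)
  qed
  ultimately show ?thesis by (simp add: isCont_cong)
 qed
 have A: "((ereal \<circ> rr \<circ> real_of_ereal) \<longlongrightarrow> 0) (at_right 0)"
 proof -
  have "(rr \<longlongrightarrow> 0) (at_right 0)" using rr_tendsto by simp
  then have "((%x. ereal (rr x)) \<longlongrightarrow> ereal 0) (at_right 0)" by (rule tendsto_ereal)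
  then have "((ereal \<circ> rr) \<longlongrightarrow> ereal 0) (at_right 0)" by (simp add: comp_def)
  then show ?thesis unfolding zero_ereal_def by (subst ereal_tendsto_simps1(1)[symmetric, unfolded comp_assoc] | subst ereal_tendsto_simps1 | simp only: ereal_tendsto_simps1)+
 qed
 have B: "((ereal \<circ> rr \<circ> real_of_ereal) \<longlongrightarrow> ereal b1) (at_left (ereal 1))"
 proof -
  have "((%x. ereal (rr x)) \<longlongrightarrow> ereal b1) (at_left 1)" by (rule tendsto_ereal) (rule rr_tendsto)
  then have "((ereal \<circ> rr) \<longlongrightarrow> ereal b1) (at_left 1)" by (simp add: comp_def)
  then show ?thesis by (simp only: ereal_tendsto_simps1)
 qed
 have g0: "0 \<le> g' x" for x using pos[of x] by (auto simp: g'_def less_imp_le)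
 have dg: "(rr has_real_derivative g' x) (at x)" if "0 < x" "x < 1" for x
  using drr[OF that] that by (simp add: g'_def)
 have cf: "isCont f (rr x)" if "0 < x" "x < 1" for x
  using c rr_props[OF that] by (simp add: continuous_on_eq_continuous_at)
 note S = interval_integral_substitution_nonneg[where a = 0 and b = "ereal 1" and A = 0 and B = "ereal b1" and g = rr and g' = g' and f = f, OF _ _ _ _ _ _ A B fg]
 have "set_integrable lborel (einterval 0 (ereal b1)) f \<and> (LBINT x=0..ereal b1. f x) = (LBINT x=0..ereal 1. f (rr x) * g' x)"
  by (intro conjI S) (auto intro: dg cf cont_g' nn rr_props g0)
 then have 1: "set_integrable lborel {0<..<b1} f" and 2: "(LBINT x=0..ereal b1. f x) = (LBINT x=0..ereal 1. f (rr x) * g' x)"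
  unfolding e2 by auto
 show "set_integrable lborel {0<..<b1} f" by (rule 1)
 have "(LBINT r:{0<..<b1}. f r) = (LBINT x=0..ereal b1. f x)"
  using basic(1) by (simp add: interval_lebesgue_integral_def e2)
 also have "\<dots> = (LBINT s:{0<..<1}. f (rr s) * g' s)"
  unfolding 2 by (simp add: interval_lebesgue_integral_def e1)
 also have "\<dots> = (LBINT s:{0<..<1}. f (rr s) * (rr s / (pf (rr s) * s)))"
  by (rule set_lebesgue_integral_cong) (auto simp: g'_def)
 finally show "(LBINT r:{0<..<b1}. f r) = (LBINT s:{0<..<1}. f (rr s) * (rr s / (pf (rr s) * s)))" .
qed

text \<open>phi continued by constants beyond its interval. Being continuous on the whole line, it
  serves in all arguments on openness, closedness and measurability.\<close>

definition phix :: "real \<Rightarrow> real" where "phix r = \<phi> (min b1 (max 0 r))"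

lemma phix_cont: "continuous_on A phix"
proof -
 have "continuous_on UNIV phix" unfolding phix_def[abs_def]
  by (rule continuous_on_compose2[OF basic(4)]) (use basic(1) in \<open>auto intro!: continuous_intros\<close>)
 then show ?thesis by (rule continuous_on_subset) simp
qed

lemma phix_eq: "0 \<le> r ==> r \<le> b1 ==> phix r = \<phi> r" by (simp add: phix_def)

abbreviation "D \<equiv> domain_of b1 \<phi>"

lemma domain_eq: "D = {z. cmod (fst z) < b1} \<inter> {z. cmod (snd z) < phix (cmod (fst z))}"
 by (auto simp: domain_of_def phix_eq)

lemma open_domain: "open D"
 unfolding domain_eq by (intro open_Int open_Collect_less continuous_intros continuous_on_compose2[OF phix_cont]) auto

text \<open>The domain is star-shaped about the origin because phi decreases; radial approximation
  then shows that every point of the candidate boundary is in the closure.\<close>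

lemma in_domain_scaled:
 assumes "cmod (fst z) \<le> b1" "cmod (snd z) = \<phi> (cmod (fst z))" "0 < t" "t < 1"
 shows "t *\<^sub>R z \<in> D"
proof -
 define r where "r = cmod (fst z)"
 have r: "0 \<le> r" "r \<le> b1" using assms by (auto simp: r_def)
 have tr: "t * r < b1"
 proof (cases "r = 0")
  case False
  then have "t * r < 1 * r" using assms r by (intro mult_strict_right_mono) auto
  then show ?thesis using r by simp
 qed (use basic(1) in simp)
 have "t * \<phi> r < \<phi> (t * r)"
 proof (cases "r = 0")
  case True then show ?thesis using assms b2_pos by (simp add: b2_def)
 next
  case False
  then have "t * r < r" using assms r by simp
  then have "\<phi> r < \<phi> (t * r)" using r assms by (intro phi_strict) auto
  moreover have "0 \<le> \<phi> r" using assms(2) by (metis norm_ge_zero r_def)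
  then have "t * \<phi> r \<le> 1 * \<phi> r" using assms by (intro mult_right_mono) auto
  ultimately show ?thesis by simp
 qed
 then show ?thesis using tr assms by (simp add: domain_of_def r_def norm_mult)
qed

theorem bD_eq: "bD b1 \<phi> = {z. cmod (fst z) \<le> b1 \<and> cmod (snd z) = \<phi> (cmod (fst z))}"
proof (rule set_eqI)
 fix z :: C2
 have fr: "z \<in> bD b1 \<phi> \<longleftrightarrow> z \<in> closure D \<and> z \<notin> D"
  unfolding frontier_def using interior_open[OF open_domain] by auto
 have cl: "closure D \<subseteq> {z. cmod (fst z) \<le> b1} \<inter> {z. cmod (snd z) \<le> phix (cmod (fst z))}"
 proof (rule closure_minimal)
  show "closed ({z. cmod (fst z) \<le> b1} \<inter> {z :: C2. cmod (snd z) \<le> phix (cmod (fst z))})"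
   by (intro closed_Int closed_Collect_le continuous_intros continuous_on_compose2[OF phix_cont]) auto
 qed (auto simp: domain_eq)
 show "z \<in> bD b1 \<phi> \<longleftrightarrow> z \<in> {z. cmod (fst z) \<le> b1 \<and> cmod (snd z) = \<phi> (cmod (fst z))}"
 proof
  assume "z \<in> bD b1 \<phi>"
  then have z: "cmod (fst z) \<le> b1" "cmod (snd z) \<le> \<phi> (cmod (fst z))" "z \<notin> D" using fr subsetD[OF cl, of z] phix_eq[of "cmod (fst z)"] by auto
  have "cmod (snd z) = \<phi> (cmod (fst z))"
  proof (cases "cmod (fst z) = b1")
   case True then show ?thesis using z(2) basic(6) by simp
  next
   case False then show ?thesis using z by (auto simp: domain_of_def)
  qed
  then show "z \<in> {z. cmod (fst z) \<le> b1 \<and> cmod (snd z) = \<phi> (cmod (fst z))}" using z by simp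
 next
  assume z: "z \<in> {z. cmod (fst z) \<le> b1 \<and> cmod (snd z) = \<phi> (cmod (fst z))}"
  have "z \<in> closure D" unfolding closure_sequential
  proof (intro exI conjI allI)
   show "(1 - 1 / real (n + 2)) *\<^sub>R z \<in> D" for n using z by (intro in_domain_scaled) auto
   have "(%n. 1 - 1 / real (n + 2)) \<longlonglongrightarrow> 1" by real_asymp
   from tendsto_scaleR[OF this tendsto_const[of z]] show "(%n. (1 - 1 / real (n + 2)) *\<^sub>R z) \<longlonglongrightarrow> z" by simp
  qed
  then show "z \<in> bD b1 \<phi>" using fr z by (auto simp: domain_of_def)
 qed
qed

lemma bD_trivial_limit: "z \<in> bD b1 \<phi> ==> at z within D \<noteq> bot"
proof -
 assume z: "z \<in> bD b1 \<phi>"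
 then have "z \<in> closure D" "z \<notin> D" unfolding frontier_def using interior_open[OF open_domain] by auto
 then have "z islimpt D" by (auto simp: closure_def)
 then show ?thesis using trivial_limit_within[of z D] by simp
qed

lemma compact_bD: "compact (bD b1 \<phi>)"
proof -
 have "bounded (bD b1 \<phi>)"
 proof (rule boundedI)
  fix z assume z: "z \<in> bD b1 \<phi>"
  then have r: "cmod (fst z) \<le> b1" "cmod (snd z) = \<phi> (cmod (fst z))" unfolding bD_eq by auto
  have "\<phi> (cmod (fst z)) \<le> b2" using phi_lt_b2[of "cmod (fst z)"] r by (cases "fst z = 0") (auto simp: b2_def)
  then show "norm z \<le> b1 + b2" using r norm_Pair_le[of "fst z" "snd z"] by simp
 qed
 then show ?thesis by (simp add: compact_eq_bounded_closed frontier_closed)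
qed

lemma bd_param_simps:
 assumes "0 \<le> r" "r \<le> b1"
 shows "cmod (fst (bd_param \<phi> (r, t))) = r" "cmod (snd (bd_param \<phi> (r, t))) = \<phi> r" "bd_param \<phi> (r, t) \<in> bD b1 \<phi>"
proof -
 have "0 \<le> \<phi> r" using phi_pos[of r] basic(6) assms by (cases "r = b1") auto
 then show 1: "cmod (fst (bd_param \<phi> (r, t))) = r" "cmod (snd (bd_param \<phi> (r, t))) = \<phi> r"
  using assms by (auto simp: bd_param_def norm_mult split: prod.splits)
 then show "bd_param \<phi> (r, t) \<in> bD b1 \<phi>" unfolding bD_eq using assms by simp
qed

end

section \<open>The Levi form and the surface measure in boundary coordinates\<close>

lemma frechet_derivativeI: "(f has_derivative f') (at x) ==> frechet_derivative f (at x) = f'"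
 by (rule frechet_derivative_at[symmetric])

lemma inner_complex_eq: "inner a h = Re (cnj a * h)" for a h :: complex
 by (simp add: inner_complex_def)

text \<open>The real-linear form h -> Re (conj a h) splits into its complex linear and antilinear
  halves; these are the combinations formed by \<open>del\<close> and \<open>delbar\<close>.\<close>

lemma wirtinger_inner:
 fixes a h :: complex
 shows "of_real (inner a h) - \<i> * of_real (inner a (\<i> * h)) = cnj a * h"
  "of_real (inner a h) + \<i> * of_real (inner a (\<i> * h)) = a * cnj h"
 by (auto simp: complex_eq_iff inner_complex_def algebra_simps)

context reinhardt_domain begin

lemma rho_deriv:
 assumes z: "fst z \<noteq> 0" "cmod (fst z) < b1" "snd z \<noteq> 0"
 shows "(rho \<phi> has_derivative (%v. inner (sgn (snd z)) (snd v) - \<phi>' (cmod (fst z)) * inner (sgn (fst z)) (fst v))) (at z)"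
proof -
 have n: "(cmod has_derivative (%h. inner (sgn x) h)) (at x)" if "x \<noteq> 0" for x :: complex
  using has_derivative_norm[OF that] by (simp add: real_inner_class.inner_commute)
 have 1: "((%z. cmod (fst z)) has_derivative (%v. inner (sgn (fst z)) (fst v))) (at z)"
  by (rule has_derivative_compose[OF has_derivative_fst[OF has_derivative_ident] n[OF z(1)]])
 have 2: "((%z. cmod (snd z)) has_derivative (%v. inner (sgn (snd z)) (snd v))) (at z)"
  by (rule has_derivative_compose[OF has_derivative_snd[OF has_derivative_ident] n[OF z(3)]])
 have "(\<phi> has_derivative (%h. \<phi>' (cmod (fst z)) * h)) (at (cmod (fst z)))"
  using dphi[of "cmod (fst z)"] z by (simp add: has_field_derivative_def)
 from has_derivative_diff[OF 2 has_derivative_compose[OF 1 this]] show ?thesis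
  by (simp add: rho_def[abs_def])
qed

lemma del_rho:
 assumes z: "fst z \<noteq> 0" "cmod (fst z) < b1" "snd z \<noteq> 0"
 shows "del (crho \<phi>) z v = (cnj (sgn (snd z)) * snd v - of_real (\<phi>' (cmod (fst z))) * (cnj (sgn (fst z)) * fst v)) / 2"
proof -
 have "((%z. complex_of_real (rho \<phi> z)) has_derivative
   (%v. of_real (inner (sgn (snd z)) (snd v) - \<phi>' (cmod (fst z)) * inner (sgn (fst z)) (fst v)))) (at z)"
  by (rule has_derivative_of_real[OF rho_deriv[OF z]])
 note F = frechet_derivativeI[OF this]
 show ?thesis
  unfolding del_def F ctimes_def wirtinger_inner(1)[symmetric] by (simp add: algebra_simps)
qed

lemma norm_inverse_deriv:
 fixes x :: complex assumes "x \<noteq> 0"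
 shows "((%x. cnj (sgn x)) has_derivative (%h. cnj h / of_real (cmod x) - cnj x * of_real (inner (sgn x) h) / of_real (cmod x) ^ 2)) (at x)"
proof -
 have n: "(cmod has_derivative (%h. inner (sgn x) h)) (at x)"
  using has_derivative_norm[OF assms] by (simp add: real_inner_class.inner_commute)
 have n': "((%x. complex_of_real (cmod x)) has_derivative (%h. of_real (inner (sgn x) h))) (at x)"
  by (rule has_derivative_of_real[OF n])
 have c: "(cnj has_derivative cnj) (at x)" by (rule bounded_linear_imp_has_derivative[OF bounded_linear_cnj])
 have "((%x. cnj x / of_real (cmod x)) has_derivative
   (%h. - cnj x * (inverse (of_real (cmod x)) * of_real (inner (sgn x) h) * inverse (of_real (cmod x))) + cnj h / of_real (cmod x))) (at x)"
  by (rule has_derivative_divide[OF c n']) (use assms in simp)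
 moreover have "(%x. cnj x / of_real (cmod x)) = (%x. cnj (sgn x))" by (auto simp: sgn_div_norm scaleR_conv_of_real divide_inverse mult.commute)
 moreover have "(%h. - cnj x * (inverse (of_real (cmod x)) * of_real (inner (sgn x) h) * inverse (of_real (cmod x))) + cnj h / of_real (cmod x))
   = (%h. cnj h / of_real (cmod x) - cnj x * of_real (inner (sgn x) h) / of_real (cmod x) ^ 2)"
  by (rule ext) (simp add: divide_inverse power2_eq_square mult_ac)
 ultimately show ?thesis by simp
qed

lemma delbar_del_rho_aux:
 assumes z: "fst z \<noteq> 0" "cmod (fst z) < b1" "snd z \<noteq> 0"
 shows "delbar (%z. del (crho \<phi>) z w) z v =
  (snd w * cnj (snd v) / of_real (cmod (snd z)) - of_real (\<phi>'' (cmod (fst z)) + \<phi>' (cmod (fst z)) / cmod (fst z)) * (fst w * cnj (fst v))) / 4"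
proof -
 define x where "x = fst z"
 define y where "y = snd z"
 have xy: "x \<noteq> 0" "y \<noteq> 0" "0 < cmod x" "cmod x < b1" using z by (auto simp: x_def y_def)
 define U where "U = {z :: C2. fst z \<noteq> 0} \<inter> {z. cmod (fst z) < b1} \<inter> {z. snd z \<noteq> 0}"
 have U: "open U" "z \<in> U" unfolding U_def using z by (auto intro!: open_Int open_Collect_neq open_Collect_less continuous_intros)
 define N where "N = (%x h. cnj h / of_real (cmod x) - cnj x * of_real (inner (sgn x) h) / of_real (cmod x) ^ 2)"
 have n: "(cmod has_derivative (%h. inner (sgn x) h)) (at x)"
  using has_derivative_norm[OF xy(1)] by (simp add: real_inner_class.inner_commute)
 have p0: "(\<phi>' has_derivative (%h. \<phi>'' (cmod x) * h)) (at (cmod x))"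
  using dphi'[of "cmod x"] xy by (simp add: has_field_derivative_def)
 have p: "((%x. complex_of_real (\<phi>' (cmod x))) has_derivative (%h. of_real (\<phi>'' (cmod x) * inner (sgn x) h))) (at x)"
  by (rule has_derivative_of_real[OF has_derivative_compose[OF n p0]])
 have 1: "((%z. cnj (sgn (snd z))) has_derivative (%h. N y (snd h))) (at z)"
  using has_derivative_compose[OF has_derivative_snd[OF has_derivative_ident] norm_inverse_deriv[of "snd z"]] xy(2) by (simp add: N_def y_def)
 have 2: "((%x. of_real (\<phi>' (cmod x)) * cnj (sgn x)) has_derivative
   (%h. of_real (\<phi>' (cmod x)) * N x h + of_real (\<phi>'' (cmod x) * inner (sgn x) h) * cnj (sgn x))) (at x)"
  using has_derivative_mult[OF p norm_inverse_deriv[OF xy(1)]] by (simp add: N_def)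
 have 3: "((%z. of_real (\<phi>' (cmod (fst z))) * cnj (sgn (fst z))) has_derivative
   (%h. of_real (\<phi>' (cmod x)) * N x (fst h) + of_real (\<phi>'' (cmod x) * inner (sgn x) (fst h)) * cnj (sgn x))) (at z)"
  by (rule has_derivative_compose[OF has_derivative_fst[OF has_derivative_ident] 2[unfolded x_def], folded x_def])
 define L where "L = (%h. (N y (snd h) * snd w - (of_real (\<phi>' (cmod x)) * N x (fst h) + of_real (\<phi>'' (cmod x) * inner (sgn x) (fst h)) * cnj (sgn x)) * fst w) * (1 / 2))"
 have "((%z. (cnj (sgn (snd z)) * snd w - (of_real (\<phi>' (cmod (fst z))) * cnj (sgn (fst z))) * fst w) * (1 / 2)) has_derivative L) (at z)"
  unfolding L_def by (intro has_derivative_mult_left has_derivative_diff 1 3)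
 then have "((%z. del (crho \<phi>) z w) has_derivative L) (at z)"
  by (rule has_derivative_transform_within_open[OF _ U]) (simp add: U_def del_rho mult.assoc)
 note F = frechet_derivativeI[OF this]
 \<comment> \<open>Only the antilinear part of the derivative of conj (sgn u) survives in
   \<open>delbar\<close>; the sgn terms combine to half of conj h / |u|.\<close>
 have Nbar: "N u h + \<i> * N u (\<i> * h) = cnj h / of_real (cmod u)" if "u \<noteq> 0" for u h
 proof -
  have "N u h + \<i> * N u (\<i> * h) = 2 * cnj h / of_real (cmod u) - cnj u * (of_real (inner (sgn u) h) + \<i> * of_real (inner (sgn u) (\<i> * h))) / of_real (cmod u) ^ 2"
   by (simp add: N_def diff_divide_distrib add_divide_distrib algebra_simps)
  also have "\<dots> = 2 * cnj h / of_real (cmod u) - (cnj u * sgn u) * cnj h / of_real (cmod u) ^ 2"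
   unfolding wirtinger_inner(2) by (simp add: mult_ac)
  also have "cnj u * sgn u = of_real (cmod u)"
  proof -
   have "u * cnj u = of_real (cmod u) ^ 2" by (simp add: complex_norm_square[symmetric])
   moreover have "cnj u * sgn u = (u * cnj u) / of_real (cmod u)" by (simp add: sgn_div_norm scaleR_conv_of_real divide_inverse mult_ac)
   ultimately show ?thesis using that by (simp add: power2_eq_square)
  qed
  finally show ?thesis using that by (simp add: power2_eq_square field_simps)
 qed
 have Ibar: "(of_real (c * inner (sgn u) h) * cnj (sgn u)) + \<i> * (of_real (c * inner (sgn u) (\<i> * h)) * cnj (sgn u)) = of_real c * cnj h"
  if "u \<noteq> 0" for u h c
 proof -
  have "(of_real (c * inner (sgn u) h) * cnj (sgn u)) + \<i> * (of_real (c * inner (sgn u) (\<i> * h)) * cnj (sgn u)) =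
   of_real c * (of_real (inner (sgn u) h) + \<i> * of_real (inner (sgn u) (\<i> * h))) * cnj (sgn u)" by (simp add: algebra_simps)
  also have "\<dots> = of_real c * cnj h * (sgn u * cnj (sgn u))" unfolding wirtinger_inner(2) by (simp add: mult_ac)
  also have "sgn u * cnj (sgn u) = 1" using that by (simp add: complex_norm_square[symmetric] norm_sgn)
  finally show ?thesis by simp
 qed
 have "L v + \<i> * L (ctimes \<i> v) = ((N y (snd v) + \<i> * N y (\<i> * snd v)) * snd w - (of_real (\<phi>' (cmod x)) * (N x (fst v) + \<i> * N x (\<i> * fst v)) +
   ((of_real (\<phi>'' (cmod x) * inner (sgn x) (fst v)) * cnj (sgn x)) + \<i> * (of_real (\<phi>'' (cmod x) * inner (sgn x) (\<i> * fst v)) * cnj (sgn x)))) * fst w) / 2"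
  unfolding L_def ctimes_def by (simp add: algebra_simps)
 also have "\<dots> = (cnj (snd v) / of_real (cmod y) * snd w - (of_real (\<phi>' (cmod x)) * (cnj (fst v) / of_real (cmod x)) + of_real (\<phi>'' (cmod x)) * cnj (fst v)) * fst w) / 2"
  unfolding Nbar[OF xy(1)] Nbar[OF xy(2)] Ibar[OF xy(1)] ..
 finally have E: "L v + \<i> * L (ctimes \<i> v) = (cnj (snd v) / of_real (cmod y) * snd w - (of_real (\<phi>' (cmod x)) * (cnj (fst v) / of_real (cmod x)) + of_real (\<phi>'' (cmod x)) * cnj (fst v)) * fst w) / 2" .
 show ?thesis unfolding delbar_def F E x_def[symmetric] y_def[symmetric] by (simp add: algebra_simps)
qed

text \<open>The form del rho vanishes on the radial frame vector, so two of the three terms of the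
  wedge product remain. They add up to a multiple of D^2 ds/dr with D = phi - r phi', which later
  cancels against the denominator of the kernel.\<close>

lemma leray_density_eq:
 assumes r: "0 < r" "r < b1" and z: "cmod (fst z) = r" "cmod (snd z) = \<phi> r"
 shows "leray_density \<phi> z = - of_real ((\<phi> r - r * \<phi>' r)\<^sup>2 * (pf r * sc r / r) / 4)"
proof -
 have f: "0 < \<phi> r" using phi_pos r by simp
 have nz: "fst z \<noteq> 0" "cmod (fst z) < b1" "snd z \<noteq> 0" using r f z by auto
 define e where "e = sgn (fst z)"
 define g where "g = sgn (snd z)"
 have eg: "e * cnj e = 1" "g * cnj g = 1" using nz by (auto simp: e_def g_def complex_norm_square[symmetric] norm_sgn)
 have ze: "fst z = of_real r * e" "snd z = of_real (\<phi> r) * g"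
  using nz z r f by (auto simp: e_def g_def sgn_div_norm scaleR_conv_of_real divide_inverse[symmetric])
 have del: "del (crho \<phi>) z v = (cnj g * snd v - of_real (\<phi>' r) * (cnj e * fst v)) / 2" for v
  unfolding del_rho[OF nz] z by (simp add: e_def g_def)
 have db: "delbar (%z. del (crho \<phi>) z w) z v = (snd w * cnj (snd v) / of_real (\<phi> r) - of_real (\<phi>'' r + \<phi>' r / r) * (fst w * cnj (fst v))) / 4" for v w
  unfolding delbar_del_rho_aux[OF nz] z ..
 have F: "frame \<phi> z 1 = (e, of_real (\<phi>' r) * g)" "frame \<phi> z 2 = (\<i> * (of_real r * e), 0)" "frame \<phi> z 3 = (0, \<i> * (of_real (\<phi> r) * g))"
  using ze z by (auto simp: frame_def e_def g_def)
 have eg': "cnj e * e = 1" "cnj g * g = 1" using eg by (auto simp: mult.commute)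
 have d1: "del (crho \<phi>) z (frame \<phi> z 1) = 0"
  unfolding del F fst_conv snd_conv using eg' by (simp add: algebra_simps)
 have d2: "del (crho \<phi>) z (frame \<phi> z 2) = - \<i> * of_real (r * \<phi>' r) / 2"
 proof -
  have "del (crho \<phi>) z (frame \<phi> z 2) = - \<i> * of_real (r * \<phi>' r) * (cnj e * e) / 2" unfolding del F by (simp add: algebra_simps)
  then show ?thesis by (simp add: eg')
 qed
 have d3: "del (crho \<phi>) z (frame \<phi> z 3) = \<i> * of_real (\<phi> r) / 2"
 proof -
  have "del (crho \<phi>) z (frame \<phi> z 3) = \<i> * of_real (\<phi> r) * (cnj g * g) / 2" unfolding del F by (simp add: algebra_simps)
  then show ?thesis by (simp add: eg')
 qed
 have b31: "delbar_del (crho \<phi>) z (frame \<phi> z 3) (frame \<phi> z 1) = - \<i> * of_real (\<phi>' r) / 2"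
 proof -
  have "delbar_del (crho \<phi>) z (frame \<phi> z 3) (frame \<phi> z 1) = - \<i> * of_real (\<phi>' r) * (g * cnj g) * (of_real (\<phi> r) / of_real (\<phi> r)) / 2"
   unfolding delbar_del_def db F by (simp add: algebra_simps)
  then show ?thesis using f by (simp add: eg)
 qed
 have b12: "delbar_del (crho \<phi>) z (frame \<phi> z 1) (frame \<phi> z 2) = - \<i> * of_real (r * (\<phi>'' r + \<phi>' r / r)) / 2"
 proof -
  have "delbar_del (crho \<phi>) z (frame \<phi> z 1) (frame \<phi> z 2) = - \<i> * of_real (r * (\<phi>'' r + \<phi>' r / r)) * (e * cnj e) / 2"
  proof -
   define K where "K = complex_of_real (\<phi>'' r + \<phi>' r / r)"
   show ?thesis unfolding delbar_del_def db F of_real_mult K_def[symmetric] by (simp add: algebra_simps)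
  qed
  then show ?thesis by (simp add: eg)
 qed
 have "leray_density \<phi> z = (- \<i> * of_real (r * \<phi>' r) / 2) * (- \<i> * of_real (\<phi>' r) / 2) + (\<i> * of_real (\<phi> r) / 2) * (- \<i> * of_real (r * (\<phi>'' r + \<phi>' r / r)) / 2)"
  unfolding leray_density_def leray_form_def d1 d2 d3 b31 b12 by simp
 also have "\<dots> = of_real ((- (r * \<phi>' r * \<phi>' r) + \<phi> r * (r * (\<phi>'' r + \<phi>' r / r))) / 4)"
  by (simp add: complex_eq_iff)
 also have "(- (r * \<phi>' r * \<phi>' r) + \<phi> r * (r * (\<phi>'' r + \<phi>' r / r))) / 4 = - ((\<phi> r - r * \<phi>' r)\<^sup>2 * (pf r * sc r / r) / 4)"
 proof -
  define Dn where "Dn = \<phi> r - r * \<phi>' r"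
  have n: "\<phi>' r \<noteq> 0" "Dn \<noteq> 0" using phi'_neg[OF r] denom_pos[OF r] by (auto simp: Dn_def)
  have "Dn\<^sup>2 * (pf r * sc r / r) = Dn\<^sup>2 * ((1 + r * \<phi> r * \<phi>'' r / (\<phi>' r * Dn)) * (- r * \<phi>' r / Dn) / r)"
   unfolding p_profile_def s_coord_def Dn_def[symmetric] ..
  also have "\<dots> = - (\<phi>' r * Dn + r * \<phi> r * \<phi>'' r)" using n r by (simp add: field_simps power2_eq_square)
  also have "\<dots> = - (- (r * \<phi>' r * \<phi>' r) + \<phi> r * (r * (\<phi>'' r + \<phi>' r / r)))" using r by (simp add: Dn_def algebra_simps)
  finally have "Dn\<^sup>2 * (pf r * sc r / r) = - (- (r * \<phi>' r * \<phi>' r) + \<phi> r * (r * (\<phi>'' r + \<phi>' r / r)))" .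
  moreover have "Y / 4 = - (X / 4)" if "X = - Y" for X Y :: real using that by simp
  ultimately show ?thesis unfolding Dn_def by blast
 qed
 finally show ?thesis by simp
qed

text \<open>The three frame vectors are orthogonal, so the Gram determinant is the product of their
  squared lengths.\<close>

lemma surface_density_eq:
 assumes r: "0 < r" "r < b1" and z: "cmod (fst z) = r" "cmod (snd z) = \<phi> r"
 shows "surface_density \<phi> z = SD r"
proof -
 have f: "0 < \<phi> r" using phi_pos r by simp
 have nz: "fst z \<noteq> 0" "snd z \<noteq> 0" using r f z by auto
 have i12: "inner (\<i> * x) (sgn x) = 0" "inner (sgn x) (\<i> * x) = 0" for x :: complex
  by (auto simp: sgn_div_norm inner_complex_def)
 have i11: "inner (\<i> * x) (\<i> * x) = (cmod x)\<^sup>2" for x :: complex unfolding cmod_power2 by (simp add: inner_complex_def power2_eq_square)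
 have i00: "inner (sgn x) (sgn x) = 1" if "x \<noteq> 0" for x :: complex using that by (simp add: dot_square_norm norm_sgn)
 have G: "frame \<phi> z 1 \<bullet> frame \<phi> z 1 = 1 + (\<phi>' r)\<^sup>2" "frame \<phi> z 2 \<bullet> frame \<phi> z 2 = r\<^sup>2" "frame \<phi> z 3 \<bullet> frame \<phi> z 3 = (\<phi> r)\<^sup>2"
  "frame \<phi> z 1 \<bullet> frame \<phi> z 2 = 0" "frame \<phi> z 2 \<bullet> frame \<phi> z 1 = 0" "frame \<phi> z 1 \<bullet> frame \<phi> z 3 = 0" "frame \<phi> z 3 \<bullet> frame \<phi> z 1 = 0"
  "frame \<phi> z 2 \<bullet> frame \<phi> z 3 = 0" "frame \<phi> z 3 \<bullet> frame \<phi> z 2 = 0"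
  using z i00[OF nz(1)] i00[OF nz(2)] by (auto simp: frame_def inner_prod_def i12 i11 scaleR_conv_of_real[symmetric] power2_eq_square)
 have "det (\<chi> i j. frame \<phi> z i \<bullet> frame \<phi> z j) = (1 + (\<phi>' r)\<^sup>2) * r\<^sup>2 * (\<phi> r)\<^sup>2"
  unfolding det_3 by (simp add: G)
 then show ?thesis unfolding surface_density_def SD_def using r f by (simp add: real_sqrt_mult mult_ac)
qed

lemma grad_norm_sq_eq:
 assumes r: "0 < r" "r < b1" and z: "cmod (fst z) = r" "cmod (snd z) = \<phi> r"
 shows "grad_norm_sq (rho \<phi>) z = 1 + (\<phi>' r)\<^sup>2"
proof -
 have f: "0 < \<phi> r" using phi_pos r by simp
 have nz: "fst z \<noteq> 0" "cmod (fst z) < b1" "snd z \<noteq> 0" using r f z by auto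
 have s: "(Re (sgn x))\<^sup>2 + (Im (sgn x))\<^sup>2 = 1" if "x \<noteq> 0" for x :: complex
 proof -
  have "cmod (sgn x) = 1" using that by (simp add: norm_sgn)
  then show ?thesis by (simp only: cmod_power2[symmetric]) simp
 qed
 have "grad_norm_sq (rho \<phi>) z = (\<phi>' r)\<^sup>2 * ((Re (sgn (fst z)))\<^sup>2 + (Im (sgn (fst z)))\<^sup>2) + ((Re (sgn (snd z)))\<^sup>2 + (Im (sgn (snd z)))\<^sup>2)"
  unfolding grad_norm_sq_def frechet_derivativeI[OF rho_deriv[OF nz]] z
  by (simp add: Basis_prod_def sum.union_disjoint sum.reindex inj_on_def Basis_complex_def inner_complex_def power_mult_distrib algebra_simps disjoint_iff del: Re_sgn Im_sgn)
 then show ?thesis using s nz by simp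
qed

lemma levi_norm_eq:
 assumes r: "0 < r" "r < b1" and z: "cmod (fst z) = r" "cmod (snd z) = \<phi> r"
 shows "levi_norm \<phi> z = LV r"
proof -
 have f: "0 < \<phi> r" using phi_pos r by simp
 have nz: "fst z \<noteq> 0" "snd z \<noteq> 0" using r f z by auto
 show ?thesis
  unfolding levi_norm_def leray_density_eq[OF r z] surface_density_eq[OF r z] grad_norm_sq_eq[OF r z] using nz
  by (simp add: LV_def SD_def mult_ac)
qed

end

section \<open>Rotation-invariant measures of order q\<close>

lemma cis_measurable[measurable]: "cis \<in> borel_measurable borel"
 by (intro borel_measurable_continuous_onI continuous_intros)

lemma nn_integral_lborel_shift:
 fixes g :: "real \<Rightarrow> ennreal" assumes [measurable]: "g \<in> borel_measurable borel"
 shows "(\<integral>\<^sup>+t. g (t + a) \<partial>lborel) = (\<integral>\<^sup>+t. g t \<partial>lborel)"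
 using nn_integral_real_affine[of g 1 a] by (simp add: add.commute)

text \<open>Reduce the shift to an angle b in [0, 2 pi), cut the shifted interval at 2 pi and move
  the excess back by one period.\<close>

lemma nn_integral_cis_shift:
 fixes g :: "complex \<Rightarrow> ennreal" assumes [measurable]: "g \<in> borel_measurable borel"
 shows "(\<integral>\<^sup>+t\<in>{0..<2*pi}. g (cis t * cis a) \<partial>lborel) = (\<integral>\<^sup>+t\<in>{0..<2*pi}. g (cis t) \<partial>lborel)"
proof -
 define b where "b = Arg2pi (cis a)"
 have b: "0 \<le> b" "b < 2 * pi" "cis b = cis a"
  using Arg2pi[of "cis a"] Arg2pi_eq[of "cis a"] by (auto simp: b_def cis_conv_exp[symmetric])
 have "(\<integral>\<^sup>+t\<in>{0..<2*pi}. g (cis t * cis a) \<partial>lborel) = (\<integral>\<^sup>+t. g (cis (t + b)) * indicator {b..<2*pi+b} (t + b) \<partial>lborel)"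
  unfolding b(3)[symmetric] cis_mult by (intro nn_integral_cong) (auto simp: indicator_def)
 also have "\<dots> = (\<integral>\<^sup>+t. g (cis t) * indicator {b..<2*pi+b} t \<partial>lborel)"
  by (rule nn_integral_lborel_shift) measurable
 also have "\<dots> = (\<integral>\<^sup>+t. g (cis t) * indicator {b..<2*pi} t + g (cis t) * indicator {2*pi..<2*pi+b} t \<partial>lborel)"
  using b by (intro nn_integral_cong) (auto simp: indicator_def)
 also have "\<dots> = (\<integral>\<^sup>+t. g (cis t) * indicator {b..<2*pi} t \<partial>lborel) + (\<integral>\<^sup>+t. g (cis t) * indicator {2*pi..<2*pi+b} t \<partial>lborel)"
  by (rule nn_integral_add) measurable
 also have "(\<integral>\<^sup>+t. g (cis t) * indicator {2*pi..<2*pi+b} t \<partial>lborel) = (\<integral>\<^sup>+t. g (cis (t + 2*pi)) * indicator {2*pi..<2*pi+b} (t + 2*pi) \<partial>lborel)"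
  by (rule nn_integral_lborel_shift[symmetric]) measurable
 also have "\<dots> = (\<integral>\<^sup>+t. g (cis t) * indicator {0..<b} t \<partial>lborel)"
  by (intro nn_integral_cong) (auto simp: indicator_def cis_mult[symmetric])
 also have "(\<integral>\<^sup>+t. g (cis t) * indicator {b..<2*pi} t \<partial>lborel) + (\<integral>\<^sup>+t. g (cis t) * indicator {0..<b} t \<partial>lborel)
   = (\<integral>\<^sup>+t. g (cis t) * indicator {b..<2*pi} t + g (cis t) * indicator {0..<b} t \<partial>lborel)"
  by (rule nn_integral_add[symmetric]) measurable
 also have "\<dots> = (\<integral>\<^sup>+t\<in>{0..<2*pi}. g (cis t) \<partial>lborel)"
  using b by (intro nn_integral_cong) (auto simp: indicator_def)
 finally show ?thesis .
qed

definition rot :: "real \<Rightarrow> real \<Rightarrow> C2 \<Rightarrow> C2" where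
 "rot a b z = (cis a * fst z, cis b * snd z)"

lemma rot_continuous: "continuous_on A (rot a b)"
 unfolding rot_def[abs_def] by (intro continuous_intros)

lemma rot_rot: "rot a b (rot c d z) = rot (a + c) (b + d) z"
 by (simp add: rot_def cis_mult[symmetric] mult.assoc)

lemma rot_0: "rot 0 0 z = z" by (simp add: rot_def)

locale reinhardt_order = reinhardt_domain +
 fixes q :: real
 assumes q1: "p1 \<noteq> 2 ==> \<bar>q\<bar> < \<bar>p1 / (p1 - 2)\<bar>" and q2: "p2 \<noteq> 2 ==> \<bar>q\<bar> < \<bar>p2 / (p2 - 2)\<bar>"
begin

definition box :: "(real \<times> real \<times> real) set" where "box = {0<..<b1} \<times> {0..<2 * pi} \<times> {0..<2 * pi}"

text \<open>Agrees with \<open>bd_param\<close> on the parameter box and is continuous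
  everywhere.\<close>

definition bdx :: "real \<times> real \<times> real \<Rightarrow> C2" where
 "bdx = (%(r, t1, t2). (of_real r * cis t1, of_real (phix r) * cis t2))"

definition pos_fun :: "(real \<Rightarrow> real) \<Rightarrow> bool" where
 "pos_fun h \<longleftrightarrow> continuous_on {0..b1} h \<and> (\<forall>r. 0 \<le> r \<longrightarrow> r \<le> b1 \<longrightarrow> 0 < h r)"

text \<open>The measures of order q whose continuous factor depends on |z1| alone;
  \<open>has_order_radial\<close> shows that every measure of the theorem is of this form.\<close>

definition radial_measure :: "(real \<Rightarrow> real) \<Rightarrow> C2 measure" where
 "radial_measure h = distr (density (param_measure b1) (%x. ennreal (weight h q (fst x))))
   (restrict_space borel (bD b1 \<phi>)) (bd_param \<phi>)"

definition Wx :: "(real \<Rightarrow> real) \<Rightarrow> real \<Rightarrow> real" where "Wx h r = indicator {0<..<b1} r * weight h q r"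

lemma box_sets[measurable]: "box \<in> sets borel"
 unfolding box_def by (intro borel_Times) auto

lemma space_param: "space (param_measure b1) = box" and sets_param: "sets (param_measure b1) = sets (restrict_space borel box)"
 by (auto simp: param_measure_def box_def space_restrict_space sets_restrict_space)

lemma bd_param_box: "x \<in> box ==> bd_param \<phi> x \<in> bD b1 \<phi>" "x \<in> box ==> bdx x = bd_param \<phi> x"
 "x \<in> box ==> cmod (fst (bd_param \<phi> x)) = fst x" "x \<in> box ==> cmod (snd (bd_param \<phi> x)) = \<phi> (fst x)"
 "x \<in> box ==> 0 < fst x" "x \<in> box ==> fst x < b1"
 using bd_param_simps[of "fst x" "snd x"] phix_eq[of "fst x"] by (auto simp: box_def bdx_def bd_param_def)

lemma phix_measurable[measurable]: "phix \<in> borel_measurable borel"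
 by (intro borel_measurable_continuous_onI phix_cont)

lemma bdx_measurable[measurable]: "bdx \<in> borel_measurable borel"
 unfolding bdx_def by (intro borel_measurable_continuous_onI) (auto simp: case_prod_beta intro!: continuous_intros continuous_on_compose2[OF phix_cont[of UNIV]])

lemma bd_param_measurable[measurable]: "bd_param \<phi> \<in> measurable (param_measure b1) (restrict_space borel (bD b1 \<phi>))"
proof (rule measurable_restrict_space2)
 show "bd_param \<phi> \<in> space (param_measure b1) \<rightarrow> bD b1 \<phi>" using bd_param_box(1) by (auto simp: space_param)
 have "bdx \<in> measurable (param_measure b1) borel"
  using measurable_restrict_space1[OF bdx_measurable, of box] by (simp add: measurable_cong_sets[OF sets_param refl])
 then show "bd_param \<phi> \<in> measurable (param_measure b1) borel"
  by (rule measurable_cong[THEN iffD1, rotated]) (simp add: space_param bd_param_box)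
qed

lemma LV_SD_cont: "continuous_on {0<..<b1} LV" "continuous_on {0<..<b1} SD"
proof -
 have sc: "continuous_on {0<..<b1} sc"
  using dsc by (auto intro!: continuous_at_imp_continuous_on DERIV_isCont)
 have nz: "1 + x\<^sup>2 \<noteq> 0" "4 + 4 * x\<^sup>2 \<noteq> 0" "0 < r ==> r < b1 ==> \<phi> r \<noteq> 0" for x r :: real
  using phi_pos[of r] by (auto simp: add_nonneg_eq_0_iff)
 show "continuous_on {0<..<b1} LV" unfolding LV_def[abs_def]
  by (intro continuous_intros phi_cont phi'_cont pf_cont sc) (auto simp: nz)
 show "continuous_on {0<..<b1} SD" unfolding SD_def[abs_def]
  by (intro continuous_intros phi_cont phi'_cont)
qed

lemma weight_cont: "pos_fun h ==> continuous_on {0<..<b1} (weight h q)"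
proof -
 assume "pos_fun h"
 then have "continuous_on {0<..<b1} h" by (auto simp: pos_fun_def intro: continuous_on_subset)
 then show "continuous_on {0<..<b1} (weight h q)" unfolding weight_def[abs_def]
  by (intro continuous_intros LV_SD_cont) (use LV_eq(2) in \<open>auto simp: less_le\<close>)
qed

lemma weight_pos: "pos_fun h ==> 0 < r ==> r < b1 ==> 0 < weight h q r"
 unfolding weight_def pos_fun_def using LV_eq(2,3)[of r] by (auto intro!: mult_pos_pos)

lemma Wx_measurable[measurable]: "pos_fun h ==> Wx h \<in> borel_measurable borel"
proof -
 assume h: "pos_fun h"
 have "(%r. indicator {0<..<b1} r *\<^sub>R weight h q r) \<in> borel_measurable borel"
  by (rule borel_measurable_continuous_on_indicator[OF _ weight_cont[OF h]]) simp
 then show ?thesis by (simp add: Wx_def[abs_def])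
qed

lemma weight_param_measurable: "pos_fun h ==> (%x. ennreal (weight h q (fst x))) \<in> borel_measurable (param_measure b1)"
proof -
 assume h: "pos_fun h"
 note [measurable] = Wx_measurable[OF h]
 have "(%x :: real \<times> real \<times> real. fst x) \<in> borel_measurable borel" by (intro borel_measurable_continuous_onI continuous_intros)
 then have "(%x :: real \<times> real \<times> real. ennreal (Wx h (fst x))) \<in> borel_measurable borel" by measurable
 then have "(%x. ennreal (Wx h (fst x))) \<in> borel_measurable (restrict_space borel box)" by (rule measurable_restrict_space1)
 then have "(%x. ennreal (Wx h (fst x))) \<in> borel_measurable (param_measure b1)" by (simp add: measurable_cong_sets[OF sets_param refl])
 then show ?thesis
  by (rule measurable_cong[THEN iffD1, rotated]) (auto simp: space_param Wx_def bd_param_box)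
qed

lemma weight_integrable:
 assumes h: "pos_fun h" shows "set_integrable lborel {0<..<b1} (weight h q)"
proof -
 interpret leray_profile prof_P prof_C1 prof_C2 "prof_H h q" rr "%s. \<phi> (rr s)" "prof_w h q" "- (q * (1 - 2 / p1))" "- (q * (1 - 2 / p2))"
  by (rule profile) (use h q1 q2 in \<open>auto simp: pos_fun_def\<close>)
 have "set_integrable lborel {0<..<1} (%s. weight h q (rr s) * (rr s / (pf (rr s) * s)))"
  using integrand_integrable[of 0 0] by (simp add: prof_w_def)
 then show ?thesis using weight_pos[OF h] by (intro transfer_integral weight_cont h) (auto intro: less_imp_le)
qed

lemma bD_sets[measurable]: "bD b1 \<phi> \<in> sets borel" by (simp add: borel_closed frontier_closed)

lemma radial_sets[simp]: "sets (radial_measure h) = sets (restrict_space borel (bD b1 \<phi>))" "space (radial_measure h) = bD b1 \<phi>"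
 by (auto simp: radial_measure_def space_restrict_space)

lemma radial_sets_borel: "A \<in> sets (radial_measure h) ==> A \<in> sets borel \<and> A \<subseteq> bD b1 \<phi>"
 by (auto simp: sets_restrict_space_iff)

lemma nn_integral_param:
 assumes h: "pos_fun h" and F: "F \<in> borel_measurable (restrict_space borel (bD b1 \<phi>))"
 shows "(\<integral>\<^sup>+z. F z \<partial>radial_measure h) = (\<integral>\<^sup>+x. ennreal (weight h q (fst x)) * F (bd_param \<phi> x) \<partial>param_measure b1)"
proof -
 have "(\<integral>\<^sup>+z. F z \<partial>radial_measure h) = (\<integral>\<^sup>+x. F (bd_param \<phi> x) \<partial>density (param_measure b1) (%x. ennreal (weight h q (fst x))))"
  unfolding radial_measure_def by (intro nn_integral_distr) (use F in simp_all)
 also have "\<dots> = (\<integral>\<^sup>+x. ennreal (weight h q (fst x)) * F (bd_param \<phi> x) \<partial>param_measure b1)"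
  by (intro nn_integral_density weight_param_measurable h measurable_compose[OF bd_param_measurable F])
 finally show ?thesis .
qed

lemma nn_integral_radial:
 assumes h: "pos_fun h" and F[measurable]: "F \<in> borel_measurable borel"
 shows "(\<integral>\<^sup>+z. F z \<partial>radial_measure h) =
  (\<integral>\<^sup>+r. (\<integral>\<^sup>+t1\<in>{0..<2*pi}. (\<integral>\<^sup>+t2\<in>{0..<2*pi}. ennreal (Wx h r) * F (of_real r * cis t1, of_real (phix r) * cis t2) \<partial>lborel) \<partial>lborel) \<partial>lborel)"
proof -
 note [measurable] = Wx_measurable[OF h]
 let ?T = "{0..<2*pi}"
 define G where "G = (%r t1 t2. ennreal (Wx h r) * F (of_real r * cis t1, of_real (phix r) * cis t2))"
 define f where "f = (%x :: real \<times> real \<times> real. G (fst x) (fst (snd x)) (snd (snd x)) * indicator ?T (snd (snd x)) * indicator ?T (fst (snd x)))"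
 have fm: "f \<in> borel_measurable (lborel \<Otimes>\<^sub>M (lborel \<Otimes>\<^sub>M lborel))" unfolding f_def G_def by measurable
 have fr: "(%y. f (r, y)) \<in> borel_measurable (lborel \<Otimes>\<^sub>M lborel)" for r unfolding f_def G_def fst_conv snd_conv by measurable
 have sf: "sigma_finite_measure (lborel \<Otimes>\<^sub>M lborel :: (real \<times> real) measure)" unfolding lborel_prod by (rule sigma_finite_lborel)
 have "(\<integral>\<^sup>+z. F z \<partial>radial_measure h) = (\<integral>\<^sup>+x. ennreal (weight h q (fst x)) * F (bd_param \<phi> x) \<partial>restrict_space lborel box)"
  by (subst nn_integral_param[OF h measurable_restrict_space1[OF F]]) (simp add: param_measure_def box_def)
 also have "\<dots> = (\<integral>\<^sup>+x. ennreal (weight h q (fst x)) * F (bd_param \<phi> x) * indicator box x \<partial>lborel)"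
  by (rule nn_integral_restrict_space) simp
 also have "\<dots> = (\<integral>\<^sup>+x. f x \<partial>(lborel \<Otimes>\<^sub>M (lborel \<Otimes>\<^sub>M lborel)))"
  unfolding lborel_prod
 proof (intro nn_integral_cong)
  fix x :: "real \<times> real \<times> real"
  obtain r t1 t2 where x: "x = (r, t1, t2)" by (cases x)
  show "ennreal (weight h q (fst x)) * F (bd_param \<phi> x) * indicator box x = f x"
  proof (cases "x \<in> box")
   case True
   then show ?thesis using bd_param_box(2)[OF True] by (simp add: x Wx_def bdx_def box_def f_def G_def)
  next
   case False
   then have "r \<notin> {0<..<b1} \<or> t1 \<notin> ?T \<or> t2 \<notin> ?T" by (auto simp: x box_def)
   then have "f x = 0" by (auto simp: x f_def G_def Wx_def)
   then show ?thesis using False by simp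
  qed
 qed
 also have "\<dots> = (\<integral>\<^sup>+r. \<integral>\<^sup>+y. f (r, y) \<partial>(lborel \<Otimes>\<^sub>M lborel) \<partial>lborel)"
  by (rule sigma_finite_measure.nn_integral_fst[OF sf fm, symmetric])
 also have "\<dots> = (\<integral>\<^sup>+r. \<integral>\<^sup>+t1. \<integral>\<^sup>+t2. f (r, t1, t2) \<partial>lborel \<partial>lborel \<partial>lborel)"
  by (intro nn_integral_cong lborel.nn_integral_fst[OF fr, symmetric])
 also have "\<dots> = (\<integral>\<^sup>+r. (\<integral>\<^sup>+t1\<in>?T. (\<integral>\<^sup>+t2\<in>?T. G r t1 t2 \<partial>lborel) \<partial>lborel) \<partial>lborel)"
 proof (intro nn_integral_cong)
  fix r t1 :: real
  show "(\<integral>\<^sup>+t2. f (r, t1, t2) \<partial>lborel) = (\<integral>\<^sup>+t2\<in>?T. G r t1 t2 \<partial>lborel) * indicator ?T t1"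
   unfolding f_def fst_conv snd_conv by (rule nn_integral_multc) (unfold G_def, measurable)
 qed
 finally show ?thesis unfolding G_def .
qed

lemma nn_integral_radial_fun:
 assumes h: "pos_fun h" and G[measurable]: "G \<in> borel_measurable borel"
 shows "(\<integral>\<^sup>+z. G (cmod (fst z)) \<partial>radial_measure h) = ennreal (4 * pi\<^sup>2) * (\<integral>\<^sup>+r. ennreal (Wx h r) * G r \<partial>lborel)"
proof -
 note [measurable] = Wx_measurable[OF h]
 have "(%z :: C2. G (cmod (fst z))) \<in> borel_measurable borel"
  by (rule measurable_compose[OF borel_measurable_continuous_onI G]) (intro continuous_intros)
 from nn_integral_radial[OF h this] have "(\<integral>\<^sup>+z. G (cmod (fst z)) \<partial>radial_measure h) =
  (\<integral>\<^sup>+r. (\<integral>\<^sup>+t1\<in>{0..<2*pi}. (\<integral>\<^sup>+t2\<in>{0..<2*pi}. ennreal (Wx h r) * G \<bar>r\<bar> \<partial>lborel) \<partial>lborel) \<partial>lborel)"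
  by (simp add: norm_mult)
 also have "\<dots> = (\<integral>\<^sup>+r. ennreal (4 * pi\<^sup>2) * (ennreal (Wx h r) * G r) \<partial>lborel)"
 proof (intro nn_integral_cong)
  fix r :: real
  have "(\<integral>\<^sup>+t1\<in>{0..<2*pi}. (\<integral>\<^sup>+t2\<in>{0..<2*pi}. ennreal (Wx h r) * G \<bar>r\<bar> \<partial>lborel) \<partial>lborel) = ennreal (Wx h r) * G \<bar>r\<bar> * ennreal (2*pi) * ennreal (2*pi)"
   by (simp add: nn_integral_cmult_indicator)
  also have "\<dots> = ennreal (4 * pi\<^sup>2) * (ennreal (Wx h r) * G \<bar>r\<bar>)"
  proof -
   have "ennreal (2 * pi) * ennreal (2 * pi) = ennreal (4 * pi\<^sup>2)" by (subst ennreal_mult[symmetric]) (auto simp: power2_eq_square)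
   then show ?thesis by (metis mult.assoc mult.commute)
  qed
  also have "\<dots> = ennreal (4 * pi\<^sup>2) * (ennreal (Wx h r) * G r)" by (cases "0 \<le> r") (auto simp: Wx_def)
  finally show "(\<integral>\<^sup>+t1\<in>{0..<2*pi}. (\<integral>\<^sup>+t2\<in>{0..<2*pi}. ennreal (Wx h r) * G \<bar>r\<bar> \<partial>lborel) \<partial>lborel) = ennreal (4 * pi\<^sup>2) * (ennreal (Wx h r) * G r)" .
 qed
 also have "\<dots> = ennreal (4 * pi\<^sup>2) * (\<integral>\<^sup>+r. ennreal (Wx h r) * G r \<partial>lborel)"
  by (rule nn_integral_cmult) simp
 finally show ?thesis .
qed

lemma finite_radial: assumes h: "pos_fun h" shows "finite_measure (radial_measure h)"
proof
 note [measurable] = Wx_measurable[OF h]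
 have i: "integrable lborel (Wx h)" using weight_integrable[OF h] by (simp add: set_integrable_def Wx_def[abs_def])
 have W: "0 \<le> Wx h r" for r using weight_pos[OF h, of r] by (auto simp: Wx_def indicator_def)
 have "emeasure (radial_measure h) (space (radial_measure h)) = (\<integral>\<^sup>+z. 1 \<partial>radial_measure h)" by simp
 also have "\<dots> = ennreal (4 * pi\<^sup>2) * (\<integral>\<^sup>+r. ennreal (Wx h r) \<partial>lborel)"
  using nn_integral_radial_fun[OF h, of "%_. 1"] by simp
 also have "\<dots> = ennreal (4 * pi\<^sup>2) * ennreal (LBINT r. Wx h r)"
  using W by (subst nn_integral_eq_integral[OF i]) auto
 finally show "emeasure (radial_measure h) (space (radial_measure h)) \<noteq> \<infinity>" by (simp add: ennreal_mult_eq_top_iff)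
qed

lemma rot_bD: "z \<in> bD b1 \<phi> ==> rot a b z \<in> bD b1 \<phi>"
 unfolding bD_eq by (simp add: rot_def norm_mult)

lemma rot_measurable: "rot a b \<in> measurable (restrict_space borel (bD b1 \<phi>)) (restrict_space borel (bD b1 \<phi>))"
 by (intro measurable_restrict_space3 borel_measurable_continuous_onI rot_continuous) (use rot_bD in auto)

lemma radial_rotation_invariant:
 assumes h: "pos_fun h" shows "distr (radial_measure h) (radial_measure h) (rot a b) = radial_measure h"
proof (rule measure_eqI)
 note [measurable] = Wx_measurable[OF h]
 have m: "rot a b \<in> measurable (radial_measure h) (radial_measure h)"
  using rot_measurable by (simp add: measurable_cong_sets[OF radial_sets(1) radial_sets(1)])
 fix A assume "A \<in> sets (distr (radial_measure h) (radial_measure h) (rot a b))"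
 then have A: "A \<in> sets (radial_measure h)" by simp
 then have [measurable]: "A \<in> sets borel" using radial_sets_borel by blast
 have [measurable]: "rot a b \<in> borel_measurable borel" by (intro borel_measurable_continuous_onI rot_continuous)
 have [measurable]: "(%z. indicator A z :: ennreal) \<in> borel_measurable borel" by simp
 have "emeasure (distr (radial_measure h) (radial_measure h) (rot a b)) A = (\<integral>\<^sup>+z. indicator A z \<partial>distr (radial_measure h) (radial_measure h) (rot a b))"
  using A by simp
 also have "\<dots> = (\<integral>\<^sup>+z. indicator A (rot a b z) \<partial>radial_measure h)"
  by (rule nn_integral_distr[OF m]) (use A in \<open>auto intro!: borel_measurable_indicator\<close>)
 also have "\<dots> = (\<integral>\<^sup>+r. (\<integral>\<^sup>+t1\<in>{0..<2*pi}. (\<integral>\<^sup>+t2\<in>{0..<2*pi}. ennreal (Wx h r) * indicator A (of_real r * (cis t1 * cis a), of_real (phix r) * (cis t2 * cis b)) \<partial>lborel) \<partial>lborel) \<partial>lborel)"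
 proof -
  have "(%z. indicator A (rot a b z) :: ennreal) \<in> borel_measurable borel" by measurable
  from nn_integral_radial[OF h this] show ?thesis by (simp add: rot_def mult_ac)
 qed
 also have "\<dots> = (\<integral>\<^sup>+r. (\<integral>\<^sup>+t1\<in>{0..<2*pi}. (\<integral>\<^sup>+t2\<in>{0..<2*pi}. ennreal (Wx h r) * indicator A (of_real r * (cis t1 * cis a), of_real (phix r) * cis t2) \<partial>lborel) \<partial>lborel) \<partial>lborel)"
  by (intro nn_integral_cong arg_cong2[where f = "(*)"] refl nn_integral_cis_shift) measurable
 also have "\<dots> = (\<integral>\<^sup>+r. (\<integral>\<^sup>+t1\<in>{0..<2*pi}. (\<integral>\<^sup>+t2\<in>{0..<2*pi}. ennreal (Wx h r) * indicator A (of_real r * cis t1, of_real (phix r) * cis t2) \<partial>lborel) \<partial>lborel) \<partial>lborel)"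
  by (intro nn_integral_cong nn_integral_cis_shift) measurable
 also have "\<dots> = emeasure (radial_measure h) A"
  by (subst nn_integral_radial[OF h, symmetric]) (use A in auto)
 finally show "emeasure (distr (radial_measure h) (radial_measure h) (rot a b)) A = emeasure (radial_measure h) A" .
qed simp


lemma levi_measurable: "levi_norm \<phi> \<in> borel_measurable (restrict_space borel (bD b1 \<phi>))"
proof -
 define l where "l = (%r. indicator {0<..<b1} r *\<^sub>R LV r)"
 have [measurable]: "l \<in> borel_measurable borel" unfolding l_def
  by (rule borel_measurable_continuous_on_indicator[OF _ LV_SD_cont(1)]) simp
 have [measurable]: "(%z :: C2. fst z) \<in> borel_measurable borel" "(%z :: C2. snd z) \<in> borel_measurable borel"
  by (intro borel_measurable_continuous_onI continuous_intros)+
 have "(%z :: C2. if fst z = 0 \<or> snd z = 0 then 0 else l (cmod (fst z))) \<in> borel_measurable borel" by measurable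
 then have "(%z :: C2. if fst z = 0 \<or> snd z = 0 then 0 else l (cmod (fst z))) \<in> borel_measurable (restrict_space borel (bD b1 \<phi>))"
  by (rule measurable_restrict_space1)
 moreover have "(if fst z = 0 \<or> snd z = 0 then 0 else l (cmod (fst z))) = levi_norm \<phi> z" if z: "z \<in> bD b1 \<phi>" for z
 proof (cases "fst z = 0 \<or> snd z = 0")
  case True then show ?thesis by (simp add: levi_norm_def)
 next
  case False
  have z: "cmod (fst z) \<le> b1" "cmod (snd z) = \<phi> (cmod (fst z))" using that unfolding bD_eq by auto
  then have "cmod (fst z) \<noteq> b1" using False basic(6) by auto
  then have r: "0 < cmod (fst z)" "cmod (fst z) < b1" using z False by auto
  then show ?thesis using levi_norm_eq[OF r refl z(2)] False by (simp add: l_def)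
 qed
 ultimately show ?thesis by (subst measurable_cong[symmetric]) (auto simp: space_restrict_space)
qed

lemma SD_measurable: "(%x. ennreal (SD (fst x))) \<in> borel_measurable (param_measure b1)"
proof -
 define l where "l = (%r. indicator {0<..<b1} r *\<^sub>R SD r)"
 have [measurable]: "l \<in> borel_measurable borel" unfolding l_def
  by (rule borel_measurable_continuous_on_indicator[OF _ LV_SD_cont(2)]) simp
 have "(%x :: real \<times> real \<times> real. fst x) \<in> borel_measurable borel" by (intro borel_measurable_continuous_onI continuous_intros)
 then have "(%x :: real \<times> real \<times> real. ennreal (l (fst x))) \<in> borel_measurable borel" by measurable
 then have "(%x. ennreal (l (fst x))) \<in> borel_measurable (restrict_space borel box)" by (rule measurable_restrict_space1)
 then have "(%x. ennreal (l (fst x))) \<in> borel_measurable (param_measure b1)" by (simp add: measurable_cong_sets[OF sets_param refl])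
 then show ?thesis
  by (rule measurable_cong[THEN iffD1, rotated]) (auto simp: space_param l_def bd_param_box)
qed

lemma pos_fun_one: "pos_fun (%_. 1)" by (simp add: pos_fun_def)

lemma weight_mult: "weight h q r = h r * weight (%_. 1) q r" by (simp add: weight_def)

lemma density_radial:
 assumes h: "h \<in> borel_measurable (restrict_space borel (bD b1 \<phi>))"
 shows "density (radial_measure (%_. 1)) h =
  distr (density (param_measure b1) (%x. ennreal (weight (%_. 1) q (fst x)) * h (bd_param \<phi> x))) (restrict_space borel (bD b1 \<phi>)) (bd_param \<phi>)"
proof -
 have "density (radial_measure (%_. 1)) h = distr (density (density (param_measure b1) (%x. ennreal (weight (%_. 1) q (fst x)))) (%x. h (bd_param \<phi> x))) (restrict_space borel (bD b1 \<phi>)) (bd_param \<phi>)"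
  unfolding radial_measure_def by (rule density_distr) (use h bd_param_measurable in auto)
 also have "density (density (param_measure b1) (%x. ennreal (weight (%_. 1) q (fst x)))) (%x. h (bd_param \<phi> x))
   = density (param_measure b1) (%x. ennreal (weight (%_. 1) q (fst x)) * h (bd_param \<phi> x))"
  by (rule density_density_eq) (use weight_param_measurable[OF pos_fun_one] measurable_compose[OF bd_param_measurable h] in auto)
 finally show ?thesis .
qed

text \<open>The set where two continuous functions differ is open in the parameters; if it is a null
  set, it is empty.\<close>

lemma rot_invariant_continuous:
 fixes h :: "C2 \<Rightarrow> real"
 assumes h: "continuous_on (bD b1 \<phi>) h" and ae: "AE z in radial_measure (%_. 1). h z = h (rot a b z)"
  and x: "x \<in> {0<..<b1} \<times> {0<..<2*pi} \<times> {0<..<2*pi}"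
 shows "h (bd_param \<phi> x) = h (rot a b (bd_param \<phi> x))"
proof -
 \<comment> \<open>The parameter box contains the angle 0 and is not open; the argument needs an
   open set.\<close>
 let ?O = "{0<..<b1} \<times> {0<..<2*pi} \<times> {0<..<2*pi} :: (real \<times> real \<times> real) set"
 have Ob: "?O \<subseteq> box" by (auto simp: box_def)
 have bdm: "bd_param \<phi> \<in> measurable (density (param_measure b1) (%x. ennreal (weight (%_. 1) q (fst x)))) (restrict_space borel (bD b1 \<phi>))"
  using bd_param_measurable by simp
 have "AE x in density (param_measure b1) (%x. ennreal (weight (%_. 1) q (fst x))). h (bd_param \<phi> x) = h (rot a b (bd_param \<phi> x))"
  using ae unfolding radial_measure_def by (rule AE_distrD[OF bdm])
 then have "AE x in param_measure b1. 0 < ennreal (weight (%_. 1) q (fst x)) \<longrightarrow> h (bd_param \<phi> x) = h (rot a b (bd_param \<phi> x))"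
  by (subst (asm) AE_density[OF weight_param_measurable[OF pos_fun_one]])
 then have "AE x in lborel. x \<in> box \<longrightarrow> 0 < ennreal (weight (%_. 1) q (fst x)) \<longrightarrow> h (bd_param \<phi> x) = h (rot a b (bd_param \<phi> x))"
  unfolding param_measure_def box_def[symmetric] by (subst (asm) AE_restrict_space_iff) auto
 then have A: "AE x in lborel. x \<in> ?O \<longrightarrow> h (bdx x) = h (rot a b (bdx x))"
 proof (eventually_elim, intro impI)
  fix x :: "real \<times> real \<times> real" assume 1: "x \<in> box \<longrightarrow> 0 < ennreal (weight (%_. 1) q (fst x)) \<longrightarrow> h (bd_param \<phi> x) = h (rot a b (bd_param \<phi> x))" and "x \<in> ?O"
  then have x: "x \<in> box" using Ob by blast
  then show "h (bdx x) = h (rot a b (bdx x))" using 1 weight_pos[OF pos_fun_one, of "fst x"] bd_param_box[OF x] by simp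
 qed
 have bO: "bdx ` ?O \<subseteq> bD b1 \<phi>" 
 proof (rule image_subsetI)
  fix x assume "x \<in> ?O"
  then have "x \<in> box" using Ob by blast
  then show "bdx x \<in> bD b1 \<phi>" using bd_param_box(1,2)[of x] by simp
 qed
 have cb: "continuous_on ?O bdx"
  unfolding bdx_def by (auto simp: case_prod_beta intro!: continuous_intros continuous_on_compose2[OF phix_cont[of UNIV]])
 have c1: "continuous_on ?O (%x. h (bdx x))" by (rule continuous_on_compose2[OF h cb bO])
 have c2: "continuous_on ?O (%x. h (rot a b (bdx x)))"
 proof (rule continuous_on_compose2[OF h])
  show "continuous_on ?O (%x. rot a b (bdx x))" by (rule continuous_on_compose2[OF rot_continuous[of UNIV] cb]) simp
  show "(%x. rot a b (bdx x)) ` ?O \<subseteq> bD b1 \<phi>" by (rule image_subsetI, rule rot_bD) (use bO in blast)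
 qed
 define U where "U = ?O \<inter> (%x. h (bdx x) - h (rot a b (bdx x))) -` (- {0})"
 have "open ?O" by (intro open_Times) auto
 then have U: "open U" unfolding U_def
  by (intro continuous_open_preimage continuous_on_diff c1 c2) auto
 have "AE x in lborel. x \<notin> U" using A by eventually_elim (auto simp: U_def)
 then have "U \<in> null_sets lborel" using U by (subst AE_iff_null_sets) auto
 then have "negligible U" by (simp add: negligible_iff_null_sets null_sets_completionI)
 then have "U = {}" using open_not_negligible[OF U] by blast
 have "h (bdx x) = h (rot a b (bdx x))"
 proof (rule ccontr)
  assume "h (bdx x) \<noteq> h (rot a b (bdx x))"
  then have "x \<in> U" unfolding U_def by (intro IntI x vimageI2) simp
  then show False using \<open>U = {}\<close> by simp
 qed
 moreover have "x \<in> box" using Ob x by blast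
 ultimately show ?thesis using bd_param_box(2)[of x] by simp
qed

text \<open>Invariance of the measure gives invariance of its density almost everywhere, separately
  for each rotation. Since the density is continuous, this improves to all points of the open box,
  so it is a function of the radius.\<close>

theorem has_order_radial:
 assumes inv: "rotation_invariant \<mu>" and ord: "has_order b1 \<phi> q \<mu>"
 shows "\<exists>h. pos_fun h \<and> \<mu> = radial_measure h"
proof -
 obtain h where h: "continuous_on (bD b1 \<phi>) h" "\<forall>z\<in>bD b1 \<phi>. 0 < h z"
  and mu: "\<mu> = density (surface_measure b1 \<phi>) (%z. ennreal (h z * levi_norm \<phi> z powr (1 - q)))"
  using ord unfolding has_order_def by (elim exE conjE)
 let ?S = "restrict_space borel (bD b1 \<phi>)" let ?P = "param_measure b1" let ?bd = "bd_param \<phi>"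
 let ?N = "radial_measure (%_. 1)" let ?w = "%x. ennreal (weight (%_. 1) q (fst x))"
 have hm[measurable]: "h \<in> borel_measurable ?S" by (rule borel_measurable_continuous_on_restrict[OF h(1)])
 have hm': "(%z. ennreal (h z)) \<in> borel_measurable ?S" by measurable
 note [measurable] = levi_measurable bd_param_measurable
 define d where "d = (%z. ennreal (h z * levi_norm \<phi> z powr (1 - q)))"
 have dm[measurable]: "d \<in> borel_measurable ?S" unfolding d_def by measurable
 have SDeq: "surface_density \<phi> (?bd x) = SD (fst x)" "levi_norm \<phi> (?bd x) = LV (fst x)" if "x \<in> box" for x
  using bd_param_box[OF that] surface_density_eq[of "fst x" "?bd x"] levi_norm_eq[of "fst x" "?bd x"] by auto
 have sdm: "(%x. ennreal (surface_density \<phi> (?bd x))) \<in> borel_measurable ?P"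
  by (rule measurable_cong[THEN iffD2, OF _ SD_measurable]) (simp add: space_param SDeq)
 have muN: "\<mu> = density ?N (%z. ennreal (h z))"
 proof -
  have "\<mu> = distr (density (density ?P (%x. ennreal (surface_density \<phi> (?bd x)))) (%x. d (?bd x))) ?S ?bd"
   unfolding mu surface_measure_def d_def[symmetric] by (rule density_distr) auto
  also have "density (density ?P (%x. ennreal (surface_density \<phi> (?bd x)))) (%x. d (?bd x)) = density ?P (%x. ennreal (surface_density \<phi> (?bd x)) * d (?bd x))"
   by (rule density_density_eq[OF sdm]) measurable
  also have "\<dots> = density ?P (%x. ?w x * ennreal (h (?bd x)))"
  proof (rule density_cong)
   show "(%x. ennreal (surface_density \<phi> (?bd x)) * d (?bd x)) \<in> borel_measurable ?P"
    by (intro borel_measurable_times_ennreal sdm measurable_compose[OF bd_param_measurable dm])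
   show "(%x. ?w x * ennreal (h (?bd x))) \<in> borel_measurable ?P"
    by (intro borel_measurable_times_ennreal weight_param_measurable pos_fun_one measurable_compose[OF bd_param_measurable hm'])
   show "AE x in ?P. ennreal (surface_density \<phi> (?bd x)) * d (?bd x) = ?w x * ennreal (h (?bd x))"
   proof (rule AE_I2)
    fix x assume "x \<in> space ?P"
    then have x: "x \<in> box" by (simp add: space_param)
    have p: "0 < h (?bd x)" "0 < SD (fst x)" using h(2) bd_param_box[OF x] LV_eq(3)[of "fst x"] by auto
    show "ennreal (surface_density \<phi> (?bd x)) * d (?bd x) = ?w x * ennreal (h (?bd x))"
     unfolding d_def SDeq[OF x] weight_def using p by (simp add: ennreal_mult[symmetric] mult_ac)
   qed
  qed
  finally show ?thesis by (simp add: density_radial[OF hm'])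
 qed
 have rm: "rot a b \<in> measurable ?N ?N" for a b
  using rot_measurable by (simp add: measurable_cong_sets[OF radial_sets(1) radial_sets(1)])
 interpret N: finite_measure ?N by (rule finite_radial[OF pos_fun_one])
 have setsmu: "sets \<mu> = sets ?N" by (simp add: muN)
 have ae: "AE z in ?N. h z = h (rot a b z)" for a b
 proof -
  have hN: "(%z. ennreal (h z)) \<in> borel_measurable ?N" using hm' by (simp add: measurable_cong_sets[OF radial_sets(1) refl])
  have hrN: "(%z. ennreal (h (rot a b z))) \<in> borel_measurable ?N" by (rule measurable_compose[OF rm hN])
  have "\<mu> = density (distr ?N ?N (rot a b)) (%z. ennreal (h z))" unfolding muN radial_rotation_invariant[OF pos_fun_one] ..
  also have "\<dots> = distr (density ?N (%z. ennreal (h (rot a b z)))) ?N (rot a b)"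
   by (rule density_distr[OF hN rm])
  finally have e1: "\<mu> = distr (density ?N (%z. ennreal (h (rot a b z)))) ?N (rot a b)" .
  \<comment> \<open>Rotating back compares mu = h N with (h o rot) N, and uniqueness of densities
    with respect to the finite measure N applies.\<close>
  have "distr \<mu> ?N (rot (-a) (-b)) = distr \<mu> \<mu> (rot (-a) (-b))" by (rule distr_cong) (auto simp: setsmu)
  also have "\<dots> = \<mu>" using inv unfolding rotation_invariant_def rot_def[abs_def] by blast
  finally have "\<mu> = distr \<mu> ?N (rot (-a) (-b))" ..
  also have "\<dots> = distr (density ?N (%z. ennreal (h (rot a b z)))) ?N (rot (-a) (-b) \<circ> rot a b)"
   by (subst e1) (rule distr_distr, use rm in auto)
  also have "rot (-a) (-b) \<circ> rot a b = (%z. z)" by (auto simp: rot_rot rot_0)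
  also have "distr (density ?N (%z. ennreal (h (rot a b z)))) ?N (%z. z) = density ?N (%z. ennreal (h (rot a b z)))"
   by (rule distr_id2) simp
  finally have "density ?N (%z. ennreal (h z)) = density ?N (%z. ennreal (h (rot a b z)))" using muN by simp
  from N.density_unique[OF hN hrN this] have "AE z in ?N. ennreal (h z) = ennreal (h (rot a b z))" .
  moreover have "AE z in ?N. z \<in> bD b1 \<phi>" by (rule AE_I2) simp
  ultimately show ?thesis by eventually_elim (use h(2) rot_bD in \<open>auto simp: less_imp_le\<close>)
 qed
 \<comment> \<open>The angles pi are interior to the box. Every other point, including those with
   angle 0, is reached by rotating this one.\<close>
 define h0 where "h0 = (%r. h (?bd (r, pi, pi)))"
 have h0: "h (?bd x) = h0 (fst x)" if "x \<in> box" for x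
 proof -
  obtain r t1 t2 where x: "x = (r, t1, t2)" by (cases x)
  have r: "0 < r" "r < b1" using that by (auto simp: x box_def)
  have e: "rot (t1 - pi) (t2 - pi) (?bd (r, pi, pi)) = ?bd x"
  proof -
   have "cis (t - pi) = - cis t" for t by (simp add: complex_eq_iff cos_diff sin_diff)
   then show ?thesis by (simp add: rot_def bd_param_def x mult.commute)
  qed
  have "h (?bd (r, pi, pi)) = h (rot (t1 - pi) (t2 - pi) (?bd (r, pi, pi)))"
   by (rule rot_invariant_continuous[OF h(1) ae]) (use r in auto)
  then show ?thesis unfolding e by (simp add: h0_def x)
 qed
 have p0: "pos_fun h0" unfolding pos_fun_def
 proof (intro conjI allI impI)
  have "continuous_on {0..b1} (%r. ?bd (r, pi, pi))" unfolding bd_param_def by (auto intro!: continuous_intros basic(4))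
  then show "continuous_on {0..b1} h0" unfolding h0_def
   by (rule continuous_on_compose2[OF h(1)]) (use bd_param_simps(3) in auto)
  show "0 < h0 r" if "0 \<le> r" "r \<le> b1" for r unfolding h0_def using h(2) bd_param_simps(3)[OF that] by blast
 qed
 have "\<mu> = distr (density ?P (%x. ?w x * ennreal (h (?bd x)))) ?S ?bd" unfolding muN by (rule density_radial[OF hm'])
 also have "\<dots> = radial_measure h0" unfolding radial_measure_def
 proof (rule arg_cong[where f = "%M. distr M ?S ?bd"], rule density_cong)
  show "(%x. ?w x * ennreal (h (?bd x))) \<in> borel_measurable ?P"
   by (intro borel_measurable_times_ennreal weight_param_measurable pos_fun_one measurable_compose[OF bd_param_measurable hm'])
  show "(%x. ennreal (weight h0 q (fst x))) \<in> borel_measurable ?P" by (rule weight_param_measurable[OF p0])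
  show "AE x in ?P. ?w x * ennreal (h (?bd x)) = ennreal (weight h0 q (fst x))"
  proof (rule AE_I2)
   fix x assume "x \<in> space ?P"
   then have x: "x \<in> box" by (simp add: space_param)
   have "0 < h0 (fst x)" "0 < weight (%_. 1) q (fst x)"
    using p0 bd_param_box(5,6)[OF x] weight_pos[OF pos_fun_one] by (auto simp: pos_fun_def)
   then show "?w x * ennreal (h (?bd x)) = ennreal (weight h0 q (fst x))"
    unfolding h0[OF x] weight_mult[of h0] by (simp add: ennreal_mult[symmetric] mult.commute)
  qed
 qed
 finally show ?thesis using p0 by (intro exI[of _ h0] conjI)
qed

end

section \<open>Polynomials in the coordinates and their conjugates\<close>

lemma continuous_imp_borel_C2:
 fixes f :: "C2 \<Rightarrow> 'b :: topological_space" shows "continuous_on UNIV f ==> f \<in> borel_measurable borel"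
 by (rule borel_measurable_continuous_onI)

text \<open>These polynomials are dense by the Stone-Weierstrass theorem, and each single term is an
  (i - j, k - l)-monomial; this links the density theorem with the monomial decomposition.\<close>

inductive mpoly :: "(C2 \<Rightarrow> complex) \<Rightarrow> bool" where
 monomial: "mpoly (%z. c * (fst z ^ i * cnj (fst z) ^ j * (snd z ^ k * cnj (snd z) ^ l)))"
| sum: "mpoly f ==> mpoly g ==> mpoly (%z. f z + g z)"

lemma mpoly_term_mult:
 assumes "mpoly g" shows "mpoly (%z. c * (fst z ^ i * cnj (fst z) ^ j * (snd z ^ k * cnj (snd z) ^ l)) * g z)"
 using assms
proof induction
 case (monomial d i' j' k' l')
 have "mpoly (%z. (c * d) * (fst z ^ (i + i') * cnj (fst z) ^ (j + j') * (snd z ^ (k + k') * cnj (snd z) ^ (l + l'))))"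
  by (rule mpoly.monomial)
 then show ?case by (simp add: power_add mult_ac)
next
 case (sum f g)
 from mpoly.sum[OF sum.IH] show ?case by (simp add: distrib_left)
qed

lemma mpoly_mult: assumes "mpoly f" "mpoly g" shows "mpoly (%z. f z * g z)"
 using assms(1)
proof induction
 case monomial show ?case by (rule mpoly_term_mult[OF assms(2)])
next
 case (sum f1 f2)
 from mpoly.sum[OF sum.IH] show ?case by (simp add: distrib_right)
qed

text \<open>The one substantial case is a real-linear form: it is c1 z1 + c2 z2 plus the conjugate
  expression, the coefficients being found from its values on 1 and the imaginary unit in each
  coordinate.\<close>

lemma mpoly_real_polynomial: "real_polynomial_function g ==> mpoly (%z. complex_of_real (g z))"
proof (induction rule: real_polynomial_function.induct)
 case (linear f)
 interpret bounded_linear f by (rule linear)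
 have "complex_of_real (f z) = (((of_real (f (1, 0)) / 2 - \<i> * of_real (f (\<i>, 0)) / 2) * (fst z ^ 1 * cnj (fst z) ^ 0 * (snd z ^ 0 * cnj (snd z) ^ 0)) +
   (of_real (f (1, 0)) / 2 + \<i> * of_real (f (\<i>, 0)) / 2) * (fst z ^ 0 * cnj (fst z) ^ 1 * (snd z ^ 0 * cnj (snd z) ^ 0))) +
   (of_real (f (0, 1)) / 2 - \<i> * of_real (f (0, \<i>)) / 2) * (fst z ^ 0 * cnj (fst z) ^ 0 * (snd z ^ 1 * cnj (snd z) ^ 0))) +
   (of_real (f (0, 1)) / 2 + \<i> * of_real (f (0, \<i>)) / 2) * (fst z ^ 0 * cnj (fst z) ^ 0 * (snd z ^ 0 * cnj (snd z) ^ 1))" for z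
 proof -
  have "z = Re (fst z) *\<^sub>R (1, 0) + Im (fst z) *\<^sub>R (\<i>, 0) + Re (snd z) *\<^sub>R (0, 1) + Im (snd z) *\<^sub>R (0, \<i>)"
   by (rule prod_eqI) (simp_all add: complex_eq_iff)
  then have "f z = f (Re (fst z) *\<^sub>R (1, 0) + Im (fst z) *\<^sub>R (\<i>, 0) + Re (snd z) *\<^sub>R (0, 1) + Im (snd z) *\<^sub>R (0, \<i>))" by (rule arg_cong)
  also have "\<dots> = Re (fst z) * f (1, 0) + Im (fst z) * f (\<i>, 0) + Re (snd z) * f (0, 1) + Im (snd z) * f (0, \<i>)"
   by (simp only: add scaleR real_scaleR_def)
  finally have "f z = Re (fst z) * f (1, 0) + Im (fst z) * f (\<i>, 0) + Re (snd z) * f (0, 1) + Im (snd z) * f (0, \<i>)" .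
  moreover define A B C D x y where "A = f (1, 0)" and "B = f (\<i>, 0)" and "C = f (0, 1)" and "D = f (0, \<i>)" and "x = fst z" and "y = snd z"
  ultimately have e: "f z = Re x * A + Im x * B + Re y * C + Im y * D" by simp
  show ?thesis unfolding e A_def[symmetric] B_def[symmetric] C_def[symmetric] D_def[symmetric] x_def[symmetric] y_def[symmetric]
   by (simp add: complex_eq_iff)
 qed
 then have eq: "(%z. complex_of_real (f z)) = (%z. (((of_real (f (1, 0)) / 2 - \<i> * of_real (f (\<i>, 0)) / 2) * (fst z ^ 1 * cnj (fst z) ^ 0 * (snd z ^ 0 * cnj (snd z) ^ 0)) +
   (of_real (f (1, 0)) / 2 + \<i> * of_real (f (\<i>, 0)) / 2) * (fst z ^ 0 * cnj (fst z) ^ 1 * (snd z ^ 0 * cnj (snd z) ^ 0))) +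
   (of_real (f (0, 1)) / 2 - \<i> * of_real (f (0, \<i>)) / 2) * (fst z ^ 0 * cnj (fst z) ^ 0 * (snd z ^ 1 * cnj (snd z) ^ 0))) +
   (of_real (f (0, 1)) / 2 + \<i> * of_real (f (0, \<i>)) / 2) * (fst z ^ 0 * cnj (fst z) ^ 0 * (snd z ^ 0 * cnj (snd z) ^ 1)))" by (rule ext)
 show ?case unfolding eq by (intro mpoly.intros)
next
 case (const c)
 from mpoly.monomial[of "complex_of_real c" 0 0 0 0] show ?case by simp
next
 case (add f g) from mpoly.sum[OF add.IH] show ?case by simp
next
 case (mult f g) from mpoly_mult[OF mult.IH] show ?case by simp
qed

lemma sgn_mult_powi: "sgn (cis a * z) powi n = cis (a * of_int n) * sgn z powi n" for z :: complex
proof -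
 have "cis a powi n = cis (a * of_int n)" by (simp add: cis_power_int mult.commute)
 moreover have "sgn (cis a * z) = cis a * sgn z" by (simp add: sgn_mult sgn_div_norm[of "cis a"])
 ultimately show ?thesis by (simp add: power_int_mult_distrib)
qed

lemma powi_sgn:
 fixes z :: complex assumes "z \<noteq> 0"
 shows "z ^ i * cnj z ^ j = of_real (cmod z ^ (i + j)) * sgn z powi (int i - int j)"
proof -
 have z: "z = of_real (cmod z) * sgn z" using assms by (simp add: sgn_div_norm scaleR_conv_of_real)
 have s: "sgn z \<noteq> 0" using assms by (simp add: sgn_zero_iff)
 have c: "cnj (sgn z) = inverse (sgn z)"
 proof -
  have "sgn z * cnj (sgn z) = 1" using assms by (simp add: complex_norm_square[symmetric] norm_sgn)
  then show ?thesis by (metis inverse_unique)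
 qed
 have "z ^ i * cnj z ^ j = (of_real (cmod z) * sgn z) ^ i * cnj (of_real (cmod z) * sgn z) ^ j" by (simp only: z[symmetric])
 also have "\<dots> = of_real (cmod z ^ (i + j)) * (sgn z ^ i * inverse (sgn z) ^ j)"
  using c by (simp add: power_mult_distrib power_add)
 also have "sgn z ^ i * inverse (sgn z) ^ j = sgn z powi (int i - int j)"
  using s by (simp add: power_int_diff divide_inverse power_inverse)
 finally show ?thesis .
qed

section \<open>Orthogonal decomposition into monomials\<close>

locale reinhardt_L2 = reinhardt_order +
 fixes h :: "real \<Rightarrow> real"
 assumes h: "pos_fun h"
begin

abbreviation "\<mu> \<equiv> radial_measure h"

sublocale mu: finite_measure \<mu> by (rule finite_radial[OF h])

lemma mu_measurableI: "f \<in> borel_measurable borel ==> f \<in> borel_measurable \<mu>" for f :: "C2 \<Rightarrow> 'b :: topological_space"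
 using measurable_restrict_space1 measurable_cong_sets[OF radial_sets(1) refl] by blast

lemma fst_snd_mu[measurable]: "fst \<in> borel_measurable \<mu>" "snd \<in> borel_measurable \<mu>"
 by (intro mu_measurableI continuous_imp_borel_C2 continuous_intros)+

text \<open>The points covered by the coordinate s; the two exceptional circles form a null
  set.\<close>

definition regular :: "C2 \<Rightarrow> bool" where
 "regular z \<longleftrightarrow> z \<in> bD b1 \<phi> \<and> fst z \<noteq> 0 \<and> snd z \<noteq> 0 \<and> 0 < cmod (fst z) \<and> cmod (fst z) < b1"

lemma regularD:
 assumes "regular z"
 shows "0 < cmod (fst z)" "cmod (fst z) < b1" "cmod (snd z) = \<phi> (cmod (fst z))" "z \<in> bD b1 \<phi>" "fst z \<noteq> 0" "snd z \<noteq> 0"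
  "rr (sc (cmod (fst z))) = cmod (fst z)"
proof -
 show z: "0 < cmod (fst z)" "cmod (fst z) < b1" "z \<in> bD b1 \<phi>" "fst z \<noteq> 0" "snd z \<noteq> 0" using assms unfolding regular_def by blast+
 show "cmod (snd z) = \<phi> (cmod (fst z))" using z(3) unfolding bD_eq by blast
 show "rr (sc (cmod (fst z))) = cmod (fst z)" by (rule rr_sc[OF z(1,2)])
qed

lemma AE_regular: "AE z in \<mu>. regular z"
proof -
 have "AE z in \<mu>. fst z \<noteq> 0 \<and> snd z \<noteq> 0"
  unfolding radial_measure_def
 proof (subst AE_distr_iff)
  show "bd_param \<phi> \<in> measurable (density (param_measure b1) (%x. ennreal (weight h q (fst x)))) (restrict_space borel (bD b1 \<phi>))"
   using bd_param_measurable by simp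
  have "{x \<in> space \<mu>. fst x \<noteq> 0 \<and> snd x \<noteq> 0} \<in> sets \<mu>" by measurable
  then show "{x \<in> space (restrict_space borel (bD b1 \<phi>)). fst x \<noteq> 0 \<and> snd x \<noteq> 0} \<in> sets (restrict_space borel (bD b1 \<phi>))"
   by (simp add: space_restrict_space)
  show "AE x in density (param_measure b1) (%x. ennreal (weight h q (fst x))). fst (bd_param \<phi> x) \<noteq> 0 \<and> snd (bd_param \<phi> x) \<noteq> 0"
  proof (rule AE_I2)
   fix x assume "x \<in> space (density (param_measure b1) (%x. ennreal (weight h q (fst x))))"
   then have x: "x \<in> box" by (simp add: space_param)
   then have "cmod (fst (bd_param \<phi> x)) \<noteq> 0" "cmod (snd (bd_param \<phi> x)) \<noteq> 0"
    using bd_param_box[OF x] phi_pos[of "fst x"] by auto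
   then show "fst (bd_param \<phi> x) \<noteq> 0 \<and> snd (bd_param \<phi> x) \<noteq> 0" by auto
  qed
 qed
 moreover have "AE z in \<mu>. z \<in> bD b1 \<phi>" by (rule AE_I2) simp
 ultimately show ?thesis
 proof eventually_elim
  fix z assume z: "fst z \<noteq> 0 \<and> snd z \<noteq> 0" "z \<in> bD b1 \<phi>"
  then have "cmod (fst z) \<le> b1" "cmod (snd z) = \<phi> (cmod (fst z))" unfolding bD_eq by auto
  moreover have "cmod (fst z) \<noteq> b1" using z calculation basic(6) by auto
  ultimately show "regular z" using z by (simp add: regular_def)
 qed
qed

lemma L2_bounded: assumes "f \<in> borel_measurable \<mu>" "!!z. z \<in> bD b1 \<phi> ==> cmod (f z) \<le> B" shows "f \<in> L2 \<mu>"
 unfolding L2_iff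
proof
 have "AE z in \<mu>. \<bar>(cmod (f z))\<^sup>2\<bar> \<le> B\<^sup>2" using assms(2) by (intro AE_I2) (simp add: power_mono)
 then show "integrable \<mu> (%z. (cmod (f z))\<^sup>2)" using assms(1)
  by (intro mu.integrable_const_bound[of _ "B\<^sup>2"]) auto
qed fact

lemma L2_continuous: assumes "continuous_on UNIV f" shows "f \<in> L2 \<mu>"
proof -
 have "compact (f ` bD b1 \<phi>)" by (intro compact_continuous_image compact_bD continuous_on_subset[OF assms]) simp
 then obtain B where "\<forall>y\<in>f ` bD b1 \<phi>. cmod y \<le> B" using compact_imp_bounded bounded_iff by metis
 then show ?thesis by (intro L2_bounded[of _ B] mu_measurableI continuous_imp_borel_C2 assms) auto
qed

definition V :: "int \<Rightarrow> int \<Rightarrow> (C2 \<Rightarrow> complex) set" where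
 "V n m = {f \<in> L2 \<mu>. is_monomial b1 \<phi> n m f}"

lemma V_L2: "f \<in> V n m ==> f \<in> L2 \<mu>" by (simp add: V_def)

lemma is_monomialI:
 assumes "!!z. regular z ==> f z = g (sc (cmod (fst z))) * (sgn (fst z) powi n * sgn (snd z) powi m)"
 shows "is_monomial b1 \<phi> n m f"
 unfolding is_monomial_def
proof (intro exI ballI impI)
 fix z assume z: "z \<in> bD b1 \<phi>" "fst z \<noteq> 0" "snd z \<noteq> 0"
 then have "cmod (fst z) \<le> b1" "cmod (snd z) = \<phi> (cmod (fst z))" unfolding bD_eq by auto
 moreover have "cmod (fst z) \<noteq> b1" using z calculation basic(6) by auto
 ultimately have "regular z" using z by (simp add: regular_def)
 then show "f z = g (sc (cmod (fst z))) * (sgn (fst z) powi n * sgn (snd z) powi m)" by (rule assms)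
qed

lemma is_monomialD:
 assumes "is_monomial b1 \<phi> n m f"
 shows "\<exists>g. \<forall>z. regular z \<longrightarrow> f z = g (sc (cmod (fst z))) * (sgn (fst z) powi n * sgn (snd z) powi m)"
proof -
 obtain g where g: "\<forall>\<zeta>\<in>bD b1 \<phi>. fst \<zeta> \<noteq> 0 \<longrightarrow> snd \<zeta> \<noteq> 0 \<longrightarrow> f \<zeta> = g (sc (cmod (fst \<zeta>))) * (sgn (fst \<zeta>) powi n * sgn (snd \<zeta>) powi m)"
  using assms unfolding is_monomial_def by (elim exE)
 then show ?thesis by (intro exI[of _ g]) (simp add: regular_def)
qed

lemma V_subspace: "l2_subspace \<mu> (V n m)"
 unfolding l2_subspace_def
proof (intro conjI ballI allI)
 show "V n m \<subseteq> L2 \<mu>" by (auto simp: V_def)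
 have "(%_. 0) \<in> V n m" unfolding V_def by (simp, rule is_monomialI[of _ "%_. 0"]) simp
 then show "V n m \<noteq> {}" by blast
 fix f g c d assume f: "f \<in> V n m" and g: "g \<in> V n m"
 have "is_monomial b1 \<phi> n m f" "is_monomial b1 \<phi> n m g" using f g by (auto simp: V_def)
 from is_monomialD[OF this(1)] is_monomialD[OF this(2)] obtain f' g' where
  fg: "\<forall>z. regular z \<longrightarrow> f z = f' (sc (cmod (fst z))) * (sgn (fst z) powi n * sgn (snd z) powi m)"
   "\<forall>z. regular z \<longrightarrow> g z = g' (sc (cmod (fst z))) * (sgn (fst z) powi n * sgn (snd z) powi m)"
  by (elim exE)
 have "is_monomial b1 \<phi> n m (%x. c * f x + d * g x)"
  by (rule is_monomialI[of _ "%s. c * f' s + d * g' s"]) (simp add: fg distrib_right mult.assoc)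
 then show "(%x. c * f x + d * g x) \<in> V n m" using L2_lincomb[of f \<mu> g c d] f g by (simp add: V_def)
qed

text \<open>The limit in L2 is constructed pointwise from a subsequence, so at regular points it
  inherits the form g(s) times a fixed character. This yields an honest monomial, without a
  modification on a null set.\<close>

lemma V_closed: "l2_closed \<mu> (V n m)"
 unfolding l2_closed_def
proof (intro allI impI)
 fix u assume u: "\<forall>j. u j \<in> V n m" and C: "l2_Cauchy \<mu> u"
 have uL: "u j \<in> L2 \<mu>" "is_monomial b1 \<phi> n m (u j)" for j using u by (auto simp: V_def)
 obtain k hh where k: "strict_mono k" and hh: "hh = (%x. if convergent (%j. u (k j) x) then lim (%j. u (k j) x) else 0)"
  and L: "hh \<in> L2 \<mu>" "(%n. l2_norm \<mu> (%x. u n x - hh x)) \<longlonglongrightarrow> 0"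
  using L2_complete[OF uL(1) C] by (elim exE conjE)
 have "\<forall>j. \<exists>g. \<forall>z. regular z \<longrightarrow> u j z = g (sc (cmod (fst z))) * (sgn (fst z) powi n * sgn (snd z) powi m)"
  by (intro allI is_monomialD[OF uL(2)])
 from choice[OF this] obtain g where g: "\<forall>j z. regular z \<longrightarrow> u j z = g j (sc (cmod (fst z))) * (sgn (fst z) powi n * sgn (snd z) powi m)"
  by (elim exE)
 have "is_monomial b1 \<phi> n m hh"
 proof (rule is_monomialI[of _ "%s. if convergent (%j. g (k j) s) then lim (%j. g (k j) s) else 0"])
  fix z assume z: "regular z"
  define c where "c = sgn (fst z) powi n * sgn (snd z) powi m"
  \<comment> \<open>As the character does not vanish, convergence of the products is equivalent to
    convergence of the radial factors.\<close>
  have c: "c \<noteq> 0" using z by (auto simp: c_def regular_def sgn_zero_iff)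
  have e: "(%j. u (k j) z) = (%j. g (k j) (sc (cmod (fst z))) * c)" by (rule ext) (simp only: g[rule_format, OF z] c_def)
  have i: "convergent (%j. g (k j) (sc (cmod (fst z))) * c) \<longleftrightarrow> convergent (%j. g (k j) (sc (cmod (fst z))))"
   by (rule convergent_mult_const_right_iff[OF c])
  have l: "lim (%j. g (k j) (sc (cmod (fst z))) * c) = lim (%j. g (k j) (sc (cmod (fst z)))) * c" if "convergent (%j. g (k j) (sc (cmod (fst z))))"
   by (rule limI, rule tendsto_mult_right, rule convergent_LIMSEQ_iff[THEN iffD1, OF that])
  show "hh z = (if convergent (%j. g (k j) (sc (cmod (fst z)))) then lim (%j. g (k j) (sc (cmod (fst z)))) else 0) * (sgn (fst z) powi n * sgn (snd z) powi m)"
  proof (cases "convergent (%j. g (k j) (sc (cmod (fst z))))")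
   case True
   have "hh z = lim (%j. g (k j) (sc (cmod (fst z)))) * c" unfolding hh e i l[OF True] by (rule if_P[OF True])
   then show ?thesis unfolding c_def[symmetric] if_P[OF True] .
  next
   case False
   have "hh z = 0" unfolding hh e i by (rule if_not_P[OF False])
   then show ?thesis unfolding if_not_P[OF False] mult_zero_left .
  qed
 qed
 then have hV: "hh \<in> V n m" unfolding V_def by (intro CollectI conjI L(1))
 show "\<exists>g\<in>V n m. (%n. l2_norm \<mu> (%x. u n x - g x)) \<longlonglongrightarrow> 0" 
  by (rule bexI[where P = "%g. (%n. l2_norm \<mu> (%x. u n x - g x)) \<longlonglongrightarrow> 0" and x = hh, OF L(2) hV])
qed

lemma V_rot:
 assumes "f \<in> V n m" "regular z"
 shows "f (rot a b z) = cis (a * of_int n) * cis (b * of_int m) * f z"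
proof -
 have "is_monomial b1 \<phi> n m f" using assms by (simp add: V_def)
 from is_monomialD[OF this] obtain g where g: "\<forall>z. regular z \<longrightarrow> f z = g (sc (cmod (fst z))) * (sgn (fst z) powi n * sgn (snd z) powi m)" by (elim exE)
 have c: "cmod (fst (rot a b z)) = cmod (fst z)" "fst (rot a b z) \<noteq> 0 \<longleftrightarrow> fst z \<noteq> 0" "snd (rot a b z) \<noteq> 0 \<longleftrightarrow> snd z \<noteq> 0"
  by (simp_all add: rot_def norm_mult)
 have r: "regular (rot a b z)" unfolding regular_def c
  by (intro conjI rot_bD regularD[OF assms(2)])
 show ?thesis unfolding g[rule_format, OF r] g[rule_format, OF assms(2)] c(1)
  by (simp only: rot_def fst_conv snd_conv sgn_mult_powi mult_ac)
qed

lemma integral_rot: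
 fixes F :: "C2 \<Rightarrow> complex"
 assumes "F \<in> borel_measurable \<mu>" shows "(\<integral>z. F (rot a b z) \<partial>\<mu>) = (\<integral>z. F z \<partial>\<mu>)"
proof -
 have m: "rot a b \<in> measurable \<mu> \<mu>"
  using rot_measurable by (simp add: measurable_cong_sets[OF radial_sets(1) radial_sets(1)])
 have "(\<integral>z. F z \<partial>distr \<mu> \<mu> (rot a b)) = (\<integral>z. F (rot a b z) \<partial>\<mu>)" by (rule integral_distr[OF m assms])
 then show ?thesis unfolding radial_rotation_invariant[OF h] by (rule sym)
qed


text \<open>A suitable rotation preserves the measure and multiplies the integrand by -1, so the
  inner product equals its negative.\<close>

lemma V_orthogonal:
 assumes f: "f \<in> V n m" and g: "g \<in> V n' m'" and ne: "(n, m) \<noteq> (n', m')"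
 shows "l2_inner \<mu> f g = 0"
proof -
 \<comment> \<open>The rotation is made in a coordinate in which the indices differ, by an angle
   that changes the phase by pi.\<close>
 define a where "a = (if n \<noteq> n' then pi / of_int (n - n') else 0)"
 define b where "b = (if n \<noteq> n' then 0 else pi / of_int (m - m'))"
 have "a * of_int (n - n') + b * of_int (m - m') = pi" 
 proof (cases "n = n'")
  case True then show ?thesis using ne by (simp add: a_def b_def)
 next
  case False
  then have "real_of_int (n - n') \<noteq> 0" by simp
  then show ?thesis using False unfolding a_def b_def by (simp del: of_int_diff)
 qed
 then have "a * of_int n + b * of_int m - (a * of_int n' + b * of_int m') = pi" by (simp add: algebra_simps)
 then have e: "a * of_int n + b * of_int m + (- (a * of_int n') + - (b * of_int m')) = pi" by simp
 have c: "cis (a * of_int n) * cis (b * of_int m) * (cnj (cis (a * of_int n')) * cnj (cis (b * of_int m'))) = - 1"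
  unfolding cis_cnj cis_mult e by simp
 have Fm: "(%z. f z * cnj (g z)) \<in> borel_measurable \<mu>"
  using integrable_inner[OF V_L2[OF f] V_L2[OF g]] by (rule borel_measurable_integrable)
 have m: "rot a b \<in> measurable \<mu> \<mu>"
  using rot_measurable by (simp add: measurable_cong_sets[OF radial_sets(1) radial_sets(1)])
 have "l2_inner \<mu> f g = (\<integral>z. f (rot a b z) * cnj (g (rot a b z)) \<partial>\<mu>)"
  unfolding l2_inner_def by (rule integral_rot[OF Fm, symmetric])
 also have "\<dots> = (\<integral>z. - (f z * cnj (g z)) \<partial>\<mu>)"
 proof (rule integral_cong_AE)
  show "(%z. f (rot a b z) * cnj (g (rot a b z))) \<in> borel_measurable \<mu>" by (rule measurable_compose[OF m Fm])
  show "AE z in \<mu>. f (rot a b z) * cnj (g (rot a b z)) = - (f z * cnj (g z))"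
   using AE_regular
  proof eventually_elim
   fix z assume z: "regular z"
   have "f (rot a b z) * cnj (g (rot a b z)) = (cis (a * of_int n) * cis (b * of_int m) * (cnj (cis (a * of_int n')) * cnj (cis (b * of_int m')))) * (f z * cnj (g z))"
    unfolding V_rot[OF f z] V_rot[OF g z] complex_cnj_mult by (simp only: mult_ac)
   then show "f (rot a b z) * cnj (g (rot a b z)) = - (f z * cnj (g z))" unfolding c by simp
  qed
 qed (use Fm in simp)
 also have "\<dots> = - l2_inner \<mu> f g" unfolding l2_inner_def by (rule Bochner_Integration.integral_minus)
 finally have "l2_inner \<mu> f g = - l2_inner \<mu> f g" .
 then have "2 * l2_inner \<mu> f g = 0" unfolding mult_2 by (rule eq_neg_iff_add_eq_0[THEN iffD1])
 then show ?thesis by simp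
qed


lemma term_in_V: "(%z. fst z ^ i * cnj (fst z) ^ j * (snd z ^ k * cnj (snd z) ^ l)) \<in> V (int i - int j) (int k - int l)"
proof -
 have "(%z. fst z ^ i * cnj (fst z) ^ j * (snd z ^ k * cnj (snd z) ^ l)) \<in> L2 \<mu>"
  by (rule L2_continuous) (intro continuous_intros)
 moreover have "is_monomial b1 \<phi> (int i - int j) (int k - int l) (%z. fst z ^ i * cnj (fst z) ^ j * (snd z ^ k * cnj (snd z) ^ l))"
 proof (rule is_monomialI[of _ "%s. of_real (rr s ^ (i + j) * \<phi> (rr s) ^ (k + l))"])
  fix z assume z: "regular z"
  note p = powi_sgn[OF regularD(5)[OF z], of i j] powi_sgn[OF regularD(6)[OF z], of k l]
  show "fst z ^ i * cnj (fst z) ^ j * (snd z ^ k * cnj (snd z) ^ l) = of_real (rr (sc (cmod (fst z))) ^ (i + j) * \<phi> (rr (sc (cmod (fst z)))) ^ (k + l)) *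
    (sgn (fst z) powi (int i - int j) * sgn (snd z) powi (int k - int l))"
   unfolding p regularD(3)[OF z] regularD(7)[OF z] by (simp only: of_real_mult mult_ac)
 qed
 ultimately show ?thesis by (simp add: V_def)
qed


lemma mpoly_L2: "mpoly g ==> g \<in> L2 \<mu>"
proof (induction rule: mpoly.induct)
 case (monomial c i j k l) show ?case by (rule L2_cmult[OF V_L2[OF term_in_V[of i j k l]]])
qed (rule L2_add)

lemma mpoly_orthogonal:
 assumes f: "f \<in> L2 \<mu>" and o: "!!n m v. v \<in> V n m ==> l2_inner \<mu> f v = 0" and "mpoly g"
 shows "l2_inner \<mu> f g = 0"
 using assms(3)
proof (induction rule: mpoly.induct)
 case (monomial c i j k l)
 show ?case unfolding inner_cmult_right using o[OF term_in_V[of i j k l]] by simp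
next
 case (sum g1 g2)
 have "l2_inner \<mu> f (%x. 1 * g1 x + 1 * g2 x) = 0"
  using inner_lincomb_right[of g1 \<mu> g2 f 1 1] mpoly_L2 sum f by simp
 then show ?case by simp
qed

text \<open>Orthogonality to all monomials passes to polynomials, by Stone-Weierstrass on the
  compact boundary to continuous functions, by dominated convergence to closed sets, and by the
  pi-lambda theorem to Borel sets.\<close>

lemma V_total:
 assumes f: "f \<in> L2 \<mu>" and o: "!!n m v. v \<in> V n m ==> l2_inner \<mu> f v = 0"
 shows "AE z in \<mu>. f z = 0"
proof -
 note [measurable] = L2_measurable[OF f]
 have one: "(%_. 1) \<in> L2 \<mu>" by (rule L2_continuous) simp
 have fi: "integrable \<mu> f" using integrable_inner[OF f one] by simp
 have cont0: "(\<integral>z. f z * of_real (k z) \<partial>\<mu>) = 0" if k: "continuous_on UNIV k" for k :: "C2 \<Rightarrow> real"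
 proof -
  have kL: "(%z. complex_of_real (k z)) \<in> L2 \<mu>" by (rule L2_continuous) (intro continuous_intros k)
  have "cmod (\<integral>z. f z * of_real (k z) \<partial>\<mu>) \<le> e * (\<integral>z. cmod (f z) \<partial>\<mu>)" if e: "0 < e" for e
  proof -
   obtain g where g: "real_polynomial_function g" "!!x. x \<in> bD b1 \<phi> ==> \<bar>k x - g x\<bar> < e"
    using Stone_Weierstrass_real_polynomial_function[OF compact_bD continuous_on_subset[OF k] e] by (metis subset_UNIV)
   have gL: "(%z. complex_of_real (g z)) \<in> L2 \<mu>" by (rule mpoly_L2[OF mpoly_real_polynomial[OF g(1)]])
   have "(\<integral>z. f z * cnj (of_real (g z)) \<partial>\<mu>) = 0"
    using mpoly_orthogonal[OF f o mpoly_real_polynomial[OF g(1)]] unfolding l2_inner_def .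
   then have "(\<integral>z. f z * of_real (k z) \<partial>\<mu>) = (\<integral>z. f z * cnj (of_real (k z)) \<partial>\<mu>) - (\<integral>z. f z * cnj (of_real (g z)) \<partial>\<mu>)" by simp
   also have "\<dots> = (\<integral>z. f z * cnj (of_real (k z)) - f z * cnj (of_real (g z)) \<partial>\<mu>)"
    by (rule Bochner_Integration.integral_diff[symmetric]) (intro integrable_inner f kL gL)+
   also have "\<dots> = (\<integral>z. f z * of_real (k z - g z) \<partial>\<mu>)" by (rule Bochner_Integration.integral_cong) (auto simp: algebra_simps)
   also have "cmod \<dots> \<le> (\<integral>z. cmod (f z) * e \<partial>\<mu>)"
   proof (rule order_trans[OF integral_norm_bound integral_mono])
    have "integrable \<mu> (%z. f z * cnj (of_real (k z)) - f z * cnj (of_real (g z)))"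
     by (intro Bochner_Integration.integrable_diff integrable_inner f kL gL)
    then have "integrable \<mu> (%z. f z * of_real (k z - g z))" by (simp add: right_diff_distrib)
    then show "integrable \<mu> (%z. cmod (f z * of_real (k z - g z)))" by (rule integrable_norm)
    show "integrable \<mu> (%z. cmod (f z) * e)" using fi by auto
    show "cmod (f z * of_real (k z - g z)) \<le> cmod (f z) * e" if "z \<in> space \<mu>" for z
     unfolding norm_mult norm_of_real using g(2)[of z] that by (intro mult_left_mono) auto
   qed
   finally show ?thesis by (simp add: mult.commute)
  qed
  note B = this
  define I where "I = (\<integral>z. cmod (f z) \<partial>\<mu>)"
  have I: "0 \<le> I" by (simp add: I_def)
  have "cmod (\<integral>z. f z * of_real (k z) \<partial>\<mu>) \<le> 0 + e" if "0 < e" for e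
  proof -
   have "cmod (\<integral>z. f z * of_real (k z) \<partial>\<mu>) \<le> e / (I + 1) * I" unfolding I_def by (rule B) (use that I in \<open>simp add: I_def[symmetric]\<close>)
   also have "\<dots> \<le> e" using that I by (simp add: field_simps)
   finally show ?thesis by simp
  qed
  then have "cmod (\<integral>z. f z * of_real (k z) \<partial>\<mu>) \<le> 0" by (rule field_le_epsilon)
  then show ?thesis by simp
 qed
 have closed0: "(\<integral>z. f z * indicator C z \<partial>\<mu>) = 0" if C: "closed C" "C \<noteq> {}" for C
 proof -
  \<comment> \<open>Continuous functions that decrease to the indicator of C as j grows.\<close>
  define k where "k = (%j z. max 0 (1 - real j * infdist z C))"
  have kc: "continuous_on UNIV (k j)" for j unfolding k_def by (intro continuous_intros)
  have kb: "\<bar>k j z\<bar> \<le> 1" for j z by (auto simp: k_def infdist_nonneg)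
  have km[measurable]: "(%z. k j z) \<in> borel_measurable \<mu>" for j by (intro mu_measurableI continuous_imp_borel_C2 kc)
  have "(%j. \<integral>z. f z * of_real (k j z) \<partial>\<mu>) \<longlonglongrightarrow> (\<integral>z. f z * indicator C z \<partial>\<mu>)"
  proof (rule integral_dominated_convergence[of _ _ _ "%z. cmod (f z)"])
   have "indicator C \<in> borel_measurable (borel :: C2 measure)" using C by (intro borel_measurable_indicator) auto
   then have "(%z. indicator C z :: complex) \<in> borel_measurable \<mu>" using C by (intro mu_measurableI borel_measurable_indicator) auto
   then show "(%z. f z * indicator C z) \<in> borel_measurable \<mu>" by measurable
   show "integrable \<mu> (%z. cmod (f z))" using fi by auto
   show "AE z in \<mu>. (%j. f z * of_real (k j z)) \<longlonglongrightarrow> f z * indicator C z"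
   proof (rule AE_I2, rule tendsto_mult_left)
    fix z
    have "(%j. k j z) \<longlonglongrightarrow> indicator C z"
    proof (cases "z \<in> C")
     case True then show ?thesis by (simp add: k_def)
    next
     case False
     then have d: "0 < infdist z C" using in_closed_iff_infdist_zero[OF C] infdist_nonneg[of z C] by (simp add: less_le)
     have "\<forall>\<^sub>F j in sequentially. 1 / infdist z C < real j" using reals_Archimedean2 filterlim_at_top_dense filterlim_real_sequentially by blast
     then have "\<forall>\<^sub>F j in sequentially. k j z = 0"
     proof eventually_elim
      fix j assume "1 / infdist z C < real j"
      then show "k j z = 0" using d by (simp add: k_def field_simps)
     qed
     then show ?thesis using False by (simp add: tendsto_eventually)
    qed
    then have "(%j. complex_of_real (k j z)) \<longlonglongrightarrow> of_real (indicator C z)" by (rule tendsto_of_real)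
    then show "(%j. complex_of_real (k j z)) \<longlonglongrightarrow> indicator C z" by (cases "z \<in> C") (simp_all add: indicator_def)
   qed
   show "AE z in \<mu>. cmod (f z * of_real (k j z)) \<le> cmod (f z)" for j
    using kb by (intro AE_I2) (simp add: norm_mult mult_left_le)
  qed measurable
  then show ?thesis unfolding cont0[OF kc] using LIMSEQ_unique tendsto_const by metis
 qed
 have si: "set_integrable \<mu> A f" if "A \<in> sets \<mu>" for A
  using integrable_mult_indicator[OF that fi] by (simp add: set_integrable_def)
 have sets_eq: "B \<inter> bD b1 \<phi> \<in> sets \<mu>" if "B \<in> sets borel" for B using that by (auto simp: sets_restrict_space)
 have setint: "(LINT z:(B \<inter> bD b1 \<phi>)|\<mu>. f z) = 0" if "B \<in> sets borel" for B
 proof -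
  \<comment> \<open>Closed sets generate the Borel sets and are stable under intersection, as the
    induction over disjoint unions and complements requires.\<close>
  have "B \<in> sigma_sets UNIV (Collect closed)" using that by (simp add: borel_eq_closed)
  then show ?thesis
  proof (rule sigma_sets_induct_disjoint[where P = "%B. (LINT z:(B \<inter> bD b1 \<phi>)|\<mu>. f z) = 0" and G = "Collect closed" and \<Omega> = UNIV, rotated 2])
   fix A :: "C2 set" assume basic: "A \<in> Collect closed"
   have eq: "(LINT z:(A \<inter> bD b1 \<phi>)|\<mu>. f z) = (\<integral>z. f z * indicator A z \<partial>\<mu>)"
    unfolding set_lebesgue_integral_def by (rule Bochner_Integration.integral_cong) (auto simp: indicator_def)
   show "(LINT z:(A \<inter> bD b1 \<phi>)|\<mu>. f z) = 0" unfolding eq using closed0[of A] basic by (cases "A = {}") auto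
  next
   show "(LINT z:({} \<inter> bD b1 \<phi>)|\<mu>. f z) = 0" by (simp add: set_lebesgue_integral_def)
  next
   fix A :: "C2 set" assume A: "A \<in> sigma_sets UNIV (Collect closed)" and IH: "(LINT z:(A \<inter> bD b1 \<phi>)|\<mu>. f z) = 0"
   then have A: "A \<in> sets borel" by (simp add: borel_eq_closed)
   have "(LINT z:((UNIV - A) \<inter> bD b1 \<phi>) \<union> (A \<inter> bD b1 \<phi>)|\<mu>. f z) = (LINT z:((UNIV - A) \<inter> bD b1 \<phi>)|\<mu>. f z) + (LINT z:(A \<inter> bD b1 \<phi>)|\<mu>. f z)"
    by (rule set_integral_Un) (use A in \<open>auto intro!: si sets_eq\<close>)
   moreover have "((UNIV - A) \<inter> bD b1 \<phi>) \<union> (A \<inter> bD b1 \<phi>) = UNIV \<inter> bD b1 \<phi>" by blast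
   moreover have "(LINT z:(UNIV \<inter> bD b1 \<phi>)|\<mu>. f z) = (\<integral>z. f z * indicator UNIV z \<partial>\<mu>)"
    unfolding set_lebesgue_integral_def by (rule Bochner_Integration.integral_cong) (auto simp: indicator_def)
   ultimately show "(LINT z:((UNIV - A) \<inter> bD b1 \<phi>)|\<mu>. f z) = 0" using closed0[of UNIV] IH by simp
  next
   fix A :: "nat \<Rightarrow> C2 set" assume disj: "disjoint_family A" and union: "range A \<subseteq> sigma_sets UNIV (Collect closed)" and IH: "!!i. (LINT z:(A i \<inter> bD b1 \<phi>)|\<mu>. f z) = 0"
   have A: "A i \<in> sets borel" for i using union by (auto simp: borel_eq_closed)
   have e: "(\<Union>i. A i) \<inter> bD b1 \<phi> = (\<Union>i. A i \<inter> bD b1 \<phi>)" by blast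
   have "(LINT z:(\<Union>i. A i \<inter> bD b1 \<phi>)|\<mu>. f z) = (\<Sum>i. LINT z:(A i \<inter> bD b1 \<phi>)|\<mu>. f z)"
   proof (rule lebesgue_integral_countable_add)
    show "!!i j. i \<noteq> j ==> (A i \<inter> bD b1 \<phi>) \<inter> (A j \<inter> bD b1 \<phi>) = {}" using disj by (auto simp: disjoint_family_on_def)
    show "set_integrable \<mu> (\<Union>i. A i \<inter> bD b1 \<phi>) f" by (rule si, rule sets.countable_nat_UN) (use sets_eq[OF A] in blast)
   qed (use sets_eq[OF A] in auto)
   then show "(LINT z:(\<Union> (range A) \<inter> bD b1 \<phi>)|\<mu>. f z) = 0" unfolding e using IH by simp
  qed (auto simp: Int_stable_def)
 qed
 have zero: "set_lebesgue_integral \<mu> A f = 0" if "A \<in> sets \<mu>" for A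
  using setint[of A] radial_sets_borel[OF that] by (simp add: Int_absorb2)
 have re: "AE z in \<mu>. Re (f z) = 0"
 proof (rule density_unique_real)
  show "integrable \<mu> (%z. Re (f z))" using fi by auto
  show "integrable \<mu> (%z. 0 :: real)" by simp
  fix A assume A: "A \<in> sets \<mu>"
  have "set_lebesgue_integral \<mu> A (%z. Re (f z)) = Re (set_lebesgue_integral \<mu> A f)"
   unfolding set_lebesgue_integral_def using si[OF A] by (subst integral_Re[symmetric]) (auto simp: set_integrable_def)
  then show "set_lebesgue_integral \<mu> A (%z. Re (f z)) = set_lebesgue_integral \<mu> A (%z. 0)" using zero[OF A] by simp
 qed
 have im: "AE z in \<mu>. Im (f z) = 0"
 proof (rule density_unique_real)
  show "integrable \<mu> (%z. Im (f z))" using fi by auto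
  show "integrable \<mu> (%z. 0 :: real)" by simp
  fix A assume A: "A \<in> sets \<mu>"
  have "set_lebesgue_integral \<mu> A (%z. Im (f z)) = Im (set_lebesgue_integral \<mu> A f)"
   unfolding set_lebesgue_integral_def using si[OF A] by (subst integral_Im[symmetric]) (auto simp: set_integrable_def)
  then show "set_lebesgue_integral \<mu> A (%z. Im (f z)) = set_lebesgue_integral \<mu> A (%z. 0)" using zero[OF A] by simp
 qed
 from re im show ?thesis by eventually_elim (simp add: complex_eq_iff)
qed

text \<open>Project f onto each space of monomials. The projections are square summable by a Bessel
  argument, and the difference between f and their sum is orthogonal to every monomial, hence null.
  The inner products with monomials are recorded because the Leray transform sees f only through
  them.\<close>

theorem monomial_decomposition:
 assumes f: "f \<in> L2 \<mu>"
 shows "\<exists>F. (\<forall>n m. F (n, m) \<in> V n m) \<and> (\<forall>n m. \<forall>v\<in>V n m. l2_inner \<mu> (F (n, m)) v = l2_inner \<mu> f v) \<and> l2_has_sum \<mu> F UNIV f"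
proof -
 have "\<forall>i. \<exists>g. g \<in> V (fst i) (snd i) \<and> (\<forall>v\<in>V (fst i) (snd i). l2_inner \<mu> (%x. f x - g x) v = 0)"
  using projection_L2[OF V_subspace V_closed f] by blast
 from choice[OF this] obtain F where F': "\<forall>i. F i \<in> V (fst i) (snd i) \<and> (\<forall>v\<in>V (fst i) (snd i). l2_inner \<mu> (%x. f x - F i x) v = 0)"
  by (elim exE)
 have F: "!!i. F i \<in> V (fst i) (snd i)" "!!i v. v \<in> V (fst i) (snd i) ==> l2_inner \<mu> (%x. f x - F i x) v = 0"
  using F' by blast+
 have FL: "F i \<in> L2 \<mu>" for i by (rule V_L2[OF F(1)])
 have Fv: "l2_inner \<mu> (F i) v = l2_inner \<mu> f v" if "v \<in> V (fst i) (snd i)" for i v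
  using F(2)[OF that] inner_diff_left[OF f FL V_L2[OF that]] by simp
 have o: "l2_inner \<mu> (F i) (F j) = 0" if "i \<noteq> j" for i j
  by (rule V_orthogonal[OF F(1) F(1)]) (use that in \<open>auto simp: prod_eq_iff\<close>)
 have bess: "(\<Sum>i\<in>X. (l2_norm \<mu> (F i))\<^sup>2) \<le> (l2_norm \<mu> f)\<^sup>2" if X: "finite X" for X
 proof -
  define S where "S = (%x. \<Sum>i\<in>X. F i x)"
  have SL: "S \<in> L2 \<mu>" unfolding S_def by (intro L2_sum FL)
  have nS: "(l2_norm \<mu> S)\<^sup>2 = (\<Sum>i\<in>X. (l2_norm \<mu> (F i))\<^sup>2)" unfolding S_def
   by (rule norm_sq_orthogonal_sum[OF X FL]) (rule o)
  have "l2_inner \<mu> f S = (\<Sum>i\<in>X. l2_inner \<mu> f (F i))" unfolding S_def by (rule inner_sum_right[OF FL f])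
  also have "\<dots> = (\<Sum>i\<in>X. of_real ((l2_norm \<mu> (F i))\<^sup>2))"
   by (intro sum.cong refl) (simp add: Fv[OF F(1), symmetric] inner_self)
  also have "\<dots> = l2_inner \<mu> S S" by (simp add: inner_self nS)
  finally have e: "l2_inner \<mu> (%x. f x - S x) S = 0" using inner_diff_left[OF f SL SL] by simp
  have "(l2_norm \<mu> (%x. (f x - S x) + S x))\<^sup>2 = (l2_norm \<mu> (%x. f x - S x))\<^sup>2 + (l2_norm \<mu> S)\<^sup>2"
   by (rule Pythagoras_L2[OF L2_diff[OF f SL] SL e])
  then show ?thesis using nS by simp
 qed
 have "(%i. (l2_norm \<mu> (F i))\<^sup>2) summable_on UNIV"
  by (rule nonneg_bdd_above_summable_on) (auto intro!: bdd_aboveI2 bess)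
 then obtain hh where hh: "l2_has_sum \<mu> F UNIV hh" using orthogonal_sum_exists[of UNIV F \<mu>] FL o by blast
 have hL: "hh \<in> L2 \<mu>" using hh by (rule l2_has_sum_L2)
 have "AE z in \<mu>. f z - hh z = 0"
 proof (rule V_total[OF L2_diff[OF f hL]])
  fix n m v assume v: "v \<in> V n m"
  have "((%i. l2_inner \<mu> (F i) v) has_sum l2_inner \<mu> hh v) UNIV" by (rule l2_has_sum_inner[OF hh V_L2[OF v]])
  moreover have "((%i. l2_inner \<mu> (F i) v) has_sum l2_inner \<mu> (F (n, m)) v) UNIV"
  proof -
   have "((%i. l2_inner \<mu> (F i) v) has_sum (\<Sum>i\<in>{(n,m)}. l2_inner \<mu> (F i) v)) {(n,m)}" by (rule has_sum_finite) simp
   then show ?thesis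
   proof (subst has_sum_cong_neutral[where T = "{(n,m)}" and g = "%i. l2_inner \<mu> (F i) v"])
    show "l2_inner \<mu> (F i) v = 0" if "i \<in> UNIV - {(n, m)}" for i
     by (rule V_orthogonal[OF F(1) v]) (use that in \<open>auto simp: prod_eq_iff\<close>)
   qed auto
  qed
  ultimately have "l2_inner \<mu> hh v = l2_inner \<mu> (F (n, m)) v" by (rule has_sum_unique)
  also have "\<dots> = l2_inner \<mu> f v" by (rule Fv) (simp add: v)
  finally show "l2_inner \<mu> (%x. f x - hh x) v = 0" using inner_diff_left[OF f hL V_L2[OF v]] by simp
 qed
 then have ae: "AE z in \<mu>. f z = hh z" by simp
 have "l2_norm \<mu> (%x. hh x - (\<Sum>i\<in>X. F i x)) = l2_norm \<mu> (%x. f x - (\<Sum>i\<in>X. F i x))" for X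
 proof (rule norm_cong_AE)
  show "(%x. hh x - (\<Sum>i\<in>X. F i x)) \<in> borel_measurable \<mu>" by (intro L2_measurable L2_diff hL L2_sum FL)
  show "(%x. f x - (\<Sum>i\<in>X. F i x)) \<in> borel_measurable \<mu>" by (intro L2_measurable L2_diff f L2_sum FL)
  show "AE x in \<mu>. hh x - (\<Sum>i\<in>X. F i x) = f x - (\<Sum>i\<in>X. F i x)" using ae by eventually_elim simp
 qed
 then have "l2_has_sum \<mu> F UNIV f" using hh f unfolding l2_has_sum_def by simp
 then show ?thesis using F(1) Fv by (intro exI[of _ F] conjI allI ballI) auto
qed

end

section \<open>The Leray kernel and its power series\<close>

lemma sgn_complex_measurable[measurable]: "sgn \<in> borel_measurable (borel :: complex measure)"
proof -
 have "sgn = (%x :: complex. x /\<^sub>R norm x)" by (auto simp: sgn_div_norm)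
 moreover have "(%x :: complex. x /\<^sub>R norm x) \<in> borel_measurable borel" by measurable
 ultimately show ?thesis by simp
qed

context reinhardt_L2 begin

lemma sc_cont: "continuous_on {0<..<b1} sc"
 using dsc by (auto intro!: continuous_at_imp_continuous_on DERIV_isCont)

lemma indicator_measurable: "continuous_on {0<..<b1} f ==> (%r. indicator {0<..<b1} r * f r) \<in> borel_measurable borel" for f :: "real \<Rightarrow> real"
 using borel_measurable_continuous_on_indicator[of "{0<..<b1}" f] by simp

definition ds :: "real \<Rightarrow> real" where "ds r = pf r * sc r / r"
text \<open>The density of ds dtheta1 dtheta2 / (4 pi^2) with respect to mu. \<open>Ax\<close> and
  \<open>Bx\<close> below are the moduli s / r1 and (1 - s) / r2 of the coefficients in the
  kernel.\<close>

definition kap :: "real \<Rightarrow> real" where "kap r = indicator {0<..<b1} r * (ds r / (4 * pi\<^sup>2 * weight h q r))"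
definition Ax :: "real \<Rightarrow> real" where "Ax r = indicator {0<..<b1} r * (sc r / r)"
definition Bx :: "real \<Rightarrow> real" where "Bx r = indicator {0<..<b1} r * ((1 - sc r) / \<phi> r)"

lemma ds_cont: "continuous_on {0<..<b1} ds" unfolding ds_def[abs_def]
 by (intro continuous_intros pf_cont sc_cont) auto
lemma kap_cont: "continuous_on {0<..<b1} (%r. ds r / (4 * pi\<^sup>2 * weight h q r))"
 by (intro continuous_intros ds_cont weight_cont[OF h]) (use weight_pos[OF h] in \<open>auto simp: less_le\<close>)
lemma Ax_cont: "continuous_on {0<..<b1} (%r. sc r / r)" by (intro continuous_intros sc_cont) auto
lemma Bx_cont: "continuous_on {0<..<b1} (%r. (1 - sc r) / \<phi> r)"
 by (intro continuous_intros sc_cont phi_cont) (use phi_pos in \<open>auto simp: less_le\<close>)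

lemma coeff_measurable[measurable]: "kap \<in> borel_measurable borel" "Ax \<in> borel_measurable borel" "Bx \<in> borel_measurable borel"
 unfolding kap_def[abs_def] Ax_def[abs_def] Bx_def[abs_def]
 by (intro indicator_measurable kap_cont Ax_cont Bx_cont)+

lemma radial_profile: "leray_profile prof_P prof_C1 prof_C2 (prof_H h q) rr (%s. \<phi> (rr s)) (prof_w h q) (- (q * (1 - 2 / p1))) (- (q * (1 - 2 / p2)))"
 by (rule profile) (use h q1 q2 in \<open>auto simp: pos_fun_def\<close>)

abbreviation "I_nm \<equiv> leray_profile.I rr (%s. \<phi> (rr s)) (prof_w h q)"
abbreviation "J_nm \<equiv> leray_profile.I (%s. s / rr s) (%s. (1 - s) / \<phi> (rr s)) (%s. inverse (prof_w h q s))"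

lemma norm_radial:
 assumes f: "f \<in> borel_measurable \<mu>" and G: "G \<in> borel_measurable borel" "!!r. 0 < r ==> r < b1 ==> 0 \<le> G r"
  and c: "continuous_on {0<..<b1} G" and e: "!!z. regular z ==> (cmod (f z))\<^sup>2 = G (cmod (fst z))"
  and i: "set_integrable lborel {0<..<1} (%s. G (rr s) * prof_w h q s)"
 shows "f \<in> L2 \<mu>" "(l2_norm \<mu> f)\<^sup>2 = 4 * pi\<^sup>2 * (LBINT s:{0<..<1}. G (rr s) * prof_w h q s)"
proof -
 note [measurable] = f G(1) Wx_measurable[OF h]
 have i': "set_integrable lborel {0<..<1} (%s. (G (rr s) * weight h q (rr s)) * (rr s / (pf (rr s) * s)))"
  using i by (simp add: prof_w_def mult.assoc)
 have nn: "0 \<le> G r * weight h q r" if "0 < r" "r < b1" for r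
  using G(2)[OF that] weight_pos[OF h that] by simp
 have T: "set_integrable lborel {0<..<b1} (%r. G r * weight h q r)"
  "(LBINT r:{0<..<b1}. G r * weight h q r) = (LBINT s:{0<..<1}. (G (rr s) * weight h q (rr s)) * (rr s / (pf (rr s) * s)))"
  by (rule transfer_integral[OF continuous_on_mult[OF c weight_cont[OF h]] _ i'], erule (1) nn)+
 have T2: "(LBINT r:{0<..<b1}. G r * weight h q r) = (LBINT s:{0<..<1}. G (rr s) * prof_w h q s)"
  unfolding T(2) prof_w_def mult.assoc ..
 let ?R = "LBINT r:{0<..<b1}. G r * weight h q r"
 have "(\<integral>\<^sup>+z. ennreal ((cmod (f z))\<^sup>2) \<partial>\<mu>) = (\<integral>\<^sup>+z. ennreal (G (cmod (fst z))) \<partial>\<mu>)"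
  by (rule nn_integral_cong_AE) (use AE_regular in eventually_elim, simp add: e)
 also have "\<dots> = ennreal (4 * pi\<^sup>2) * (\<integral>\<^sup>+r. ennreal (Wx h r) * ennreal (G r) \<partial>lborel)"
  by (rule nn_integral_radial_fun[OF h]) measurable
 also have "(\<integral>\<^sup>+r. ennreal (Wx h r) * ennreal (G r) \<partial>lborel) = (\<integral>\<^sup>+r. ennreal (indicator {0<..<b1} r *\<^sub>R (G r * weight h q r)) \<partial>lborel)"
 proof (rule nn_integral_cong)
  fix r :: real
  show "ennreal (Wx h r) * ennreal (G r) = ennreal (indicator {0<..<b1} r *\<^sub>R (G r * weight h q r))"
  proof (cases "0 < r \<and> r < b1")
   case True
   then show ?thesis using G(2)[of r] weight_pos[OF h, of r] by (simp add: Wx_def ennreal_mult[symmetric] mult.commute)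
  qed (auto simp: Wx_def)
 qed
 also have "\<dots> = ennreal ?R"
  unfolding set_lebesgue_integral_def
 proof (rule nn_integral_eq_integral)
  show "integrable lborel (%r. indicator {0<..<b1} r *\<^sub>R (G r * weight h q r))" using T(1) by (simp add: set_integrable_def)
  show "AE r in lborel. 0 \<le> indicator {0<..<b1} r *\<^sub>R (G r * weight h q r)"
   using nn by (intro AE_I2) (auto simp: indicator_def)
 qed
 also have "ennreal (4 * pi\<^sup>2) * ennreal ?R = ennreal (4 * pi\<^sup>2 * ?R)" by (rule ennreal_mult'[symmetric]) simp
 finally have N: "(\<integral>\<^sup>+z. ennreal ((cmod (f z))\<^sup>2) \<partial>\<mu>) = ennreal (4 * pi\<^sup>2 * ?R)" .
 have R0: "0 \<le> ?R" unfolding set_lebesgue_integral_def using nn by (intro integral_nonneg_AE AE_I2) (auto simp: indicator_def)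
 have "has_bochner_integral \<mu> (%z. (cmod (f z))\<^sup>2) (4 * pi\<^sup>2 * ?R)"
  by (rule has_bochner_integral_nn_integral[OF _ _ _ N]) (use R0 in auto)
 then show "f \<in> L2 \<mu>" "(l2_norm \<mu> f)\<^sup>2 = 4 * pi\<^sup>2 * (LBINT s:{0<..<1}. G (rr s) * prof_w h q s)"
  unfolding T2[symmetric] L2_iff norm_sq using f by (auto simp: has_bochner_integral_iff)
qed

definition vn :: "nat \<Rightarrow> nat \<Rightarrow> C2 \<Rightarrow> complex" where "vn n m z = fst z ^ n * snd z ^ m"

text \<open>The function that represents the (n, m) coefficient of the Leray transform: in the
  expansion of the kernel against mu, its conjugate is the factor of w1^n w2^m, up to c_nm.\<close>

definition un :: "nat \<Rightarrow> nat \<Rightarrow> C2 \<Rightarrow> complex" where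
 "un n m z = of_real (kap (cmod (fst z)) * (Ax (cmod (fst z)) ^ n * Bx (cmod (fst z)) ^ m)) * (sgn (fst z) ^ n * sgn (snd z) ^ m)"

lemma vn_V: "vn n m \<in> V (int n) (int m)"
 using term_in_V[of n 0 m 0] by (simp add: vn_def[abs_def])

lemma vn_norm: "(l2_norm \<mu> (vn n m))\<^sup>2 = 4 * pi\<^sup>2 * I_nm n m"
proof -
 interpret leray_profile prof_P prof_C1 prof_C2 "prof_H h q" rr "%s. \<phi> (rr s)" "prof_w h q" "- (q * (1 - 2 / p1))" "- (q * (1 - 2 / p2))"
  by (rule radial_profile)
 define G where "G = (%r. r ^ (2 * n) * phix r ^ (2 * m))"
 have Geq: "G (rr s) = rr s ^ (2 * n) * \<phi> (rr s) ^ (2 * m)" if "0 < s" "s < 1" for s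
  using rr_props[OF that] by (simp add: G_def phix_eq)
 have "(l2_norm \<mu> (vn n m))\<^sup>2 = 4 * pi\<^sup>2 * (LBINT s:{0<..<1}. G (rr s) * prof_w h q s)"
 proof (rule norm_radial(2))
  show "vn n m \<in> borel_measurable \<mu>" by (rule L2_measurable[OF V_L2[OF vn_V]])
  show "G \<in> borel_measurable borel" unfolding G_def by measurable
  show "0 \<le> G r" for r unfolding G_def by (simp add: power_mult)
  show "continuous_on {0<..<b1} G" unfolding G_def by (intro continuous_intros phix_cont)
  show "(cmod (vn n m z))\<^sup>2 = G (cmod (fst z))" if z: "regular z" for z
   using regularD(1,2)[OF z] by (simp add: vn_def G_def norm_mult norm_power regularD(3)[OF z] phix_eq power_mult_distrib power_mult[symmetric] mult.commute)
  show "set_integrable lborel {0<..<1} (%s. G (rr s) * prof_w h q s)"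
   using integrand_integrable[of n m] by (rule set_integrable_cong[THEN iffD1, rotated 3]) (auto simp: Geq)
 qed
 also have "(LBINT s:{0<..<1}. G (rr s) * prof_w h q s) = I_nm n m"
  unfolding I_def by (rule set_lebesgue_integral_cong) (auto simp: Geq)
 finally show ?thesis .
qed

lemma prof_w_ds: assumes s: "0 < s" "s < 1" shows "prof_w h q s = weight h q (rr s) / ds (rr s)" "0 < ds (rr s)" "0 < prof_w h q s"
proof -
 note r = rr_props[OF s]
 have p: "0 < pf (rr s)" using pf_gt_1[OF r(1,2)] by simp
 show "prof_w h q s = weight h q (rr s) / ds (rr s)" unfolding prof_w_def ds_def r(3) by simp
 show d: "0 < ds (rr s)" unfolding ds_def r(3) using p r s by simp
 show "0 < prof_w h q s" unfolding prof_w_def using p r s weight_pos[OF h r(1,2)] by simp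
qed

text \<open>One factor w of the measure against two factors 1/w from \<open>kap\<close> leaves the
  inverse weight, and s / r1, (1 - s) / r2 take the place of the radii: the integral
  \<open>I\<close> of the dual profile.\<close>

lemma un_norm: "un n m \<in> L2 \<mu>" "(l2_norm \<mu> (un n m))\<^sup>2 = J_nm n m / (4 * pi\<^sup>2)"
proof -
 interpret L: leray_profile prof_P prof_C1 prof_C2 "prof_H h q" rr "%s. \<phi> (rr s)" "prof_w h q" "- (q * (1 - 2 / p1))" "- (q * (1 - 2 / p2))"
  by (rule radial_profile)
 note Ld = L.dual
 define G where "G = (%r. (kap r * (Ax r ^ n * Bx r ^ m))\<^sup>2)"
 have Geq: "G (rr s) * prof_w h q s = (s / rr s) ^ (2 * n) * ((1 - s) / \<phi> (rr s)) ^ (2 * m) * inverse (prof_w h q s) / (16 * pi ^ 4)" if s: "0 < s" "s < 1" for s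
 proof -
  note r = rr_props[OF s]
  have w: "0 < weight h q (rr s)" by (rule weight_pos[OF h r(1,2)])
  have k: "(kap (rr s))\<^sup>2 * prof_w h q s = inverse (prof_w h q s) / (16 * pi ^ 4)"
   using r prof_w_ds(2)[OF s] w unfolding prof_w_ds(1)[OF s] by (simp add: kap_def power2_eq_square power4_eq_xxxx field_simps)
  have "G (rr s) * prof_w h q s = ((kap (rr s))\<^sup>2 * prof_w h q s) * ((Ax (rr s)) ^ (2 * n) * (Bx (rr s)) ^ (2 * m))"
   unfolding G_def by (simp add: power_mult_distrib power_mult[symmetric] mult_ac)
  also have "\<dots> = inverse (prof_w h q s) / (16 * pi ^ 4) * ((s / rr s) ^ (2 * n) * ((1 - s) / \<phi> (rr s)) ^ (2 * m))"
   unfolding k using r by (simp add: Ax_def Bx_def)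
  finally show ?thesis by simp
 qed
 have um: "un n m \<in> borel_measurable \<mu>" unfolding un_def[abs_def] by measurable
 have int: "set_integrable lborel {0<..<1} (%s. (s / rr s) ^ (2 * n) * ((1 - s) / \<phi> (rr s)) ^ (2 * m) * inverse (prof_w h q s))"
  by (rule leray_profile.integrand_integrable[OF Ld])
 have a: "G \<in> borel_measurable borel" unfolding G_def by measurable
 have b: "0 \<le> G r" for r by (simp add: G_def)
 have c: "continuous_on {0<..<b1} G"
 proof -
  have "continuous_on {0<..<b1} (%r. (ds r / (4 * pi\<^sup>2 * weight h q r) * ((sc r / r) ^ n * ((1 - sc r) / \<phi> r) ^ m))\<^sup>2)"
   by (intro continuous_on_power continuous_on_mult kap_cont Ax_cont Bx_cont)
  then show ?thesis by (rule continuous_on_eq) (simp add: G_def kap_def Ax_def Bx_def)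
 qed
 have d: "(cmod (un n m z))\<^sup>2 = G (cmod (fst z))" if z: "regular z" for z
  using regularD(5,6)[OF z] by (simp add: un_def G_def norm_mult norm_power norm_sgn power_mult_distrib power_abs[symmetric])
 have e: "set_integrable lborel {0<..<1} (%s. G (rr s) * prof_w h q s)"
 proof (rule set_integrable_cong[THEN iffD1, rotated 3])
  show "set_integrable lborel {0<..<1} (%s. (s / rr s) ^ (2 * n) * ((1 - s) / \<phi> (rr s)) ^ (2 * m) * inverse (prof_w h q s) / (16 * pi ^ 4))"
   using int by simp
 qed (auto simp: Geq)
 note N = norm_radial[OF um a b c d e]
 show "un n m \<in> L2 \<mu>" by (rule N(1))
 have "(LBINT s:{0<..<1}. G (rr s) * prof_w h q s) = (LBINT s:{0<..<1}. (s / rr s) ^ (2 * n) * ((1 - s) / \<phi> (rr s)) ^ (2 * m) * inverse (prof_w h q s) / (16 * pi ^ 4))"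
  by (rule set_lebesgue_integral_cong) (auto simp: Geq)
 also have "\<dots> = J_nm n m / (16 * pi ^ 4)" unfolding leray_profile.I_def[OF Ld] by simp
 finally have X: "(LBINT s:{0<..<1}. G (rr s) * prof_w h q s) = J_nm n m / (16 * pi ^ 4)" .
 have "(l2_norm \<mu> (un n m))\<^sup>2 = 4 * pi\<^sup>2 * (LBINT s:{0<..<1}. G (rr s) * prof_w h q s)" by (rule N(2))
 also have "\<dots> = J_nm n m / (4 * pi\<^sup>2)" unfolding X by (simp add: field_simps power4_eq_xxxx power2_eq_square)
 finally show "(l2_norm \<mu> (un n m))\<^sup>2 = J_nm n m / (4 * pi\<^sup>2)" .
qed

lemma un_V: "un n m \<in> V (int n) (int m)"
proof -
 have "is_monomial b1 \<phi> (int n) (int m) (un n m)"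
  by (rule is_monomialI[of _ "%s. of_real (kap (rr s) * (Ax (rr s) ^ n * Bx (rr s) ^ m))"]) (simp add: un_def regularD(7))
 then show ?thesis using un_norm(1) by (simp add: V_def)
qed

definition Xk :: "C2 \<Rightarrow> C2 \<Rightarrow> complex" where
 "Xk w z = of_real (Ax (cmod (fst z))) * cnj (sgn (fst z)) * fst w + of_real (Bx (cmod (fst z))) * cnj (sgn (snd z)) * snd w"

text \<open>Both the form and the square of the denominator contain the factor D^2 with D = phi - r
  phi'; after cancellation the kernel is ds / (4 pi^2) over (1 - Xk)^2.\<close>

lemma kernel_eq:
 assumes z: "regular z"
 shows "leray_kernel \<phi> z w = of_real (weight h q (cmod (fst z)) * kap (cmod (fst z))) / (1 - Xk w z)\<^sup>2"
proof -
 define r where "r = cmod (fst z)"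
 note rz = regularD[OF z, folded r_def]
 define Dn where "Dn = \<phi> r - r * \<phi>' r"
 have Dn: "0 < Dn" using denom_pos[OF rz(1,2)] by (simp add: Dn_def)
 have f: "0 < \<phi> r" using phi_pos rz by simp
 have w: "0 < weight h q r" by (rule weight_pos[OF h rz(1,2)])
 have A: "Ax r = - \<phi>' r / Dn" and B: "Bx r = 1 / Dn"
  using rz(1,2) f Dn sc_01(3,4)[OF rz(1,2), folded Dn_def] by (auto simp: Ax_def Bx_def)
 have e: "cnj (sgn (fst z)) * fst z = of_real r" "cnj (sgn (snd z)) * snd z = of_real (\<phi> r)"
 proof -
  have "cnj (sgn u) * u = of_real (cmod u)" if "u \<noteq> 0" for u
  proof -
   have "cnj (sgn u) * u = (u * cnj u) / of_real (cmod u)" by (simp add: sgn_div_norm scaleR_conv_of_real divide_inverse mult_ac)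
   also have "u * cnj u = of_real (cmod u) * of_real (cmod u)" by (simp add: complex_norm_square[symmetric] power2_eq_square)
   finally show ?thesis using that by simp
  qed
  from this[OF rz(5)] this[OF rz(6)] show "cnj (sgn (fst z)) * fst z = of_real r" "cnj (sgn (snd z)) * snd z = of_real (\<phi> r)"
   unfolding rz(3) r_def by auto
 qed
 have "del (crho \<phi>) z (z - w) = (cnj (sgn (snd z)) * snd z - of_real (\<phi>' r) * (cnj (sgn (fst z)) * fst z)
   - (cnj (sgn (snd z)) * snd w - of_real (\<phi>' r) * (cnj (sgn (fst z)) * fst w))) / 2"
  using rz(2) unfolding del_rho[OF rz(5) rz(2)[unfolded r_def] rz(6)] r_def by (simp add: algebra_simps)
 also have "\<dots> = of_real Dn / 2 * (1 - Xk w z)"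
 proof -
  have "of_real Dn * Xk w z = cnj (sgn (snd z)) * snd w - of_real (\<phi>' r) * (cnj (sgn (fst z)) * fst w)"
   unfolding Xk_def r_def[symmetric] A B using Dn by (simp add: field_simps)
  moreover have "of_real Dn / 2 * (1 - Xk w z) = (of_real Dn - of_real Dn * Xk w z) / 2" by (simp add: algebra_simps diff_divide_distrib)
  moreover have "complex_of_real Dn = of_real (\<phi> r) - of_real (\<phi>' r) * of_real r" by (simp add: Dn_def mult.commute)
  ultimately show ?thesis unfolding e by simp
 qed
 finally have del: "del (crho \<phi>) z (z - w) = of_real Dn / 2 * (1 - Xk w z)" .
 have ld: "leray_density \<phi> z = - of_real (Dn\<^sup>2 * ds r / 4)"
  using leray_density_eq[OF rz(1,2) r_def[symmetric] rz(3)] by (simp add: Dn_def ds_def)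
 have wk: "weight h q r * kap r = ds r / (4 * pi\<^sup>2)" using w rz(1,2) by (simp add: kap_def)
 have "leray_kernel \<phi> z w = 1 / (2 * of_real pi * \<i>)\<^sup>2 * (- of_real (Dn\<^sup>2 * ds r / 4) / (of_real Dn / 2 * (1 - Xk w z))\<^sup>2)"
  unfolding leray_kernel_def del ld ..
 also have "\<dots> = of_real (ds r / (4 * pi\<^sup>2)) / (1 - Xk w z)\<^sup>2"
 proof -
  have s: "(2 * of_real pi * \<i>)\<^sup>2 = - of_real (4 * pi\<^sup>2)" by (simp add: power_mult_distrib)
  have s2: "(of_real Dn / 2 * (1 - Xk w z))\<^sup>2 = of_real (Dn\<^sup>2 / 4) * (1 - Xk w z)\<^sup>2" by (simp add: power_mult_distrib power_divide)
  have "- of_real (Dn\<^sup>2 * ds r / 4) / (of_real (Dn\<^sup>2 / 4) * (1 - Xk w z)\<^sup>2) = - (of_real (ds r) / (1 - Xk w z)\<^sup>2)"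
   using Dn by (simp add: field_simps)
  then show ?thesis unfolding s s2 by simp
 qed
 finally show ?thesis unfolding r_def[symmetric] wk .
qed

lemma leray_as_integral:
 assumes f: "f \<in> borel_measurable \<mu>"
 shows "leray_transform b1 \<phi> f w = (\<integral>z. f z * of_real (kap (cmod (fst z))) / (1 - Xk w z)\<^sup>2 \<partial>\<mu>)"
proof -
 note [measurable] = f
 let ?S = "restrict_space borel (bD b1 \<phi>)"
 define F where "F = (%z. f z * of_real (kap (cmod (fst z))) / (1 - Xk w z)\<^sup>2)"
 have "F \<in> borel_measurable \<mu>" unfolding F_def Xk_def by measurable
 then have F: "F \<in> borel_measurable ?S" by (simp add: measurable_cong_sets[OF radial_sets(1) refl])
 have wm: "(%x. weight h q (fst x)) \<in> borel_measurable (param_measure b1)"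
 proof (rule measurable_cong[THEN iffD1])
  show "enn2real (ennreal (weight h q (fst x))) = weight h q (fst x)" if "x \<in> space (param_measure b1)" for x
   using that weight_pos[OF h, of "fst x"] bd_param_box(5,6)[of x] by (simp add: space_param)
  show "(%x. enn2real (ennreal (weight h q (fst x)))) \<in> borel_measurable (param_measure b1)"
   by (rule measurable_compose[OF weight_param_measurable[OF h]]) simp
 qed
 have "(\<integral>z. F z \<partial>\<mu>) = (\<integral>x. F (bd_param \<phi> x) \<partial>density (param_measure b1) (%x. ennreal (weight h q (fst x))))"
  unfolding radial_measure_def by (rule integral_distr) (use bd_param_measurable F in auto)
 also have "\<dots> = (\<integral>x. weight h q (fst x) *\<^sub>R F (bd_param \<phi> x) \<partial>param_measure b1)"
 proof (rule integral_density[OF measurable_compose[OF bd_param_measurable F] wm])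
  show "AE x in param_measure b1. 0 \<le> weight h q (fst x)"
   by (rule AE_I2) (use weight_pos[OF h] bd_param_box(5,6) in \<open>auto simp: space_param less_imp_le\<close>)
 qed
 also have "\<dots> = leray_transform b1 \<phi> f w" unfolding leray_transform_def
 proof (rule Bochner_Integration.integral_cong[OF refl])
  fix x assume "x \<in> space (param_measure b1)"
  then have x: "x \<in> box" by (simp add: space_param)
  have "0 < \<phi> (fst x)" using phi_pos bd_param_box(5,6)[OF x] by simp
  then have "fst (bd_param \<phi> x) \<noteq> 0" "snd (bd_param \<phi> x) \<noteq> 0"
   using bd_param_box(3,4,5)[OF x] by auto
  then have z: "regular (bd_param \<phi> x)" unfolding regular_def using bd_param_box[OF x] by simp
  show "weight h q (fst x) *\<^sub>R F (bd_param \<phi> x) = f (bd_param \<phi> x) * leray_kernel \<phi> (bd_param \<phi> x) w"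
   unfolding kernel_eq[OF z] F_def bd_param_box(3)[OF x] by (simp add: scaleR_conv_of_real mult_ac)
 qed
 finally show ?thesis unfolding F_def ..
qed

text \<open>The complex tangent planes avoid the domain: by convexity the profile lies below each of
  its tangent lines. As D is open, w may be enlarged by some t > 1, and this gives the bound 1 / t
  uniformly in the boundary point.\<close>

lemma Xk_bound:
 assumes w: "w \<in> D"
 shows "\<exists>\<rho>. 0 \<le> \<rho> \<and> \<rho> < 1 \<and> (\<forall>z. regular z \<longrightarrow> cmod (Xk w z) \<le> \<rho>)"
proof -
 have "isCont (%t. t *\<^sub>R w) (1 :: real)" by (intro continuous_intros)
 then have "((%t :: real. t *\<^sub>R w) \<longlongrightarrow> w) (at 1)" by (simp add: isCont_def)
 from topological_tendstoD[OF this open_domain w] obtain d where d: "0 < d" "!!t. t \<noteq> 1 ==> dist t 1 < d ==> t *\<^sub>R w \<in> D"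
  unfolding eventually_at by blast
 define t where "t = 1 + d / 2"
 have t: "1 < t" using d by (simp add: t_def)
 have "t *\<^sub>R w \<in> D" by (rule d(2)) (use d(1) in \<open>auto simp: t_def dist_real_def\<close>)
 then have tw: "t * cmod (fst w) < b1" "t * cmod (snd w) < \<phi> (t * cmod (fst w))" using t by (auto simp: domain_of_def)
 have "cmod (Xk w z) \<le> 1 / t" if z: "regular z" for z
 proof -
  define r where "r = cmod (fst z)"
  note rz = regularD[OF z, folded r_def]
  define Dn where "Dn = \<phi> r - r * \<phi>' r"
  have Dn: "0 < Dn" using denom_pos[OF rz(1,2)] by (simp add: Dn_def)
  have f: "0 < \<phi> r" using phi_pos rz by simp
  have n: "\<phi>' r < 0" by (rule phi'_neg[OF rz(1,2)])
  have A: "Ax r = - \<phi>' r / Dn" and B: "Bx r = 1 / Dn"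
   using rz(1,2) f Dn sc_01(3,4)[OF rz(1,2), folded Dn_def] by (auto simp: Ax_def Bx_def)
  have cv: "convex_on {0..b1} (%x. - \<phi> x)" using class_R unfolding class_R_def concave_on_def by blast
  have "((%x. - \<phi> x) has_field_derivative - \<phi>' r) (at r within {0..b1})"
   by (intro DERIV_minus has_field_derivative_at_within[OF dphi[OF rz(1,2)]])
  \<comment> \<open>The tangent at r = |z1|, evaluated at t |w1|, lies above phi (t |w1|) and so
    above t |w2|.\<close>
  from convex_on_imp_above_tangent[OF cv _ _ _ this, of "t * cmod (fst w)"]
  have "- \<phi> (t * cmod (fst w)) - - \<phi> r \<ge> - \<phi>' r * (t * cmod (fst w) - r)"
   using rz(1,2) tw(1) t by (simp add: interior_atLeastAtMost_real)
  then have "t * cmod (snd w) + (- \<phi>' r) * (t * cmod (fst w)) \<le> Dn" using tw(2) by (simp add: Dn_def algebra_simps)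
  then have b: "t * ((- \<phi>' r) * cmod (fst w) + cmod (snd w)) \<le> Dn" by (simp add: algebra_simps)
  have "cmod (Xk w z) \<le> cmod (of_real (Ax r) * cnj (sgn (fst z)) * fst w) + cmod (of_real (Bx r) * cnj (sgn (snd z)) * snd w)"
   unfolding Xk_def r_def[symmetric] by (rule norm_triangle_ineq)
  also have "\<dots> = ((- \<phi>' r) * cmod (fst w) + cmod (snd w)) / Dn"
   using rz(5,6) n Dn by (simp add: norm_mult norm_divide norm_sgn A B add_divide_distrib diff_divide_distrib abs_of_neg[OF n] abs_of_pos[OF Dn])
  also have "\<dots> \<le> 1 / t" using b Dn t by (simp add: field_simps)
  finally show ?thesis .
 qed
 then show ?thesis using t by (intro exI[of _ "1 / t"]) auto
qed

lemma Xk_power: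
 assumes z: "regular z"
 shows "of_real (kap (cmod (fst z))) * Xk w z ^ N = (\<Sum>a\<le>N. of_nat (N choose a) * (fst w ^ a * snd w ^ (N - a)) * cnj (un a (N - a) z))"
proof -
 have "Xk w z ^ N = (\<Sum>a\<le>N. of_nat (N choose a) * (of_real (Ax (cmod (fst z))) * cnj (sgn (fst z)) * fst w) ^ a * (of_real (Bx (cmod (fst z))) * cnj (sgn (snd z)) * snd w) ^ (N - a))"
  unfolding Xk_def by (rule binomial_ring)
 then show ?thesis unfolding un_def
  by (simp add: sum_distrib_left power_mult_distrib) (intro sum.cong refl, simp add: mult_ac)
qed

text \<open>The derivative of the geometric series, integrated term by term; |Xk| \<le> rho < 1
  gives the majorant (N + 1) rho^N times |f| \<open>kap\<close>. The latter is integrable because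
  \<open>kap\<close> is itself the square integrable function \<open>un 0 0\<close>.\<close>

lemma leray_expansion:
 assumes f: "f \<in> L2 \<mu>" and w: "w \<in> D"
 shows "(%N. of_nat (Suc N) * (\<Sum>a\<le>N. of_nat (N choose a) * (fst w ^ a * snd w ^ (N - a)) * l2_inner \<mu> f (un a (N - a)))) sums leray_transform b1 \<phi> f w"
proof -
 obtain \<rho> where rho: "0 \<le> \<rho>" "\<rho> < 1" "!!z. regular z ==> cmod (Xk w z) \<le> \<rho>" using Xk_bound[OF w] by blast
 define k where "k = (%z. f z * of_real (kap (cmod (fst z))))"
 have u0: "un 0 0 = (%z. of_real (kap (cmod (fst z))))" by (simp add: un_def[abs_def])
 have ki: "integrable \<mu> k" using integrable_inner[OF f un_norm(1)[of 0 0]] unfolding u0 k_def by simp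
 define g where "g = (%N z. of_nat (Suc N) * (Xk w z ^ N * k z))"
 have eq: "g N z = of_nat (Suc N) * (\<Sum>a\<le>N. of_nat (N choose a) * (fst w ^ a * snd w ^ (N - a)) * (f z * cnj (un a (N - a) z)))" if z: "regular z" for N z
 proof -
  have "g N z = of_nat (Suc N) * (f z * (of_real (kap (cmod (fst z))) * Xk w z ^ N))" by (simp add: g_def k_def mult_ac)
  also have "\<dots> = of_nat (Suc N) * (\<Sum>a\<le>N. of_nat (N choose a) * (fst w ^ a * snd w ^ (N - a)) * (f z * cnj (un a (N - a) z)))"
   unfolding Xk_power[OF z] sum_distrib_left by (intro sum.cong refl) (simp only: mult_ac)
  finally show ?thesis .
 qed
 have km[measurable]: "k \<in> borel_measurable \<mu>" by (rule borel_measurable_integrable[OF ki])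
 have gm: "g N \<in> borel_measurable \<mu>" for N unfolding g_def Xk_def by measurable
 define G where "G = (%N z. of_nat (Suc N) * (\<Sum>a\<le>N. of_nat (N choose a) * (fst w ^ a * snd w ^ (N - a)) * (f z * cnj (un a (N - a) z))))"
 have Gi: "integrable \<mu> (G N)" for N unfolding G_def
  by (intro integrable_mult_right Bochner_Integration.integrable_sum integrable_inner f un_norm(1))
 have gG: "AE z in \<mu>. g N z = G N z" for N using AE_regular by eventually_elim (simp only: eq G_def)
 have gi: "integrable \<mu> (g N)" for N
 proof -
  have "AE z in \<mu>. G N z = g N z" using gG[of N] by eventually_elim simp
  then show ?thesis by (rule integrable_cong_AE_imp[OF Gi gm])
 qed
 have gint: "(\<integral>z. g N z \<partial>\<mu>) = of_nat (Suc N) * (\<Sum>a\<le>N. of_nat (N choose a) * (fst w ^ a * snd w ^ (N - a)) * l2_inner \<mu> f (un a (N - a)))" for N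
 proof -
  have "(\<integral>z. g N z \<partial>\<mu>) = (\<integral>z. G N z \<partial>\<mu>)" by (rule integral_cong_AE[OF gm borel_measurable_integrable[OF Gi] gG])
  also have "\<dots> = of_nat (Suc N) * (\<integral>z. (\<Sum>a\<le>N. of_nat (N choose a) * (fst w ^ a * snd w ^ (N - a)) * (f z * cnj (un a (N - a) z))) \<partial>\<mu>)"
   unfolding G_def by (rule integral_mult_right_zero)
  also have "(\<integral>z. (\<Sum>a\<le>N. of_nat (N choose a) * (fst w ^ a * snd w ^ (N - a)) * (f z * cnj (un a (N - a) z))) \<partial>\<mu>)
   = (\<Sum>a\<le>N. of_nat (N choose a) * (fst w ^ a * snd w ^ (N - a)) * l2_inner \<mu> f (un a (N - a)))"
   unfolding l2_inner_def
   by (subst Bochner_Integration.integral_sum) (auto intro!: integrable_mult_right integrable_inner f un_norm(1))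
  finally show ?thesis .
 qed
 have nb: "AE z in \<mu>. cmod (g N z) \<le> real (Suc N) * \<rho> ^ N * cmod (k z)" for N
  using AE_regular
 proof eventually_elim
  fix z assume z: "regular z"
  have "cmod (g N z) = real (Suc N) * (cmod (Xk w z) ^ N * cmod (k z))" unfolding g_def norm_mult norm_power norm_of_nat ..
  also have "\<dots> \<le> real (Suc N) * (\<rho> ^ N * cmod (k z))"
   by (intro mult_left_mono mult_right_mono power_mono rho(3)[OF z]) auto
  finally show "cmod (g N z) \<le> real (Suc N) * \<rho> ^ N * cmod (k z)" by (simp only: mult.assoc)
 qed
 have sr: "summable (%N. real (Suc N) * \<rho> ^ N)"
  using geometric_deriv_sums[of \<rho>] rho by (auto simp: sums_iff)
 have "(%N. \<integral>z. g N z \<partial>\<mu>) sums (\<integral>z. (\<Sum>N. g N z) \<partial>\<mu>)"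
 proof (rule sums_integral[OF gi])
  show "AE z in \<mu>. summable (%N. cmod (g N z))"
   using AE_regular
  proof eventually_elim
   fix z assume z: "regular z"
   have "cmod (g N z) \<le> real (Suc N) * \<rho> ^ N * cmod (k z)" for N
   proof -
    have "cmod (g N z) = real (Suc N) * (cmod (Xk w z) ^ N * cmod (k z))" unfolding g_def norm_mult norm_power norm_of_nat ..
    also have "\<dots> \<le> real (Suc N) * (\<rho> ^ N * cmod (k z))"
     by (intro mult_left_mono mult_right_mono power_mono rho(3)[OF z]) auto
    finally show ?thesis by (simp only: mult.assoc)
   qed
   then show "summable (%N. cmod (g N z))"
    by (intro summable_comparison_test'[OF summable_mult2[OF sr, of "cmod (k z)"], of 0]) simp
  qed
  show "summable (%N. \<integral>z. cmod (g N z) \<partial>\<mu>)"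
  proof (rule summable_comparison_test'[OF summable_mult2[OF sr, of "\<integral>z. cmod (k z) \<partial>\<mu>"], of 0])
   fix N :: nat
   have "(\<integral>z. cmod (g N z) \<partial>\<mu>) \<le> (\<integral>z. real (Suc N) * \<rho> ^ N * cmod (k z) \<partial>\<mu>)"
    by (rule integral_mono_AE) (use gi ki nb in auto)
   then show "norm (\<integral>z. cmod (g N z) \<partial>\<mu>) \<le> real (Suc N) * \<rho> ^ N * (\<integral>z. cmod (k z) \<partial>\<mu>)" by simp
  qed
 qed
 moreover have "(\<integral>z. (\<Sum>N. g N z) \<partial>\<mu>) = leray_transform b1 \<phi> f w"
  unfolding leray_as_integral[OF L2_measurable[OF f]]
 proof (rule integral_cong_AE)
  show "(%z. \<Sum>N. g N z) \<in> borel_measurable \<mu>" by (intro borel_measurable_suminf gm)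
  show "(%z. f z * of_real (kap (cmod (fst z))) / (1 - Xk w z)\<^sup>2) \<in> borel_measurable \<mu>"
   using km unfolding k_def Xk_def by measurable
  show "AE z in \<mu>. (\<Sum>N. g N z) = f z * of_real (kap (cmod (fst z))) / (1 - Xk w z)\<^sup>2"
   using AE_regular
  proof eventually_elim
   fix z assume z: "regular z"
   have "cmod (Xk w z) < 1" using rho(2) rho(3)[OF z] by simp
   from sums_mult2[OF geometric_deriv_sums[OF this], of "k z"] have "g N z = of_nat (Suc N) * Xk w z ^ N * k z" and
    "(%N. of_nat (Suc N) * Xk w z ^ N * k z) sums (1 / (1 - Xk w z)\<^sup>2 * k z)" for N by (auto simp: g_def)
   then have "(%N. g N z) sums (1 / (1 - Xk w z)\<^sup>2 * k z)" by (simp add: g_def mult.assoc)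
   then show "(\<Sum>N. g N z) = f z * of_real (kap (cmod (fst z))) / (1 - Xk w z)\<^sup>2" by (simp add: sums_iff k_def)
  qed
 qed
 ultimately show ?thesis unfolding gint by simp
qed

text \<open>The product of N + 1, from the derivative of the geometric series, and the binomial
  coefficient N choose n, where N = n + m.\<close>

definition cnm :: "nat \<Rightarrow> nat \<Rightarrow> real" where "cnm n m = fact (n + m + 1) / (fact n * fact m)"

text \<open>Among all terms of the expansion only the one with the indices of f survives, by
  orthogonality of monomials.\<close>

lemma leray_monomial:
 assumes f: "f \<in> V (int n) (int m)" and w: "w \<in> D"
 shows "leray_transform b1 \<phi> f w = of_real (cnm n m) * l2_inner \<mu> f (un n m) * (fst w ^ n * snd w ^ m)"
proof -
 define T where "T = (%N. of_nat (Suc N) * (\<Sum>a\<le>N. of_nat (N choose a) * (fst w ^ a * snd w ^ (N - a)) * l2_inner \<mu> f (un a (N - a))))"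
 have z: "l2_inner \<mu> f (un a b) = 0" if "(a, b) \<noteq> (n, m)" for a b
  by (rule V_orthogonal[OF f un_V]) (use that in auto)
 have 0: "T N = 0" if "N \<noteq> n + m" for N
 proof -
  have "l2_inner \<mu> f (un a (N - a)) = 0" if "a \<le> N" for a by (rule z) (use that \<open>N \<noteq> n + m\<close> in auto)
  then show ?thesis unfolding T_def by simp
 qed
 have "T (n + m) = of_nat (Suc (n + m)) * (\<Sum>a\<le>n + m. if a = n then of_nat ((n + m) choose n) * (fst w ^ n * snd w ^ m) * l2_inner \<mu> f (un n m) else 0)"
  unfolding T_def by (intro arg_cong2[where f = "(*)"] refl sum.cong) (auto simp: z)
 also have "\<dots> = of_nat (Suc (n + m)) * (of_nat ((n + m) choose n) * (fst w ^ n * snd w ^ m) * l2_inner \<mu> f (un n m))" by simp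
 also have "\<dots> = of_real (cnm n m) * l2_inner \<mu> f (un n m) * (fst w ^ n * snd w ^ m)"
 proof -
  have "real (Suc (n + m)) * real ((n + m) choose n) = cnm n m"
   unfolding cnm_def by (subst binomial_fact) auto
  then have "(of_nat (Suc (n + m)) :: complex) * of_nat ((n + m) choose n) = of_real (cnm n m)" by (metis of_real_mult of_real_of_nat_eq)
  then show ?thesis by (simp only: mult.assoc[symmetric]) (simp only: mult_ac)
 qed
 finally have E: "T (n + m) = of_real (cnm n m) * l2_inner \<mu> f (un n m) * (fst w ^ n * snd w ^ m)" .
 have "T sums (\<Sum>N\<in>{n + m}. T N)" by (rule sums_finite) (use 0 in auto)
 moreover have "T sums leray_transform b1 \<phi> f w" unfolding T_def by (rule leray_expansion[OF V_L2[OF f] w])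
 ultimately show ?thesis using sums_unique2 E by fastforce
qed

lemma leray_bv_monomial:
 assumes f: "f \<in> V (int n) (int m)" and z: "z \<in> bD b1 \<phi>"
 shows "leray_bv b1 \<phi> f z = of_real (cnm n m) * l2_inner \<mu> f (un n m) * vn n m z"
 unfolding leray_bv_def
proof (rule tendsto_Lim)
 show "at z within D \<noteq> bot" by (rule bD_trivial_limit[OF z])
 have "((%w. of_real (cnm n m) * l2_inner \<mu> f (un n m) * (fst w ^ n * snd w ^ m)) \<longlongrightarrow> of_real (cnm n m) * l2_inner \<mu> f (un n m) * vn n m z) (at z within D)"
  unfolding vn_def by (intro tendsto_intros)
 moreover have "\<forall>\<^sub>F w in at z within D. of_real (cnm n m) * l2_inner \<mu> f (un n m) * (fst w ^ n * snd w ^ m) = leray_transform b1 \<phi> f w"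
  unfolding eventually_at_filter by (rule always_eventually) (simp add: leray_monomial[OF f])
 ultimately show "(leray_transform b1 \<phi> f \<longlongrightarrow> of_real (cnm n m) * l2_inner \<mu> f (un n m) * vn n m z) (at z within D)"
  by (rule Lim_transform_eventually)
qed

end

section \<open>Diagonalisation of the Leray transform\<close>

lemma l2_has_sum_AE:
 assumes F: "l2_has_sum M F A h" and h': "h' \<in> L2 M" and ae: "AE x in M. h x = h' x"
 shows "l2_has_sum M F A h'"
proof -
 have FL: "\<forall>i\<in>A. F i \<in> L2 M" and hL: "h \<in> L2 M"
  and lim: "((%X. l2_norm M (%x. h x - (\<Sum>i\<in>X. F i x))) \<longlongrightarrow> 0) (finite_subsets_at_top A)"
  using F unfolding l2_has_sum_def by blast+
 have "\<forall>\<^sub>F X in finite_subsets_at_top A. l2_norm M (%x. h x - (\<Sum>i\<in>X. F i x)) = l2_norm M (%x. h' x - (\<Sum>i\<in>X. F i x))"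
 proof (rule eventually_finite_subsets_at_top_weakI)
  fix X assume X: "finite X" "X \<subseteq> A"
  have S: "(%x. \<Sum>i\<in>X. F i x) \<in> L2 M" by (rule L2_sum) (use FL X in blast)
  show "l2_norm M (%x. h x - (\<Sum>i\<in>X. F i x)) = l2_norm M (%x. h' x - (\<Sum>i\<in>X. F i x))"
   by (rule norm_cong_AE[OF L2_measurable[OF L2_diff[OF hL S]] L2_measurable[OF L2_diff[OF h' S]]])
    (use ae in eventually_elim, simp)
 qed
 from Lim_transform_eventually[OF lim this] show ?thesis unfolding l2_has_sum_def using FL h' by blast
qed

text \<open>Equality of terms is asked for on the space of M only: boundary values are known on the
  boundary, while the functions are defined on all of C2.\<close>

lemma l2_has_sum_reindex:
 assumes G: "l2_has_sum M G (p ` B) h" and inj: "inj_on p B"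
  and eq: "!!b x. b \<in> B ==> x \<in> space M ==> F b x = G (p b) x"
 shows "l2_has_sum M F B h"
proof -
 have GL: "\<forall>i\<in>p ` B. G i \<in> L2 M" and hL: "h \<in> L2 M"
  and lim: "((%X. l2_norm M (%x. h x - (\<Sum>i\<in>X. G i x))) \<longlongrightarrow> 0) (finite_subsets_at_top (p ` B))"
  using G unfolding l2_has_sum_def by blast+
 have FL: "F b \<in> L2 M" if b: "b \<in> B" for b
 proof (rule L2_cong_AE[of "G (p b)"])
  show g: "G (p b) \<in> L2 M" using GL b by blast
  show "F b \<in> borel_measurable M"
   by (rule measurable_cong[THEN iffD2, OF _ L2_measurable[OF g]]) (rule eq[OF b])
  show "AE x in M. G (p b) x = F b x" by (rule AE_I2) (simp add: eq[OF b])
 qed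
 have "((%X. l2_norm M (%x. h x - (\<Sum>i\<in>p ` X. G i x))) \<longlongrightarrow> 0) (finite_subsets_at_top B)"
  using lim unfolding filtermap_image_finite_subsets_at_top[OF inj, symmetric] filterlim_filtermap .
 moreover have "\<forall>\<^sub>F X in finite_subsets_at_top B. l2_norm M (%x. h x - (\<Sum>i\<in>p ` X. G i x)) = l2_norm M (%x. h x - (\<Sum>i\<in>X. F i x))"
 proof (rule eventually_finite_subsets_at_top_weakI)
  fix X assume X: "finite X" "X \<subseteq> B"
  have "(\<Sum>i\<in>p ` X. G i x) = (\<Sum>i\<in>X. F i x)" if x: "x \<in> space M" for x
  proof -
   have "(\<Sum>i\<in>p ` X. G i x) = (\<Sum>i\<in>X. G (p i) x)"
    by (subst sum.reindex[OF inj_on_subset[OF inj X(2)]]) simp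
   also have "\<dots> = (\<Sum>i\<in>X. F i x)" by (rule sum.cong[OF refl], rule eq[symmetric, OF _ x]) (use X in blast)
   finally show ?thesis .
  qed
  then show "l2_norm M (%x. h x - (\<Sum>i\<in>p ` X. G i x)) = l2_norm M (%x. h x - (\<Sum>i\<in>X. F i x))"
   unfolding l2_norm_def by (intro arg_cong[where f = sqrt] Bochner_Integration.integral_cong refl) simp
 qed
 ultimately have "((%X. l2_norm M (%x. h x - (\<Sum>i\<in>X. F i x))) \<longlongrightarrow> 0) (finite_subsets_at_top B)"
  by (rule Lim_transform_eventually)
 then show ?thesis unfolding l2_has_sum_def using FL hL by blast
qed

lemma bounded_op_of_has_sum:
 assumes e: "orthonormal_on M e A" and t: "\<forall>k\<in>A. cmod (t k) \<le> C" and C: "0 \<le> C"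
  and T: "!!f. f \<in> L2 M ==> l2_has_sum M (%k x. t k * l2_inner M f (e k) * e k x) A (T f)"
 shows "bounded_op M T"
 unfolding bounded_op_def
proof (intro conjI ballI allI)
 show "T f \<in> L2 M" if "f \<in> L2 M" for f by (rule l2_has_sum_L2(1)[OF T[OF that]])
 have "\<forall>f\<in>L2 M. l2_norm M (T f) \<le> C * l2_norm M f" by (intro ballI diag_op_norm[OF e e t _ C T])
 then show "\<exists>C. \<forall>f\<in>L2 M. l2_norm M (T f) \<le> C * l2_norm M f" by (rule exI)
 fix f g c d assume f: "f \<in> L2 M" and g: "g \<in> L2 M"
 show "AE x in M. T (%y. c * f y + d * g y) x = c * T f x + d * T g x"
 proof (rule l2_has_sum_unique[OF T[OF L2_lincomb[OF f g]] l2_has_sum_lincomb[OF T[OF f] T[OF g]]])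
  fix k assume k: "k \<in> A"
  show "AE x in M. t k * l2_inner M (%x. c * f x + d * g x) (e k) * e k x = c * (t k * l2_inner M f (e k) * e k x) + d * (t k * l2_inner M g (e k) * e k x)"
   unfolding inner_lincomb_left[OF f g orthonormal_onD(1)[OF e k]] by (rule AE_I2) (simp add: algebra_simps)
 qed
qed

text \<open>Uses 1/p' = 1 - 1/p, whence 1/p - 1/p' = 2/p - 1.\<close>

lemma corner_value_eq: assumes p: "1 < p" shows "corner_value (1 / p) (- (q * (1 - 2 / p))) n = lambda_pqn p q n"
proof -
 have c: "1 / conj_exp p = 1 - 1 / p" "2 / conj_exp p = 2 * (1 - 1 / p)" "2 * real n / conj_exp p = 2 * real n * (1 - 1 / p)"
  using p by (auto simp: conj_exp_def field_simps)
 have a: "2 * real n / p + 1 + q * (1 / p - 1 / conj_exp p) = 2 * real n * (1 / p) + - (q * (1 - 2 / p)) + 1"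
  "2 * real n / conj_exp p + 1 + q * (1 / conj_exp p - 1 / p) = 2 * real n * (1 - 1 / p) - - (q * (1 - 2 / p)) + 1"
  unfolding c by (auto simp: algebra_simps)
 show ?thesis unfolding corner_value_def lambda_pqn_def Let_def a c(2) by simp
qed

lemma bulk_value_eq: assumes p: "1 < p" shows "1 / (2 * sqrt (1 / p * (1 - 1 / p))) = sqrt (p * conj_exp p) / 2"
proof -
 have "1 / p * (1 - 1 / p) = 1 / (p * conj_exp p)" using p by (simp add: conj_exp_def field_simps power2_eq_square)
 then show ?thesis by (simp add: real_sqrt_divide)
qed

context reinhardt_L2 begin

sublocale prof: leray_profile prof_P prof_C1 prof_C2 "prof_H h q" rr "%s. \<phi> (rr s)" "prof_w h q" "- (q * (1 - 2 / p1))" "- (q * (1 - 2 / p2))"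
 by (rule radial_profile)

lemma not_AE_False: "\<not> (AE z in \<mu>. False)"
proof
 assume "AE z in \<mu>. False"
 then have "(\<integral>\<^sup>+z. 1 \<partial>\<mu>) = 0" by (subst nn_integral_0_iff_AE) auto
 moreover have "(\<integral>\<^sup>+z. 1 \<partial>\<mu>) = ennreal (4 * pi\<^sup>2) * (\<integral>\<^sup>+r. ennreal (Wx h r) * 1 \<partial>lborel)"
  by (rule nn_integral_radial_fun[OF h, of "%_. 1"]) simp
 ultimately have "(\<integral>\<^sup>+r. ennreal (Wx h r) \<partial>lborel) = 0" by (simp add: ennreal_eq_0_iff)
 moreover have "(%r. ennreal (Wx h r)) \<in> borel_measurable lborel" using Wx_measurable[OF h] by simp
 ultimately have "AE r in lborel. ennreal (Wx h r) = 0" by (simp add: nn_integral_0_iff_AE)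
 then have "AE r in lborel. r \<notin> {0<..<b1}"
 proof eventually_elim
  fix r assume "ennreal (Wx h r) = 0"
  then show "r \<notin> {0<..<b1}" using weight_pos[OF h, of r] by (auto simp: Wx_def ennreal_eq_0_iff)
 qed
 then have "{0<..<b1} \<in> null_sets lborel" by (subst AE_iff_null_sets) auto
 then show False using basic(1) by (simp add: null_sets_def)
qed

lemma norm_nonzero: assumes "f \<in> L2 \<mu>" "!!z. regular z ==> f z \<noteq> 0" shows "l2_norm \<mu> f \<noteq> 0"
proof
 assume "l2_norm \<mu> f = 0"
 then have "AE z in \<mu>. f z = 0" using norm_zero_iff[OF assms(1)] by simp
 with AE_regular have "AE z in \<mu>. False" by eventually_elim (use assms(2) in blast)
 then show False using not_AE_False by simp
qed

lemma un_nonzero: "l2_norm \<mu> (un n m) \<noteq> 0"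
proof (rule norm_nonzero[OF un_norm(1)])
 fix z assume z: "regular z"
 define r where "r = cmod (fst z)"
 note rz = regularD[OF z, folded r_def]
 have "0 < ds r" using dsc_pos[OF rz(1,2)] by (simp add: ds_def)
 then have "kap r \<noteq> 0" "Ax r \<noteq> 0" "Bx r \<noteq> 0"
  using rz(1,2) weight_pos[OF h rz(1,2)] sc_01(1,2)[OF rz(1,2)] phi_pos[of r] by (auto simp: kap_def Ax_def Bx_def)
 then show "un n m z \<noteq> 0" using rz(5,6) by (simp add: un_def r_def[symmetric] sgn_zero_iff)
qed

lemma vn_nonzero: "l2_norm \<mu> (vn n m) \<noteq> 0"
 by (rule norm_nonzero[OF V_L2[OF vn_V]]) (simp add: vn_def regularD(5,6))

lemma normalised_orthonormal:
 fixes f :: "'i \<Rightarrow> C2 \<Rightarrow> complex" and N M :: "'i \<Rightarrow> int"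
 assumes f: "!!i. f i \<in> V (N i) (M i)" and n: "!!i. l2_norm \<mu> (f i) \<noteq> 0" and inj: "!!i j. i \<noteq> j ==> (N i, M i) \<noteq> (N j, M j)"
 shows "orthonormal_on \<mu> (%i x. of_real (1 / l2_norm \<mu> (f i)) * f i x) UNIV"
 unfolding orthonormal_on_def
proof (intro conjI ballI)
 show "(%x. of_real (1 / l2_norm \<mu> (f i)) * f i x) \<in> L2 \<mu>" for i by (rule L2_cmult[OF V_L2[OF f]])
 show "l2_inner \<mu> (%x. of_real (1 / l2_norm \<mu> (f i)) * f i x) (%x. of_real (1 / l2_norm \<mu> (f j)) * f j x) = (if i = j then 1 else 0)" for i j
 proof (cases "i = j")
  case True
  then show ?thesis using n[of j] unfolding inner_cmult_left inner_cmult_right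
   by (simp add: inner_self power2_eq_square)
 next
  case False
  then show ?thesis unfolding inner_cmult_left inner_cmult_right V_orthogonal[OF f f inj[OF False]] by simp
 qed
qed

definition eu :: "nat \<times> nat \<Rightarrow> C2 \<Rightarrow> complex" where
 "eu k x = of_real (1 / l2_norm \<mu> (un (fst k) (snd k))) * un (fst k) (snd k) x"
definition ev :: "nat \<times> nat \<Rightarrow> C2 \<Rightarrow> complex" where
 "ev k x = of_real (1 / l2_norm \<mu> (vn (fst k) (snd k))) * vn (fst k) (snd k) x"
text \<open>The singular values: L maps \<open>eu k\<close> to \<open>tau k\<close> times
  \<open>ev k\<close>, which is c_nm times an inner product with u_nm times v_nm, after
  normalisation.\<close>

definition tau :: "nat \<times> nat \<Rightarrow> real" where
 "tau k = cnm (fst k) (snd k) * l2_norm \<mu> (un (fst k) (snd k)) * l2_norm \<mu> (vn (fst k) (snd k))"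
definition lamk :: "nat \<times> nat \<Rightarrow> real" where "lamk k = case_prod prof.lam k"

lemma eu_orthonormal: "orthonormal_on \<mu> eu UNIV"
 unfolding eu_def[abs_def]
 by (rule normalised_orthonormal[where N = "%k. int (fst k)" and M = "%k. int (snd k)"])
  (use un_V un_nonzero in \<open>auto simp: prod_eq_iff\<close>)

lemma ev_orthonormal: "orthonormal_on \<mu> ev UNIV"
 unfolding ev_def[abs_def]
 by (rule normalised_orthonormal[where N = "%k. int (fst k)" and M = "%k. int (snd k)"])
  (use vn_V vn_nonzero in \<open>auto simp: prod_eq_iff\<close>)

lemma tau_sq: "(tau k)\<^sup>2 = lamk k"
proof -
 obtain n m where k: "k = (n, m)" by (cases k)
 have "(tau k)\<^sup>2 = (cnm n m)\<^sup>2 * ((l2_norm \<mu> (un n m))\<^sup>2 * (l2_norm \<mu> (vn n m))\<^sup>2)"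
  by (simp add: tau_def k power_mult_distrib)
 also have "\<dots> = (cnm n m)\<^sup>2 * (I_nm n m * J_nm n m)" unfolding un_norm(2) vn_norm by simp
 finally show ?thesis by (simp add: lamk_def k prof.lam_def cnm_def)
qed

lemma lamk_nonneg: "0 \<le> lamk k" unfolding tau_sq[symmetric] by simp

text \<open>Unbounded eigenvalues would allow an injective sequence of indices along which they tend
  to infinity, but every injective sequence has a subsequence with a finite limit. So boundedness of
  L is a by-product of the limit theorems.\<close>

lemma lamk_bounded: "\<exists>C\<ge>0. \<forall>k. lamk k \<le> C"
proof (rule ccontr)
 assume not: "\<not> (\<exists>C\<ge>0. \<forall>k. lamk k \<le> C)"
 have ub: "\<exists>k. C < lamk k" if "0 \<le> C" for C 
 proof (rule ccontr)
  assume "\<nexists>k. C < lamk k"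
  then have "\<forall>k. lamk k \<le> C" by (simp only: not_ex not_less simp_thms)
  with that have "\<exists>C\<ge>0. \<forall>k. lamk k \<le> C" by (intro exI[of _ C] conjI)
  with not show False by (rule notE)
 qed
 have inf: "infinite {k. real j < lamk k}" for j :: nat
 proof
  assume fin: "finite {k. real j < lamk k}"
  then have "bdd_above (lamk ` {k. real j < lamk k})" by simp
  then obtain B where B: "!!k. real j < lamk k ==> lamk k \<le> B" unfolding bdd_above_def by auto
  have "0 \<le> max (real j) B" by (simp add: le_max_iff_disj)
  from ub[OF this] obtain k where "max (real j) B < lamk k" by (elim exE)
  then show False using B[of k] by auto
 qed
 obtain f where f': "\<forall>j. f j \<in> {k. real j < lamk k}" and f2: "inj f"
  using injective_selection[where S = "%j. {k. real j < lamk k}", OF inf] by (elim exE conjE)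
 have f: "!!j. real j < lamk (f j)" "inj f" using f' f2 by blast+
 obtain r c where r: "strict_mono r" "(%k. case_prod prof.lam (f (r k))) \<longlonglongrightarrow> c" using prof.lam_subseq[OF f(2)] by (elim exE conjE)
 from r(2) have "(%k. lamk (f (r k))) \<longlonglongrightarrow> c" unfolding lamk_def .
 then have "\<forall>\<^sub>F k in sequentially. lamk (f (r k)) < c + 1" by (rule order_tendstoD) simp
 moreover have "\<forall>\<^sub>F k in sequentially. c + 1 < real k"
  using filterlim_real_sequentially unfolding filterlim_at_top_dense by blast
 ultimately have "\<forall>\<^sub>F k in sequentially. False"
 proof eventually_elim
  fix k :: nat assume "lamk (f (r k)) < c + 1" "c + 1 < real k"
  moreover have "real k \<le> real (r k)" using seq_suble[OF r(1), of k] by simp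
  ultimately show False using f(1)[of "r k"] by linarith
 qed
 then show False by simp
qed

text \<open>L is built from its singular value decomposition; that this is the Leray transform,
  defined through boundary values of monomials, is \<open>lop_leray\<close>.\<close>

definition lop :: "C2 l2op" where "lop = diag_op \<mu> UNIV (%k. of_real (tau k)) eu ev"

lemma tau_bound: "\<exists>C\<ge>0. \<forall>k\<in>UNIV. cmod (complex_of_real (tau k)) \<le> C"
proof -
 obtain C where C: "0 \<le> C" "!!k. lamk k \<le> C" using lamk_bounded by blast
 have "\<bar>tau k\<bar> \<le> sqrt C" for k
 proof -
  have "sqrt ((tau k)\<^sup>2) \<le> sqrt C" unfolding tau_sq using C(2) by (rule real_sqrt_le_mono)
  then show ?thesis by simp
 qed
 then show ?thesis using C(1) by (intro exI[of _ "sqrt C"]) auto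
qed

lemma lop_bounded: "bounded_op \<mu> lop"
proof -
 obtain C where "0 \<le> C" "\<forall>k\<in>UNIV. cmod (complex_of_real (tau k)) \<le> C" using tau_bound by blast
 then show ?thesis unfolding lop_def by (intro diag_op_bounded[OF eu_orthonormal ev_orthonormal])
qed

lemma lop_has_sum: "f \<in> L2 \<mu> ==> l2_has_sum \<mu> (%k x. of_real (tau k) * l2_inner \<mu> f (eu k) * ev k x) UNIV (lop f)"
proof -
 assume f: "f \<in> L2 \<mu>"
 obtain C where "\<forall>k\<in>UNIV. cmod (complex_of_real (tau k)) \<le> C" using tau_bound by blast
 from diag_op_has_sum[OF eu_orthonormal ev_orthonormal this f] show ?thesis unfolding lop_def .
qed

definition ladj :: "C2 l2op" where "ladj = diag_op \<mu> UNIV (%k. cnj (of_real (tau k))) ev eu"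

lemma lop_adjoint: "is_adjoint \<mu> lop ladj"
proof -
 obtain C where C: "0 \<le> C" "\<forall>k\<in>UNIV. cmod (complex_of_real (tau k)) \<le> C" using tau_bound by blast
 show ?thesis unfolding lop_def ladj_def by (rule diag_op_adjoint[OF eu_orthonormal ev_orthonormal C(2,1)])
qed

text \<open>Any adjoint agrees almost everywhere with the explicit one, so the expansion of the
  product does not depend on the representative A.\<close>

lemma adjoint_lop_has_sum:
 assumes A: "is_adjoint \<mu> lop A" and f: "f \<in> L2 \<mu>"
 shows "l2_has_sum \<mu> (%k x. of_real (lamk k) * l2_inner \<mu> f (eu k) * eu k x) UNIV ((A \<circ> lop) f)"
proof -
 obtain C where C: "\<forall>k\<in>UNIV. cmod (complex_of_real (tau k)) \<le> C" using tau_bound by blast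
 then have C': "\<forall>k\<in>UNIV. cmod (cnj (complex_of_real (tau k))) \<le> C" by simp
 have Lf: "lop f \<in> L2 \<mu>" by (rule bounded_opD(1)[OF lop_bounded f])
 have bA: "bounded_op \<mu> A" using A by (simp add: is_adjoint_def)
 have co: "l2_inner \<mu> (lop f) (ev k) = of_real (tau k) * l2_inner \<mu> f (eu k)" for k
  by (rule l2_has_sum_coeff[OF ev_orthonormal lop_has_sum[OF f]]) simp
 have "l2_has_sum \<mu> (%k x. cnj (of_real (tau k)) * l2_inner \<mu> (lop f) (ev k) * eu k x) UNIV (ladj (lop f))"
  unfolding ladj_def by (rule diag_op_has_sum[OF ev_orthonormal eu_orthonormal C' Lf])
 then have 1: "l2_has_sum \<mu> (%k x. of_real (lamk k) * l2_inner \<mu> f (eu k) * eu k x) UNIV (ladj (lop f))"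
  by (rule l2_has_sum_cong) (simp_all add: co tau_sq[symmetric] power2_eq_square)
 have 2: "AE x in \<mu>. ladj (lop f) x = (A \<circ> lop) f x"
  unfolding comp_apply by (rule adjoint_unique[OF lop_adjoint A Lf])
 have 3: "(A \<circ> lop) f \<in> L2 \<mu>" unfolding comp_apply by (rule bounded_opD(1)[OF bA Lf])
 show ?thesis by (rule l2_has_sum_AE[OF 1 3 2])
qed

text \<open>Monomials of index (-(j + 1), 0), on which L vanishes: the infinite orthogonal system in
  the kernel that puts 0 into the essential spectrum.\<close>

definition zv :: "nat \<Rightarrow> C2 \<Rightarrow> complex" where "zv j x = cnj (fst x) ^ (j + 1)"

lemma zv_V: "zv j \<in> V (- int (j + 1)) 0"
 using term_in_V[of 0 "j + 1" 0 0] by (simp add: zv_def[abs_def])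

lemma zv_nonzero: "l2_norm \<mu> (zv j) \<noteq> 0"
 by (rule norm_nonzero[OF V_L2[OF zv_V]]) (simp add: zv_def regularD(5))

lemma diagonal:
 assumes A: "is_adjoint \<mu> lop A"
 shows "\<exists>C. diagonal_operator \<mu> UNIV eu lamk (A \<circ> lop) (%j x. of_real (1 / l2_norm \<mu> (zv j)) * zv j x) C"
proof -
 obtain C where C: "0 \<le> C" "!!k. lamk k \<le> C" using lamk_bounded by blast
 have b: "\<bar>lamk k\<bar> \<le> C" for k using C(2)[of k] lamk_nonneg[of k] by simp
 have "diagonal_operator \<mu> UNIV eu lamk (A \<circ> lop) (%j x. of_real (1 / l2_norm \<mu> (zv j)) * zv j x) C"
 proof (rule diagonal_operator.intro)
  show "orthonormal_on \<mu> eu UNIV" by (rule eu_orthonormal)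
  show "bounded_op \<mu> (A \<circ> lop)"
  proof (rule bounded_op_of_has_sum[where t = "%k. of_real (lamk k)", OF eu_orthonormal _ C(1)])
   show "\<forall>k\<in>UNIV. cmod (complex_of_real (lamk k)) \<le> C" by (intro ballI) (simp only: norm_of_real b)
   show "l2_has_sum \<mu> (%k x. of_real (lamk k) * l2_inner \<mu> f (eu k) * eu k x) UNIV ((A \<circ> lop) f)" if "f \<in> L2 \<mu>" for f
    by (rule adjoint_lop_has_sum[OF A that])
  qed
  show "l2_has_sum \<mu> (%k x. of_real (lamk k) * l2_inner \<mu> f (eu k) * eu k x) UNIV ((A \<circ> lop) f)" if "f \<in> L2 \<mu>" for f
   by (rule adjoint_lop_has_sum[OF A that])
  show "\<bar>lamk k\<bar> \<le> C" for k by (rule b)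
  show "orthonormal_on \<mu> (%j x. of_real (1 / l2_norm \<mu> (zv j)) * zv j x) UNIV"
  proof (rule normalised_orthonormal[where f = zv and N = "%j. - int (j + 1)" and M = "%_. 0"])
   show "zv j \<in> V (- int (j + 1)) 0" for j by (rule zv_V)
   show "l2_norm \<mu> (zv j) \<noteq> 0" for j by (rule zv_nonzero)
   show "(- int (i + 1), 0 :: int) \<noteq> (- int (j + 1), 0)" if "i \<noteq> j" for i j using that by simp
  qed
  show "l2_inner \<mu> (%x. of_real (1 / l2_norm \<mu> (zv j)) * zv j x) (eu k) = 0" for j k
  proof -
   have "l2_inner \<mu> (zv j) (un (fst k) (snd k)) = 0" 
   proof (rule V_orthogonal[OF zv_V un_V])
    have "- int (j + 1) \<noteq> int (fst k)" by linarith
    then show "(- int (j + 1), 0) \<noteq> (int (fst k), int (snd k))" by blast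
   qed
   then show ?thesis unfolding eu_def[abs_def] inner_cmult_left inner_cmult_right by simp
  qed
 qed
 then show ?thesis by (intro exI[of _ C])
qed


text \<open>A cluster point is the limit along some injective sequence, so it lies in the limit set
  by \<open>lam_subseq\<close>; conversely \<open>lam_attained\<close> provides an injective
  sequence, hence infinitely many indices near the limit.\<close>

lemma cluster_limit_set:
 "(\<forall>\<epsilon>>0. infinite {k \<in> UNIV. cmod (of_real (lamk k) - c) < \<epsilon>}) \<longleftrightarrow> c \<in> complex_of_real ` prof.limit_set"
proof
 assume cl: "\<forall>\<epsilon>>0. infinite {k \<in> UNIV. cmod (of_real (lamk k) - c) < \<epsilon>}"
 have inf: "infinite {k. cmod (of_real (lamk k) - c) < 1 / real (Suc n)}" for n using cl[rule_format, of "1 / real (Suc n)"] by simp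
 obtain f where f': "\<forall>n. f n \<in> {k. cmod (of_real (lamk k) - c) < 1 / real (Suc n)}" and f2: "inj f"
  using injective_selection[where S = "%n. {k. cmod (of_real (lamk k) - c) < 1 / real (Suc n)}", OF inf] by (elim exE conjE)
 have f: "!!n. cmod (of_real (lamk (f n)) - c) < 1 / real (Suc n)" "inj f" using f' f2 by blast+
 have lim: "(%n. complex_of_real (lamk (f n))) \<longlonglongrightarrow> c"
 proof (rule LIM_zero_cancel, rule Lim_null_comparison)
  show "\<forall>\<^sub>F n in sequentially. norm (complex_of_real (lamk (f n)) - c) \<le> 1 / real (Suc n)"
   by (rule always_eventually, rule allI, rule less_imp_le, rule f(1))
  show "(%n. 1 / real (Suc n)) \<longlonglongrightarrow> 0" by real_asymp
 qed
 obtain r x where r: "strict_mono r" "x \<in> prof.limit_set" "(%k. case_prod prof.lam (f (r k))) \<longlonglongrightarrow> x" using prof.lam_subseq[OF f(2)] by (elim exE conjE)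
 have l1: "(%n. complex_of_real (lamk (f (r n)))) \<longlonglongrightarrow> of_real x" using tendsto_of_real[OF r(3)] unfolding lamk_def .
 have l2: "(%n. complex_of_real (lamk (f (r n)))) \<longlonglongrightarrow> c" using LIMSEQ_subseq_LIMSEQ[OF lim r(1)] by (simp add: comp_def)
 have "c = of_real x" by (rule LIMSEQ_unique[OF l2 l1])
 then show "c \<in> complex_of_real ` prof.limit_set" using r(2) by blast
next
 assume "c \<in> complex_of_real ` prof.limit_set"
 then obtain x where x': "c = of_real x" "x \<in> prof.limit_set" by (rule imageE)
 note x = x'(2,1)
 obtain f where f: "inj f" "(%k. case_prod prof.lam (f k)) \<longlonglongrightarrow> x" using prof.lam_attained[OF x(1)] by (elim exE conjE)
 have lim: "(%k. lamk (f k)) \<longlonglongrightarrow> x" using f(2) unfolding lamk_def .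
 show "\<forall>\<epsilon>>0. infinite {k \<in> UNIV. cmod (of_real (lamk k) - c) < \<epsilon>}"
 proof (intro allI impI)
  fix \<epsilon> :: real assume e: "0 < \<epsilon>"
  obtain N where N: "\<forall>k\<ge>N. norm (lamk (f k) - x) < \<epsilon>" using LIMSEQ_D[OF lim e] by (elim exE)
  have "cmod (of_real (lamk (f k)) - c) < \<epsilon>" if "N \<le> k" for k
   using N[rule_format, OF that] unfolding x(2) of_real_diff[symmetric] norm_of_real real_norm_def .
  then have "f ` {N..} \<subseteq> {k \<in> UNIV. cmod (of_real (lamk k) - c) < \<epsilon>}" by (intro image_subsetI CollectI conjI UNIV_I) (simp only: atLeast_iff)
  moreover have "infinite (f ` {N..})"
  proof
   assume fin: "finite (f ` {N..})"
   have "inj_on f {N..}" by (rule inj_on_subset[OF f(1)]) simp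
   from finite_imageD[OF fin this] show False by (simp add: infinite_Ici)
  qed
  ultimately show "infinite {k \<in> UNIV. cmod (of_real (lamk k) - c) < \<epsilon>}" by (rule infinite_super)
 qed
qed


text \<open>The closed interval of s parametrises the boundary modulo rotation; s = 0 and s = 1
  correspond to the circles z1 = 0 and z2 = 0.\<close>

lemma prof_P_values:
 "{1 / (2 * sqrt (prof_P z * (1 - prof_P z))) | z. 0 \<le> z \<and> z \<le> 1}
   = {sqrt (p_exponent \<phi> p1 p2 \<zeta> * conj_exp (p_exponent \<phi> p1 p2 \<zeta>)) / 2 | \<zeta>. \<zeta> \<in> bD b1 \<phi>}"
proof (intro subset_antisym subsetI)
 have pe: "p_exponent \<phi> p1 p2 z = pf (cmod (fst z))" if "fst z \<noteq> 0" "snd z \<noteq> 0" for z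
  using that by (simp add: p_exponent_def p_profile_def Let_def)
 have P0: "prof_P 0 = 1 / p1" "prof_P 1 = 1 / p2" by (auto simp: prof_P_def)
 have Ps: "prof_P s = 1 / pf (rr s)" if "0 < s" "s < 1" for s using that by (simp add: prof_P_def)
 {
  fix x assume "x \<in> {1 / (2 * sqrt (prof_P z * (1 - prof_P z))) | z. 0 \<le> z \<and> z \<le> 1}"
  then obtain s where s: "0 \<le> s" "s \<le> 1" "x = 1 / (2 * sqrt (prof_P s * (1 - prof_P s)))" by (elim CollectE exE conjE)
  have "\<exists>z\<in>bD b1 \<phi>. 1 < p_exponent \<phi> p1 p2 z \<and> prof_P s = 1 / p_exponent \<phi> p1 p2 z"
  proof -
   consider "s = 0" | "s = 1" | "0 < s" "s < 1" using s by linarith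
   then show ?thesis
   proof cases
    case 1
    have "(0, of_real (\<phi> 0)) \<in> bD b1 \<phi>" unfolding bD_eq using basic(1) b2_pos by (simp add: b2_def)
    moreover have "p_exponent \<phi> p1 p2 (0, of_real (\<phi> 0)) = p1" by (simp add: p_exponent_def)
    ultimately show ?thesis using 1 P0 basic(2) by (intro bexI[of _ "(0, of_real (\<phi> 0))"]) auto
   next
    case 2
    have "(of_real b1, 0) \<in> bD b1 \<phi>" unfolding bD_eq using basic(1,6) by simp
    moreover have "p_exponent \<phi> p1 p2 (of_real b1, 0) = p2" using basic(1) by (simp add: p_exponent_def)
    ultimately show ?thesis using 2 P0 basic(3) by (intro bexI[of _ "(of_real b1, 0)"]) auto
   next
    case 3
    define z where "z = bd_param \<phi> (rr s, 0, 0)"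
    note r = rr_props[OF 3]
    have z: "cmod (fst z) = rr s" "cmod (snd z) = \<phi> (rr s)" "z \<in> bD b1 \<phi>"
     unfolding z_def by (intro bd_param_simps, use r in auto)+
    have "0 < \<phi> (rr s)" using phi_pos r by simp
    then have "fst z \<noteq> 0" "snd z \<noteq> 0" using z r by auto
    then have "p_exponent \<phi> p1 p2 z = pf (rr s)" using pe z(1) by simp
    then show ?thesis using Ps[OF 3] pf_gt_1[OF r(1,2)] z(3) by (intro bexI[of _ z]) auto
   qed
  qed
  then obtain z where z: "z \<in> bD b1 \<phi>" "1 < p_exponent \<phi> p1 p2 z" "prof_P s = 1 / p_exponent \<phi> p1 p2 z" by blast
  have "x = sqrt (p_exponent \<phi> p1 p2 z * conj_exp (p_exponent \<phi> p1 p2 z)) / 2" unfolding s(3) z(3) by (rule bulk_value_eq[OF z(2)])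
  then show "x \<in> {sqrt (p_exponent \<phi> p1 p2 \<zeta> * conj_exp (p_exponent \<phi> p1 p2 \<zeta>)) / 2 | \<zeta>. \<zeta> \<in> bD b1 \<phi>}" by (intro CollectI exI[of _ z] conjI z(1))
 }
 fix x assume "x \<in> {sqrt (p_exponent \<phi> p1 p2 \<zeta> * conj_exp (p_exponent \<phi> p1 p2 \<zeta>)) / 2 | \<zeta>. \<zeta> \<in> bD b1 \<phi>}"
 then obtain z where z: "z \<in> bD b1 \<phi>" "x = sqrt (p_exponent \<phi> p1 p2 z * conj_exp (p_exponent \<phi> p1 p2 z)) / 2" by (elim CollectE exE conjE)
 have "\<exists>s. 0 \<le> s \<and> s \<le> 1 \<and> 1 < p_exponent \<phi> p1 p2 z \<and> prof_P s = 1 / p_exponent \<phi> p1 p2 z"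
 proof -
  consider "fst z = 0" | "fst z \<noteq> 0" "snd z = 0" | "fst z \<noteq> 0" "snd z \<noteq> 0" by blast
  then show ?thesis
  proof cases
   case 1 then show ?thesis using P0 basic(2) by (intro exI[of _ 0]) (simp add: p_exponent_def)
  next
   case 2 then show ?thesis using P0 basic(3) by (intro exI[of _ 1]) (simp add: p_exponent_def)
  next
   case 3
   have zz: "cmod (fst z) \<le> b1" "cmod (snd z) = \<phi> (cmod (fst z))" using z(1) unfolding bD_eq by auto
   have "cmod (fst z) \<noteq> b1" using 3 zz basic(6) by auto
   then have r: "0 < cmod (fst z)" "cmod (fst z) < b1" using zz 3 by auto
   have "prof_P (sc (cmod (fst z))) = 1 / pf (cmod (fst z))" using Ps[OF sc_01(1,2)[OF r]] rr_sc[OF r] by simp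
   then show ?thesis using pe[OF 3] pf_gt_1[OF r] sc_01(1,2)[OF r] by (intro exI[of _ "sc (cmod (fst z))"]) auto
  qed
 qed
 then obtain s where s: "0 \<le> s" "s \<le> 1" "1 < p_exponent \<phi> p1 p2 z" "prof_P s = 1 / p_exponent \<phi> p1 p2 z" by blast
 have "x = 1 / (2 * sqrt (prof_P s * (1 - prof_P s)))" unfolding z(2) s(4) by (rule bulk_value_eq[OF s(3), symmetric])
 then show "x \<in> {1 / (2 * sqrt (prof_P z * (1 - prof_P z))) | z. 0 \<le> z \<and> z \<le> 1}" by (intro CollectI exI[of _ s] conjI s(1,2))
qed

lemma limit_set_eq:
 "prof.limit_set = {sqrt (p_exponent \<phi> p1 p2 \<zeta> * conj_exp (p_exponent \<phi> p1 p2 \<zeta>)) / 2 | \<zeta>. \<zeta> \<in> bD b1 \<phi>} \<union> {lambda_pqn p q n | p n. p \<in> {p1, p2}}"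
proof -
 have "corner_value (prof_P 0) (- (q * (1 - 2 / p1))) = lambda_pqn p1 q" "corner_value (prof_P 1) (- (q * (1 - 2 / p2))) = lambda_pqn p2 q"
  by (rule ext, simp add: prof_P_def corner_value_eq basic)+
 moreover have "range (lambda_pqn p1 q) \<union> range (lambda_pqn p2 q) = {lambda_pqn p q n | p n. p \<in> {p1, p2}}" by blast
 ultimately show ?thesis unfolding prof.limit_set_def prof_P_values by (simp only: Un_assoc)
qed


text \<open>The boundary value for F (n, m) depends on it only through the inner product with u_nm,
  which is that of f; so the required sum is the singular value expansion, term by term.\<close>

lemma lop_leray: "is_leray_operator b1 \<phi> \<mu> lop"
 unfolding is_leray_operator_def
proof
 fix f assume f: "f \<in> L2 \<mu>"
 obtain F where F': "\<forall>n m. F (n, m) \<in> V n m" "\<forall>n m. \<forall>v\<in>V n m. l2_inner \<mu> (F (n, m)) v = l2_inner \<mu> f v" and F3: "l2_has_sum \<mu> F UNIV f"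
  using monomial_decomposition[OF f] by (elim exE conjE)
 have F: "F (n, m) \<in> V n m" "v \<in> V n m ==> l2_inner \<mu> (F (n, m)) v = l2_inner \<mu> f v" for n m v
  using F' by simp_all
 \<comment> \<open>The Leray transform is summed over nonnegative integers, the operator over
   natural numbers; p is the bijection between them.\<close>
 define p :: "int \<times> int \<Rightarrow> nat \<times> nat" where "p = (%k. (nat (fst k), nat (snd k)))"
 define B :: "(int \<times> int) set" where "B = {0..} \<times> {0..}"
 have "p ` B = UNIV"
 proof (intro equalityI subsetI)
  fix k :: "nat \<times> nat" assume "k \<in> UNIV"
  have "k = p (int (fst k), int (snd k))" "(int (fst k), int (snd k)) \<in> B" by (auto simp: p_def B_def)
  then show "k \<in> p ` B" by (rule image_eqI)
 qed simp
 then have G: "l2_has_sum \<mu> (%k x. of_real (tau k) * l2_inner \<mu> f (eu k) * ev k x) (p ` B) (lop f)" using lop_has_sum[OF f] by simp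
 have inj: "inj_on p B" by (rule inj_onI) (auto simp: p_def B_def prod_eq_iff eq_nat_nat_iff)
 have "l2_has_sum \<mu> (%k. leray_bv b1 \<phi> (F k)) B (lop f)"
 proof (rule l2_has_sum_reindex[OF G inj])
  fix b x assume b: "b \<in> B" and x: "x \<in> space \<mu>"
  define n where "n = nat (fst b)"
  define m where "m = nat (snd b)"
  have bb: "b = (int n, int m)" "p b = (n, m)" using b by (auto simp: B_def n_def m_def p_def prod_eq_iff)
  have "leray_bv b1 \<phi> (F b) x = of_real (cnm n m) * l2_inner \<mu> f (un n m) * vn n m x"
  proof -
   have x': "x \<in> bD b1 \<phi>" using x by simp
   show ?thesis unfolding bb(1) leray_bv_monomial[OF F(1)[of "int n" "int m"] x'] F(2)[OF un_V[of n m]] ..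
  qed
  also have "\<dots> = of_real (tau (p b)) * l2_inner \<mu> f (eu (p b)) * ev (p b) x"
   unfolding bb(2) tau_def eu_def[abs_def] ev_def inner_cmult_right using un_nonzero[of n m] vn_nonzero[of n m] by simp
  finally show "leray_bv b1 \<phi> (F b) x = of_real (tau (p b)) * l2_inner \<mu> f (eu (p b)) * ev (p b) x" .
 qed
 moreover have "is_monomial b1 \<phi> n m (F (n, m))" for n m using F(1)[of n m] by (simp add: V_def)
 ultimately show "\<exists>F. (\<forall>n m. is_monomial b1 \<phi> n m (F (n, m))) \<and> l2_has_sum \<mu> F UNIV f \<and> l2_has_sum \<mu> (%k. leray_bv b1 \<phi> (F k)) ({0..} \<times> {0..}) (lop f)"
  using F3 unfolding B_def by (intro exI[of _ F] conjI allI)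
qed

end

section \<open>Boundedness, eigenbasis and essential spectrum\<close>

theorem theorem1:
  fixes \<phi> :: "real \<Rightarrow> real" and b1 p1 p2 q :: real and \<mu> :: "(complex \<times> complex) measure"
  assumes "class_R b1 \<phi> p1 p2"
    and "rotation_invariant \<mu>"
    and "has_order b1 \<phi> q \<mu>"
    and "p1 \<noteq> 2 \<Longrightarrow> \<bar>q\<bar> < \<bar>p1 / (p1 - 2)\<bar>"
    and "p2 \<noteq> 2 \<Longrightarrow> \<bar>q\<bar> < \<bar>p2 / (p2 - 2)\<bar>"
  shows "\<exists>L. is_leray_operator b1 \<phi> \<mu> L \<and> bounded_op \<mu> L \<and>
    (\<exists>A. is_adjoint \<mu> L A) \<and>
    (\<forall>A. is_adjoint \<mu> L A \<longrightarrow>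
      (\<exists>E. orthogonal_basis \<mu> E \<and> (\<forall>e\<in>E. is_eigenfunction \<mu> (A \<circ> L) e)) \<and>
      essential_spectrum \<mu> (A \<circ> L) = complex_of_real `
        ({0} \<union>
         {sqrt (p_exponent \<phi> p1 p2 \<zeta> * conj_exp (p_exponent \<phi> p1 p2 \<zeta>)) / 2 | \<zeta>. \<zeta> \<in> bD b1 \<phi>} \<union>
         {lambda_pqn p q n | p n. p \<in> {p1, p2}}))"
proof -
  interpret O: reinhardt_order b1 \<phi> p1 p2 q
    by unfold_locales (use assms(1,4,5) in auto)
  \<comment> \<open>From here on the measure is given by a positive continuous function of the
    radius alone.\<close>
  obtain h where h: "O.pos_fun h" "\<mu> = O.radial_measure h" using O.has_order_radial[OF assms(2,3)] by blast
  interpret R: reinhardt_L2 b1 \<phi> p1 p2 q h by unfold_locales (rule h(1))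
  show ?thesis unfolding h(2)
  proof (rule exI[of _ R.lop], intro conjI allI impI)
    show "is_leray_operator b1 \<phi> (O.radial_measure h) R.lop" by (rule R.lop_leray)
    show "bounded_op (O.radial_measure h) R.lop" by (rule R.lop_bounded)
    show "\<exists>A. is_adjoint (O.radial_measure h) R.lop A" by (rule exI[of _ R.ladj], rule R.lop_adjoint)
    fix A assume A: "is_adjoint (O.radial_measure h) R.lop A"
    obtain C where "diagonal_operator (O.radial_measure h) UNIV R.eu R.lamk (A \<circ> R.lop) (\<lambda>j x. of_real (1 / l2_norm (O.radial_measure h) (R.zv j)) * R.zv j x) C"
      using R.diagonal[OF A] by (elim exE)
    then interpret diagonal_operator "O.radial_measure h" UNIV R.eu R.lamk "A \<circ> R.lop" "\<lambda>j x. of_real (1 / l2_norm (O.radial_measure h) (R.zv j)) * R.zv j x" C .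
    show "\<exists>E. orthogonal_basis (O.radial_measure h) E \<and> (\<forall>e\<in>E. is_eigenfunction (O.radial_measure h) (A \<circ> R.lop) e)" by (rule eigenbasis)
    have "{c. cluster c} = complex_of_real ` R.prof.limit_set"
      unfolding cluster_def R.cluster_limit_set by blast
    then show "essential_spectrum (O.radial_measure h) (A \<circ> R.lop) = complex_of_real `
        ({0} \<union> {sqrt (p_exponent \<phi> p1 p2 \<zeta> * conj_exp (p_exponent \<phi> p1 p2 \<zeta>)) / 2 | \<zeta>. \<zeta> \<in> bD b1 \<phi>} \<union> {lambda_pqn p q n | p n. p \<in> {p1, p2}})"
      unfolding essential_spectrum_diagonal R.limit_set_eq by (simp add: image_Un)
  qed
qed

end
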